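(* Let $M\ge 4$ and let $\vec p=(p_1,\dots,p_M)$ be pairwise coprime integers $p_j\ge 2$ (or let $M=3$ with $\sum_j 1/p_j<1$, in which case all sums $\sum_{a\ge1}\sum_{b=0}^{a-1}\sum'_{\vec\eta(a)}$ below are empty and the terms containing them are read as $0$). Let $\tau_N(\mathcal M)$ be the $SU(2)$ Witten--Reshetikhin--Turaev invariant of the Seifert fibered homology sphere $\mathcal M=\Sigma(\vec p)$. With the notation of the context, as $N\to\infty$ through the positive integers, \begin{align*} & e^{\frac{2\pi i}{N}\left(\frac{\phi(\vec p)}{4}-\frac12\right)}\left(e^{\frac{2\pi i}{N}}-1\right)\tau_N(\mathcal M)\\ &\simeq \frac12\,\frac{1}{(M-3)!}\,\frac{1}{i^{\frac32-m_2(M)}}\sum_{j=0}^{\lfloor\frac{M-3}{2}\rfloor} N^{j+\lfloor\frac M2\rfloor-\frac12}\left(\frac{i}{2P\pi}\right)^{\lfloor\frac{M-3}{2}\rfloor-j}K^{(j)}_{\lfloor\frac{M-3}{2}\rfloor,\,m_2(M)}\\ &\qquad\times\frac{1}{2j+2-m_2(M)}\sum_{\vec\ell'}\mathbf S^{\sigma_1^{M-1}(\vec E)}_{\vec\ell'}\left[\sum_{n=1}^{2P}\chi_{2P}^{\vec\ell'}(n)\,B_{2j+2-m_2(M)}\!\left(\frac{n}{2P}\right)\right]e^{-N\frac P2\left(1+\sum_j\frac{\ell'_j}{p_j}\right)^2\pi i}\\ &+\frac{1}{(M-3)!}\,\frac{(-1)^M}{i^{3/2}}\sum_{m=1}^{\lfloor\frac{M-3}{2}\rfloor}\sum_{a=0}^{P}\chi_{2P}^{\sigma_1^{M-1}(\vec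 E)}(a)\,f_{2m}^{M-2}\!\left(\frac{a}{2P}-\frac{m_2(M)}{2}\right)\\ &\qquad\times\sum_{j=1}^{m}N^{m+j-\frac12}\left(\frac{i}{2P\pi}\right)^{m-j}K^{(j-1)}_{m-1,0}\,\frac mj\sum_{c=0}^{P}\mathbf N^a_c\,\frac{2-\delta_{c,0}-\delta_{c,P}}{2}\,B_{2j}\!\left(\frac{c}{2P}\right)e^{-N\frac{c^2}{2P}\pi i}\\ &+\frac{1}{(M-3)!}\,\frac{(-1)^{M-1}}{i^{1/2}}\sum_{m=0}^{\lfloor\frac{M-4}{2}\rfloor}\sum_{a=1}^{P}\chi_{2P}^{\sigma_1^{M-1}(\vec E)}(a)\,f_{2m+1}^{M-2}\!\left(\frac{a}{2P}-\frac{m_2(M)}{2}\right)\\ &\qquad\times\sum_{j=0}^{m}N^{m+j+\frac12}\left(\frac{i}{2P\pi}\right)^{m-j}K^{(j)}_{m,1}\,\frac{2m+1}{2j+1}\sum_{c=1}^{P-1}\mathbf M^a_c\,B_{2j+1}\!\left(\frac{c}{2P}\right)e^{-N\frac{c^2}{2P}\pi i}\\ &+\frac{(-1)^M}{(M-4)!}\sum_{a=1}^{\infty}\sum_{b=0}^{a-1}{\sum_{\vec\eta(a)}}'\Biggl\{\sum_{m=1}^{\lfloor\frac{M-3}{2}\rfloor}f_{2m}^{M-3}\!\left(b+\frac12-\frac12\sum_i\frac{\eta_i}{p_i}\right)\frac{-1}{i^{3/2}}\sum_{j=1}^{m}N^{m+j-\frac12}\left(\frac{i}{2P\pi}\right)^{m-j}\\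 &\qquad\qquad\times K^{(j-1)}_{m-1,0}\,\frac mj\sum_{c=0}^{P}\mathbf N^{\,x(\vec\eta,a)}_{c}\,\frac{2-\delta_{c,0}-\delta_{c,P}}{2}\,B_{2j}\!\left(\frac{c}{2P}\right)e^{-N\frac{c^2}{2P}\pi i}\\ &\qquad+(-1)^{M-1}\sum_{m=0}^{\lfloor\frac{M-4}{2}\rfloor}f_{2m+1}^{M-3}\!\left(b+\frac12-\frac12\sum_i\frac{\eta_i}{p_i}\right)\frac{-1}{i^{1/2}}\sum_{j=0}^{m}N^{m+j+\frac12}\left(\frac{i}{2P\pi}\right)^{m-j}\\ &\qquad\qquad\times K^{(j)}_{m,1}\,\frac{2m+1}{2j+1}\sum_{c=1}^{P-1}\mathbf M^{\,x(\vec\eta,a)}_{c}\,B_{2j+1}\!\left(\frac{c}{2P}\right)e^{-N\frac{c^2}{2P}\pi i}\Biggr\}\\ &+\sum_{k=0}^{\infty}\frac{T_{\vec p}(k)}{k!}\left(\frac{\pi i}{2PN}\right)^k, \end{align*} where $x(\vec\eta,a)=\sigma^{M-1}\!\left(P\sum_i\frac{\eta_i}{p_i}-P(2a-1)\right)$ and \begin{align*} T_{\vec p}(k)&=\frac{(-1)^{M+1}}{2}\,\frac{(2P)^{2k}}{(M-3)!}\sum_{n=1}^{2P}\chi_{2P}^{\sigma_1^{M-1}(\vec E)}(n)\sum_{j=1}^{M-2}(-1)^j\frac{j}{2k+j}\,B_{2k+j}\!\left(\frac{n}{2P}\right)\\ &\qquad\qquad\times f_j^{M-2}\!\left(\frac{n+(M-1)P}{2P}-\left\lfloor\frac{n+(M-1)P}{2P}\right\rfloor-\frac12\right)\\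 &\quad-\frac{(2P)^{2k}}{(M-4)!}\sum_{a=1}^{\infty}\sum_{b=0}^{a-1}{\sum_{\vec\eta(a)}}'\sum_{j=1}^{M-3}(-1)^{(M+1)(j+1)}\frac{j}{2k+j}\,f_j^{M-3}\!\left(b+\frac12-\frac12\sum_i\frac{\eta_i}{p_i}\right)B_{2k+j}\!\left(\frac{x(\vec\eta,a)}{2P}\right). \end{align*}
   Context: Notation. $P=\prod_{j=1}^M p_j$; $m_2(M)=0$ if $M$ is even and $1$ if $M$ is odd; $i=\sqrt{-1}$, $i^{s}=e^{\pi i s/2}$ (the letter $i$ is also used as a summation index in $\sum_i \eta_i/p_i$). $B_k(x)$ is the $k$-th Bernoulli polynomial, $\frac{te^{xt}}{e^t-1}=\sum_k B_k(x)\frac{t^k}{k!}$. $\delta$ is the Kronecker delta. Empty sums are $0$. The meaning of $\simeq$: the left side minus all the (finitely many) terms of the right side other than the last power series has, as $N\to\infty$, the power series in $1/N$ as its (Poincar\'e) asymptotic expansion, i.e. truncating the series after $k=K$ leaves an error $O(N^{-K-1})$ for each $K$. WRT invariant. $\tau_N(\mathcal M)$ (normalized by $\tau_N(S^3)=1$) of $\mathcal M=\Sigma(p_1,\dots,p_M)$ is given by the Lawrence--Rozansky formula $$e^{\frac{2\pi i}{N}\left(\frac{\phi(\vec p)}{4}-\frac12\right)}\left(e^{\frac{2\pi i}{N}}-1\right)\tau_N(\mathcal M)=\frac{e^{\pi i/4}}{2\sqrt{2PN}}\sum_{\substack{0\le n\le 2PN-1\\ N\nmid n}}e^{-\frac{n^2}{2PN}\pi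 i}\,\frac{\prod_{j=1}^M\left(e^{\frac{n}{Np_j}\pi i}-e^{-\frac{n}{Np_j}\pi i}\right)}{\left(e^{\frac nN\pi i}-e^{-\frac nN\pi i}\right)^{M-2}},$$ $\phi(\vec p)=3-\frac1P+12\sum_{j=1}^M s(P/p_j,p_j)$, with the Dedekind sum $s(b,a)=\sum_{k=1}^{a-1}((k/a))((kb/a))$, $((x))=x-\lfloor x\rfloor-\frac12$ for $x\notin\mathbb Z$ and $0$ for $x\in\mathbb Z$. Periodic functions. For an $M$-tuple $\vec\ell=(\ell_1,\dots,\ell_M)$ of integers with $0<\ell_j<p_j$, $\chi_{2P}^{\vec\ell}:\mathbb Z\to\mathbb Z$ has period $2P$, $\chi_{2P}^{\vec\ell}(n)=-\prod_j\varepsilon_j$ if $n\equiv P\left(1+\sum_j\varepsilon_j\ell_j/p_j\right)\bmod 2P$ for some $\varepsilon_j\in\{\pm1\}$, and $0$ otherwise. $\sigma_j(\vec\ell)$ is $\vec\ell$ with $\ell_j$ replaced by $p_j-\ell_j$; one has $\chi_{2P}^{\sigma_i\sigma_j(\vec\ell)}=\chi_{2P}^{\vec\ell}$. $\vec E=(1,\dots,1)$ ($M$ ones). Sums over $\vec\ell'$ run over one representative of each class of $M$-tuples modulo $\vec\ell\sim\sigma_i\sigma_j(\vec\ell)$; there are $D=2^{-(M-1)}\prod_j(p_j-1)$ classes. Matrices. $$\mathbf S^{\vec\ell}_{\vec\ell'}=\frac{2^M i^{M-m_2(M)}}{\sqrt{2P}}(-1)^{P\left(1+\sum_j\frac{\ell_j+\ell'_j}{p_j}\right)+P\sum_j\sum_{k\ne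 j}\frac{\ell_j\ell'_k}{p_jp_k}}\prod_{j=1}^M\sin\!\left(P\frac{\ell_j\ell'_j}{p_j^2}\pi\right).$$ $\mathbf N^a_b=\frac1{\sqrt{2P}}$ if $a\equiv0$, $\mathbf N^a_b=\frac1{\sqrt{2P}}\cos(b\pi)$ if $a\equiv P$, and $\mathbf N^a_b=\sqrt{2/P}\,\cos\frac{ab\pi}{P}$ for other $a$ (mod $2P$), $0\le b\le P$; $\mathbf M^a_b=\sqrt{2/P}\,\sin\frac{ab\pi}{P}$, $1\le b\le P-1$. Other notation. $K^{(j)}_{b,x}=\binom bj\prod_{k=0}^{b-j-1}\left(\frac12+b-x-k\right)$. Stirling numbers of the first kind: $\prod_{j=0}^{n-1}(x-j)=\sum_{m=0}^nS_n^{(m)}x^m$. For integers $L\ge m>0$, $f_m^L(x)=\sum_{k=m}^L\frac1kS_L^{(k)}\binom km\left(x+\frac L2\right)^{k-m}$. The signed sum is ${\sum'_{\vec\eta(a)}}\cdots=\sum_{\vec\eta}\left[\prod_{j=1}^M\eta_j\right]\cdots$ over $\vec\eta\in\{\pm1\}^M$ with $2a-1<\sum_j\eta_j/p_j<2a+1$ (so the sum over $a$ is finite). $\sigma$ is the involution $\sigma(x)=P-x \bmod 2P$ on $\mathbb Z/2P$, with representatives taken in $\{0,\dots,2P-1\}$; $\sigma^{M-1}$ is its $(M-1)$-st iterate. *)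

theory Defs
  imports
    "HOL-Analysis.Analysis"
    "HOL-Library.Landau_Symbols"
    "HOL-Computational_Algebra.Computational_Algebra"
    "HOL-Combinatorics.Stirling"
    "HOL-Number_Theory.Cong"
begin

text \<open>
  A tuple \<open>(p_1, \<dots>, p_M)\<close> is a function on \<open>nat\<close> of which only the values at
  \<open>1, \<dots>, M\<close> are used.  All exact quotients such as \<open>P / p_j\<close> and
  \<open>P / (p_j p_k)\<close> (with \<open>j \<noteq> k\<close>) are written with \<open>div\<close> where the result has to be an integer;
  no rounding takes place, because the \<open>p_j\<close> are pairwise coprime.
\<close>

definition prodP :: "nat \<Rightarrow> (nat \<Rightarrow> nat) \<Rightarrow> nat" where
  "prodP M p = (\<Prod>j=1..M. p j)"

definition m2 :: "nat \<Rightarrow> nat" where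
  "m2 M = (if even M then 0 else 1)"

definition epi :: "real \<Rightarrow> complex" where
  "epi x = exp (complex_of_real x * complex_of_real pi * \<i>)"

definition ipow :: "real \<Rightarrow> complex" where
  "ipow s = epi (s / 2)"


subsection \<open>Special polynomials and coefficients\<close>

text \<open>The quotient is one of formal power series in \<open>t\<close> (the denominator has order 1).\<close>

definition bernpoly :: "nat \<Rightarrow> real \<Rightarrow> real" where
  "bernpoly k x = fact k * fps_nth (fps_X * fps_exp x / (fps_exp 1 - 1)) k"

lemma bernpoly_generating:
  "(fps_exp 1 - 1) * Abs_fps (\<lambda>k. bernpoly k x / fact k) = fps_X * fps_exp x"
proof -
  have nz: "fps_exp 1 - 1 \<noteq> (0 :: real fps)"
    by (auto simp: fps_eq_iff intro!: exI[of _ 1])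
  have "subdegree (fps_exp 1 - 1 :: real fps) = 1"
    by (rule subdegreeI) auto
  moreover have "subdegree (fps_X * fps_exp x) = 1"
    by (rule subdegreeI) auto
  moreover have "fps_X * fps_exp x \<noteq> 0"
    by simp
  ultimately have "fps_exp 1 - 1 dvd fps_X * fps_exp x"
    using nz by (subst fps_dvd_iff) auto
  then have "(fps_exp 1 - 1) * (fps_X * fps_exp x / (fps_exp 1 - 1)) = fps_X * fps_exp x"
    by (rule dvd_mult_div_cancel)
  moreover have "Abs_fps (\<lambda>k. bernpoly k x / fact k) = fps_X * fps_exp x / (fps_exp 1 - 1)"
    by (simp add: fps_eq_iff bernpoly_def)
  ultimately show ?thesis by simp
qed

text \<open>\<open>Kcoeff j b x\<close> is \<open>K\<close> with upper index \<open>(j)\<close> and lower indices \<open>b, x\<close>.\<close>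

definition Kcoeff :: "nat \<Rightarrow> nat \<Rightarrow> real \<Rightarrow> real" where
  "Kcoeff j b x = real (b choose j) * (\<Prod>k<b - j. 1/2 + real b - x - real k)"

text \<open>The library's \<^const>\<open>stirling\<close> numbers are the unsigned ones.\<close>

definition stirling1 :: "nat \<Rightarrow> nat \<Rightarrow> int" where
  "stirling1 n m = (-1) ^ (n + m) * int (stirling n m)"

lemma stirling1_generating:
  fixes x :: "'a :: comm_ring_1"
  shows "(\<Prod>j<n. x - of_nat j) = (\<Sum>m\<le>n. of_int (stirling1 n m) * x ^ m)"
proof -
  have "(\<Sum>m\<le>n. of_int (stirling1 n m) * x ^ m)
      = (-1) ^ n * (\<Sum>m\<le>n. of_nat (stirling n m) * (- x) ^ m)"
    by (auto simp: sum_distrib_left stirling1_def power_add power_minus[of x] mult_ac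
             intro!: sum.cong)
  also have "\<dots> = (-1) ^ n * pochhammer (- x) n"
    by (simp add: stirling_pochhammer)
  also have "\<dots> = (\<Prod>j<n. (-1) * (- x + of_nat j))"
    unfolding pochhammer_prod prod.distrib by (simp add: atLeast0LessThan)
  finally show ?thesis by simp
qed

text \<open>\<open>fpoly m L\<close> is \<open>f\<close> with lower index \<open>m\<close> and upper index \<open>L\<close>.\<close>

definition fpoly :: "nat \<Rightarrow> nat \<Rightarrow> real \<Rightarrow> real" where
  "fpoly m L x = (\<Sum>k=m..L. 1 / real k * real_of_int (stirling1 L k) * real (k choose m)
                    * (x + real L / 2) ^ (k - m))"


subsection \<open>The WRT invariant\<close>

definition sawtooth :: "real \<Rightarrow> real" where
  "sawtooth x = (if x \<in> \<int> then 0 else x - of_int \<lfloor>x\<rfloor> - 1/2)"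

definition dedekind_sum :: "nat \<Rightarrow> nat \<Rightarrow> real" where
  "dedekind_sum b a = (\<Sum>k=1..<a. sawtooth (real k / real a) * sawtooth (real (k * b) / real a))"

definition phi :: "nat \<Rightarrow> (nat \<Rightarrow> nat) \<Rightarrow> real" where
  "phi M p = 3 - 1 / real (prodP M p) + 12 * (\<Sum>j=1..M. dedekind_sum (prodP M p div p j) (p j))"

definition lawrence_rozansky :: "nat \<Rightarrow> (nat \<Rightarrow> nat) \<Rightarrow> nat \<Rightarrow> complex" where
  "lawrence_rozansky M p N =
     (let P = prodP M p in
      epi (1/4) / complex_of_real (2 * sqrt (2 * real P * real N)) *
      (\<Sum>n \<in> {n \<in> {0..<2 * P * N}. \<not> N dvd n}.
          epi (- (real n ^ 2 / (2 * real P * real N)))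
          * (\<Prod>j=1..M. epi (real n / (real N * real (p j))) - epi (- (real n / (real N * real (p j)))))
          / (epi (real n / real N) - epi (- (real n / real N))) ^ (M - 2)))"

text \<open>
  The Witten--Reshetikhin--Turaev invariant of \<open>\<Sigma>(p_1, \<dots>, p_M)\<close>, normalised to 1 on the
  3-sphere: the Lawrence--Rozansky formula solved for the invariant.  The divisor is nonzero
  exactly for \<open>N \<ge> 2\<close>; the value at \<open>N = 1\<close> carries no information.
\<close>

definition wrt :: "nat \<Rightarrow> (nat \<Rightarrow> nat) \<Rightarrow> nat \<Rightarrow> complex" where
  "wrt M p N =
     lawrence_rozansky M p N / (epi (2 / real N * (phi M p / 4 - 1/2)) * (epi (2 / real N) - 1))"


subsection \<open>Tuples and periodic functions\<close>

definition tuples :: "nat \<Rightarrow> (nat \<Rightarrow> nat) \<Rightarrow> (nat \<Rightarrow> int) set" where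
  "tuples M p = (\<Pi>\<^sub>E j\<in>{1..M}. {0<..<int (p j)})"

definition signs :: "nat \<Rightarrow> (nat \<Rightarrow> int) set" where
  "signs M = (\<Pi>\<^sub>E j\<in>{1..M}. {-1, 1})"

definition allones :: "nat \<Rightarrow> nat \<Rightarrow> int" where
  "allones M = (\<lambda>j\<in>{1..M}. 1)"

definition flip :: "(nat \<Rightarrow> nat) \<Rightarrow> nat \<Rightarrow> (nat \<Rightarrow> int) \<Rightarrow> (nat \<Rightarrow> int)" where
  "flip p j l = l(j := int (p j) - l j)"

text \<open>The integer \<open>P (1 + \<Sum>\<^sub>j \<epsilon>_j l_j / p_j)\<close>.\<close>

definition res :: "nat \<Rightarrow> (nat \<Rightarrow> nat) \<Rightarrow> (nat \<Rightarrow> int) \<Rightarrow> (nat \<Rightarrow> int) \<Rightarrow> int" where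
  "res M p e l = int (prodP M p) + (\<Sum>j=1..M. e j * l j * int (prodP M p div p j))"

text \<open>
  For pairwise coprime \<open>p_j\<close> the \<open>2^M\<close> residues \<open>res M p e l\<close> are distinct modulo \<open>2 P\<close>,
  so the choice below is unique.
\<close>

definition chi :: "nat \<Rightarrow> (nat \<Rightarrow> nat) \<Rightarrow> (nat \<Rightarrow> int) \<Rightarrow> int \<Rightarrow> int" where
  "chi M p l n =
     (let Q = (\<lambda>e. e \<in> signs M \<and> [n = res M p e l] (mod 2 * int (prodP M p))) in
      if \<exists>e. Q e then - (\<Prod>j=1..M. (SOME e. Q e) j) else 0)"

definition tuple_equiv ::
    "nat \<Rightarrow> (nat \<Rightarrow> nat) \<Rightarrow> (nat \<Rightarrow> int) \<Rightarrow> (nat \<Rightarrow> int) \<Rightarrow> bool" where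
  "tuple_equiv M p =
     equivclp (\<lambda>l l'. \<exists>i\<in>{1..M}. \<exists>j\<in>{1..M}. l' = flip p i (flip p j l))"

definition representatives :: "nat \<Rightarrow> (nat \<Rightarrow> nat) \<Rightarrow> (nat \<Rightarrow> int) set \<Rightarrow> bool" where
  "representatives M p R \<longleftrightarrow>
     R \<subseteq> tuples M p \<and> (\<forall>l\<in>tuples M p. \<exists>!r. r \<in> R \<and> tuple_equiv M p l r)"

lemma representatives_exist: "\<exists>R. representatives M p R"
proof -
  let ?c = "\<lambda>l. SOME r. r \<in> tuples M p \<and> tuple_equiv M p l r"
  have refl: "tuple_equiv M p l l" for l
    unfolding tuple_equiv_def by (rule equivclp_refl)
  have sym: "tuple_equiv M p l' l" if "tuple_equiv M p l l'" for l l'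
    using that unfolding tuple_equiv_def by (rule equivclp_sym)
  have trans: "tuple_equiv M p l l''" if "tuple_equiv M p l l'" "tuple_equiv M p l' l''" for l l' l''
    using that unfolding tuple_equiv_def by (rule equivclp_trans)
  have c: "?c l \<in> tuples M p \<and> tuple_equiv M p l (?c l)" if "l \<in> tuples M p" for l
    by (rule someI[of "\<lambda>r. r \<in> tuples M p \<and> tuple_equiv M p l r" l]) (use that refl in simp)
  have eq: "?c l = ?c l'" if "tuple_equiv M p l l'" for l l'
  proof -
    have "tuple_equiv M p l r \<longleftrightarrow> tuple_equiv M p l' r" for r
      using that sym trans by blast
    then show ?thesis by simp
  qed
  have "\<exists>!r. r \<in> ?c ` tuples M p \<and> tuple_equiv M p l r" if l: "l \<in> tuples M p" for l
  proof (rule ex1I[of _ "?c l"])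
    show "?c l \<in> ?c ` tuples M p \<and> tuple_equiv M p l (?c l)"
      using c[OF l] l by blast
  next
    fix r assume r: "r \<in> ?c ` tuples M p \<and> tuple_equiv M p l r"
    then obtain l' where l': "l' \<in> tuples M p" "r = ?c l'" by blast
    then have "tuple_equiv M p l l'"
      using c[of l'] r sym trans by blast
    then show "r = ?c l" using eq l'(2) by simp
  qed
  then have "representatives M p (?c ` tuples M p)"
    unfolding representatives_def using c by blast
  then show ?thesis by blast
qed


subsection \<open>Matrices\<close>

text \<open>The second argument is the upper index, the third the lower one.\<close>

definition Smat :: "nat \<Rightarrow> (nat \<Rightarrow> nat) \<Rightarrow> (nat \<Rightarrow> int) \<Rightarrow> (nat \<Rightarrow> int) \<Rightarrow> complex" where
  "Smat M p l l' =
     (let P = prodP M p in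
      2 ^ M * ipow (real M - real (m2 M)) / complex_of_real (sqrt (2 * real P))
      * (-1) powi (int P + (\<Sum>j=1..M. (l j + l' j) * int (P div p j))
                   + (\<Sum>j=1..M. \<Sum>k\<in>{1..M} - {j}. l j * l' k * int (P div (p j * p k))))
      * complex_of_real (\<Prod>j=1..M.
          sin (real P * (real_of_int (l j) * real_of_int (l' j) / real (p j) ^ 2) * pi)))"

definition Nmat :: "nat \<Rightarrow> int \<Rightarrow> nat \<Rightarrow> real" where
  "Nmat P a b =
     (if [a = 0] (mod 2 * int P) then 1 / sqrt (2 * real P)
      else if [a = int P] (mod 2 * int P) then 1 / sqrt (2 * real P) * cos (real b * pi)
      else sqrt (2 / real P) * cos (real_of_int a * real b * pi / real P))"

definition Mmat :: "nat \<Rightarrow> int \<Rightarrow> nat \<Rightarrow> real" where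
  "Mmat P a b = sqrt (2 / real P) * sin (real_of_int a * real b * pi / real P)"


subsection \<open>Sign sums\<close>

definition eta_quot :: "nat \<Rightarrow> (nat \<Rightarrow> nat) \<Rightarrow> (nat \<Rightarrow> int) \<Rightarrow> real" where
  "eta_quot M p \<eta> = (\<Sum>j=1..M. real_of_int (\<eta> j) / real (p j))"

definition eta_set :: "nat \<Rightarrow> (nat \<Rightarrow> nat) \<Rightarrow> nat \<Rightarrow> (nat \<Rightarrow> int) set" where
  "eta_set M p a =
     {\<eta> \<in> signs M. 2 * real a - 1 < eta_quot M p \<eta> \<and> eta_quot M p \<eta> < 2 * real a + 1}"

definition signed_sum ::
    "nat \<Rightarrow> (nat \<Rightarrow> nat) \<Rightarrow> nat \<Rightarrow> ((nat \<Rightarrow> int) \<Rightarrow> 'a) \<Rightarrow> 'a :: comm_ring_1" where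
  "signed_sum M p a g = (\<Sum>\<eta>\<in>eta_set M p a. of_int (\<Prod>j=1..M. \<eta> j) * g \<eta>)"

definition sigma :: "nat \<Rightarrow> int \<Rightarrow> int" where
  "sigma P x = (int P - x) mod (2 * int P)"

text \<open>
  The result lies in \<open>{0..<2 * P}\<close>, also when \<open>M - 1\<close> is even, since \<open>sigma\<close> is then iterated
  at least twice (\<open>M \<ge> 3\<close>).
\<close>

definition xarg :: "nat \<Rightarrow> (nat \<Rightarrow> nat) \<Rightarrow> (nat \<Rightarrow> int) \<Rightarrow> nat \<Rightarrow> int" where
  "xarg M p \<eta> a =
     (sigma (prodP M p) ^^ (M - 1))
       ((\<Sum>j=1..M. \<eta> j * int (prodP M p div p j)) - int (prodP M p) * (2 * int a - 1))"


subsection \<open>Ingredients of the expansion\<close>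

text \<open>The two inner sums over \<open>j\<close>, each of which occurs twice in the expansion.\<close>

definition even_part :: "nat \<Rightarrow> nat \<Rightarrow> nat \<Rightarrow> int \<Rightarrow> complex" where
  "even_part P N m a =
     (\<Sum>j=1..m. complex_of_real (real N powr (real m + real j - 1/2))
        * (\<i> / complex_of_real (2 * real P * pi)) ^ (m - j)
        * complex_of_real (Kcoeff (j - 1) (m - 1) 0 * (real m / real j))
        * (\<Sum>c=0..P. complex_of_real (Nmat P a c
              * ((2 - of_bool (c = 0) - of_bool (c = P)) / 2)
              * bernpoly (2 * j) (real c / (2 * real P)))
            * epi (- (real N * (real c ^ 2 / (2 * real P))))))"

definition odd_part :: "nat \<Rightarrow> nat \<Rightarrow> nat \<Rightarrow> int \<Rightarrow> complex" where
  "odd_part P N m a =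
     (\<Sum>j=0..m. complex_of_real (real N powr (real m + real j + 1/2))
        * (\<i> / complex_of_real (2 * real P * pi)) ^ (m - j)
        * complex_of_real (Kcoeff j m 1 * (real (2 * m + 1) / real (2 * j + 1)))
        * (\<Sum>c=1..P - 1. complex_of_real (Mmat P a c
              * bernpoly (2 * j + 1) (real c / (2 * real P)))
            * epi (- (real N * (real c ^ 2 / (2 * real P))))))"

definition Tcoeff :: "nat \<Rightarrow> (nat \<Rightarrow> nat) \<Rightarrow> nat \<Rightarrow> real" where
  "Tcoeff M p k =
     (let P = prodP M p; l0 = (flip p 1 ^^ (M - 1)) (allones M) in
      (-1) ^ (M + 1) / 2 * ((2 * real P) ^ (2 * k) / fact (M - 3))
      * (\<Sum>n=1..2 * P. real_of_int (chi M p l0 (int n))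
          * (\<Sum>j=1..M - 2. (-1) ^ j * (real j / real (2 * k + j))
              * bernpoly (2 * k + j) (real n / (2 * real P))
              * fpoly j (M - 2)
                  (real (n + (M - 1) * P) / (2 * real P)
                    - of_int \<lfloor>real (n + (M - 1) * P) / (2 * real P)\<rfloor> - 1/2)))
      - (2 * real P) ^ (2 * k) / fact (M - 4)
      * (\<Sum>\<^sub>\<infinity>a\<in>{1..}. \<Sum>b<a. signed_sum M p a (\<lambda>\<eta>.
          \<Sum>j=1..M - 3. (-1) ^ ((M + 1) * (j + 1)) * (real j / real (2 * k + j))
            * fpoly j (M - 3) (real b + 1/2 - 1/2 * eta_quot M p \<eta>)
            * bernpoly (2 * k + j) (real_of_int (xarg M p \<eta> a) / (2 * real P)))))"

end

theory Submission
  imports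
    Defs
    "HOL-Complex_Analysis.Complex_Analysis"
    "HOL-Probability.Distributions"
    "HOL-Real_Asymp.Real_Asymp"
begin

text \<open>
  With \<open>T = 2\<pi>\<i>n/N\<close> the summand of the Lawrence--Rozansky formula becomes \<open>g(T) = exp(\<i>\<lambda>T\<^sup>2) F(T)\<close>, where
  \<open>\<lambda> = N/(8\<pi>P)\<close> and \<open>F\<close> is an even quotient of hyperbolic sines with period \<open>4\<pi>\<i>P\<close>.  Completing the square gives
  \<open>g(T + 4\<pi>\<i>P) = exp(-NT) g(T)\<close>, so \<open>h(T) = g(T)/(1 - exp(-NT))\<close> satisfies \<open>h(T) - h(T + 4\<pi>\<i>P) = g(T)\<close>, and
  \<open>2\<pi>\<i>\<close> times the sum of the residues of \<open>h\<close> with \<open>0 < Im T < 4\<pi>P\<close> is the integral of \<open>g\<close> over the real line.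
  The residues with \<open>n\<close> not divisible by \<open>N\<close> form the Lawrence--Rozansky sum.  The other poles are those of \<open>F\<close>, of order \<open>M - 2\<close>;
  their residues are quadratic Gauss sums weighted by Bernoulli polynomials and yield the finitely many
  leading terms.  Rotating the integral to the line of steepest descent, Watson's lemma yields the power series,
  whose coefficients are the Taylor coefficients of \<open>F\<close> at \<open>0\<close>.
\<close>

subsection \<open>Laurent coefficients in terms of Bernoulli polynomials\<close>

text \<open>At T = 2 pi i m the function h can have a pole of order M - 1, one more than F, because
  1 - exp(-NT) vanishes there too. The part due to this extra simple pole, 1/(N t), is the same for
  all m, so its total is the residue of a twisted sum of the Laurent expansions of F. The twist is a
  quadratic Gauss sum whose frequency depends on a sign vector \<eta>; multiplication by units u
  with u^2 = 1 modulo 4P, supplied by pairwise coprimality, shows that its value does not depend on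
  \<eta>. What is left is a multiple of the expansion of F at 0, where M zeros of the numerator
  against M - 2 of the denominator leave a double zero. The absence of a principal part at 0 also
  removes the remainder B_1(0) of the odd Bernoulli sums. The polynomials f_m^L enter because
  e^(at)/(1 - e^t)^L arises from e^(yt)/(1 - e^t), with a - y an integer, by a differential operator
  whose symbol is the derivative in z of the sum of f_m^L(x) z^m. The sums over a and b measure how
  far the sum of the \<eta>_j / p_j leaves (-1, 1).\<close>

definition fgen :: "nat \<Rightarrow> real \<Rightarrow> real poly" where
  "fgen L x = (\<Sum>m=1..L. monom (real m * fpoly m L x) (m - 1))"

lemma coeff_fgen: "m \<in> {1..L} \<Longrightarrow> coeff (fgen L x) (m - 1) = real m * fpoly m L x"
  unfolding fgen_def coeff_sum coeff_monom
  by (subst sum.mono_neutral_right[of _ "{m}"]) auto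

lemma degree_fgen: "degree (fgen L x) \<le> L - 1"
  unfolding fgen_def by (rule degree_sum_le) (auto intro: order_trans[OF degree_monom_le])

text \<open>Put X = x + L/2. The identity m binom(k, m) = k binom(k-1, m-1) cancels the factor 1/k
  in \<open>fpoly\<close>, and the binomial theorem then sums over m. What remains is the falling
  factorial of length L at X + y divided by X + y; \<open>fgen L x\<close> is thus the derivative in
  y of the sum of \<open>fpoly m L x\<close> times y^m.\<close>

lemma fgen_eq:
  assumes "L \<ge> 1"
  shows "fgen L x = (\<Prod>j=1..<L. [:x + real L / 2 - real j, 1:])"
proof -
  define X where "X = x + real L / 2"
  have *: "real m * fpoly m L x * y ^ (m - 1)
      = (\<Sum>k=1..L. if m \<le> k then of_int (stirling1 L k) * (real (k - 1 choose (m - 1)) * X ^ (k - m) * y ^ (m - 1)) else 0)"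
    if "m \<in> {1..L}" for m y
  proof -
    have "real m * fpoly m L x * y ^ (m - 1)
       = (\<Sum>k=m..L. of_int (stirling1 L k) * (real (k - 1 choose (m - 1)) * X ^ (k - m) * y ^ (m - 1)))"
      unfolding fpoly_def sum_distrib_left sum_distrib_right
    proof (rule sum.cong)
      fix k assume k: "k \<in> {m..L}"
      have "real m * real (k choose m) = real k * real (k - 1 choose (m - 1))"
        using times_binomial_minus1_eq[of m k] that k
        by (metis atLeastAtMost_iff less_eq_Suc_le One_nat_def of_nat_mult)
      then have eq: "real (k - 1 choose (m - 1)) = real m / real k * real (k choose m)"
        using that k by (simp add: field_simps)
      show "real m * (1 / real k * of_int (stirling1 L k) * real (k choose m) * (x + real L / 2) ^ (k - m)) * y ^ (m - 1)
        = of_int (stirling1 L k) * (real (k - 1 choose (m - 1)) * X ^ (k - m) * y ^ (m - 1))"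
        unfolding X_def eq by simp
    qed simp
    also have "\<dots> = (\<Sum>k=1..L. if m \<le> k then of_int (stirling1 L k) * (real (k - 1 choose (m - 1)) * X ^ (k - m) * y ^ (m - 1)) else 0)"
      using that by (intro sum.mono_neutral_cong_left) auto
    finally show ?thesis .
  qed
  have ev: "poly (fgen L x) y = (\<Sum>k=1..L. of_int (stirling1 L k) * (X + y) ^ (k - 1))" for y
  proof -
    have "poly (fgen L x) y = (\<Sum>m=1..L. real m * fpoly m L x * y ^ (m - 1))"
      by (simp add: fgen_def poly_sum poly_monom)
    also have "\<dots> = (\<Sum>m=1..L. \<Sum>k=1..L. if m \<le> k then of_int (stirling1 L k) * (real (k - 1 choose (m - 1)) * X ^ (k - m) * y ^ (m - 1)) else 0)"
      using * by (intro sum.cong) auto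
    also have "\<dots> = (\<Sum>k=1..L. \<Sum>m=1..L. if m \<le> k then of_int (stirling1 L k) * (real (k - 1 choose (m - 1)) * X ^ (k - m) * y ^ (m - 1)) else 0)"
      by (rule sum.swap)
    also have "\<dots> = (\<Sum>k=1..L. of_int (stirling1 L k) * (X + y) ^ (k - 1))"
    proof (rule sum.cong)
      fix k assume k: "k \<in> {1..L}"
      have "(\<Sum>m=1..L. if m \<le> k then of_int (stirling1 L k) * (real (k - 1 choose (m - 1)) * X ^ (k - m) * y ^ (m - 1)) else 0)
         = (\<Sum>m=1..k. of_int (stirling1 L k) * (real (k - 1 choose (m - 1)) * X ^ (k - m) * y ^ (m - 1)))"
        using k by (intro sum.mono_neutral_cong_right) auto
      also have "\<dots> = (\<Sum>i\<le>k - 1. of_int (stirling1 L k) * (real (k - 1 choose i) * X ^ (k - 1 - i) * y ^ i))"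
        using k by (intro sum.reindex_bij_witness[of _ Suc "\<lambda>m. m - 1"]) auto
      also have "\<dots> = of_int (stirling1 L k) * (y + X) ^ (k - 1)"
        unfolding binomial_ring sum_distrib_left by (intro sum.cong) (auto simp: mult_ac)
      finally show "(\<Sum>m=1..L. if m \<le> k then of_int (stirling1 L k) * (real (k - 1 choose (m - 1)) * X ^ (k - m) * y ^ (m - 1)) else 0)
        = of_int (stirling1 L k) * (X + y) ^ (k - 1)"
        by (simp add: add.commute)
    qed simp
    finally show ?thesis .
  qed
  \<comment> \<open>The linear factor for j = 0 is restored on both sides so that the Stirling
    generating function applies; it is cancelled afterwards as a nonzero polynomial.\<close>
  have "[:X, 1:] * fgen L x = [:X, 1:] * (\<Prod>j=1..<L. [:X - real j, 1:])"
  proof (rule poly_eq_poly_eq_iff[THEN iffD1], rule ext)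
    fix y
    have "poly ([:X, 1:] * fgen L x) y = (X + y) * poly (fgen L x) y"
      by (simp add: algebra_simps)
    also have "\<dots> = (\<Sum>k=1..L. of_int (stirling1 L k) * ((X + y) * (X + y) ^ (k - 1)))"
      unfolding ev sum_distrib_left by (simp add: mult_ac)
    also have "\<dots> = (\<Sum>k=1..L. of_int (stirling1 L k) * (X + y) ^ k)"
      by (intro sum.cong) (auto simp flip: power_Suc)
    also have "\<dots> = (\<Sum>k\<le>L. of_int (stirling1 L k) * (X + y) ^ k)"
      using assms by (intro sum.mono_neutral_left) (auto simp: stirling1_def not_le)
    also have "\<dots> = (\<Prod>j<L. X + y - real j)"
      by (rule stirling1_generating[symmetric])
    also have "{..<L} = insert 0 {1..<L}"
      using assms by auto
    also have "(\<Prod>j\<in>insert 0 {1..<L}. X + y - real j) = poly ([:X, 1:] * (\<Prod>j=1..<L. [:X - real j, 1:])) y"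
      by (simp add: poly_prod algebra_simps)
    finally show "poly ([:X, 1:] * fgen L x) y = poly ([:X, 1:] * (\<Prod>j=1..<L. [:X - real j, 1:])) y" .
  qed
  then show ?thesis
    by (subst (asm) mult_left_cancel) (auto simp: X_def)
qed

lemma poly_fgen: "L \<ge> 1 \<Longrightarrow> poly (fgen L x) y = (\<Prod>j=1..<L. y + x + real L / 2 - real j)"
  by (simp add: fgen_eq poly_prod algebra_simps)

lemma fpoly_self: "fpoly L L x = 1 / real L"
  by (simp add: fpoly_def stirling1_def)

text \<open>The numbers j - L/2 with 1 <= j < L are symmetric about 0: replacing j by L - j turns
  the L - 1 linear factors of \<open>fgen\<close> at - x into the negatives of those at x with y
  negated.\<close>

lemma fpoly_uminus:
  assumes "l \<in> {1..L}"
  shows "fpoly l L (- x) = (-1) ^ (L + l) * fpoly l L x"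
proof -
  have L: "L \<ge> 1" using assms by auto
  have "fgen L (- x) = smult ((-1) ^ (L - 1)) (pcompose (fgen L x) [:0, -1:])"
  proof (rule poly_eq_poly_eq_iff[THEN iffD1], rule ext)
    fix y
    have "poly (fgen L (- x)) y = (\<Prod>j=1..<L. y - x + real L / 2 - real j)"
      using L by (simp add: poly_fgen)
    also have "\<dots> = (\<Prod>j=1..<L. y - x + real L / 2 - real (L - j))"
      by (rule prod.reindex_bij_witness[of _ "\<lambda>j. L - j" "\<lambda>j. L - j"]) auto
    also have "\<dots> = (\<Prod>j=1..<L. (-1) * (- y + x + real L / 2 - real j))"
      by (intro prod.cong) (auto simp: of_nat_diff field_simps)
    also have "\<dots> = (-1) ^ (L - 1) * (\<Prod>j=1..<L. - y + x + real L / 2 - real j)"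
      by (subst prod.distrib) simp
    also have "\<dots> = poly (smult ((-1) ^ (L - 1)) (pcompose (fgen L x) [:0, -1:])) y"
      using L by (simp add: poly_fgen poly_pcompose)
    finally show "poly (fgen L (- x)) y = poly (smult ((-1) ^ (L - 1)) (pcompose (fgen L x) [:0, -1:])) y" .
  qed
  then have "coeff (fgen L (- x)) (l - 1) = (-1) ^ (L - 1) * ((-1) ^ (l - 1) * coeff (fgen L x) (l - 1))"
    by (simp add: coeff_pcompose_linear)
  then have "real l * fpoly l L (- x) = real l * ((-1) ^ (L - 1) * (-1) ^ (l - 1) * fpoly l L x)"
    unfolding coeff_fgen[OF assms] by (simp add: mult.assoc)
  moreover have "(-1::real) ^ (L - 1) * (-1) ^ (l - 1) = (-1) ^ (L + l)"
    using assms by (cases L; cases l) (auto simp: power_add)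
  ultimately show ?thesis using assms by auto
qed

text \<open>A shift of x by 1 exchanges a single linear factor: with Z = y + x + L/2 both products
  share the factors Z - j for 1 <= j <= L - 2, and the remaining ones, Z and Z - (L - 1), differ by
  L - 1. The common product belongs to L - 1, where the argument x + 1/2 makes up for the change of
  L/2.\<close>

lemma fpoly_plus_one:
  assumes "l \<in> {1..L}" "L \<ge> 2"
  shows "fpoly l L (x + 1) = fpoly l L x + (if l < L then real (L - 1) * fpoly l (L - 1) (x + 1/2) else 0)"
proof -
  have "fgen L (x + 1) = fgen L x + smult (real (L - 1)) (fgen (L - 1) (x + 1/2))"
  proof (rule poly_eq_poly_eq_iff[THEN iffD1], rule ext)
    fix y
    define Z where "Z = y + x + real L / 2"
    have 1: "{1..<L} = insert (L - 1) {1..<L - 1}" using assms by auto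
    have "poly (fgen L (x + 1)) y = (\<Prod>j=1..<L. Z + 1 - real j)"
      using assms by (simp add: poly_fgen Z_def algebra_simps)
    also have "\<dots> = (\<Prod>j<L-1. Z - real j)"
      by (rule prod.reindex_bij_witness[of _ Suc "\<lambda>j. j - 1"]) auto
    also have "{..<L-1} = insert 0 {1..<L-1}" using assms by auto
    also have "(\<Prod>j\<in>insert 0 {1..<L-1}. Z - real j) = Z * (\<Prod>j=1..<L-1. Z - real j)"
      by simp
    finally have A: "poly (fgen L (x + 1)) y = Z * (\<Prod>j=1..<L-1. Z - real j)" .
    have B: "poly (fgen L x) y = (Z - real (L - 1)) * (\<Prod>j=1..<L-1. Z - real j)"
      using assms unfolding 1 by (simp add: poly_fgen[of L, unfolded 1] Z_def)
    have C: "poly (fgen (L - 1) (x + 1/2)) y = (\<Prod>j=1..<L-1. Z - real j)"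
      using assms by (auto simp: poly_fgen Z_def of_nat_diff field_simps intro!: prod.cong)
    show "poly (fgen L (x + 1)) y = poly (fgen L x + smult (real (L - 1)) (fgen (L - 1) (x + 1/2))) y"
      unfolding poly_add poly_smult A B C by (simp add: algebra_simps)
  qed
  then have *: "coeff (fgen L (x + 1)) (l - 1) = coeff (fgen L x) (l - 1) + real (L - 1) * coeff (fgen (L - 1) (x + 1/2)) (l - 1)"
    by simp
  have "coeff (fgen (L - 1) (x + 1/2)) (l - 1) = (if l < L then real l * fpoly l (L - 1) (x + 1/2) else 0)"
    using assms coeff_fgen[of l "L - 1"] degree_fgen[of "L - 1" "x + 1/2"]
    by (auto intro: coeff_eq_0)
  with * have "real l * fpoly l L (x + 1) = real l * (fpoly l L x + (if l < L then real (L - 1) * fpoly l (L - 1) (x + 1/2) else 0))"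
    unfolding coeff_fgen[OF assms(1)] by (auto simp: distrib_left)
  then show ?thesis using assms by simp
qed

section \<open>Bernoulli polynomials as Laurent coefficients of exponential quotients\<close>

lemma bernpoly_generating_scaled:
  fixes c :: complex
  shows "(fps_exp c - 1) * Abs_fps (\<lambda>k. c ^ k * of_real (bernpoly k y) / fact k)
    = fps_const c * fps_X * fps_exp (c * of_real y)"
proof (rule fps_ext)
  fix n
  have "(\<Sum>i=0..n. fps_nth (fps_exp 1 - 1) i * (bernpoly (n - i) y / fact (n - i))) = fps_nth (fps_X * fps_exp y) n"
    using arg_cong[OF bernpoly_generating[of y], of "\<lambda>f. fps_nth f n"]
    by (simp add: fps_mult_nth)
  then have *: "(\<Sum>i=0..n. complex_of_real (fps_nth (fps_exp 1 - 1) i * (bernpoly (n - i) y / fact (n - i))))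
      = of_real (fps_nth (fps_X * fps_exp y) n)"
    by (metis of_real_sum)
  have "fps_nth ((fps_exp c - 1) * Abs_fps (\<lambda>k. c ^ k * of_real (bernpoly k y) / fact k)) n
     = (\<Sum>i=0..n. c ^ n * complex_of_real (fps_nth (fps_exp 1 - 1) i * (bernpoly (n - i) y / fact (n - i))))"
    unfolding fps_mult_nth
  proof (rule sum.cong)
    fix i assume "i \<in> {0..n}"
    then have "c ^ n = c ^ i * c ^ (n - i)" by (simp flip: power_add)
    then show "fps_nth (fps_exp c - 1) i * fps_nth (Abs_fps (\<lambda>k. c ^ k * of_real (bernpoly k y) / fact k)) (n - i)
      = c ^ n * complex_of_real (fps_nth (fps_exp 1 - 1) i * (bernpoly (n - i) y / fact (n - i)))"
      by (cases i) (auto simp: field_simps)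
  qed simp
  also have "\<dots> = c ^ n * of_real (fps_nth (fps_X * fps_exp y) n)"
    by (simp only: * flip: sum_distrib_left)
  also have "\<dots> = fps_nth (fps_const c * fps_X * fps_exp (c * of_real y)) n"
    by (cases n) (auto simp: mult.assoc power_mult_distrib)
  finally show "fps_nth ((fps_exp c - 1) * Abs_fps (\<lambda>k. c ^ k * of_real (bernpoly k y) / fact k)) n
    = fps_nth (fps_const c * fps_X * fps_exp (c * of_real y)) n" .
qed

definition flsexp :: "complex \<Rightarrow> complex fls" where
  "flsexp a = fps_to_fls (fps_exp a)"

lemma flsexp_add: "flsexp (a + b) = flsexp a * flsexp b"
  by (simp add: flsexp_def fps_exp_add_mult fls_times_fps_to_fls)

lemma flsexp_deriv: "fls_deriv (flsexp a) = fls_const a * flsexp a"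
  by (simp add: flsexp_def fls_deriv_fps_to_fls fls_times_fps_to_fls flip: fps_const_to_fls)

lemma flsexp_eq_1_iff: "flsexp a = 1 \<longleftrightarrow> a = 0"
  unfolding flsexp_def
  by (metis fps_exp_eq_1_iff fps_one_to_fls fps_to_fls_eq_iff)

text \<open>The quotient is - 1/(c t) times the generating function of the
  \<open>bernpoly k y\<close> at c t; hence the simple pole and the index shift by 1.\<close>

lemma bern_quotient_nth:
  fixes c :: complex
  assumes c: "c \<noteq> 0"
  shows "fls_nth (flsexp (c * of_real y) / (1 - flsexp c)) n
    = (if n < -1 then 0 else - (c ^ nat (n + 1) * of_real (bernpoly (nat (n + 1)) y) / fact (nat (n + 1))) / c)"
proof -
  let ?A = "Abs_fps (\<lambda>k. c ^ k * of_real (bernpoly k y) / fact k)"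
  have nz: "1 - flsexp c \<noteq> 0"
    using c flsexp_eq_1_iff[of c] by auto
  have "(flsexp c - 1) * fps_to_fls ?A = fls_const c * fls_X * flsexp (c * of_real y)"
    using arg_cong[OF bernpoly_generating_scaled[of c y], of fps_to_fls]
    by (simp add: flsexp_def fls_times_fps_to_fls)
  then have "flsexp (c * of_real y) * (fls_const c * fls_X) = (1 - flsexp c) * (- fps_to_fls ?A)"
    by (simp add: algebra_simps)
  then have "flsexp (c * of_real y) * (fls_const c * fls_X) * (fls_const (1 / c) * fls_X_inv)
    = (1 - flsexp c) * (- fps_to_fls ?A) * (fls_const (1 / c) * fls_X_inv)"
    by simp
  moreover have "(fls_const c * fls_X) * (fls_const (1 / c) * fls_X_inv) = (1 :: complex fls)"
  proof -
    have "(fls_const c * fls_X) * (fls_const (1 / c) * fls_X_inv)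
      = (fls_const c * fls_const (1 / c)) * (fls_X * (fls_X_inv :: complex fls))"
      by (simp only: mult_ac)
    also have "\<dots> = 1" using c by (simp add: fls_X_times_conv_shift fls_X_inv_times_conv_shift)
    finally show ?thesis .
  qed
  ultimately have "flsexp (c * of_real y) = (1 - flsexp c) * (fls_const (- 1 / c) * (fls_X_inv * fps_to_fls ?A))"
    by (metis (no_types, lifting) fls_const_uminus minus_divide_left mult.assoc mult.commute mult.right_neutral mult_minus_left)
  then have "flsexp (c * of_real y) / (1 - flsexp c) = fls_const (- 1 / c) * (fls_X_inv * fps_to_fls ?A)"
    using nz by (metis nonzero_mult_div_cancel_left)
  then show ?thesis
    by (auto simp: fls_X_inv_times_conv_shift)
qed

text \<open>The constant-coefficient differential operator p(d/dt) on Laurent series. In this form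
  the linear factors of \<open>fgen\<close> can act one at a time and in any order.\<close>

definition fls_poly_deriv :: "real poly \<Rightarrow> complex fls \<Rightarrow> complex fls" where
  "fls_poly_deriv p f = (\<Sum>i\<le>degree p. fls_const (of_real (coeff p i)) * (fls_deriv ^^ i) f)"

lemma fls_poly_deriv_altdef:
  assumes "degree p \<le> n"
  shows "fls_poly_deriv p f = (\<Sum>i\<le>n. fls_const (of_real (coeff p i)) * (fls_deriv ^^ i) f)"
  unfolding fls_poly_deriv_def using assms
  by (intro sum.mono_neutral_left) (auto simp: coeff_eq_0)

lemma fls_poly_deriv_linear_factor:
  "fls_poly_deriv ([:c, 1:] * p) f
    = fls_deriv (fls_poly_deriv p f) + fls_const (of_real c) * fls_poly_deriv p f"
proof -
  let ?n = "degree p"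
  let ?D = "\<lambda>i. (fls_deriv ^^ i) f"
  have deg: "degree ([:c, 1:] * p) \<le> Suc ?n"
    by (rule order_trans[OF degree_mult_le]) auto
  have c: "coeff ([:c, 1:] * p) i = c * coeff p i + (if i = 0 then 0 else coeff p (i - 1))" for i
    by (cases i) auto
  have "fls_poly_deriv ([:c, 1:] * p) f
    = (\<Sum>i\<le>Suc ?n. fls_const (of_real c) * (fls_const (of_real (coeff p i)) * ?D i))
      + (\<Sum>i\<le>Suc ?n. fls_const (of_real (if i = 0 then 0 else coeff p (i - 1))) * ?D i)"
    unfolding fls_poly_deriv_altdef[OF deg] sum.distrib[symmetric] c
    by (intro sum.cong refl) (simp only: ring_distribs mult.assoc of_real_add of_real_mult
          flip: fls_const_mult_const fls_plus_const)
  also have "(\<Sum>i\<le>Suc ?n. fls_const (of_real c) * (fls_const (of_real (coeff p i)) * ?D i))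
    = fls_const (of_real c) * fls_poly_deriv p f"
    by (simp only: fls_poly_deriv_altdef[of p "Suc ?n", OF le_SucI[OF order_refl]] sum_distrib_left)
  also have "(\<Sum>i\<le>Suc ?n. fls_const (of_real (if i = 0 then 0 else coeff p (i - 1))) * ?D i)
    = (\<Sum>i\<le>?n. fls_const (of_real (coeff p i)) * ?D (Suc i))"
    by (subst sum.atMost_Suc_shift) simp
  also have "\<dots> = fls_deriv (fls_poly_deriv p f)"
    by (simp add: fls_poly_deriv_def fls_deriv_sum)
  finally show ?thesis by (simp add: add.commute)
qed

text \<open>Obtained by differentiating V U^L = e^(at) with U = 1 - e^t and U' = - e^t. The second
  term carries a raised exponent together with a raised pole order.\<close>

lemma fls_deriv_exp_quotient:
  "fls_deriv (flsexp a / (1 - flsexp 1) ^ L)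
    = fls_const a * (flsexp a / (1 - flsexp 1) ^ L)
      + of_nat L * (flsexp (a + 1) / (1 - flsexp 1) ^ Suc L)"
proof -
  define U where "U = 1 - flsexp 1"
  define V where "V = flsexp a / U ^ L"
  have U: "U \<noteq> 0" using flsexp_eq_1_iff[of 1] by (auto simp: U_def)
  have dU: "fls_deriv U = - flsexp 1" by (simp add: U_def flsexp_deriv)
  have V: "V * U ^ L = flsexp a" using U by (simp add: V_def)
  have "fls_deriv (V * U ^ L) = fls_const a * (V * U ^ L)" by (simp only: V flsexp_deriv)
  then have "fls_deriv V * U ^ L - V * (of_nat L * U ^ (L - 1) * flsexp 1) = fls_const a * (V * U ^ L)"
    by (simp add: fls_deriv_power dU algebra_simps)
  then have "fls_deriv V * U ^ L * U = fls_const a * (V * U ^ L) * U + V * (of_nat L * (U ^ (L - 1) * U) * flsexp 1)"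
    by (simp add: algebra_simps)
  also have "of_nat L * (U ^ (L - 1) * U) = of_nat L * U ^ L"
    by (cases L) (auto simp: mult_ac)
  also have "V * (of_nat L * U ^ L * flsexp 1) = of_nat L * (V * U ^ L * flsexp 1)" by (simp add: mult_ac)
  also have "V * U ^ L * flsexp 1 = flsexp (a + 1)" by (simp add: V flsexp_add)
  finally have "fls_deriv V * U ^ Suc L = (fls_const a * V + of_nat L * (flsexp (a + 1) / U ^ Suc L)) * U ^ Suc L"
    using U by (simp add: field_simps)
  then have "fls_deriv V = fls_const a * V + of_nat L * (flsexp (a + 1) / U ^ Suc L)"
    using U by (subst (asm) mult_right_cancel) auto
  then show ?thesis by (simp only: V_def U_def)
qed

lemma flsexp_quotient_step:
  "flsexp a / (1 - flsexp 1) ^ Suc L - flsexp (a + 1) / (1 - flsexp 1) ^ Suc L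
    = flsexp a / (1 - flsexp 1) ^ L"
proof -
  define U where "U = 1 - flsexp 1"
  have U: "U \<noteq> 0" using flsexp_eq_1_iff[of 1] by (auto simp: U_def)
  have "flsexp a / U ^ Suc L - flsexp (a + 1) / U ^ Suc L = (flsexp a * U) / U ^ Suc L"
    by (simp add: diff_divide_distrib[symmetric] flsexp_add U_def algebra_simps del: power_Suc)
  also have "\<dots> = flsexp a / U ^ L"
    using U by simp
  finally show ?thesis by (simp only: U_def)
qed

text \<open>With \<open>D = d/dt\<close>, the factors \<open>D - y - i\<close> raise both the exponent of \<open>e\<^sup>t\<close> and the order of the
  pole, while the factors \<open>D - y - q + n + 1\<close> raise only the latter.\<close>

lemma flsexp_quotient_chain:
  fixes y :: real
  shows "fls_poly_deriv (\<Prod>i<n. [:if i < q then - (y + real i) else real i + 1 - y - real q, 1:])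
      (flsexp (of_real y) / (1 - flsexp 1))
    = of_nat (fact n) * (flsexp (of_real y + of_nat (min n q)) / (1 - flsexp 1) ^ Suc n)"
proof (induction n)
  case 0
  show ?case by (simp add: fls_poly_deriv_def)
next
  case (Suc n)
  let ?U = "1 - flsexp 1"
  let ?a = "complex_of_real y + of_nat (min n q)"
  let ?V = "flsexp ?a / ?U ^ Suc n"
  let ?W = "flsexp (?a + 1) / ?U ^ Suc (Suc n)"
  let ?c = "if n < q then - (y + real n) else real n + 1 - y - real q"
  have "fls_poly_deriv (\<Prod>i<Suc n. [:if i < q then - (y + real i) else real i + 1 - y - real q, 1:]) (flsexp (of_real y) / ?U)
     = fls_deriv (of_nat (fact n) * ?V) + fls_const (of_real ?c) * (of_nat (fact n) * ?V)"
    by (simp only: prod.lessThan_Suc mult.commute[of _ "[:?c, 1:]"] fls_poly_deriv_linear_factor Suc.IH)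
  also have "\<dots> = of_nat (fact n) * (fls_deriv ?V + fls_const (of_real ?c) * ?V)"
    by (simp only: fls_deriv_mult fls_deriv_of_nat mult_zero_left add_0_left add_0_right distrib_left mult.left_commute[of "fls_const _"])
  also have "fls_deriv ?V + fls_const (of_real ?c) * ?V
    = fls_const (?a + of_real ?c) * ?V + of_nat (Suc n) * ?W"
    by (simp only: fls_deriv_exp_quotient fls_plus_const[symmetric] ring_distribs) (simp add: algebra_simps)
  also have "\<dots> = of_nat (Suc n) * (flsexp (of_real y + of_nat (min (Suc n) q)) / ?U ^ Suc (Suc n))"
  proof (cases "n < q")
    case True
    then show ?thesis by (simp add: min_def add_ac)
  next
    case False
    \<comment> \<open>From step q on the constant is chosen so that the undifferentiated term has
      coefficient n + 1, equal to that of the term with raised exponent; the two merge into one term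
      with the old exponent.\<close>
    then have 1: "?a + of_real ?c = of_nat (Suc n)" and 2: "min (Suc n) q = min n q" by (auto simp: min_def)
    have "fls_const (?a + of_real ?c) = (of_nat (Suc n) :: complex fls)"
      unfolding 1 by (rule fls_of_nat[symmetric])
    then have "fls_const (?a + of_real ?c) * ?V + of_nat (Suc n) * ?W = of_nat (Suc n) * (?V + ?W)"
      by (simp only: ring_distribs)
    also have "?V + ?W = flsexp ?a / ?U ^ Suc (Suc n)"
      using flsexp_quotient_step[of ?a "Suc n"] by (simp only: diff_eq_eq)
    finally show ?thesis by (simp only: 2)
  qed
  finally show ?case by (simp add: algebra_simps)
qed

text \<open>At the argument L/2 - (y + q) the L - 1 factors of \<open>fgen\<close> are the operators
  of the preceding chain in another order: those with L - j <= q raise the exponent from y to y + q,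
  the others only the pole order. There are q of the former kind exactly because q < L.\<close>

lemma fls_poly_deriv_fgen:
  fixes y :: real
  assumes "q < L"
  shows "fls_poly_deriv (fgen L (real L / 2 - (y + real q))) (flsexp (of_real y) / (1 - flsexp 1))
    = of_nat (fact (L - 1)) * (flsexp (of_real (y + real q)) / (1 - flsexp 1) ^ L)"
proof -
  have "fgen L (real L / 2 - (y + real q)) = (\<Prod>j=1..<L. [:real L - real j - y - real q, 1:])"
    using assms by (simp add: fgen_eq algebra_simps)
  also have "\<dots> = (\<Prod>i<L - 1. [:if i < q then - (y + real i) else real i + 1 - y - real q, 1:])"
    by (rule prod.reindex_bij_witness[of _ "\<lambda>i. if i < q then L - (q - i) else L - (i + 1)"
          "\<lambda>j. if L - j \<le> q then q - (L - j) else L - j - (1::nat)"])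
       (use assms in \<open>auto simp: of_nat_diff\<close>)
  finally have "fgen L (real L / 2 - (y + real q)) = \<dots>" .
  moreover have "min (L - 1) q = q" "Suc (L - 1) = L" using assms by auto
  ultimately show ?thesis
    using flsexp_quotient_chain[where n = "L - 1" and q = q and y = y]
    by (simp only: of_real_add of_real_of_nat_eq)
qed

lemma fls_deriv_funpow_nth:
  fixes f :: "complex fls"
  shows "fls_nth ((fls_deriv ^^ i) f) n = pochhammer (of_int (n + 1)) i * fls_nth f (n + int i)"
  by (induction i arbitrary: n) (auto simp: pochhammer_rec add_ac)

lemma fls_poly_deriv_fgen_nth:
  "fls_nth (fls_poly_deriv (fgen L x) f) n
    = (\<Sum>m=1..L. of_real (real m * fpoly m L x) * (pochhammer (of_int (n + 1)) (m - 1) * fls_nth f (n + int (m - 1))))"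
proof (cases L)
  case 0
  then show ?thesis by (simp add: fgen_def fls_poly_deriv_def)
next
  case (Suc k)
  have "fls_nth (fls_poly_deriv (fgen L x) f) n = (\<Sum>i\<le>L - 1. of_real (coeff (fgen L x) i)
      * (pochhammer (of_int (n + 1)) i * fls_nth f (n + int i)))"
    by (simp add: fls_poly_deriv_altdef[OF degree_fgen] fls_nth_sum fls_deriv_funpow_nth)
  also have "\<dots> = (\<Sum>m=1..L. of_real (coeff (fgen L x) (m - 1)) * (pochhammer (of_int (n + 1)) (m - 1) * fls_nth f (n + int (m - 1))))"
    by (rule sum.reindex_bij_witness[of _ "\<lambda>m. m - 1" Suc]) (auto simp: Suc)
  also have "\<dots> = (\<Sum>m=1..L. of_real (real m * fpoly m L x) * (pochhammer (of_int (n + 1)) (m - 1) * fls_nth f (n + int (m - 1))))"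
    by (intro sum.cong refl) (simp only: coeff_fgen)
  finally show ?thesis .
qed

text \<open>Coefficient extraction from the operator identity: repeated differentiation multiplies
  by a rising factorial, which reduces the denominator (n + m)! of the Bernoulli coefficient to n!
  times n + m.\<close>

lemma flsexp_quotient_nth:
  fixes y :: real
  assumes "q < L"
  shows "fls_nth (flsexp (of_real (y + real q)) / (1 - flsexp 1) ^ L) (int n)
    = - (1 / (fact (L - 1) * fact n)) * of_real (\<Sum>m=1..L. real m / real (n + m)
          * fpoly m L (real L / 2 - (y + real q)) * bernpoly (n + m) y)"
proof -
  let ?Q = "flsexp (of_real (y + real q)) / (1 - flsexp 1) ^ L"
  have f: "(fact (n + k) :: complex) = fact n * pochhammer (of_int (int n + 1)) k" for k and n :: nat
    by (induction k) (simp_all add: pochhammer_Suc algebra_simps)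
  have "fls_nth (of_nat (fact (L - 1)) * ?Q) (int n) = fact (L - 1) * fls_nth ?Q (int n)"
    by (metis fls_of_nat fls_mult_const_nth(1) of_nat_fact)
  also have "fls_nth (of_nat (fact (L - 1)) * ?Q) (int n)
     = (\<Sum>m=1..L. of_real (real m * fpoly m L (real L / 2 - (y + real q)))
         * (pochhammer (of_int (int n + 1)) (m - 1) * (- of_real (bernpoly (n + m) y) / fact (n + m))))"
    unfolding fls_poly_deriv_fgen[OF assms, symmetric] fls_poly_deriv_fgen_nth
  proof (intro sum.cong refl arg_cong2[of _ _ _ _ "(*)"])
    fix m assume "m \<in> {1..L}"
    then have "nat (int n + int (m - 1) + 1) = n + m" "\<not> int n + int (m - 1) < -1" by auto
    then show "fls_nth (flsexp (of_real y) / (1 - flsexp 1)) (int n + int (m - 1)) = - of_real (bernpoly (n + m) y) / fact (n + m)"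
      using bern_quotient_nth[of 1 y "int n + int (m - 1)"] by (simp add: nat_int_add)
  qed
  also have "\<dots> = (\<Sum>m=1..L. - (1 / fact n) * of_real (real m / real (n + m)
          * fpoly m L (real L / 2 - (y + real q)) * bernpoly (n + m) y))"
  proof (intro sum.cong refl)
    fix m assume m: "m \<in> {1..L}"
    then have fct: "fact (n + m) = of_nat (n + m) * (fact n * pochhammer (of_int (int n + 1)) (m - 1) :: complex)"
      using f[of n "m - 1"] by (cases m) auto
    have gen: "(k * A) * (Z * (- B / (N * (F * Z)))) = - (1 / F) * ((k / N) * A * B)"
      if "Z \<noteq> 0" "F \<noteq> 0" "N \<noteq> 0" for k A B F N Z :: complex
      using that by (simp add: field_simps)
    have "pochhammer (of_int (int n + 1)) (m - 1) \<noteq> (0 :: complex)"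
      using f[of n "m - 1"] fact_nonzero[of "n + (m - 1)", where ?'a = complex] by auto
    from gen[OF this fact_nonzero, of "of_nat (n + m)" "of_nat m"] m
    show "of_real (real m * fpoly m L (real L / 2 - (y + real q)))
         * (pochhammer (of_int (int n + 1)) (m - 1) * (- of_real (bernpoly (n + m) y) / fact (n + m)))
       = - (1 / fact n) * complex_of_real (real m / real (n + m)
          * fpoly m L (real L / 2 - (y + real q)) * bernpoly (n + m) y)"
      by (simp only: fct of_real_mult of_real_divide of_real_of_nat_eq of_nat_eq_0_iff) auto
  qed
  finally have fin: "fact (L - 1) * fls_nth ?Q (int n) = - (1 / fact n) * of_real (\<Sum>m=1..L. real m / real (n + m)
          * fpoly m L (real L / 2 - (y + real q)) * bernpoly (n + m) y)"
    by (simp only: sum_distrib_left of_real_sum)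
  have "x = - (1 / (a * b)) * s" if "a * x = - (1 / b) * s" "a \<noteq> 0" for a b s x :: complex
    using that by (cases "b = 0") (auto simp: field_simps)
  from this[OF fin fact_nonzero] show ?thesis .
qed

text \<open>Only m = l survives: for m < l the index lies below the simple pole of the base series,
  and for m > l the rising factorial starting at 1 - l contains the factor 0. The principal part
  therefore involves no Bernoulli polynomials and reads off \<open>fpoly l L\<close> itself.\<close>

lemma flsexp_quotient_nth_neg:
  fixes y :: real
  assumes "q < L" "l \<ge> 1"
  shows "fls_nth (flsexp (of_real (y + real q)) / (1 - flsexp 1) ^ L) (- int l)
    = (if l \<le> L then (-1) ^ l * fact l / fact (L - 1) * of_real (fpoly l L (real L / 2 - (y + real q))) else 0)"
proof -
  let ?Q = "flsexp (of_real (y + real q)) / (1 - flsexp 1) ^ L"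
  let ?f = "\<lambda>m. of_real (real m * fpoly m L (real L / 2 - (y + real q)))"
  let ?G = "flsexp (of_real y) / (1 - flsexp 1)"
  have z: "pochhammer (of_int (- int l + 1)) (m - 1) * fls_nth ?G (- int l + int (m - 1)) = (0::complex)"
    if "m \<noteq> l" "m \<ge> 1" for m
  proof (cases "m < l")
    case True
    then show ?thesis using bern_quotient_nth[of 1 y "- int l + int (m - 1)"] that by simp
  next
    case False
    then have "pochhammer (- of_nat (l - 1)) (m - 1) = (0::complex)"
      using that assms by (intro pochhammer_of_nat_eq_0_lemma) auto
    moreover have "of_int (- int l + 1) = - (of_nat (l - 1) :: complex)" using assms by (simp add: of_nat_diff)
    ultimately show ?thesis by simp
  qed
  have "fls_nth (of_nat (fact (L - 1)) * ?Q) (- int l) = fact (L - 1) * fls_nth ?Q (- int l)"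
    by (metis fls_of_nat fls_mult_const_nth(1) of_nat_fact)
  also have "fls_nth (of_nat (fact (L - 1)) * ?Q) (- int l)
     = (\<Sum>m=1..L. ?f m * (pochhammer (of_int (- int l + 1)) (m - 1) * fls_nth ?G (- int l + int (m - 1))))"
    unfolding fls_poly_deriv_fgen[OF assms(1), symmetric] fls_poly_deriv_fgen_nth ..
  also have "\<dots> = (\<Sum>m\<in>{1..L} \<inter> {l}. ?f m * (pochhammer (of_int (- int l + 1)) (m - 1) * fls_nth ?G (- int l + int (m - 1))))"
    using z by (intro sum.mono_neutral_right) auto
  also have "\<dots> = (if l \<le> L then ?f l * (pochhammer (of_int (- int l + 1)) (l - 1) * fls_nth ?G (-1)) else 0)"
    using assms by (auto simp: of_nat_diff)
  also have "fls_nth ?G (-1) = -1"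
  proof -
    have "bernpoly 0 y = 1"
      using arg_cong[OF bernpoly_generating[of y], of "\<lambda>f. fps_nth f 1"] by (simp add: fps_mult_nth)
    then show ?thesis using bern_quotient_nth[of 1 y "-1"] by simp
  qed
  also have "pochhammer (of_int (- int l + 1)) (l - 1) = ((-1) ^ (l - 1) * fact (l - 1) :: complex)"
    using pochhammer_same[of "l - 1", where ?'a = complex] assms by (simp add: of_nat_diff)
  also have "?f l * ((-1) ^ (l - 1) * fact (l - 1) * -1) = (-1) ^ l * fact l * complex_of_real (fpoly l L (real L / 2 - (y + real q)))"
    using assms by (cases l) auto
  finally show ?thesis by (auto simp: field_simps)
qed

subsection \<open>The generating function\<close>

lemma epi_add: "epi (x + y) = epi x * epi y"
  by (simp add: epi_def ring_distribs exp_add)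

lemma epi_0 [simp]: "epi 0 = 1"
  by (simp add: epi_def)

lemma epi_even_int: "epi (2 * real_of_int k) = 1"
  unfolding epi_def by (subst exp_eq_1) auto

lemma epi_nonzero [simp]: "epi x \<noteq> 0"
  by (simp add: epi_def)

lemma epi_cis: "epi x = cis (x * pi)"
  by (simp add: epi_def cis_conv_exp mult.commute)

lemma epi_half: "epi (1/2) = \<i>"
  by (simp add: epi_cis)

text \<open>Both cases of the theorem meet in \<open>sum_less\<close>. It says that the numerator of
  \<open>F\<close> grows more slowly than the denominator, and it bounds the absolute value of
  \<open>s \<eta>\<close> by L.\<close>

locale seifert =
  fixes M :: nat and p :: "nat \<Rightarrow> nat"
  assumes M_ge_3: "M \<ge> 3"
    and p_ge_2: "\<And>j. j \<in> {1..M} \<Longrightarrow> p j \<ge> 2"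
    and p_coprime: "pairwise (\<lambda>i j. coprime (p i) (p j)) {1..M}"
    and sum_less: "(\<Sum>j=1..M. 1 / real (p j)) < real (M - 2)"
begin

abbreviation P :: nat where "P \<equiv> prodP M p"

definition L :: nat where "L = M - 2"

lemma L_ge_1: "L \<ge> 1" and even_M: "even M \<longleftrightarrow> even L"
  using M_ge_3 by (auto simp: L_def)

lemma p_pos: "j \<in> {1..M} \<Longrightarrow> p j > 0"
  using p_ge_2[of j] by auto

lemma P_pos: "P > 0"
  unfolding prodP_def using p_pos by (intro prod_pos) auto

lemma p_dvd_P: "j \<in> {1..M} \<Longrightarrow> p j dvd P"
  unfolding prodP_def by (rule dvd_prodI) auto

lemma real_P_div: "j \<in> {1..M} \<Longrightarrow> real (P div p j) = real P / real (p j)"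
  by (rule real_of_nat_div[OF p_dvd_P])

abbreviation s :: "(nat \<Rightarrow> int) \<Rightarrow> real" where "s \<equiv> eta_quot M p"

definition esgn :: "(nat \<Rightarrow> int) \<Rightarrow> int" where "esgn \<eta> = (\<Prod>j=1..M. \<eta> j)"

text \<open>At T = 2 pi i m the summand of \<open>F\<close> with sign vector \<eta> has the phase
  exp(pi i m nn / P), so \<open>nn \<eta>\<close> modulo 2P is its frequency.\<close>

definition nn :: "(nat \<Rightarrow> int) \<Rightarrow> int" where
  "nn \<eta> = (\<Sum>j=1..M. \<eta> j * int (P div p j)) + int P * int L"

lemma nn_eq: "real_of_int (nn \<eta>) = real P * (s \<eta> + real L)"
proof -
  have "real_of_int (nn \<eta>) = (\<Sum>j=1..M. real_of_int (\<eta> j) * real (P div p j)) + real P * real L"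
    by (simp add: nn_def)
  also have "(\<Sum>j=1..M. real_of_int (\<eta> j) * real (P div p j)) = (\<Sum>j=1..M. real P * (real_of_int (\<eta> j) / real (p j)))"
    by (intro sum.cong) (auto simp: real_P_div)
  finally show ?thesis by (simp add: eta_quot_def sum_distrib_left algebra_simps)
qed

lemma finite_signs: "finite (signs M)"
  by (simp add: signs_def finite_PiE)

lemma signs_cases: "\<eta> \<in> signs M \<Longrightarrow> j \<in> {1..M} \<Longrightarrow> \<eta> j = 1 \<or> \<eta> j = -1"
  by (auto simp: signs_def PiE_def Pi_def)

lemma abs_s_less: "\<eta> \<in> signs M \<Longrightarrow> \<bar>s \<eta>\<bar> < real L"
proof -
  assume \<eta>: "\<eta> \<in> signs M"
  have "\<bar>s \<eta>\<bar> \<le> (\<Sum>j=1..M. \<bar>real_of_int (\<eta> j) / real (p j)\<bar>)"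
    unfolding eta_quot_def by (rule sum_abs)
  also have "\<dots> = (\<Sum>j=1..M. 1 / real (p j))"
  proof (intro sum.cong refl)
    fix j assume "j \<in> {1..M}"
    then show "\<bar>real_of_int (\<eta> j) / real (p j)\<bar> = 1 / real (p j)"
      using signs_cases[OF \<eta>, of j] by (auto simp: abs_divide)
  qed
  finally show ?thesis using sum_less by (simp add: L_def)
qed

section \<open>The function \<open>F\<close> and its Laurent expansions at the points 2 pi i
  m\<close>

definition F :: "complex \<Rightarrow> complex" where
  "F T = (\<Prod>j=1..M. exp (T / (2 * of_nat (p j))) - exp (- (T / (2 * of_nat (p j)))))
     / (exp (T / 2) - exp (- (T / 2))) ^ L"

lemma prod_exp_diff:
  "(\<Prod>j=1..M. exp (T / (2 * of_nat (p j))) - exp (- (T / (2 * of_nat (p j)))))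
    = (\<Sum>\<eta>\<in>signs M. of_int (esgn \<eta>) * exp (T * of_real (s \<eta>) / 2) :: complex)"
proof -
  have "(\<Prod>j=1..M. exp (T / (2 * of_nat (p j))) - exp (- (T / (2 * of_nat (p j)))))
    = (\<Prod>j=1..M. \<Sum>e\<in>{-1,1::int}. of_int e * exp (of_int e * T / (2 * of_nat (p j))))"
    by (intro prod.cong) auto
  also have "\<dots> = (\<Sum>\<eta>\<in>signs M. \<Prod>j=1..M. of_int (\<eta> j) * exp (of_int (\<eta> j) * T / (2 * of_nat (p j))))"
    unfolding signs_def by (rule prod_sum_PiE) auto
  also have "\<dots> = (\<Sum>\<eta>\<in>signs M. of_int (esgn \<eta>) * exp (T * of_real (s \<eta>) / 2))"
  proof (intro sum.cong refl)
    fix \<eta>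
    have *: "(\<Sum>j=1..M. of_int (\<eta> j) * T / (2 * of_nat (p j))) = T * of_real (s \<eta>) / 2"
      unfolding eta_quot_def of_real_sum sum_distrib_left sum_divide_distrib
      by (intro sum.cong) (auto simp: field_simps)
    show "(\<Prod>j=1..M. of_int (\<eta> j) * exp (of_int (\<eta> j) * T / (2 * of_nat (p j))))
       = of_int (esgn \<eta>) * exp (T * of_real (s \<eta>) / 2)"
      by (simp only: prod.distrib exp_sum[symmetric, OF finite_atLeastAtMost] *) (simp add: esgn_def)
  qed
  finally show ?thesis .
qed

lemma F_expand:
  "F T = (-1) ^ L * (\<Sum>\<eta>\<in>signs M. of_int (esgn \<eta>) * (exp (T * of_real ((s \<eta> + real L) / 2)) / (1 - exp T) ^ L))"
proof -
  have "exp (T / 2) - exp (- (T / 2)) = - exp (- (T / 2)) * (1 - exp T)"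
    by (simp add: algebra_simps flip: exp_add)
  then have "(exp (T / 2) - exp (- (T / 2))) ^ L = (-1) ^ L * exp (- (T / 2)) ^ L * (1 - exp T) ^ L"
    by (metis mult_minus1 power_mult_distrib)
  also have "exp (- (T / 2)) ^ L = exp (- (T * of_real (real L / 2)))"
    unfolding exp_of_nat_mult[symmetric] by (rule arg_cong[of _ _ exp]) simp
  also have "\<dots> = inverse (exp (T * of_real (real L / 2)))" by (rule exp_minus)
  finally have "F T = (-1) ^ L * (\<Sum>\<eta>\<in>signs M. of_int (esgn \<eta>) * exp (T * of_real (s \<eta>) / 2))
      * exp (T * of_real (real L / 2)) / (1 - exp T) ^ L"
    unfolding F_def prod_exp_diff
  proof -
    assume D: "(exp (T / 2) - exp (- (T / 2))) ^ L = (-1) ^ L * inverse (exp (T * of_real (real L / 2))) * (1 - exp T) ^ L"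
    have "inverse ((-1) ^ L) = ((-1) ^ L :: complex)" by (cases "even L") auto
    then show "(\<Sum>\<eta>\<in>signs M. of_int (esgn \<eta>) * exp (T * of_real (s \<eta>) / 2)) / (exp (T / 2) - exp (- (T / 2))) ^ L
      = (-1) ^ L * (\<Sum>\<eta>\<in>signs M. of_int (esgn \<eta>) * exp (T * of_real (s \<eta>) / 2)) * exp (T * of_real (real L / 2)) / (1 - exp T) ^ L"
      unfolding D by (simp only: divide_inverse inverse_mult_distrib inverse_inverse_eq mult_ac)
  qed
  also have "\<dots> = (-1) ^ L * (\<Sum>\<eta>\<in>signs M. of_int (esgn \<eta>) * (exp (T * of_real (s \<eta>) / 2) * exp (T * of_real (real L / 2)) / (1 - exp T) ^ L))"
    by (simp add: sum_distrib_left sum_distrib_right sum_divide_distrib mult_ac)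
  also have "\<dots> = (-1) ^ L * (\<Sum>\<eta>\<in>signs M. of_int (esgn \<eta>) * (exp (T * of_real ((s \<eta> + real L) / 2)) / (1 - exp T) ^ L))"
    by (simp add: exp_add[symmetric] add_divide_distrib algebra_simps)
  finally show ?thesis .
qed

text \<open>The formal expansion of \<open>F\<close> in t = T - 2 pi i m. Since e^T has period 2 pi
  i, the point enters through the phases \<open>epi\<close> only.\<close>

definition FL :: "int \<Rightarrow> complex fls" where
  "FL m = fls_const ((-1) ^ L) * (\<Sum>\<eta>\<in>signs M. fls_const (of_int (esgn \<eta>) * epi (real_of_int m * (s \<eta> + real L)))
      * (flsexp (of_real ((s \<eta> + real L) / 2)) / (1 - flsexp 1) ^ L))"

lemma has_laurent_exp: "(\<lambda>t. exp (t * a)) has_laurent_expansion flsexp a"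
proof -
  have "(\<lambda>t. exp (a * t)) has_fps_expansion fps_exp a"
    by (rule has_fps_expansion_exp)
  from has_laurent_expansion_fps[OF this] show ?thesis
    by (simp add: flsexp_def mult.commute)
qed

lemma exp_2pi_int: "exp (2 * of_real pi * \<i> * of_int m) = 1"
  by (subst exp_eq_1) auto

lemma F_has_laurent: "(\<lambda>t. F (2 * of_real pi * \<i> * of_int m + t)) has_laurent_expansion FL m"
proof -
  let ?T = "2 * of_real pi * \<i> * of_int m :: complex"
  have e: "exp ((?T + t) * of_real ((s \<eta> + real L) / 2))
      = epi (real_of_int m * (s \<eta> + real L)) * exp (t * of_real ((s \<eta> + real L) / 2))" for t \<eta>
    unfolding epi_def exp_add[symmetric] by (rule arg_cong[of _ _ exp]) (simp add: field_simps)
  have "(\<lambda>t. F (?T + t)) = (\<lambda>t. (-1) ^ L * (\<Sum>\<eta>\<in>signs M. (of_int (esgn \<eta>) * epi (real_of_int m * (s \<eta> + real L)))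
     * (exp (t * of_real ((s \<eta> + real L) / 2)) / (1 - exp (t * 1)) ^ L)))"
    unfolding F_expand e by (simp add: exp_add exp_2pi_int mult_ac)
  then show ?thesis
    unfolding FL_def by (simp only:) (intro laurent_expansion_intros has_laurent_exp)
qed

text \<open>The bound on \<open>s \<eta>\<close> places (s \<eta> + L)/2 between 0 and L, so its
  integer part is below L, as the coefficient formulas demand of q. The fractional part becomes the
  Bernoulli argument.\<close>

definition qq :: "(nat \<Rightarrow> int) \<Rightarrow> nat" where "qq \<eta> = nat \<lfloor>(s \<eta> + real L) / 2\<rfloor>"
definition yy :: "(nat \<Rightarrow> int) \<Rightarrow> real" where "yy \<eta> = frac ((s \<eta> + real L) / 2)"

lemma yy_qq:
  assumes "\<eta> \<in> signs M"
  shows "yy \<eta> + real (qq \<eta>) = (s \<eta> + real L) / 2" "qq \<eta> < L"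
proof -
  have 1: "0 \<le> (s \<eta> + real L) / 2" "(s \<eta> + real L) / 2 < real L"
    using abs_s_less[OF assms] by auto
  then show "yy \<eta> + real (qq \<eta>) = (s \<eta> + real L) / 2"
    by (simp add: yy_def qq_def frac_def)
  show "qq \<eta> < L" using 1 unfolding qq_def by linarith
qed

lemma FL_nth:
  "fls_nth (FL m) (int n) = - ((-1) ^ L / (fact (L - 1) * fact n)) * (\<Sum>\<eta>\<in>signs M. of_int (esgn \<eta>) * epi (real_of_int m * (s \<eta> + real L))
      * of_real (\<Sum>j=1..L. real j / real (n + j) * fpoly j L (- s \<eta> / 2) * bernpoly (n + j) (yy \<eta>)))"
proof -
  have "fls_nth (FL m) (int n) = (-1) ^ L * (\<Sum>\<eta>\<in>signs M. of_int (esgn \<eta>) * epi (real_of_int m * (s \<eta> + real L))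
     * fls_nth (flsexp (of_real ((s \<eta> + real L) / 2)) / (1 - flsexp 1) ^ L) (int n))"
    unfolding FL_def fls_mult_const_nth fls_nth_sum ..
  also have "\<dots> = (-1) ^ L * (\<Sum>\<eta>\<in>signs M. of_int (esgn \<eta>) * epi (real_of_int m * (s \<eta> + real L))
     * (- (1 / (fact (L - 1) * fact n)) * of_real (\<Sum>j=1..L. real j / real (n + j) * fpoly j L (- s \<eta> / 2) * bernpoly (n + j) (yy \<eta>))))"
  proof (intro arg_cong2[of _ _ _ _ "(*)"] refl sum.cong)
    fix \<eta> assume \<eta>: "\<eta> \<in> signs M"
    have *: "real L / 2 - (s \<eta> + real L) / 2 = - s \<eta> / 2" by (simp add: field_simps)
    show "fls_nth (flsexp (of_real ((s \<eta> + real L) / 2)) / (1 - flsexp 1) ^ L) (int n)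
      = - (1 / (fact (L - 1) * fact n)) * of_real (\<Sum>j=1..L. real j / real (n + j) * fpoly j L (- s \<eta> / 2) * bernpoly (n + j) (yy \<eta>))"
      using flsexp_quotient_nth[OF yy_qq(2)[OF \<eta>], of "yy \<eta>" n] unfolding yy_qq(1)[OF \<eta>] * .
  qed
  finally show ?thesis by (simp only: sum_distrib_left) (simp add: mult_ac)
qed

lemma FL_nth_neg:
  assumes "l \<ge> 1"
  shows "fls_nth (FL m) (- int l) = (if l \<le> L then (-1) ^ (L + l) * fact l / fact (L - 1) * (\<Sum>\<eta>\<in>signs M. of_int (esgn \<eta>) * epi (real_of_int m * (s \<eta> + real L))
      * of_real (fpoly l L (- s \<eta> / 2))) else 0)"
proof -
  have "fls_nth (FL m) (- int l) = (-1) ^ L * (\<Sum>\<eta>\<in>signs M. of_int (esgn \<eta>) * epi (real_of_int m * (s \<eta> + real L))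
     * fls_nth (flsexp (of_real ((s \<eta> + real L) / 2)) / (1 - flsexp 1) ^ L) (- int l))"
    unfolding FL_def fls_mult_const_nth fls_nth_sum ..
  also have "\<dots> = (-1) ^ L * (\<Sum>\<eta>\<in>signs M. of_int (esgn \<eta>) * epi (real_of_int m * (s \<eta> + real L))
     * (if l \<le> L then (-1) ^ l * fact l / fact (L - 1) * of_real (fpoly l L (- s \<eta> / 2)) else 0))"
  proof (intro arg_cong2[of _ _ _ _ "(*)"] refl sum.cong)
    fix \<eta> assume \<eta>: "\<eta> \<in> signs M"
    have *: "real L / 2 - (s \<eta> + real L) / 2 = - s \<eta> / 2" by (simp add: field_simps)
    show "fls_nth (flsexp (of_real ((s \<eta> + real L) / 2)) / (1 - flsexp 1) ^ L) (- int l)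
      = (if l \<le> L then (-1) ^ l * fact l / fact (L - 1) * of_real (fpoly l L (- s \<eta> / 2)) else 0)"
      using flsexp_quotient_nth_neg[OF yy_qq(2)[OF \<eta>] assms, of "yy \<eta>"] unfolding yy_qq(1)[OF \<eta>] * .
  qed
  finally show ?thesis by (simp add: sum_distrib_left power_add mult_ac)
qed

lemma F_0: "F 0 = 0"
  using L_ge_1 by (simp add: F_def)

text \<open>M numerator factors and L = M - 2 denominator factors change sign, and these two numbers
  have the same parity.\<close>

lemma F_uminus: "F (- T) = F T"
proof -
  have "(\<Prod>j=1..M. exp (- T / (2 * of_nat (p j))) - exp (- (- T / (2 * of_nat (p j)))))
     = (\<Prod>j=1..M. (-1) * (exp (T / (2 * of_nat (p j))) - exp (- (T / (2 * of_nat (p j))))) :: complex)"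
    by (intro prod.cong) auto
  also have "\<dots> = (-1) ^ M * (\<Prod>j=1..M. exp (T / (2 * of_nat (p j))) - exp (- (T / (2 * of_nat (p j)))))"
    by (subst prod.distrib) simp
  finally have 1: "(\<Prod>j=1..M. exp (- T / (2 * of_nat (p j))) - exp (- (- T / (2 * of_nat (p j)))))
     = (-1) ^ M * (\<Prod>j=1..M. exp (T / (2 * of_nat (p j))) - exp (- (T / (2 * of_nat (p j)))))" .
  have "exp (- T / 2) - exp (- (- T / 2)) = (-1) * (exp (T / 2) - exp (- (T / 2)))" by simp
  then have 2: "(exp (- T / 2) - exp (- (- T / 2))) ^ L = (-1) ^ L * (exp (T / 2) - exp (- (T / 2))) ^ L"
    by (metis power_mult_distrib)
  have 3: "(-1) ^ M = ((-1) ^ L :: complex)" by (simp add: minus_one_power_iff even_M)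
  show ?thesis unfolding F_def 1 2 3 by simp
qed

lemma exp_add_period:
  assumes "j \<in> {1..M}"
  shows "exp ((T + 4 * of_real pi * \<i> * of_nat P) / (2 * of_nat (p j))) = exp (T / (2 * of_nat (p j)) :: complex)"
proof -
  obtain k where k: "P = p j * k" using p_dvd_P[OF assms] by blast
  have "(T + 4 * of_real pi * \<i> * of_nat P) / (2 * of_nat (p j)) = T / (2 * of_nat (p j)) + 2 * of_real pi * \<i> * of_int (int k)"
    using p_pos[OF assms] by (simp add: k field_simps)
  then show ?thesis by (simp only: exp_add exp_2pi_int) simp
qed

lemma F_period: "F (T + 4 * of_real pi * \<i> * of_nat P) = F T"
proof -
  have 1: "exp ((T + 4 * of_real pi * \<i> * of_nat P) / 2) = exp (T / 2)"
  proof -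
    have "(T + 4 * of_real pi * \<i> * of_nat P) / 2 = T / 2 + 2 * of_real pi * \<i> * of_int (int P)"
      by (simp add: field_simps)
    then show ?thesis by (simp only: exp_add exp_2pi_int) simp
  qed
  show ?thesis
    unfolding F_def exp_minus 1 using exp_add_period
    by (intro arg_cong2[of _ _ _ _ "(/)"] prod.cong refl) auto
qed

section \<open>Exponential decay of \<open>F\<close> away from the imaginary axis\<close>

definition sg :: real where "sg = (\<Sum>j=1..M. 1 / real (p j))"

lemma sg_less: "sg < real L"
  using sum_less by (simp add: sg_def L_def)

lemma norm_exp_diff_le:
  "norm (exp z - exp (- z) :: complex) \<le> 2 * exp \<bar>Re z\<bar>"
proof -
  have "norm (exp z - exp (- z)) \<le> norm (exp z) + norm (exp (- z))" by (rule norm_triangle_ineq4)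
  also have "\<dots> \<le> exp \<bar>Re z\<bar> + exp \<bar>Re z\<bar>" by (intro add_mono) (auto simp: norm_exp_eq_Re)
  finally show ?thesis by simp
qed

lemma norm_exp_diff_ge:
  assumes "\<bar>Re z\<bar> \<ge> 1"
  shows "norm (exp z - exp (- z) :: complex) \<ge> exp \<bar>Re z\<bar> / 2"
proof -
  have "norm (exp z - exp (- z)) \<ge> \<bar>norm (exp z) - norm (exp (- z))\<bar>" by (rule norm_triangle_ineq3)
  also have "\<bar>norm (exp z) - norm (exp (- z))\<bar> = exp \<bar>Re z\<bar> - exp (- \<bar>Re z\<bar>)"
    by (cases "Re z \<ge> 0") (auto simp: norm_exp_eq_Re)
  finally have 1: "norm (exp z - exp (- z)) \<ge> exp \<bar>Re z\<bar> - exp (- \<bar>Re z\<bar>)" .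
  have "2 \<le> exp \<bar>Re z\<bar>" using exp_ge_add_one_self[of "\<bar>Re z\<bar>"] assms by linarith
  moreover have "exp (- \<bar>Re z\<bar>) \<le> 1" by simp
  ultimately show ?thesis using 1 by linarith
qed

text \<open>Up to powers of 2, the numerator is at most exp(sg |Re T| / 2) and the denominator at
  least exp(L |Re T| / 2). The condition on Re T keeps T away from the zeros of the denominator,
  uniformly in Im T.\<close>

lemma norm_F_le:
  assumes "\<bar>Re T\<bar> \<ge> 2"
  shows "norm (F T) \<le> 2 ^ M * 2 ^ L * exp (- ((real L - sg) / 2 * \<bar>Re T\<bar>))"
proof -
  have Re: "Re (T / (2 * of_nat (p j))) = Re T / (2 * real (p j))" for j
    using Re_divide_of_real[of T "2 * real (p j)"] by simp
  have num: "norm (\<Prod>j=1..M. exp (T / (2 * of_nat (p j))) - exp (- (T / (2 * of_nat (p j))))) \<le> 2 ^ M * exp (sg * \<bar>Re T\<bar> / 2)"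
  proof -
    have "norm (\<Prod>j=1..M. exp (T / (2 * of_nat (p j))) - exp (- (T / (2 * of_nat (p j))))) \<le> (\<Prod>j=1..M. 2 * exp (\<bar>Re T\<bar> / (2 * real (p j))))"
      unfolding prod_norm[symmetric]
    proof (intro prod_mono conjI norm_ge_zero)
      fix j assume "j \<in> {1..M}"
      show "norm (exp (T / (2 * of_nat (p j))) - exp (- (T / (2 * of_nat (p j))))) \<le> 2 * exp (\<bar>Re T\<bar> / (2 * real (p j)))"
        using norm_exp_diff_le[of "T / (2 * of_nat (p j))"] unfolding Re by (simp add: abs_divide)
    qed
    also have "\<dots> = 2 ^ M * exp (\<Sum>j=1..M. \<bar>Re T\<bar> / (2 * real (p j)))"
      by (simp add: prod.distrib exp_sum)
    also have "(\<Sum>j=1..M. \<bar>Re T\<bar> / (2 * real (p j))) = sg * \<bar>Re T\<bar> / 2"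
      unfolding sg_def sum_distrib_right sum_divide_distrib by (intro sum.cong) auto
    finally show ?thesis .
  qed
  have "exp \<bar>Re (T / 2)\<bar> / 2 \<le> norm (exp (T / 2) - exp (- (T / 2)))"
    using assms by (intro norm_exp_diff_ge) auto
  then have "(exp (\<bar>Re T\<bar> / 2) / 2) ^ L \<le> norm (exp (T / 2) - exp (- (T / 2))) ^ L"
    by (intro power_mono) auto
  moreover have "(exp (\<bar>Re T\<bar> / 2) / 2) ^ L = exp (real L * \<bar>Re T\<bar> / 2) / 2 ^ L"
    by (simp add: power_divide flip: exp_of_nat_mult)
  ultimately have den: "exp (real L * \<bar>Re T\<bar> / 2) / 2 ^ L \<le> norm ((exp (T / 2) - exp (- (T / 2))) ^ L)"
    by (simp add: norm_power)
  have "norm (F T) \<le> (2 ^ M * exp (sg * \<bar>Re T\<bar> / 2)) / (exp (real L * \<bar>Re T\<bar> / 2) / 2 ^ L)"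
    unfolding F_def norm_divide by (intro frac_le num den) auto
  also have "\<dots> = 2 ^ M * 2 ^ L * (exp (sg * \<bar>Re T\<bar> / 2) / exp (real L * \<bar>Re T\<bar> / 2))"
    by simp
  also have "exp (sg * \<bar>Re T\<bar> / 2) / exp (real L * \<bar>Re T\<bar> / 2) = exp (- ((real L - sg) / 2 * \<bar>Re T\<bar>))"
    unfolding exp_diff[symmetric] by (rule arg_cong[of _ _ exp]) (simp add: field_simps)
  finally show ?thesis .
qed

end

subsection \<open>The contour\<close>

text \<open>S is the quotient by T with its removable singularity at 0 filled in. Such
  factorisations replace the cancellation of zeros at 0 by quotients whose denominators do not
  vanish there.\<close>

lemma exp_diff_factor:
  obtains S :: "complex \<Rightarrow> complex" where "S holomorphic_on UNIV"
    "\<And>T. exp (c * T) - exp (- (c * T)) = T * S T" "S 0 = 2 * c"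
proof
  let ?f = "\<lambda>T::complex. exp (c * T) - exp (- (c * T))"
  let ?S = "\<lambda>T. if T = 0 then deriv ?f 0 else (?f T - ?f 0) / (T - 0)"
  show "?S holomorphic_on UNIV"
    by (intro pole_lemma_open) (auto intro!: holomorphic_intros)
  show "?f T = T * ?S T" for T by auto
  have "(?f has_field_derivative 2 * c) (at 0)"
    by (auto intro!: derivative_eq_intros)
  then show "?S 0 = 2 * c" by (simp add: DERIV_imp_deriv)
qed

lemma one_minus_exp_factor:
  obtains V :: "complex \<Rightarrow> complex" where "V holomorphic_on UNIV"
    "\<And>T. 1 - exp (- (c * T)) = T * V T" "V 0 = c"
proof
  let ?f = "\<lambda>T::complex. 1 - exp (- (c * T))"
  let ?S = "\<lambda>T. if T = 0 then deriv ?f 0 else (?f T - ?f 0) / (T - 0)"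
  show "?S holomorphic_on UNIV"
    by (intro pole_lemma_open) (auto intro!: holomorphic_intros)
  show "?f T = T * ?S T" for T by auto
  have "(?f has_field_derivative c) (at 0)"
    by (auto intro!: derivative_eq_intros)
  then show "?S 0 = c" by (simp add: DERIV_imp_deriv)
qed

text \<open>The zeros of 1 - exp(- N T) other than 0. The origin is left out because both
  \<open>F\<close> and h are regular there.\<close>

definition lattice_pts :: "real \<Rightarrow> complex set" where
  "lattice_pts N = {2 * of_real pi * \<i> * of_int n / of_real N | n. n \<noteq> 0}"

lemma lattice_pts_1: "lattice_pts 1 = {2 * of_real pi * \<i> * of_int n | n. n \<noteq> 0}"
  by (simp add: lattice_pts_def)

lemma not_in_lattice_pts_1:
  assumes "T \<notin> lattice_pts 1" "T \<noteq> 0"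
  shows "exp T \<noteq> 1"
proof
  assume "exp T = 1"
  then obtain n where n: "Re T = 0" "Im T = of_int (2 * n) * pi" by (auto simp: exp_eq_1)
  then have "T = 2 * of_real pi * \<i> * of_int n" by (simp add: complex_eq_iff)
  then show False using assms by (auto simp: lattice_pts_1)
qed

lemma not_in_lattice_pts:
  assumes "T \<notin> lattice_pts N" "T \<noteq> 0" "N > 0"
  shows "exp (- (of_real N * T)) \<noteq> 1"
proof
  assume "exp (- (of_real N * T)) = 1"
  then obtain n where n: "- (N * Re T) = 0" "- (N * Im T) = of_int (2 * n) * pi" by (auto simp: exp_eq_1)
  then have "N * Im T = - (of_int (2 * n) * pi)" "Re T = 0" using assms by auto
  then have "Im T = - (of_int (2 * n) * pi) / N" using assms by (simp add: field_simps)
  then have "T = 2 * of_real pi * \<i> * of_int (- n) / of_real N" using \<open>Re T = 0\<close>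
    by (simp add: complex_eq_iff)
  moreover have "n \<noteq> 0" using calculation assms by auto
  ultimately have "T \<in> lattice_pts N" unfolding lattice_pts_def by (intro CollectI exI[of _ "- n"]) auto
  then show False using assms by simp
qed

lemma lattice_pts_mono:
  assumes "N > 0"
  shows "lattice_pts 1 \<subseteq> lattice_pts (real N)"
proof
  fix T assume "T \<in> lattice_pts 1"
  then obtain n where "n \<noteq> 0" "T = 2 * of_real pi * \<i> * of_int n" by (auto simp: lattice_pts_1)
  then show "T \<in> lattice_pts (real N)"
    using assms unfolding lattice_pts_def by (intro CollectI exI[of _ "n * int N"]) auto
qed

lemma contour_integral_linepath_translate:
  "contour_integral (linepath (a + w) (b + w)) f = contour_integral (linepath a b) (\<lambda>z. f (z + w))"
proof -
  have "linepath (a + w) (b + w) = (+) w \<circ> linepath a b"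
    by (auto simp: linepath_def algebra_simps)
  then show ?thesis
    unfolding contour_integral_def contour_integrable_on_def by (simp add: has_contour_integral_translate)
qed

context seifert
begin

text \<open>M factors T in the numerator against L = M - 2 in the denominator leave T^2. The
  factorisation also holds at T = 0, where the quotient defining \<open>F\<close> evaluates to
  0.\<close>

lemma F_factor:
  obtains F1 where "F1 holomorphic_on - lattice_pts 1" "\<And>T. F T = T\<^sup>2 * F1 T"
proof -
  have "\<exists>S. S holomorphic_on UNIV \<and> (\<forall>T. exp (c * T) - exp (- (c * T)) = T * S T) \<and> S 0 = 2 * c" for c :: complex
    by (rule exp_diff_factor[of c]) blast
  then obtain S where S: "\<And>c. S c holomorphic_on UNIV" "\<And>c T. exp (c * T) - exp (- (c * T)) = T * S c T" "\<And>c. S c 0 = 2 * c"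
    by metis
  define c where "c = (\<lambda>j. 1 / (2 * of_nat (p j)) :: complex)"
  define F1 where "F1 = (\<lambda>T. (\<Prod>j=1..M. S (c j) T) / S (1/2) T ^ L)"
  have nz: "S (1/2) T \<noteq> 0" if "T \<notin> lattice_pts 1" for T
  proof (cases "T = 0")
    case False
    from not_in_lattice_pts_1[OF that False] have "exp T \<noteq> 1" .
    moreover have "exp T = exp (T / 2) * exp (T / 2)" by (simp flip: exp_add)
    ultimately have "exp (T / 2) \<noteq> exp (- (T / 2))"
      by (metis exp_minus exp_not_eq_zero right_inverse)
    then show ?thesis using S(2)[of "1/2" T] by auto
  qed (simp add: S)
  show ?thesis
  proof (rule that[of F1])
    show "F1 holomorphic_on - lattice_pts 1"
      unfolding F1_def using nz by (intro holomorphic_intros holomorphic_on_subset[OF S(1)]) auto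
    fix T
    have "(\<Prod>j=1..M. exp (T / (2 * of_nat (p j))) - exp (- (T / (2 * of_nat (p j))))) = (\<Prod>j=1..M. T * S (c j) T)"
      by (intro prod.cong refl) (simp add: S(2)[symmetric] c_def)
    also have "\<dots> = T ^ M * (\<Prod>j=1..M. S (c j) T)" by (simp add: prod.distrib)
    also have "T ^ M = T\<^sup>2 * T ^ L"
      unfolding power_add[symmetric] using M_ge_3 by (intro arg_cong[where f = "\<lambda>n. T ^ n"]) (simp add: L_def)
    finally have "F T = T\<^sup>2 * T ^ L * (\<Prod>j=1..M. S (c j) T) / (T * S (1/2) T) ^ L"
      unfolding F_def using S(2)[of "1/2" T] by simp
    then show "F T = T\<^sup>2 * F1 T"
      by (cases "T = 0") (auto simp: F1_def power_mult_distrib)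
  qed
qed

lemma F_holomorphic: "F holomorphic_on - lattice_pts 1"
proof -
  obtain F1 where "F1 holomorphic_on - lattice_pts 1" "\<And>T. F T = T\<^sup>2 * F1 T"
    by (rule F_factor) blast
  then show ?thesis by (auto intro!: holomorphic_intros cong: holomorphic_cong)
qed

section \<open>Quasi-periodicity, regularity and bounds of h\<close>

definition lam :: "nat \<Rightarrow> real" where "lam N = real N / (8 * pi * real P)"

definition gg :: "nat \<Rightarrow> complex \<Rightarrow> complex" where
  "gg N T = exp (\<i> * of_real (lam N) * T\<^sup>2) * F T"

definition hh :: "nat \<Rightarrow> complex \<Rightarrow> complex" where
  "hh N T = gg N T / (1 - exp (- (of_nat N * T)))"

abbreviation om :: complex where "om \<equiv> 4 * of_real pi * \<i> * of_nat P"

lemma lam_pos: "N > 0 \<Longrightarrow> lam N > 0"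
  using P_pos by (simp add: lam_def)

text \<open>N/(8 pi P) is the value of \<open>lam N\<close> for which the cross term of the square
  is exactly - N T; the constant term is then an integral multiple of 2 pi i.\<close>

lemma lam_om: "\<i> * of_real (lam N) * (T + om)\<^sup>2
    = \<i> * of_real (lam N) * T\<^sup>2 - of_nat N * T - 2 * of_real pi * \<i> * of_int (int N * int P)"
proof -
  have P: "(of_nat P :: complex) \<noteq> 0" using P_pos by simp
  have "\<i> * of_real (lam N) * (T + om)\<^sup>2
    = \<i> * of_real (lam N) * T\<^sup>2 + of_real (lam N) * (\<i> * \<i>) * (8 * of_real pi * of_nat P) * T
      + of_real (lam N) * (\<i> * \<i>) * (16 * of_real pi * of_real pi * \<i> * of_nat P * of_nat P)"
    by (simp add: power2_eq_square algebra_simps)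
  also have "of_real (lam N) * (\<i> * \<i>) * (8 * of_real pi * of_nat P) * T = - of_nat N * T"
    using P by (simp add: lam_def)
  also have "of_real (lam N) * (\<i> * \<i>) * (16 * of_real pi * of_real pi * \<i> * of_nat P * of_nat P)
    = - (2 * of_real pi * \<i> * of_int (int N * int P))"
    using P by (simp add: lam_def field_simps)
  finally show ?thesis by simp
qed

lemma exp_minus_N_om: "exp (- (of_nat N * (T + om))) = exp (- (of_nat N * T))"
proof -
  have "- (of_nat N * (T + om)) = - (of_nat N * T) + 2 * of_real pi * \<i> * of_int (- 2 * int N * int P)"
    by (simp add: algebra_simps)
  then show ?thesis by (simp only: exp_add exp_2pi_int) simp
qed

lemma gg_om: "gg N (T + om) = exp (- (of_nat N * T)) * gg N T"
proof -
  have "exp (\<i> * of_real (lam N) * (T + om)\<^sup>2) = exp (\<i> * of_real (lam N) * T\<^sup>2) * exp (- (of_nat N * T))"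
    unfolding lam_om exp_diff exp_2pi_int by (simp add: exp_minus divide_inverse)
  then show ?thesis unfolding gg_def F_period by simp
qed

lemma hh_om: "hh N (T + om) = exp (- (of_nat N * T)) * hh N T"
  by (simp add: hh_def gg_om exp_minus_N_om)

lemma gg_0: "gg N 0 = 0"
  by (simp add: gg_def F_0)

text \<open>At x = 0 the quotient defining h takes the default value 0, in accordance with g(0) = 0;
  at every other real point the denominator is nonzero.\<close>

lemma hh_diff:
  assumes "N > 0"
  shows "hh N (of_real x) - hh N (of_real x + om) = gg N (of_real x)"
proof (cases "x = 0")
  case True
  then show ?thesis using hh_om[of N 0] by (simp add: gg_0)
next
  case False
  have "exp (- (of_nat N * of_real x)) \<noteq> (1 :: complex)"
    using False assms by (simp add: exp_eq_1)
  moreover have "hh N (of_real x) - hh N (of_real x + om) = (1 - exp (- (of_nat N * of_real x))) * hh N (of_real x)"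
    by (simp only: hh_om left_diff_distrib mult_1)
  ultimately show ?thesis by (simp add: hh_def)
qed

text \<open>The double zero of \<open>F\<close> at 0 outweighs the simple zero of the denominator
  there.\<close>

lemma hh_holomorphic:
  assumes "N > 0"
  shows "hh N holomorphic_on - lattice_pts (real N)"
proof -
  obtain F1 where F1: "F1 holomorphic_on - lattice_pts 1" "\<And>T. F T = T\<^sup>2 * F1 T"
    by (rule F_factor) blast
  obtain V where V: "V holomorphic_on UNIV" "\<And>T. 1 - exp (- (of_nat N * T)) = T * V T" "V 0 = of_nat N"
    by (rule one_minus_exp_factor[of "of_nat N"]) blast
  have nz: "V T \<noteq> 0" if "T \<notin> lattice_pts (real N)" for T
    using not_in_lattice_pts[OF that] V(2)[of T] V(3) assms by (cases "T = 0") auto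
  have "hh N T = exp (\<i> * of_real (lam N) * T\<^sup>2) * T * F1 T / V T" for T
    by (cases "T = 0") (auto simp: hh_def gg_def V(2) F1(2) power2_eq_square)
  moreover have "(\<lambda>T. exp (\<i> * of_real (lam N) * T\<^sup>2) * T * F1 T / V T) holomorphic_on - lattice_pts (real N)"
    using nz lattice_pts_mono[OF assms]
    by (intro holomorphic_intros holomorphic_on_subset[OF F1(1)] holomorphic_on_subset[OF V(1)]) auto
  ultimately show ?thesis by (simp cong: holomorphic_cong)
qed

text \<open>The ends n = 0 and n = 2PN are absent: h is regular at 0, and hence at \<open>om\<close>
  by quasi-periodicity.\<close>

definition poles :: "nat \<Rightarrow> complex set" where
  "poles N = (\<lambda>n. 2 * of_real pi * \<i> * of_nat n / of_nat N) ` {1..<2 * P * N}"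

text \<open>The margin pi/N is half the spacing 2 pi/N of the zeros of the denominator. The open
  strip thus contains both horizontal sides of the rectangle but no such zeros beyond those from 0
  to \<open>om\<close>.\<close>

definition strip :: "nat \<Rightarrow> complex set" where
  "strip N = {T. - (pi / N) < Im T \<and> Im T < 4 * pi * P + pi / N}"

text \<open>Two overlapping open pieces. Below height 4 pi P every lattice point belongs to
  \<open>poles N\<close>; near the upper edge the only lattice point is \<open>om\<close>, where
  regularity is transported from 0 by \<open>hh_om\<close>.\<close>

lemma hh_holomorphic_strip:
  assumes N: "N > 0"
  shows "hh N holomorphic_on strip N - poles N"
proof -
  define A where "A = {T. - (pi / N) < Im T \<and> Im T < 4 * pi * P} - poles N"
  define B where "B = {T. 4 * pi * P - pi / N < Im T \<and> Im T < 4 * pi * P + pi / N}"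
  have fin: "finite (poles N)" by (simp add: poles_def)
  have oA: "open A" unfolding A_def
    by (intro open_Diff open_Collect_conj open_Collect_less continuous_intros finite_imp_closed fin)
  have oB: "open B" unfolding B_def
    by (intro open_Collect_conj open_Collect_less continuous_intros)
  have lat: "\<exists>n. n \<noteq> 0 \<and> T = 2 * of_real pi * \<i> * of_int n / of_nat N \<and> Im T = 2 * pi * real_of_int n / N"
    if "T \<in> lattice_pts (real N)" for T
    using that by (auto simp: lattice_pts_def)
  have "A \<subseteq> - lattice_pts (real N)"
  proof
    fix T assume T: "T \<in> A"
    show "T \<in> - lattice_pts (real N)"
    proof
      assume "T \<in> lattice_pts (real N)"
      then obtain n where n: "n \<noteq> 0" "T = 2 * of_real pi * \<i> * of_int n / of_nat N" "Im T = 2 * pi * real_of_int n / N"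
        using lat by blast
      have "- (pi / N) < 2 * pi * real_of_int n / N" "2 * pi * real_of_int n / N < 4 * pi * P"
        using T n by (auto simp: A_def)
      then have "0 < (1 + 2 * real_of_int n) * pi" "real_of_int n * pi < (real (2 * P * N)) * pi"
        using N by (auto simp: field_simps)
      then have "0 < 1 + 2 * real_of_int n" "real_of_int n < real (2 * P * N)"
        by (simp_all add: zero_less_mult_iff)
      then have "1 + 2 * n > 0" "n < int (2 * P * N)" by linarith+
      then have "T = 2 * of_real pi * \<i> * of_nat (nat n) / of_nat N" "nat n \<in> {1..<2 * P * N}"
        using n by (auto simp: nat_less_iff)
      then have "T \<in> poles N" unfolding poles_def by blast
      then show False using T by (simp add: A_def)
    qed
  qed
  then have 1: "hh N holomorphic_on A"
    by (rule holomorphic_on_subset[OF hh_holomorphic[OF N]])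
  have sub: "(\<lambda>T. T - om) ` B \<subseteq> - lattice_pts (real N)"
  proof
    fix T assume T: "T \<in> (\<lambda>T. T - om) ` B"
    show "T \<in> - lattice_pts (real N)"
    proof
      assume "T \<in> lattice_pts (real N)"
      then obtain n where n: "n \<noteq> 0" "Im T = 2 * pi * real_of_int n / N"
        using lat by blast
      have "- (pi / N) < 2 * pi * real_of_int n / N" "2 * pi * real_of_int n / N < pi / N"
        using T n by (auto simp: B_def)
      then have "0 < (1 + 2 * real_of_int n) * pi" "0 < (1 - 2 * real_of_int n) * pi"
        using N by (auto simp: field_simps)
      then have "0 < 1 + 2 * real_of_int n" "0 < 1 - 2 * real_of_int n"
        by (simp_all add: zero_less_mult_iff)
      then have "1 + 2 * n > 0" "1 - 2 * n > 0" by linarith+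
      then show False using n by auto
    qed
  qed
  have eq: "exp (- (of_nat N * (T - om))) * hh N (T - om) = hh N T" for T
    using hh_om[of N "T - om"] by simp
  have hol: "(\<lambda>T. exp (- (of_nat N * (T - om))) * hh N (T - om)) holomorphic_on B"
  proof (intro holomorphic_intros)
    have "(hh N \<circ> (\<lambda>T. T - om)) holomorphic_on B"
      by (intro holomorphic_on_compose[OF _ holomorphic_on_subset[OF hh_holomorphic[OF N] sub]] holomorphic_intros)
    then show "(\<lambda>T. hh N (T - om)) holomorphic_on B" by (simp add: o_def)
  qed
  have 2: "hh N holomorphic_on B" by (rule holomorphic_transform[OF hol eq])
  have "strip N - poles N \<subseteq> A \<union> B"
  proof
    fix T assume T: "T \<in> strip N - poles N"
    have "0 < pi / real N" using N by simp
    then show "T \<in> A \<union> B"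
      using T unfolding strip_def A_def B_def by (cases "Im T < 4 * pi * P") auto
  qed
  with holomorphic_on_Un[OF 1 2 oA oB] show ?thesis
    by (rule holomorphic_on_subset)
qed

lemma norm_exp_lam: "norm (exp (\<i> * of_real (lam N) * T\<^sup>2)) = exp (- (2 * lam N * Re T * Im T))"
  by (simp add: norm_exp_eq_Re power2_eq_square algebra_simps)

text \<open>For Re T = R the Gaussian is at most 1 and the denominator at least 1/2. For Re T = - R
  the Gaussian may grow to exp(N R), reached at the upper edge, but the denominator is at least
  exp(N R) - 1, which is no less than half of that. In both cases the quotient of the two is at most
  2.\<close>

lemma norm_hh_le:
  assumes N: "N > 0" and R: "\<bar>Re T\<bar> = R" "R \<ge> 2" and T: "0 \<le> Im T" "Im T \<le> 4 * pi * P"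
  shows "norm (hh N T) \<le> 2 * (2 ^ M * 2 ^ L * exp (- ((real L - sg) / 2 * R)))"
proof -
  have e2: "2 \<le> exp (real N * R)"
  proof -
    have "1 * 1 \<le> real N * R" using N R by (intro mult_mono) auto
    then show ?thesis using exp_ge_add_one_self[of "real N * R"] by linarith
  qed
  have F: "norm (F T) \<le> 2 ^ M * 2 ^ L * exp (- ((real L - sg) / 2 * R))"
    using norm_F_le[of T] R by simp
  have q: "norm (exp (\<i> * of_real (lam N) * T\<^sup>2)) \<le> 2 * norm (1 - exp (- (of_nat N * T)))"
  proof (cases "Re T \<ge> 0")
    case True
    then have ReT: "Re T = R" using R by simp
    have "norm (exp (\<i> * of_real (lam N) * T\<^sup>2)) \<le> 1"
      unfolding norm_exp_lam ReT using T R lam_pos[OF N] by simp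
    also have "1 \<le> 2 * (1 - norm (exp (- (of_nat N * T))))"
    proof -
      have "norm (exp (- (of_nat N * T))) = exp (- (real N * R))" by (simp add: norm_exp_eq_Re ReT)
      also have "\<dots> \<le> 1 / 2" using e2 by (simp add: exp_minus field_simps)
      finally show ?thesis by simp
    qed
    also have "\<dots> \<le> 2 * norm (1 - exp (- (of_nat N * T)))"
      using norm_triangle_ineq2[of 1 "exp (- (of_nat N * T))"] by simp
    finally show ?thesis .
  next
    case False
    then have ReT: "Re T = - R" using R by simp
    have "norm (exp (\<i> * of_real (lam N) * T\<^sup>2)) = exp (2 * lam N * R * Im T)"
      unfolding norm_exp_lam ReT by simp
    also have "2 * lam N * R * Im T \<le> 2 * lam N * R * (4 * pi * P)"
      using T R lam_pos[OF N] by (intro mult_left_mono) auto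
    also have "\<dots> = real N * R" using P_pos by (simp add: lam_def)
    finally have 1: "norm (exp (\<i> * of_real (lam N) * T\<^sup>2)) \<le> exp (real N * R)" by simp
    have "norm (exp (- (of_nat N * T))) = exp (real N * R)" by (simp add: norm_exp_eq_Re ReT)
    then have "exp (real N * R) - 1 \<le> norm (1 - exp (- (of_nat N * T)))"
      using norm_triangle_ineq2[of "exp (- (of_nat N * T))" 1] by (simp add: norm_minus_commute)
    with 1 e2 show ?thesis by linarith
  qed
  have "1 - exp (- (of_nat N * T)) \<noteq> 0"
  proof
    assume z: "1 - exp (- (of_nat N * T)) = 0"
    then have "exp (- (of_nat N * T)) = 1" by simp
    then show False using q unfolding z by simp
  qed
  then have "norm (exp (\<i> * of_real (lam N) * T\<^sup>2)) / norm (1 - exp (- (of_nat N * T))) \<le> 2"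
    using q by (simp add: divide_le_eq)
  moreover have eq: "norm (hh N T) = norm (exp (\<i> * of_real (lam N) * T\<^sup>2)) / norm (1 - exp (- (of_nat N * T))) * norm (F T)"
    by (simp add: hh_def gg_def norm_mult norm_divide)
  ultimately show ?thesis
    unfolding eq using F by (intro mult_mono) auto
qed

text \<open>The horizontal sides of the rectangle combine into the integral of g. The error consists
  of the two vertical sides, each of length 4 pi P.\<close>

lemma contour_identity:
  assumes N: "N > 0" and R: "R \<ge> 2"
  shows "norm (integral {-R..R} (\<lambda>x. gg N (of_real x)) - 2 * of_real pi * \<i> * (\<Sum>z\<in>poles N. residue (hh N) z))
    \<le> 4 * (2 ^ M * 2 ^ L * exp (- ((real L - sg) / 2 * R))) * (4 * pi * P)"
proof -
  define a1 where "a1 = complex_of_real (- R)"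
  define a2 where "a2 = complex_of_real R"
  define a3 where "a3 = complex_of_real R + om"
  define a4 where "a4 = complex_of_real (- R) + om"
  have c2: "Complex (Re a3) (Im a1) = a2" and c4: "Complex (Re a1) (Im a3) = a4"
    by (simp_all add: a1_def a2_def a3_def a4_def complex_eq_iff)
  have rp: "rectpath a1 a3 = linepath a1 a2 +++ linepath a2 a3 +++ linepath a3 a4 +++ linepath a4 a1"
    unfolding rectpath_def Let_def c2 c4 ..
  have PP: "0 < 4 * pi * P" using P_pos by simp
  have box: "box a1 a3 = {T. - R < Re T \<and> Re T < R \<and> 0 < Im T \<and> Im T < 4 * pi * P}"
    by (auto simp: in_box_complex_iff a1_def a3_def)
  have cbox: "cbox a1 a3 = {T. - R \<le> Re T \<and> Re T \<le> R \<and> 0 \<le> Im T \<and> Im T \<le> 4 * pi * P}"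
    by (auto simp: in_cbox_complex_iff a1_def a3_def)
  have polbox: "poles N \<subseteq> box a1 a3"
  proof
    fix z assume "z \<in> poles N"
    then obtain n where n: "n \<ge> 1" "n < 2 * P * N" "z = 2 * of_real pi * \<i> * of_nat n / of_nat N"
      by (auto simp: poles_def)
    have "real n < 2 * real P * real N" using n(2) by (metis of_nat_less_iff of_nat_mult of_nat_numeral)
    then have "2 * pi * real n / real N < 4 * pi * real P" using N by (simp add: field_simps)
    then show "z \<in> box a1 a3" using n N R unfolding box by simp
  qed
  have fin: "finite (poles N)" by (simp add: poles_def)
  have cstrip: "cbox a1 a3 \<subseteq> strip N"
  proof -
    have "0 < pi / real N" using N by simp
    then show ?thesis unfolding cbox strip_def by auto
  qed
  have ostrip: "open (strip N)" unfolding strip_def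
    by (intro open_Collect_conj open_Collect_less continuous_intros)
  have "convex (strip N)"
  proof -
    have "strip N = {T. Im T > - (pi / N)} \<inter> {T. Im T < 4 * pi * P + pi / N}" by (auto simp: strip_def)
    then show ?thesis by (auto intro!: convex_Int convex_halfspace_Im_gt convex_halfspace_Im_lt)
  qed
  then have conn: "connected (strip N)" by (rule convex_connected)
  have le: "Re a1 \<le> Re a3" "Im a1 \<le> Im a3" using R PP by (auto simp: a1_def a3_def)
  have img: "path_image (rectpath a1 a3) = cbox a1 a3 - box a1 a3"
    by (rule path_image_rectpath_cbox_minus_box[OF le])
  have "contour_integral (rectpath a1 a3) (hh N)
    = 2 * pi * \<i> * (\<Sum>z\<in>poles N. winding_number (rectpath a1 a3) z * residue (hh N) z)"
  proof (rule Residue_theorem[OF ostrip conn fin hh_holomorphic_strip[OF N]])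
    show "path_image (rectpath a1 a3) \<subseteq> strip N - poles N"
      unfolding img using polbox cstrip by auto
    show "\<forall>z. z \<notin> strip N \<longrightarrow> winding_number (rectpath a1 a3) z = 0"
      using winding_number_rectpath_outside[OF le] cstrip by auto
  qed auto
  also have "(\<Sum>z\<in>poles N. winding_number (rectpath a1 a3) z * residue (hh N) z) = (\<Sum>z\<in>poles N. residue (hh N) z)"
    using polbox by (intro sum.cong refl) (auto simp: winding_number_rectpath)
  finally have res: "contour_integral (rectpath a1 a3) (hh N) = 2 * of_real pi * \<i> * (\<Sum>z\<in>poles N. residue (hh N) z)"
    by simp
  have cont: "continuous_on (path_image (rectpath a1 a3)) (hh N)"
    by (rule continuous_on_subset[OF holomorphic_on_imp_continuous_on[OF hh_holomorphic_strip[OF N]]])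
       (use img polbox cstrip in auto)
  have pim: "path_image (rectpath a1 a3) = closed_segment a1 a2 \<union> closed_segment a2 a3 \<union> closed_segment a3 a4 \<union> closed_segment a4 a1"
    unfolding rp by (simp add: path_image_join Un_assoc)
  have int: "hh N contour_integrable_on linepath a1 a2" "hh N contour_integrable_on linepath a2 a3"
     "hh N contour_integrable_on linepath a3 a4" "hh N contour_integrable_on linepath a4 a1"
    by (intro contour_integrable_continuous_linepath continuous_on_subset[OF cont]; force simp: pim)+
  have split: "contour_integral (rectpath a1 a3) (hh N)
    = contour_integral (linepath a1 a2) (hh N) + (contour_integral (linepath a2 a3) (hh N)
      + (contour_integral (linepath a3 a4) (hh N) + contour_integral (linepath a4 a1) (hh N)))"
    unfolding rp using int by simp
  have "contour_integral (linepath a3 a4) (hh N) = - contour_integral (linepath a4 a3) (hh N)"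
    using contour_integral_reversepath[of "linepath a4 a3" "hh N"] by simp
  also have "contour_integral (linepath a4 a3) (hh N) = contour_integral (linepath a1 a2) (\<lambda>z. hh N (z + om))"
    unfolding a3_def a4_def a1_def a2_def by (rule contour_integral_linepath_translate)
  finally have top: "contour_integral (linepath a3 a4) (hh N) = - contour_integral (linepath a1 a2) (\<lambda>z. hh N (z + om))" .
  have int': "(\<lambda>z. hh N (z + om)) contour_integrable_on linepath a1 a2"
  proof -
    have "continuous_on (closed_segment a4 a3) (hh N)"
      by (intro continuous_on_subset[OF cont]) (auto simp: pim closed_segment_commute)
    moreover have "(\<lambda>z. z + om) ` closed_segment a1 a2 = closed_segment a4 a3"
      using closed_segment_translation[of om a1 a2] unfolding a1_def a2_def a3_def a4_def
      by (simp add: add.commute)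
    ultimately have "continuous_on (closed_segment a1 a2) (hh N \<circ> (\<lambda>z. z + om))"
      by (intro continuous_on_compose continuous_intros) simp_all
    then show ?thesis by (intro contour_integrable_continuous_linepath) (simp add: o_def)
  qed
  have "contour_integral (linepath a1 a2) (hh N) - contour_integral (linepath a1 a2) (\<lambda>z. hh N (z + om))
    = contour_integral (linepath a1 a2) (\<lambda>z. hh N z - hh N (z + om))"
    by (rule contour_integral_diff[symmetric, OF int(1) int'])
  also have "\<dots> = integral {Re a1..Re a2} (\<lambda>x. hh N (of_real x) - hh N (of_real x + om))"
    by (rule contour_integral_linepath_Reals_eq) (use R in \<open>auto simp: a1_def a2_def\<close>)
  also have "\<dots> = integral {-R..R} (\<lambda>x. gg N (of_real x))"
    by (simp add: a1_def a2_def hh_diff[OF N])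
  finally have main: "contour_integral (linepath a1 a2) (hh N) - contour_integral (linepath a1 a2) (\<lambda>z. hh N (z + om))
    = integral {-R..R} (\<lambda>x. gg N (of_real x))" .
  define B where "B = 2 * (2 ^ M * 2 ^ L * exp (- ((real L - sg) / 2 * R)))"
  have B: "B \<ge> 0" by (simp add: B_def)
  have nom: "norm om = 4 * pi * P" by (simp add: norm_mult)
  have b1: "norm (contour_integral (linepath a2 a3) (hh N)) \<le> B * norm (a3 - a2)"
  proof (rule contour_integral_bound_linepath[OF int(2) B])
    fix x assume "x \<in> closed_segment a2 a3"
    then have "Re x = R" "0 \<le> Im x \<and> Im x \<le> 4 * pi * P"
      using PP by (auto simp: closed_segment_same_Re a2_def a3_def closed_segment_eq_real_ivl)
    then show "norm (hh N x) \<le> B" unfolding B_def using R N by (intro norm_hh_le) auto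
  qed
  have b2: "norm (contour_integral (linepath a4 a1) (hh N)) \<le> B * norm (a1 - a4)"
  proof (rule contour_integral_bound_linepath[OF int(4) B])
    fix x assume "x \<in> closed_segment a4 a1"
    then have "Re x = - R" "0 \<le> Im x \<and> Im x \<le> 4 * pi * P"
      using PP by (auto simp: closed_segment_same_Re a1_def a4_def closed_segment_eq_real_ivl)
    then show "norm (hh N x) \<le> B" unfolding B_def using R N by (intro norm_hh_le) auto
  qed
  have n: "norm (a3 - a2) = 4 * pi * P" "norm (a1 - a4) = 4 * pi * P"
    by (simp_all add: a1_def a2_def a3_def a4_def norm_mult)
  have "integral {-R..R} (\<lambda>x. gg N (of_real x)) - 2 * of_real pi * \<i> * (\<Sum>z\<in>poles N. residue (hh N) z)
    = - (contour_integral (linepath a2 a3) (hh N) + contour_integral (linepath a4 a1) (hh N))"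
    unfolding res[symmetric] split top main[symmetric] by simp
  also have "norm \<dots> \<le> B * (4 * pi * P) + B * (4 * pi * P)"
    unfolding norm_minus_cancel using b1 b2 unfolding n by (intro norm_triangle_le) linarith
  finally show ?thesis by (simp add: B_def mult_ac)
qed

end

subsection \<open>Residues and Gauss sums\<close>

text \<open>A pole of order at most K meets only the first K Taylor coefficients of the regular
  factor.\<close>

lemma fls_fps_mult_nth_minus_1:
  fixes W :: "complex fls"
  assumes W: "\<And>n. n < - int K \<Longrightarrow> fls_nth W n = 0"
  shows "fls_nth (fps_to_fls f * W) (-1) = (\<Sum>k<K. fps_nth f k * fls_nth W (- int (Suc k)))"
proof (cases "W = 0")
  case False
  then have "fls_nth W (fls_subdegree W) \<noteq> 0" by simp
  then have sd: "fls_subdegree W \<ge> - int K" using W[of "fls_subdegree W"] by force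
  have "fls_nth (fps_to_fls f * W) (-1)
    = (\<Sum>i=fls_subdegree (fps_to_fls f)..- 1 - fls_subdegree W. fls_nth (fps_to_fls f) i * fls_nth W (-1 - i))"
    by (rule fls_times_nth(2))
  also have "\<dots> = (\<Sum>i\<in>{0..<int K}. fls_nth (fps_to_fls f) i * fls_nth W (-1 - i))"
  proof (rule sum.mono_neutral_left)
    show "{fls_subdegree (fps_to_fls f)..- 1 - fls_subdegree W} \<subseteq> {0..<int K}"
      using sd fls_subdegree_fls_to_fps_gt0[of f] by auto
    show "\<forall>i\<in>{0..<int K} - {fls_subdegree (fps_to_fls f)..- 1 - fls_subdegree W}.
        fls_nth (fps_to_fls f) i * fls_nth W (-1 - i) = 0"
    proof
      fix i assume "i \<in> {0..<int K} - {fls_subdegree (fps_to_fls f)..- 1 - fls_subdegree W}"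
      then consider "i < fls_subdegree (fps_to_fls f)" | "-1 - i < fls_subdegree W" by force
      then show "fls_nth (fps_to_fls f) i * fls_nth W (-1 - i) = 0"
        by cases (simp_all only: fls_eq0_below_subdegree mult_zero_left mult_zero_right)
    qed
  qed simp
  also have "\<dots> = (\<Sum>k<K. fps_nth f k * fls_nth W (- int (Suc k)))"
    by (rule sum.reindex_bij_witness[of _ int nat]) auto
  finally show ?thesis .
qed simp

lemma fls_const_sum: "fls_const (sum f A) = (\<Sum>x\<in>A. fls_const (f x))"
  by (induction A rule: infinite_finite_induct) (auto simp flip: fls_plus_const)

lemma sum_periodic_mult:
  fixes g :: "int \<Rightarrow> 'b :: comm_monoid_add"
  assumes per: "\<And>x y. [x = y] (mod n) \<Longrightarrow> g x = g y" and u: "coprime u n" and n: "n > 0"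
  shows "(\<Sum>m\<in>{0..<n}. g (u * m)) = (\<Sum>m\<in>{0..<n}. g m)"
proof -
  have "inj_on (\<lambda>m. u * m mod n) {0..<n}"
  proof (rule inj_onI)
    fix x y assume xy: "x \<in> {0..<n}" "y \<in> {0..<n}" "u * x mod n = u * y mod n"
    then have "[x = y] (mod n)"
      using u by (simp add: cong_mult_lcancel cong_def[symmetric, of "u * x"])
    then show "x = y" using xy by (auto simp: cong_def)
  qed
  moreover have "(\<lambda>m. u * m mod n) ` {0..<n} \<subseteq> {0..<n}" using n by auto
  ultimately have bij: "bij_betw (\<lambda>m. u * m mod n) {0..<n} {0..<n}"
    by (simp add: bij_betw_def endo_inj_surj)
  have "(\<Sum>m\<in>{0..<n}. g (u * m)) = (\<Sum>m\<in>{0..<n}. g (u * m mod n))"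
    by (intro sum.cong refl per) (simp add: cong_def)
  also have "\<dots> = (\<Sum>m\<in>{0..<n}. g m)" by (rule sum.reindex_bij_betw[OF bij])
  finally show ?thesis .
qed

text \<open>\<open>epi\<close> has period 2, so after division by 2P the modulus is 4P. It suits
  quadratic exponents: squares of numbers congruent modulo 2P are congruent modulo 4P.\<close>

lemma epi_cong:
  assumes "[x = y] (mod 4 * int P)" "P > 0"
  shows "epi (real_of_int x / (2 * real P)) = epi (real_of_int y / (2 * real P))"
proof -
  obtain k where "x = y + 4 * int P * k"
    using assms by (metis cong_iff_lin cong_sym mult.commute)
  then have "real_of_int x / (2 * real P) = real_of_int y / (2 * real P) + 2 * real_of_int k"
    using assms by (simp add: field_simps)
  then show ?thesis by (simp only: epi_add epi_even_int) simp
qed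

context seifert
begin

section \<open>Quadratic Gauss sums and their invariance under sign changes\<close>

definition gs :: "nat \<Rightarrow> int \<Rightarrow> int \<Rightarrow> complex" where
  "gs N a m = epi (real_of_int (- int N * m\<^sup>2 + 2 * m * a) / (2 * real P))"

lemma gs_eq: "gs N a m = epi (- (real N * real_of_int m ^ 2 / (2 * real P))) * epi (real_of_int m * real_of_int a / real P)"
proof -
  have "real_of_int (- int N * m\<^sup>2 + 2 * m * a) / (2 * real P)
    = - (real N * real_of_int m ^ 2 / (2 * real P)) + real_of_int m * real_of_int a / real P"
    using P_pos by (simp add: field_simps)
  then show ?thesis by (simp only: gs_def epi_add)
qed

lemma gs_cong:
  assumes "[m = m'] (mod 2 * int P)" "[a = a'] (mod 2 * int P)"
  shows "gs N a m = gs N a' m'"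
proof -
  obtain k where k: "m' = m + 2 * int P * k" using assms(1) by (metis cong_iff_lin mult.commute)
  obtain j where j: "a' = a + 2 * int P * j" using assms(2) by (metis cong_iff_lin mult.commute)
  have "- int N * m'\<^sup>2 + 2 * m' * a' = - int N * m\<^sup>2 + 2 * m * a
    + 4 * int P * (- int N * (m * k + int P * k * k) + m * j + k * a + 2 * int P * k * j)"
    by (simp add: k j power2_eq_square algebra_simps)
  then have "[- int N * m\<^sup>2 + 2 * m * a = - int N * m'\<^sup>2 + 2 * m' * a'] (mod 4 * int P)"
    unfolding cong_iff_lin by (metis mult.commute)
  then show ?thesis unfolding gs_def by (rule epi_cong[OF _ P_pos])
qed

definition gsum :: "nat \<Rightarrow> int \<Rightarrow> complex" where
  "gsum N a = (\<Sum>m\<in>{0..<2 * int P}. gs N a m)"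

text \<open>The substitution m -> u m permutes the residues modulo 2P. Since u^2 = 1 modulo 4P it
  preserves the quadratic part of the exponent, while in the linear part u moves over to the
  frequency.\<close>

lemma gsum_unit:
  assumes u: "4 * int P dvd u\<^sup>2 - 1" and a: "[u * a = a'] (mod 2 * int P)"
  shows "gsum N a' = gsum N a"
proof -
  have "coprime u (2 * int P)"
  proof -
    obtain k where "u\<^sup>2 - 1 = 4 * int P * k" using u by blast
    then have "u * u - 2 * (2 * int P) * k = 1" by (simp add: power2_eq_square algebra_simps)
    then show ?thesis
      by (intro coprimeI) (metis dvd_diff dvd_mult dvd_mult2)
  qed
  then have "gsum N a = (\<Sum>m\<in>{0..<2 * int P}. gs N a (u * m))"
    unfolding gsum_def using P_pos by (intro sum_periodic_mult[symmetric] gs_cong) auto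
  also have "\<dots> = (\<Sum>m\<in>{0..<2 * int P}. gs N a' m)"
  proof (intro sum.cong refl)
    fix m
    obtain k where k: "u\<^sup>2 - 1 = 4 * int P * k" using u by blast
    obtain j where j: "a' = u * a + 2 * int P * j" using a by (metis cong_iff_lin mult.commute)
    have u2: "u * u = 1 + 4 * int P * k" using k by (simp add: power2_eq_square algebra_simps)
    have "- int N * m\<^sup>2 + 2 * m * a' = - int N * (u * u * (m * m)) + 2 * (u * m) * a
       + 4 * int P * (int N * k * (m * m) + m * j)"
      unfolding u2 j by (simp add: power2_eq_square algebra_simps)
    also have "- int N * (u * u * (m * m)) = - int N * (u * m)\<^sup>2" by (simp add: power2_eq_square)
    finally have "[- int N * (u * m)\<^sup>2 + 2 * (u * m) * a = - int N * m\<^sup>2 + 2 * m * a'] (mod 4 * int P)"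
      unfolding cong_iff_lin by (metis mult.commute)
    then show "gs N a (u * m) = gs N a' m" unfolding gs_def by (rule epi_cong[OF _ P_pos])
  qed
  finally show ?thesis by (simp add: gsum_def)
qed

lemma prod_remove:
  "j \<in> {1..M} \<Longrightarrow> P div p j = (\<Prod>i\<in>{1..M} - {j}. p i)"
  unfolding prodP_def using p_pos[of j] by (subst prod.remove[of _ j]) auto

lemma coprime_p_P_div: "j \<in> {1..M} \<Longrightarrow> coprime (p j) (P div p j)"
  unfolding prod_remove using p_coprime by (intro prod_coprime_right) (auto simp: pairwise_def)

lemma p_dvd_P_div: "i \<in> {1..M} \<Longrightarrow> j \<in> {1..M} \<Longrightarrow> i \<noteq> j \<Longrightarrow> p j dvd P div p i"
  unfolding prod_remove by (rule dvd_prodI) auto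

lemma P_div_mult: "j \<in> {1..M} \<Longrightarrow> P = p j * (P div p j)"
  using p_dvd_P[of j] by simp

text \<open>A unit \<open>u\<close> with \<open>u \<equiv> -1\<close> modulo \<open>2 p\<^sub>j\<close> and \<open>u \<equiv> 1\<close> modulo \<open>2 P / p\<^sub>j\<close> flips a single sign.\<close>

lemma flip_unit:
  assumes j: "j \<in> {1..M}"
  obtains u where "4 * int P dvd u\<^sup>2 - 1"
    "\<And>\<eta>. \<eta> \<in> signs M \<Longrightarrow> [u * nn \<eta> = nn (\<eta>(j := - \<eta> j))] (mod 2 * int P)"
proof -
  define a where "a = int (p j)"
  define b where "b = int (P div p j)"
  have P: "int P = a * b" unfolding a_def b_def using P_div_mult[OF j] by (metis of_nat_mult)
  have "coprime a b" using coprime_p_P_div[OF j] by (simp add: a_def b_def)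
  then obtain v where v: "[v = 0] (mod a)" "[v = 1] (mod b)"
    using binary_chinese_remainder_int by metis
  obtain k where k: "v = a * k" using v(1) by (auto simp: cong_0_iff)
  obtain l where l: "v - 1 = b * l" using v(2) by (auto simp: cong_iff_dvd_diff)
  \<comment> \<open>Doubling turns the congruences for v into u = -1 modulo 2 p_j and u = 1 modulo 2
    P/p_j, whatever the parity of these numbers, so that (u + 1)(u - 1) is divisible by 4P.\<close>
  define u where "u = 2 * v - 1"
  have u1: "u + 1 = 2 * a * k" and u2: "u - 1 = 2 * b * l" using k l by (auto simp: u_def)
  have "u\<^sup>2 - 1 = (u + 1) * (u - 1)" by (simp add: power2_eq_square algebra_simps)
  also have "\<dots> = 4 * int P * (k * l)" unfolding u1 u2 P by simp
  finally have 1: "4 * int P dvd u\<^sup>2 - 1" by simp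
  have 2: "[u * nn \<eta> = nn (\<eta>(j := - \<eta> j))] (mod 2 * int P)" for \<eta>
  proof -
    have split: "nn \<zeta> = \<zeta> j * b + (\<Sum>i\<in>{1..M} - {j}. \<zeta> i * int (P div p i)) + int P * int L" for \<zeta>
      unfolding nn_def b_def using j by (subst sum.remove[of _ j]) auto
    have "(\<Sum>i\<in>{1..M} - {j}. (\<eta>(j := - \<eta> j)) i * int (P div p i)) = (\<Sum>i\<in>{1..M} - {j}. \<eta> i * int (P div p i))"
      by (intro sum.cong) auto
    then have "u * nn \<eta> - nn (\<eta>(j := - \<eta> j))
      = (u + 1) * b * \<eta> j + (\<Sum>i\<in>{1..M} - {j}. (u - 1) * int (P div p i) * \<eta> i) + (u - 1) * int P * int L"
      unfolding split by (simp add: sum_distrib_left algebra_simps sum_subtractf)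
    moreover have "2 * int P dvd (u + 1) * b * \<eta> j" unfolding u1 P by (simp add: mult_ac)
    moreover have "2 * int P dvd (\<Sum>i\<in>{1..M} - {j}. (u - 1) * int (P div p i) * \<eta> i)"
    proof (intro dvd_sum)
      fix i assume i: "i \<in> {1..M} - {j}"
      then have "a dvd int (P div p i)" unfolding a_def using p_dvd_P_div[of i j] j by auto
      then obtain c where "int (P div p i) = a * c" by blast
      then show "2 * int P dvd (u - 1) * int (P div p i) * \<eta> i" unfolding u2 P by (simp add: mult_ac)
    qed
    moreover have "2 * int P dvd (u - 1) * int P * int L" unfolding u2 P by (simp add: mult_ac)
    ultimately show ?thesis by (simp add: cong_iff_dvd_diff)
  qed
  show ?thesis by (rule that[OF 1 2])
qed

lemma signs_flip: "j \<in> {1..M} \<Longrightarrow> \<eta> \<in> signs M \<Longrightarrow> \<eta>(j := - \<eta> j) \<in> signs M"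
  by (auto simp: signs_def PiE_def Pi_def extensional_def)

lemma signs_flip_invariant:
  assumes flip: "\<And>\<eta> j. \<eta> \<in> signs M \<Longrightarrow> j \<in> {1..M} \<Longrightarrow> f (\<eta>(j := - \<eta> j)) = f \<eta>"
    and "\<eta> \<in> signs M"
  shows "f \<eta> = f (\<lambda>j\<in>{1..M}. 1)"
proof -
  define k where "k = card {j\<in>{1..M}. \<eta> j = -1}"
  from k_def assms(2) show ?thesis
  proof (induction k arbitrary: \<eta>)
    case 0
    then have "\<eta> j = 1" if "j \<in> {1..M}" for j using signs_cases[OF 0(2) that] that by auto
    then have "\<eta> = (\<lambda>j\<in>{1..M}. 1)" using 0(2) by (auto simp: signs_def PiE_def extensional_def fun_eq_iff)
    then show ?case by simp
  next
    case (Suc k)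
    then have "{j\<in>{1..M}. \<eta> j = -1} \<noteq> {}" by (metis card.empty nat.distinct(1))
    then obtain j where j: "j \<in> {1..M}" "\<eta> j = -1" by blast
    let ?\<eta> = "\<eta>(j := - \<eta> j)"
    have "{i\<in>{1..M}. ?\<eta> i = -1} = {i\<in>{1..M}. \<eta> i = -1} - {j}" using j by auto
    then have "card {i\<in>{1..M}. ?\<eta> i = -1} = k" using Suc.prems j by (simp add: card_Diff_singleton)
    from Suc.IH[OF this[symmetric] signs_flip[OF j(1) Suc.prems(2)]] show ?case
      by (simp only: flip[OF Suc.prems(2) j(1)])
  qed
qed

lemma gsum_flip:
  assumes "\<eta> \<in> signs M" "j \<in> {1..M}"
  shows "gsum N (nn (\<eta>(j := - \<eta> j))) = gsum N (nn \<eta>)"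
  using flip_unit[OF assms(2)] gsum_unit assms(1) by metis

lemma gsum_const:
  assumes "\<eta> \<in> signs M"
  shows "gsum N (nn \<eta>) = gsum N (nn (\<lambda>j\<in>{1..M}. 1))"
  by (rule signs_flip_invariant[where f = "\<lambda>\<eta>. gsum N (nn \<eta>)", OF gsum_flip assms])

lemma epi_nn: "epi (real_of_int m * (s \<eta> + real L)) = epi (real_of_int m * real_of_int (nn \<eta>) / real P)"
  using P_pos by (simp add: nn_eq)

abbreviation ee :: "nat \<Rightarrow> int \<Rightarrow> complex" where
  "ee N m \<equiv> epi (- (real N * real_of_int m ^ 2 / (2 * real P)))"

text \<open>Since the Gauss sum does not depend on \<open>\<eta>\<close>, the twisted sum of the Laurent expansions of \<open>F\<close> at the
  points \<open>2\<pi>\<i>m\<close> is a multiple of the expansion at \<open>0\<close>, which has no principal part.\<close>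

lemma sum_FL: "(\<Sum>m\<in>{0..<2 * int P}. fls_const (ee N m) * FL m) = fls_const (gsum N (nn (\<lambda>j\<in>{1..M}. 1))) * FL 0"
proof -
  let ?q = "\<lambda>\<eta>. flsexp (of_real ((s \<eta> + real L) / 2)) / (1 - flsexp 1) ^ L"
  have "(\<Sum>m\<in>{0..<2 * int P}. fls_const (ee N m) * FL m)
    = fls_const ((-1) ^ L) * (\<Sum>m\<in>{0..<2 * int P}. \<Sum>\<eta>\<in>signs M. fls_const (of_int (esgn \<eta>) * gs N (nn \<eta>) m) * ?q \<eta>)"
    unfolding FL_def gs_eq epi_nn sum_distrib_left
    by (intro sum.cong refl) (simp add: mult_ac flip: fls_const_mult_const)
  also have "(\<Sum>m\<in>{0..<2 * int P}. \<Sum>\<eta>\<in>signs M. fls_const (of_int (esgn \<eta>) * gs N (nn \<eta>) m) * ?q \<eta>)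
    = (\<Sum>\<eta>\<in>signs M. \<Sum>m\<in>{0..<2 * int P}. fls_const (of_int (esgn \<eta>) * gs N (nn \<eta>) m) * ?q \<eta>)"
    by (rule sum.swap)
  also have "\<dots> = (\<Sum>\<eta>\<in>signs M. fls_const (of_int (esgn \<eta>) * gsum N (nn \<eta>)) * ?q \<eta>)"
    unfolding gsum_def sum_distrib_left sum_distrib_right[symmetric]
    by (intro sum.cong refl arg_cong2[of _ _ _ _ "(*)"]) (simp add: fls_const_sum)
  also have "\<dots> = (\<Sum>\<eta>\<in>signs M. fls_const (gsum N (nn (\<lambda>j\<in>{1..M}. 1))) * (fls_const (of_int (esgn \<eta>)) * ?q \<eta>))"
  proof (intro sum.cong refl)
    fix \<eta> assume "\<eta> \<in> signs M"
    then show "fls_const (of_int (esgn \<eta>) * gsum N (nn \<eta>)) * ?q \<eta>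
        = fls_const (gsum N (nn (\<lambda>j\<in>{1..M}. 1))) * (fls_const (of_int (esgn \<eta>)) * ?q \<eta>)"
      by (simp only: gsum_const[of \<eta> N] fls_const_mult_const[symmetric] mult_ac)
  qed
  finally show ?thesis
    by (simp add: FL_def sum_distrib_left mult_ac)
qed

section \<open>Local expansions of h and its residues\<close>

lemma F_analytic_0: "F analytic_on {0}"
proof -
  have "ball 0 1 \<subseteq> - lattice_pts 1"
  proof
    fix z assume z: "z \<in> ball (0::complex) 1"
    show "z \<in> - lattice_pts 1"
    proof
      assume "z \<in> lattice_pts 1"
      then obtain n where n: "n \<noteq> 0" "z = 2 * of_real pi * \<i> * of_int n" by (auto simp: lattice_pts_1)
      then have "norm z = 2 * pi * \<bar>real_of_int n\<bar>" by (simp add: norm_mult)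
      also have "\<dots> \<ge> 2 * pi * 1" using n by (intro mult_left_mono) auto
      finally show False using z pi_gt3 by simp
    qed
  qed
  then have "F holomorphic_on ball 0 1" by (rule holomorphic_on_subset[OF F_holomorphic])
  then show ?thesis by (rule holomorphic_on_imp_analytic_at) auto
qed

lemma FL_0_fps: "FL 0 = fps_to_fls (fps_expansion F 0)"
proof -
  have "F has_fps_expansion fps_expansion F 0"
    using analytic_at_imp_has_fps_expansion_0[OF F_analytic_0] .
  then have "F has_laurent_expansion fps_to_fls (fps_expansion F 0)" by (rule has_laurent_expansion_fps)
  moreover have "F has_laurent_expansion FL 0" using F_has_laurent[of 0] by simp
  ultimately show ?thesis using has_laurent_expansion_unique by metis
qed

lemma FL_0_nth_0: "fps_nth (fps_expansion F 0) 0 = 0"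
  by (simp add: fps_expansion_def F_0)

definition QQ :: "nat \<Rightarrow> complex fps" where
  "QQ N = fps_exp (\<i> * of_real (lam N)) oo fps_X ^ 2"

lemma QQ_nth: "fps_nth (QQ N) n = (if even n then (\<i> * of_real (lam N)) ^ (n div 2) / fact (n div 2) else 0)"
  by (simp add: QQ_def fps_nth_compose_X_power)

lemma QQ_expansion: "(\<lambda>t. exp (\<i> * of_real (lam N) * t\<^sup>2)) has_fps_expansion QQ N"
proof -
  have "((\<lambda>t. exp (\<i> * of_real (lam N) * t)) \<circ> (\<lambda>t. t ^ 2)) has_fps_expansion QQ N"
    unfolding QQ_def
    by (intro has_fps_expansion_compose has_fps_expansion_exp fps_expansion_intros) (auto simp: fps_nth_power_0)
  then show ?thesis by (simp add: o_def)
qed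

text \<open>At T = 2 pi i m + t the Gaussian contributes the linear exponent - N m t/(2P).
  \<open>WW\<close> expands its exponential over 1 - exp(- N t), a Bernoulli generating function at
  the argument m/(2P); \<open>RR\<close> below is the regular part.\<close>

definition WW :: "nat \<Rightarrow> int \<Rightarrow> complex fls" where
  "WW N m = flsexp (- of_nat N * of_real (real_of_int m / (2 * real P))) / (1 - flsexp (- of_nat N))"

definition RR :: "nat \<Rightarrow> int \<Rightarrow> complex fps" where
  "RR N m = Abs_fps (\<lambda>k. - ((- of_nat N) ^ k * of_real (bernpoly (Suc k) (real_of_int m / (2 * real P))) / fact (Suc k)))"

lemma bernpoly_0: "bernpoly 0 y = 1"
  using arg_cong[OF bernpoly_generating[of y], of "\<lambda>f. fps_nth f 1"] by (simp add: fps_mult_nth)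

text \<open>The principal part 1/(N t) does not depend on m; the cancellation in
  \<open>sum_ee_Q_WW\<close> rests on this.\<close>

lemma WW_eq:
  assumes N: "N > 0"
  shows "WW N m = fls_const (1 / of_nat N) * fls_X_inv + fps_to_fls (RR N m)"
proof (rule fls_eqI)
  fix n
  have c: "(- of_nat N :: complex) \<noteq> 0" using N by simp
  note b = bern_quotient_nth[OF c, of "real_of_int m / (2 * real P)" n]
  consider "n < -1" | "n = -1" | k where "n = int k"
    using zero_le_imp_eq_int[of n] by (cases "n \<ge> 0") force+
  then show "fls_nth (WW N m) n = fls_nth (fls_const (1 / of_nat N) * fls_X_inv + fps_to_fls (RR N m)) n"
  proof cases
    case 1 then show ?thesis using b by (simp add: WW_def)
  next
    case 2 then show ?thesis using b by (simp add: WW_def bernpoly_0)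
  next
    case 3
    then have "nat (n + 1) = Suc k" by simp
    then show ?thesis using b 3 N by (simp add: WW_def RR_def)
  qed
qed

text \<open>The zero F(0) = 0 absorbs the simple pole.\<close>

lemma Q_FL_0:
  "fls_nth (fps_to_fls (QQ N) * (fls_const c * fls_X_inv) * FL 0) (-1) = 0"
proof -
  have "fps_to_fls (QQ N) * (fls_const c * fls_X_inv) * FL 0
     = fls_const c * (fls_X_inv * fps_to_fls (QQ N * fps_expansion F 0))"
    by (simp add: FL_0_fps fls_times_fps_to_fls mult_ac)
  then show ?thesis by (simp add: fls_X_inv_times_conv_shift FL_0_nth_0)
qed

lemma hh_laurent:
  "(\<lambda>t. hh N (2 * of_real pi * \<i> * of_int m + t)) has_laurent_expansion
     fls_const (ee N m) * (fps_to_fls (QQ N) * WW N m * FL m)"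
proof -
  let ?T = "2 * of_real pi * \<i> * of_int m :: complex"
  have P: "(of_nat P :: complex) \<noteq> 0" using P_pos by simp
  have "hh N (?T + t) = ee N m * (exp (\<i> * of_real (lam N) * t\<^sup>2)
       * (exp (t * (- of_nat N * of_real (real_of_int m / (2 * real P)))) / (1 - exp (t * - of_nat N))) * F (?T + t))" for t
  proof -
    have "\<i> * of_real (lam N) * (?T + t)\<^sup>2 = of_real (- (real N * real_of_int m ^ 2 / (2 * real P))) * of_real pi * \<i>
       + \<i> * of_real (lam N) * t\<^sup>2 + t * (- of_nat N * of_real (real_of_int m / (2 * real P)))"
      using P by (simp add: lam_def power2_eq_square field_simps)
    then have 1: "exp (\<i> * of_real (lam N) * (?T + t)\<^sup>2) = ee N m * exp (\<i> * of_real (lam N) * t\<^sup>2)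
       * exp (t * (- of_nat N * of_real (real_of_int m / (2 * real P))))"
      by (simp only: epi_def exp_add)
    have "- (of_nat N * (?T + t)) = t * - of_nat N + 2 * of_real pi * \<i> * of_int (- int N * m)"
      by (simp add: algebra_simps)
    then have 2: "exp (- (of_nat N * (?T + t))) = exp (t * - of_nat N)"
      by (simp only: exp_add exp_2pi_int) simp
    show ?thesis unfolding hh_def gg_def 1 2 by simp
  qed
  then have eq: "(\<lambda>t. hh N (?T + t)) = (\<lambda>t. ee N m * (exp (\<i> * of_real (lam N) * t\<^sup>2)
       * (exp (t * (- of_nat N * of_real (real_of_int m / (2 * real P)))) / (1 - exp (t * - of_nat N))) * F (?T + t)))"
    by (rule ext)
  show ?thesis unfolding eq WW_def
    by (intro laurent_expansion_intros has_laurent_expansion_fps[OF QQ_expansion] has_laurent_exp F_has_laurent)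
qed

lemma residue_hh_int:
  "residue (hh N) (2 * of_real pi * \<i> * of_int m) = ee N m * fls_nth (fps_to_fls (QQ N) * WW N m * FL m) (-1)"
  using has_laurent_expansion_residue[OF hh_laurent] by simp

text \<open>\<open>F\<close> is regular at these points, so only the simple pole of 1/(1 - exp(- N
  t)), with leading coefficient 1/N, contributes. The trivial factor exp(0) brings it into the shape
  of the Bernoulli generating function at the argument 0.\<close>

lemma residue_hh_nonint:
  assumes N: "N > 0" and n: "\<not> N dvd n"
  shows "residue (hh N) (2 * of_real pi * \<i> * of_nat n / of_nat N) = gg N (2 * of_real pi * \<i> * of_nat n / of_nat N) / of_nat N"
proof -
  let ?T = "2 * of_real pi * \<i> * of_nat n / of_nat N :: complex"
  have "?T \<notin> lattice_pts 1"
  proof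
    assume "?T \<in> lattice_pts 1"
    then obtain k where "?T = 2 * of_real pi * \<i> * of_int k" by (auto simp: lattice_pts_1)
    then have "(of_nat n :: complex) = of_int (k * int N)" using N by (simp add: field_simps)
    then have "int n = k * int N" by (metis of_int_eq_iff of_int_of_nat_eq)
    then show False using n by (metis dvd_triv_right int_dvd_int_iff)
  qed
  moreover have "?T \<noteq> 0" using n N by (auto intro: Nat.gr0I)
  ultimately have "exp ?T \<noteq> 1" by (rule not_in_lattice_pts_1)
  moreover have "exp z = exp (z / 2) * exp (z / 2)" for z :: complex by (simp flip: exp_add)
  ultimately have "exp (?T / 2) \<noteq> exp (- (?T / 2))"
    by (metis exp_minus exp_not_eq_zero right_inverse)
  then have "F analytic_on {?T}" unfolding F_def by (intro analytic_intros) (auto intro!: p_pos)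
  then have "gg N analytic_on {?T}" unfolding gg_def by (intro analytic_intros) auto
  then have "(\<lambda>t. gg N (?T + t)) has_fps_expansion fps_expansion (gg N) ?T"
    by (rule analytic_at_imp_has_fps_expansion)
  moreover define W where "W = flsexp (- of_nat N * of_real 0) / (1 - flsexp (- of_nat N))"
  ultimately have "(\<lambda>t. gg N (?T + t) * (exp (t * (- of_nat N * of_real 0)) / (1 - exp (t * - of_nat N)))) has_laurent_expansion
      fps_to_fls (fps_expansion (gg N) ?T) * W"
    unfolding W_def by (intro laurent_expansion_intros has_laurent_expansion_fps has_laurent_exp)
  also have "(\<lambda>t. gg N (?T + t) * (exp (t * (- of_nat N * of_real 0)) / (1 - exp (t * - of_nat N)))) = (\<lambda>t. hh N (?T + t))"
  proof
    fix t
    have "- (of_nat N * (?T + t)) = t * - of_nat N + 2 * of_real pi * \<i> * of_int (- int n)"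
      using N by (simp add: field_simps)
    then have 2: "exp (- (of_nat N * (?T + t))) = exp (t * - of_nat N)"
      by (simp only: exp_add exp_2pi_int) simp
    show "gg N (?T + t) * (exp (t * (- of_nat N * of_real 0)) / (1 - exp (t * - of_nat N))) = hh N (?T + t)"
      unfolding hh_def 2 by simp
  qed
  finally have "residue (hh N) ?T = fls_nth (fps_to_fls (fps_expansion (gg N) ?T) * W) (-1)"
    using has_laurent_expansion_residue by (simp only: fls_residue_def)
  also have "\<dots> = (\<Sum>k<1. fps_nth (fps_expansion (gg N) ?T) k * fls_nth W (- int (Suc k)))"
  proof (rule fls_fps_mult_nth_minus_1)
    show "fls_nth W n = 0" if "n < - int 1" for n
      unfolding W_def using bern_quotient_nth[of "- of_nat N" 0 n] that N by simp
  qed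
  also have "\<dots> = gg N ?T / of_nat N"
    unfolding W_def using bern_quotient_nth[of "- of_nat N" 0 "-1"] N
    by (simp add: fps_expansion_def bernpoly_0)
  finally show ?thesis .
qed

text \<open>Summed over m, the common principal part of the \<open>WW N m\<close> meets the twisted
  sum of the \<open>FL m\<close>, which \<open>sum_FL\<close> reduces to a multiple of
  \<open>FL 0\<close>; by \<open>Q_FL_0\<close> there is no residue. Only \<open>RR\<close>
  remains.\<close>

lemma sum_ee_Q_WW:
  assumes N: "N > 0"
  shows "(\<Sum>m\<in>{0..<2 * int P}. ee N m * fls_nth (fps_to_fls (QQ N) * WW N m * FL m) (-1))
    = (\<Sum>m\<in>{0..<2 * int P}. ee N m * fls_nth (fps_to_fls (QQ N * RR N m) * FL m) (-1))"
proof -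
  let ?X = "fls_const (1 / of_nat N) * fls_X_inv :: complex fls"
  have split: "ee N m * fls_nth (fps_to_fls (QQ N) * WW N m * FL m) (-1)
     = fls_nth (fps_to_fls (QQ N) * ?X * (fls_const (ee N m) * FL m)) (-1)
       + ee N m * fls_nth (fps_to_fls (QQ N * RR N m) * FL m) (-1)" for m
  proof -
    have "fps_to_fls (QQ N) * WW N m * FL m
       = fps_to_fls (QQ N) * ?X * FL m + fps_to_fls (QQ N * RR N m) * FL m"
      by (simp only: WW_eq[OF N] fls_times_fps_to_fls ring_distribs)
    then have "ee N m * fls_nth (fps_to_fls (QQ N) * WW N m * FL m) (-1)
       = ee N m * fls_nth (fps_to_fls (QQ N) * ?X * FL m) (-1) + ee N m * fls_nth (fps_to_fls (QQ N * RR N m) * FL m) (-1)"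
      by (simp add: distrib_left)
    also have "ee N m * fls_nth (fps_to_fls (QQ N) * ?X * FL m) (-1)
       = fls_nth (fps_to_fls (QQ N) * ?X * (fls_const (ee N m) * FL m)) (-1)"
      by (simp only: fls_mult_const_nth(1)[symmetric] mult_ac)
    finally show ?thesis .
  qed
  have "(\<Sum>m\<in>{0..<2 * int P}. fls_nth (fps_to_fls (QQ N) * ?X * (fls_const (ee N m) * FL m)) (-1))
     = fls_nth (fps_to_fls (QQ N) * ?X * (\<Sum>m\<in>{0..<2 * int P}. fls_const (ee N m) * FL m)) (-1)"
    by (simp only: sum_distrib_left fls_nth_sum)
  also have "\<dots> = gsum N (nn (\<lambda>j\<in>{1..M}. 1)) * fls_nth (fps_to_fls (QQ N) * ?X * FL 0) (-1)"
    unfolding sum_FL by (simp only: fls_mult_const_nth(1)[symmetric] mult_ac)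
  also have "\<dots> = 0" by (simp only: Q_FL_0 mult_zero_right)
  finally show ?thesis by (simp only: split sum.distrib add_0_left)
qed

text \<open>The point m = 0 is not among the poles. As its formal residue vanishes, the sum may run
  over a full residue system modulo 2P, as the Gauss sums require.\<close>

lemma residue_at_0:
  assumes N: "N > 0"
  shows "ee N 0 * fls_nth (fps_to_fls (QQ N) * WW N 0 * FL 0) (-1) = 0"
proof -
  have "fps_to_fls (QQ N) * WW N 0 * FL 0 = fps_to_fls (QQ N) * (fls_const (1 / of_nat N) * fls_X_inv) * FL 0
    + fps_to_fls (QQ N * RR N 0 * fps_expansion F 0)"
    by (simp only: WW_eq[OF N] FL_0_fps fls_times_fps_to_fls ring_distribs)
  then show ?thesis using Q_FL_0[of N "1 / of_nat N"] by simp
qed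

text \<open>Up to sign and factorials, the coefficient of t^(l-1) in \<open>QQ N * RR N m\<close>,
  summed over m against the Gauss phases of frequency a. Only even l - k occur because the Gaussian
  contains only even powers of t.\<close>

definition YY :: "nat \<Rightarrow> nat \<Rightarrow> int \<Rightarrow> complex" where
  "YY N l a = (\<Sum>k=1..l. if even (l - k) then
     of_nat N ^ k * (\<i> * of_real (lam N)) ^ ((l - k) div 2) * of_real (fact l / (fact k * fact ((l - k) div 2)))
     * (\<Sum>m\<in>{0..<2 * int P}. gs N a m * of_real (bernpoly k (real_of_int m / (2 * real P)))) else 0)"

text \<open>The contribution of the coefficients of t^(-l) of the expansions of \<open>F\<close>,
  over all points 2 pi i m, to - N times the sum of the residues.\<close>

definition XX :: "nat \<Rightarrow> nat \<Rightarrow> complex" where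
  "XX N l = (-1) ^ (L + 1) / fact (L - 1) * (\<Sum>\<eta>\<in>signs M. of_int (esgn \<eta>) * of_real (fpoly l L (- s \<eta> / 2)) * YY N l (nn \<eta>))"

lemma QR_nth:
  assumes "l \<ge> 1"
  shows "fps_nth (QQ N * RR N m) (l - 1) = - (\<Sum>k=1..l. if even (l - k) then
    (\<i> * of_real (lam N)) ^ ((l - k) div 2) / fact ((l - k) div 2)
    * ((- of_nat N) ^ (k - 1) * of_real (bernpoly k (real_of_int m / (2 * real P))) / fact k) else 0)"
proof -
  have "fps_nth (QQ N * RR N m) (l - 1) = (\<Sum>i=0..l - 1. fps_nth (QQ N) i * fps_nth (RR N m) (l - 1 - i))"
    by (rule fps_mult_nth)
  also have "\<dots> = (\<Sum>k=1..l. fps_nth (QQ N) (l - k) * fps_nth (RR N m) (k - 1))"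
    using assms by (intro sum.reindex_bij_witness[of _ "\<lambda>k. l - k" "\<lambda>i. l - i"]) auto
  also have "\<dots> = (\<Sum>k=1..l. - (if even (l - k) then
    (\<i> * of_real (lam N)) ^ ((l - k) div 2) / fact ((l - k) div 2)
    * ((- of_nat N) ^ (k - 1) * of_real (bernpoly k (real_of_int m / (2 * real P))) / fact k) else 0))"
  proof (intro sum.cong refl)
    fix k assume "k \<in> {1..l}"
    then have "Suc (k - 1) = k" by auto
    then have "fps_nth (RR N m) (k - 1) = - ((- of_nat N) ^ (k - 1) * of_real (bernpoly k (real_of_int m / (2 * real P))) / fact k)"
      by (simp only: RR_def fps_nth_Abs_fps)
    then show "fps_nth (QQ N) (l - k) * fps_nth (RR N m) (k - 1) = - (if even (l - k) then
      (\<i> * of_real (lam N)) ^ ((l - k) div 2) / fact ((l - k) div 2)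
      * ((- of_nat N) ^ (k - 1) * of_real (bernpoly k (real_of_int m / (2 * real P))) / fact k) else 0)"
      by (simp only: QQ_nth split: if_split) simp
  qed
  finally show ?thesis by (simp only: sum_negf)
qed

lemma sum_ee_QR_FL:
  "- of_nat N * (\<Sum>m\<in>{0..<2 * int P}. ee N m * fls_nth (fps_to_fls (QQ N * RR N m) * FL m) (-1)) = (\<Sum>l=1..L. XX N l)"
proof -
  let ?b = "\<lambda>k m. complex_of_real (bernpoly k (real_of_int m / (2 * real P)))"
  let ?il = "\<i> * complex_of_real (lam N)"
  have 1: "fls_nth (fps_to_fls (QQ N * RR N m) * FL m) (-1) = (\<Sum>l=1..L. fps_nth (QQ N * RR N m) (l - 1) * fls_nth (FL m) (- int l))" for m
  proof -
    have "fls_nth (fps_to_fls (QQ N * RR N m) * FL m) (-1) = (\<Sum>k<L. fps_nth (QQ N * RR N m) k * fls_nth (FL m) (- int (Suc k)))"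
    proof (rule fls_fps_mult_nth_minus_1)
      show "fls_nth (FL m) n = 0" if "n < - int L" for n
      proof -
        have "n = - int (nat (- n))" "nat (- n) \<ge> 1" "\<not> nat (- n) \<le> L" using that by auto
        then show ?thesis using FL_nth_neg[of "nat (- n)" m] by (simp only: if_False)
      qed
    qed
    also have "\<dots> = (\<Sum>l=1..L. fps_nth (QQ N * RR N m) (l - 1) * fls_nth (FL m) (- int l))"
      by (rule sum.reindex_bij_witness[of _ "\<lambda>l. l - 1" Suc]) auto
    finally show ?thesis .
  qed
  have 2: "- of_nat N * (\<Sum>m\<in>{0..<2 * int P}. ee N m * (fps_nth (QQ N * RR N m) (l - 1) * fls_nth (FL m) (- int l))) = XX N l"
    if l: "l \<in> {1..L}" for l
  proof -
    have l1: "l \<ge> 1" using l by auto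
    let ?g = "\<lambda>\<eta> m k. gs N (nn \<eta>) m * ?b k m"
    let ?c = "\<lambda>k. if even (l - k) then of_nat N ^ k * ?il ^ ((l - k) div 2) * of_real (fact l / (fact k * fact ((l - k) div 2))) else 0"
    let ?A = "(-1) ^ (L + 1) / fact (L - 1) :: complex"
    have "- of_nat N * (ee N m * (fps_nth (QQ N * RR N m) (l - 1) * fls_nth (FL m) (- int l)))
      = (\<Sum>\<eta>\<in>signs M. \<Sum>k=1..l. ?A * (of_int (esgn \<eta>) * of_real (fpoly l L (- s \<eta> / 2)) * (?c k * ?g \<eta> m k)))" for m
    proof -
      have "- of_nat N * (ee N m * (fps_nth (QQ N * RR N m) (l - 1) * fls_nth (FL m) (- int l)))
         = (\<Sum>\<eta>\<in>signs M. \<Sum>k=1..l. of_nat N * (ee N m * ((if even (l - k) then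
            ?il ^ ((l - k) div 2) / fact ((l - k) div 2) * ((- of_nat N) ^ (k - 1) * ?b k m / fact k) else 0)
           * ((-1) ^ (L + l) * fact l / fact (L - 1) * (of_int (esgn \<eta>) * epi (real_of_int m * (s \<eta> + real L)) * of_real (fpoly l L (- s \<eta> / 2)))))))"
        unfolding QR_nth[OF l1] FL_nth_neg[OF l1] using l
        by (simp add: sum_distrib_left sum_distrib_right sum_negf sum_divide_distrib)
      also have "\<dots> = (\<Sum>\<eta>\<in>signs M. \<Sum>k=1..l. ?A * (of_int (esgn \<eta>) * of_real (fpoly l L (- s \<eta> / 2)) * (?c k * ?g \<eta> m k)))"
      proof (intro sum.cong refl)
        fix \<eta> k assume k: "k \<in> {1..l}"
        show "of_nat N * (ee N m * ((if even (l - k) then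
            ?il ^ ((l - k) div 2) / fact ((l - k) div 2) * ((- of_nat N) ^ (k - 1) * ?b k m / fact k) else 0)
           * ((-1) ^ (L + l) * fact l / fact (L - 1) * (of_int (esgn \<eta>) * epi (real_of_int m * (s \<eta> + real L)) * of_real (fpoly l L (- s \<eta> / 2))))))
          = ?A * (of_int (esgn \<eta>) * of_real (fpoly l L (- s \<eta> / 2)) * (?c k * ?g \<eta> m k))"
        proof (cases "even (l - k)")
          case True
          have gen1: "n * (e * ((q / f * (x * b / g)) * (t * F / G * (es * ep * fp))))
             = (n * x) * t / G * (es * fp * (q * (F / (g * f)) * ((e * ep) * b)))"
            for n e q f x b g t F G es ep fp :: complex
            by (simp add: divide_inverse mult_ac)
          have gen2: "(t * n) / G * (es * fp * (q * v * u)) = (t / G) * (es * fp * ((n * q * v) * u))"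
            for t n G es fp q v u :: complex
            by (simp add: divide_inverse mult_ac)
          \<comment> \<open>Since k and l have the same parity, the signs from (- N)^(k-1) and from
            the principal coefficient combine to one that depends on neither.\<close>
          have sg: "(-1) ^ (k - 1) * (-1) ^ (L + l) = ((-1) ^ (L + 1) :: complex)"
            using True k by (auto simp: minus_one_power_iff)
          have N: "of_nat N * (- of_nat N) ^ (k - 1) = (-1) ^ (k - 1) * (of_nat N ^ k :: complex)"
            using k by (cases k) (simp_all add: power_minus[of "of_nat N"])
          have "of_nat N * (ee N m * ((?il ^ ((l - k) div 2) / fact ((l - k) div 2) * ((- of_nat N) ^ (k - 1) * ?b k m / fact k))
           * ((-1) ^ (L + l) * fact l / fact (L - 1) * (of_int (esgn \<eta>) * epi (real_of_int m * (s \<eta> + real L)) * of_real (fpoly l L (- s \<eta> / 2))))))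
           = (of_nat N * (- of_nat N) ^ (k - 1)) * (-1) ^ (L + l) / fact (L - 1) * (of_int (esgn \<eta>) * of_real (fpoly l L (- s \<eta> / 2))
             * (?il ^ ((l - k) div 2) * (fact l / (fact k * fact ((l - k) div 2))) * ((ee N m * epi (real_of_int m * (s \<eta> + real L))) * ?b k m)))"
            by (rule gen1)
          also have "(of_nat N * (- of_nat N) ^ (k - 1)) * (-1) ^ (L + l) = (-1) ^ (L + 1) * (of_nat N ^ k :: complex)"
            unfolding N sg[symmetric] by (simp only: mult_ac)
          also have "ee N m * epi (real_of_int m * (s \<eta> + real L)) = gs N (nn \<eta>) m"
            unfolding gs_eq epi_nn by simp
          also note gen2
          finally show ?thesis using True by (simp only: if_True of_real_divide of_real_mult of_real_fact)
        qed simp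
      qed
      finally show ?thesis .
    qed
    then have "- of_nat N * (\<Sum>m\<in>{0..<2 * int P}. ee N m * (fps_nth (QQ N * RR N m) (l - 1) * fls_nth (FL m) (- int l)))
      = (\<Sum>m\<in>{0..<2 * int P}. \<Sum>\<eta>\<in>signs M. \<Sum>k=1..l. ?A * (of_int (esgn \<eta>) * of_real (fpoly l L (- s \<eta> / 2)) * (?c k * ?g \<eta> m k)))"
      by (simp only: sum_distrib_left)
    also have "\<dots> = (\<Sum>\<eta>\<in>signs M. \<Sum>m\<in>{0..<2 * int P}. \<Sum>k=1..l. ?A * (of_int (esgn \<eta>) * of_real (fpoly l L (- s \<eta> / 2)) * (?c k * ?g \<eta> m k)))"
      by (rule sum.swap)
    also have "\<dots> = (\<Sum>\<eta>\<in>signs M. \<Sum>k=1..l. \<Sum>m\<in>{0..<2 * int P}. ?A * (of_int (esgn \<eta>) * of_real (fpoly l L (- s \<eta> / 2)) * (?c k * ?g \<eta> m k)))"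
      by (intro sum.cong refl sum.swap)
    also have "\<dots> = XX N l"
      unfolding XX_def YY_def sum_distrib_left
      by (intro sum.cong refl) (simp add: sum_distrib_left sum_negf sum_divide_distrib)
    finally show ?thesis .
  qed
  have "- of_nat N * (\<Sum>m\<in>{0..<2 * int P}. ee N m * fls_nth (fps_to_fls (QQ N * RR N m) * FL m) (-1))
     = - of_nat N * (\<Sum>m\<in>{0..<2 * int P}. \<Sum>l=1..L. ee N m * (fps_nth (QQ N * RR N m) (l - 1) * fls_nth (FL m) (- int l)))"
    by (simp only: 1 sum_distrib_left)
  also have "\<dots> = - of_nat N * (\<Sum>l=1..L. \<Sum>m\<in>{0..<2 * int P}. ee N m * (fps_nth (QQ N * RR N m) (l - 1) * fls_nth (FL m) (- int l)))"
    by (rule arg_cong[OF sum.swap])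
  also have "\<dots> = (\<Sum>l=1..L. XX N l)"
    by (subst sum_distrib_left) (intro sum.cong refl 2)
  finally show ?thesis .
qed

definition Sg :: "nat \<Rightarrow> complex" where
  "Sg N = (\<Sum>n\<in>{n \<in> {0..<2 * P * N}. \<not> N dvd n}. gg N (2 * of_real pi * \<i> * of_nat n / of_nat N))"

text \<open>The poles split by divisibility: n = m N gives the formal residues at 2 pi i m, and the
  other n give the simple poles of \<open>residue_hh_nonint\<close>.\<close>

lemma sum_residues:
  assumes N: "N > 0"
  shows "of_nat N * (\<Sum>z\<in>poles N. residue (hh N) z) = Sg N - (\<Sum>l=1..L. XX N l)"
proof -
  let ?z = "\<lambda>n. 2 * of_real pi * \<i> * of_nat n / of_nat N :: complex"
  let ?r = "\<lambda>n. residue (hh N) (?z n)"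
  have inj: "inj_on ?z {1..<2 * P * N}" using N by (auto intro!: inj_onI)
  have "(\<Sum>z\<in>poles N. residue (hh N) z) = (\<Sum>n\<in>{1..<2 * P * N}. ?r n)"
    unfolding poles_def by (subst sum.reindex[OF inj]) simp
  also have "{1..<2 * P * N} = {n \<in> {0..<2 * P * N}. \<not> N dvd n} \<union> {n \<in> {1..<2 * P * N}. N dvd n}"
    by (auto simp: Suc_le_eq intro!: Nat.gr0I)
  also have "(\<Sum>n\<in>\<dots>. ?r n) = (\<Sum>n\<in>{n \<in> {0..<2 * P * N}. \<not> N dvd n}. ?r n) + (\<Sum>n\<in>{n \<in> {1..<2 * P * N}. N dvd n}. ?r n)"
    by (intro sum.union_disjoint) auto
  also have "(\<Sum>n\<in>{n \<in> {0..<2 * P * N}. \<not> N dvd n}. ?r n) = Sg N / of_nat N"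
    unfolding Sg_def sum_divide_distrib by (intro sum.cong refl residue_hh_nonint N) auto
  also have "(\<Sum>n\<in>{n \<in> {1..<2 * P * N}. N dvd n}. ?r n) = (\<Sum>m\<in>{1..<2 * int P}. residue (hh N) (2 * of_real pi * \<i> * of_int m))"
  proof (rule sum.reindex_bij_witness[of _ "\<lambda>m. nat m * N" "\<lambda>n. int (n div N)"])
    fix n assume n: "n \<in> {n \<in> {1..<2 * P * N}. N dvd n}"
    then show nN: "nat (int (n div N)) * N = n" by simp
    have "0 < n div N" using n N by (simp add: div_greater_zero_iff dvd_imp_le)
    moreover have "n div N < 2 * P" using n N by (simp add: less_mult_imp_div_less)
    ultimately show "int (n div N) \<in> {1..<2 * int P}" by (simp flip: of_nat_mult)
    show "residue (hh N) (2 * of_real pi * \<i> * of_int (int (n div N))) = ?r n"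
      using n N by (intro arg_cong[where f = "residue (hh N)"]) (auto elim!: dvdE)
  next
    fix m assume m: "m \<in> {1..<2 * int P}"
    show "int (nat m * N div N) = m" using m N by simp
    have "nat m < 2 * P" using m by auto
    then show "nat m * N \<in> {n \<in> {1..<2 * P * N}. N dvd n}" using m N by auto
  qed
  also have "(\<Sum>m\<in>{1..<2 * int P}. residue (hh N) (2 * of_real pi * \<i> * of_int m))
    = (\<Sum>m\<in>{0..<2 * int P}. ee N m * fls_nth (fps_to_fls (QQ N) * WW N m * FL m) (-1))"
  proof (rule sum.mono_neutral_cong_left)
    show "\<forall>m\<in>{0..<2 * int P} - {1..<2 * int P}. ee N m * fls_nth (fps_to_fls (QQ N) * WW N m * FL m) (-1) = 0"
    proof
      fix m assume "m \<in> {0..<2 * int P} - {1..<2 * int P}"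
      then have "m = 0" by auto
      then show "ee N m * fls_nth (fps_to_fls (QQ N) * WW N m * FL m) (-1) = 0"
        using residue_at_0[OF N] by (simp only:)
    qed
  qed (auto simp: residue_hh_int)
  also have "\<dots> = (\<Sum>m\<in>{0..<2 * int P}. ee N m * fls_nth (fps_to_fls (QQ N * RR N m) * FL m) (-1))"
    by (rule sum_ee_Q_WW[OF N])
  finally have "of_nat N * (\<Sum>z\<in>poles N. residue (hh N) z) = Sg N
    + of_nat N * (\<Sum>m\<in>{0..<2 * int P}. ee N m * fls_nth (fps_to_fls (QQ N * RR N m) * FL m) (-1))"
    using N by (simp add: distrib_left)
  also have "of_nat N * (\<Sum>m\<in>{0..<2 * int P}. ee N m * fls_nth (fps_to_fls (QQ N * RR N m) * FL m) (-1)) = - (\<Sum>l=1..L. XX N l)"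
    unfolding sum_ee_QR_FL[symmetric] by simp
  finally show ?thesis by simp
qed

lemma lawrence_rozansky_eq:
  assumes "N > 0"
  shows "lawrence_rozansky M p N = epi (1/4) / of_real (2 * sqrt (2 * real P * real N)) * Sg N"
proof -
  have *: "gg N (2 * of_real pi * \<i> * of_nat n / of_nat N)
    = epi (- (real n ^ 2 / (2 * real P * real N)))
          * (\<Prod>j=1..M. epi (real n / (real N * real (p j))) - epi (- (real n / (real N * real (p j)))))
          / (epi (real n / real N) - epi (- (real n / real N))) ^ (M - 2)" for n
  proof -
    let ?T = "2 * of_real pi * \<i> * of_nat n / of_nat N :: complex"
    have "\<i> * of_real (lam N) * ?T\<^sup>2 = of_real (- (real n ^ 2 / (2 * real P * real N))) * of_real pi * \<i>"
      using assms P_pos by (simp add: lam_def power2_eq_square field_simps)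
    moreover have "?T / (2 * of_nat (p j)) = of_real (real n / (real N * real (p j))) * of_real pi * \<i>" for j
      by simp
    moreover have "- (?T / (2 * of_nat (p j))) = of_real (- (real n / (real N * real (p j)))) * of_real pi * \<i>" for j
      by simp
    moreover have "?T / 2 = of_real (real n / real N) * of_real pi * \<i>" "- (?T / 2) = of_real (- (real n / real N)) * of_real pi * \<i>"
      by simp_all
    ultimately show ?thesis unfolding gg_def F_def epi_def L_def by (simp only: times_divide_eq_right)
  qed
  show ?thesis unfolding lawrence_rozansky_def Let_def Sg_def * ..
qed

end

subsection \<open>Steepest descent\<close>

text \<open>The integral of exp(- \<mu> x^2) x^(2k) over x >= 0.\<close>

definition gauss_mom :: "nat \<Rightarrow> real \<Rightarrow> real" where
  "gauss_mom k \<mu> = sqrt pi / 2 * (fact (2 * k) / (2 ^ (2 * k) * fact k)) / (sqrt \<mu> * \<mu> ^ k)"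

text \<open>The moment for \<mu> = 1 is rescaled by the factor sqrt \<mu>. The integrand is
  nonnegative, so truncated integrals increase to the limit and stay below it.\<close>

lemma gauss_mom_tendsto:
  assumes \<mu>: "\<mu> > 0"
  shows "((\<lambda>R. integral {0..R} (\<lambda>x. exp (- \<mu> * x\<^sup>2) * x ^ (2 * k))) \<longlongrightarrow> gauss_mom k \<mu>) at_top"
    and "R \<ge> 0 \<Longrightarrow> integral {0..R} (\<lambda>x. exp (- \<mu> * x\<^sup>2) * x ^ (2 * k)) \<le> gauss_mom k \<mu>"
proof -
  let ?f = "\<lambda>x::real. exp (- \<mu> * x\<^sup>2) * x ^ (2 * k)"
  let ?g = "\<lambda>x::real. indicator {0..} x *\<^sub>R ?f x"
  let ?v = "sqrt pi / 2 * (fact (2 * k) / (2 ^ (2 * k) * fact k))"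
  have sq: "sqrt \<mu> > 0" "sqrt \<mu> \<noteq> 0" using \<mu> by auto
  have "has_bochner_integral lborel (\<lambda>x. indicator {0..} (0 + sqrt \<mu> * x) *\<^sub>R (exp (- (0 + sqrt \<mu> * x)\<^sup>2) * (0 + sqrt \<mu> * x) ^ (2 * k)))
      (?v /\<^sub>R \<bar>sqrt \<mu>\<bar>)"
    by (rule lborel_has_bochner_integral_real_affine_iff[OF sq(2), THEN iffD1, OF gaussian_moment_even_pos[of k]])
  also have "(\<lambda>x. indicator {0..} (0 + sqrt \<mu> * x) *\<^sub>R (exp (- (0 + sqrt \<mu> * x)\<^sup>2) * (0 + sqrt \<mu> * x) ^ (2 * k)))
     = (\<lambda>x. \<mu> ^ k * ?g x)"
  proof
    fix x
    have "(sqrt \<mu> * x) ^ (2 * k) = \<mu> ^ k * x ^ (2 * k)" "(sqrt \<mu> * x)\<^sup>2 = \<mu> * x\<^sup>2"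
      using \<mu> by (simp_all add: power_mult_distrib power_mult)
    moreover have "indicator {0..} (sqrt \<mu> * x) = (indicator {0..} x :: real)"
      using sq by (auto simp: indicator_def zero_le_mult_iff)
    ultimately show "indicator {0..} (0 + sqrt \<mu> * x) *\<^sub>R (exp (- (0 + sqrt \<mu> * x)\<^sup>2) * (0 + sqrt \<mu> * x) ^ (2 * k)) = \<mu> ^ k * ?g x"
      by simp
  qed
  finally have "has_bochner_integral lborel (\<lambda>x. inverse (\<mu> ^ k) * (\<mu> ^ k * ?g x)) (inverse (\<mu> ^ k) * (?v /\<^sub>R \<bar>sqrt \<mu>\<bar>))"
    by (intro has_bochner_integral_mult_right)
  moreover have "inverse (\<mu> ^ k) * (?v /\<^sub>R \<bar>sqrt \<mu>\<bar>) = gauss_mom k \<mu>"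
    using \<mu> by (simp add: gauss_mom_def field_simps)
  moreover have "(\<lambda>x. inverse (\<mu> ^ k) * (\<mu> ^ k * ?g x)) = ?g" using \<mu> by (simp add: mult.assoc[symmetric])
  ultimately have hb: "has_bochner_integral lborel ?g (gauss_mom k \<mu>)" by (simp only:)
  have int: "integrable lborel ?g" and val: "integral\<^sup>L lborel ?g = gauss_mom k \<mu>"
    using hb by (auto simp: has_bochner_integral_iff)
  have eq: "(\<integral>x. indicator {..R} x *\<^sub>R ?g x \<partial>lborel) = integral {0..R} ?f" for R
  proof -
    have "(\<lambda>x. indicator {..R} x *\<^sub>R ?g x) = (\<lambda>x. indicator {0..R} x *\<^sub>R ?f x)"
      by (auto simp: indicator_def)
    moreover have "set_integrable lborel {0..R} ?f"
      by (intro borel_integrable_atLeastAtMost') (auto intro!: continuous_intros)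
    from set_borel_integral_eq_integral(2)[OF this] show ?thesis
      unfolding calculation by (simp add: set_lebesgue_integral_def)
  qed
  show lim: "((\<lambda>R. integral {0..R} ?f) \<longlongrightarrow> gauss_mom k \<mu>) at_top"
    using tendsto_integral_at_top[OF sets_lborel int] by (simp only: eq val)
  show "integral {0..R} ?f \<le> gauss_mom k \<mu>" if R: "R \<ge> 0"
  proof (rule tendsto_lowerbound[OF lim])
    have "integral {0..R} ?f \<le> integral {0..R'} ?f" if "R' \<ge> R" for R'
      using that R by (intro integral_subset_le integrable_continuous_real continuous_intros) auto
    then show "\<forall>\<^sub>F R' in at_top. integral {0..R} ?f \<le> integral {0..R'} ?f"
      by (intro eventually_at_top_linorderI[of R])
  qed simp
qed

context seifert
begin

section \<open>Taylor expansion of \<open>F\<close> at 0 and on the ray of steepest descent\<close>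

definition cc :: "nat \<Rightarrow> complex" where "cc n = fps_nth (fps_expansion F 0) n"

text \<open>The radius 6 is a convenient value below 2 pi, the distance from 0 to the nearest
  lattice point.\<close>

lemma ball_lattice: "ball 0 6 \<subseteq> - lattice_pts 1"
proof
  fix z assume z: "z \<in> ball (0::complex) 6"
  show "z \<in> - lattice_pts 1"
  proof
    assume "z \<in> lattice_pts 1"
    then obtain n where n: "n \<noteq> 0" "z = 2 * of_real pi * \<i> * of_int n" by (auto simp: lattice_pts_1)
    then have "norm z = 2 * pi * \<bar>real_of_int n\<bar>" by (simp add: norm_mult)
    also have "\<dots> \<ge> 2 * pi * 1" using n by (intro mult_left_mono) auto
    finally show False using z pi_gt3 by simp
  qed
qed

lemma F_holo_ball: "F holomorphic_on ball 0 6"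
  by (rule holomorphic_on_subset[OF F_holomorphic ball_lattice])

lemma cc_odd:
  assumes "odd n"
  shows "cc n = 0"
proof -
  have "(deriv ^^ n) (\<lambda>w. F (-1 * w)) 0 = (-1) ^ n * (deriv ^^ n) F (-1 * 0)"
    by (rule higher_deriv_compose_linear[OF F_holo_ball, where S = "ball 0 6"]) auto
  then show ?thesis using assms by (simp add: F_uminus cc_def fps_expansion_def)
qed

text \<open>\<open>F\<close> is even: the Taylor polynomial of degree 2K + 1 consists of the terms
  of degree 2k with k <= K, while its remainder is already of order 2K + 2.\<close>

lemma taylor_near:
  "\<exists>C\<ge>0. \<forall>z. norm z \<le> 2 \<longrightarrow> norm (F z - (\<Sum>k\<le>K. cc (2 * k) * z ^ (2 * k))) \<le> C * norm z ^ (2 * K + 2)"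
proof -
  define n where "n = 2 * K + 1"
  have hol: "(deriv ^^ i) F holomorphic_on ball 0 6" for i
    by (rule holomorphic_higher_deriv[OF F_holo_ball open_ball])
  have sub: "cball 0 2 \<subseteq> ball (0::complex) 6" by auto
  have "compact ((deriv ^^ Suc n) F ` cball 0 2)"
    by (intro compact_continuous_image continuous_on_subset[OF holomorphic_on_imp_continuous_on[OF hol] sub]) simp
  then have "bounded ((deriv ^^ Suc n) F ` cball 0 2)" by (rule compact_imp_bounded)
  then obtain B where "\<forall>y\<in>(deriv ^^ Suc n) F ` cball 0 2. norm y \<le> B" unfolding bounded_iff ..
  then have B: "norm ((deriv ^^ Suc n) F z) \<le> B" if "z \<in> cball 0 2" for z
    by (rule bspec[OF _ imageI[OF that]])
  have "B \<ge> 0" by (rule order_trans[OF norm_ge_zero B[of 0]]) simp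
  have main: "norm (F z - (\<Sum>k\<le>K. cc (2 * k) * z ^ (2 * k))) \<le> B / fact n * norm z ^ (2 * K + 2)" if z: "norm z \<le> 2" for z
  proof -
    have "norm ((deriv ^^ 0) F z - (\<Sum>i\<le>n. (deriv ^^ i) F 0 * (z - 0) ^ i / fact i)) \<le> B * norm (z - 0) ^ Suc n / fact n"
    proof (rule complex_Taylor[of "cball 0 2"])
      show "((deriv ^^ i) F has_field_derivative (deriv ^^ Suc i) F x) (at x within cball 0 2)" if "x \<in> cball 0 2" for i x
        unfolding funpow.simps o_def by (rule holomorphic_derivI[OF hol open_ball subsetD[OF sub that]])
      show "norm ((deriv ^^ Suc n) F x) \<le> B" if "x \<in> cball 0 2" for x
        by (rule B[OF that])
    qed (use z in auto)
    moreover have "(\<Sum>i\<le>n. (deriv ^^ i) F 0 * (z - 0) ^ i / fact i) = (\<Sum>i\<le>n. cc i * z ^ i)"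
      by (simp add: cc_def fps_expansion_def)
    moreover have "(\<Sum>i\<le>n. cc i * z ^ i) = (\<Sum>k\<le>K. cc (2 * k) * z ^ (2 * k))"
    proof -
      have "(\<Sum>k\<le>K. cc (2 * k) * z ^ (2 * k)) = (\<Sum>i\<in>(\<lambda>k. 2 * k) ` {..K}. cc i * z ^ i)"
        by (subst sum.reindex) (auto simp: inj_on_def)
      also have "\<dots> = (\<Sum>i\<le>n. cc i * z ^ i)"
      proof (rule sum.mono_neutral_left)
        show "\<forall>i\<in>{..n} - (\<lambda>k. 2 * k) ` {..K}. cc i * z ^ i = 0"
        proof
          fix i assume i: "i \<in> {..n} - (\<lambda>k. 2 * k) ` {..K}"
          have "odd i"
          proof
            assume "even i"
            then obtain k where "i = 2 * k" by blast
            then show False using i by (auto simp: n_def)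
          qed
          then show "cc i * z ^ i = 0" by (simp add: cc_odd)
        qed
      qed (auto simp: n_def)
      finally show ?thesis ..
    qed
    ultimately show ?thesis by (simp add: n_def)
  qed
  show ?thesis using main \<open>B \<ge> 0\<close> by (intro exI[of _ "B / fact n"]) auto
qed

text \<open>Near 0 this is Taylor's estimate. For x >= 1 the power x^(2K+2) dominates every term:
  \<open>F\<close> is bounded on the ray, by compactness for x in [1, 2] and by its decay beyond,
  and the Taylor polynomial has lower degree. The bound has to hold on the whole ray because it is
  integrated up to infinity.\<close>

lemma taylor_ray:
  "\<exists>C\<ge>0. \<forall>x\<ge>0. norm (F ((1 + \<i>) * of_real x) - (\<Sum>k\<le>K. cc (2 * k) * ((1 + \<i>) * of_real x) ^ (2 * k))) \<le> C * x ^ (2 * (K + 1))"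
proof -
  have n1: "norm ((1 + \<i>) * of_real x) = sqrt 2 * \<bar>x\<bar>" for x
    by (simp add: norm_mult cmod_def real_sqrt_mult)
  have sq2: "sqrt 2 \<le> 2" by (simp add: real_le_lsqrt)
  obtain C1 where C1: "C1 \<ge> 0" "\<And>z. norm z \<le> 2 \<Longrightarrow> norm (F z - (\<Sum>k\<le>K. cc (2 * k) * z ^ (2 * k))) \<le> C1 * norm z ^ (2 * K + 2)"
    using taylor_near[of K] by blast
  have "(\<lambda>x. (1 + \<i>) * of_real x) ` {1..2::real} \<subseteq> - lattice_pts 1"
    by (auto simp: lattice_pts_1 complex_eq_iff)
  then have "compact ((F \<circ> (\<lambda>x. (1 + \<i>) * of_real x)) ` {1..2::real})"
    by (intro compact_continuous_image continuous_on_compose continuous_intros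
          continuous_on_subset[OF holomorphic_on_imp_continuous_on[OF F_holomorphic]]) auto
  then have "bounded ((F \<circ> (\<lambda>x. (1 + \<i>) * of_real x)) ` {1..2::real})" by (rule compact_imp_bounded)
  then obtain B1 where "\<forall>y\<in>(F \<circ> (\<lambda>x. (1 + \<i>) * of_real x)) ` {1..2::real}. norm y \<le> B1" unfolding bounded_iff ..
  then have B1: "norm (F ((1 + \<i>) * of_real x)) \<le> B1" if "x \<in> {1..2}" for x
    using that by simp
  define B2 where "B2 = max B1 (2 ^ M * 2 ^ L)"
  have B2: "norm (F ((1 + \<i>) * of_real x)) \<le> B2" if "x \<ge> 1" for x
  proof (cases "x \<le> 2")
    case True then show ?thesis using B1[of x] that by (simp add: B2_def)
  next
    case False
    have "norm (F ((1 + \<i>) * of_real x)) \<le> 2 ^ M * 2 ^ L * exp (- ((real L - sg) / 2 * \<bar>x\<bar>))"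
      using norm_F_le[of "(1 + \<i>) * of_real x"] False by simp
    also have "\<dots> \<le> 2 ^ M * 2 ^ L * 1" using sg_less by (intro mult_left_mono) auto
    finally show ?thesis by (simp add: B2_def)
  qed
  define S where "S = (\<Sum>k\<le>K. norm (cc (2 * k)) * (sqrt 2) ^ (2 * k))"
  have "S \<ge> 0" by (simp add: S_def sum_nonneg)
  define C where "C = max (C1 * (sqrt 2) ^ (2 * K + 2)) (B2 + S)"
  show ?thesis
  proof (intro exI[of _ C] conjI allI impI)
    show "C \<ge> 0" using C1(1) by (simp add: C_def le_max_iff_disj)
    fix x :: real assume x: "x \<ge> 0"
    let ?z = "(1 + \<i>) * complex_of_real x"
    show "norm (F ?z - (\<Sum>k\<le>K. cc (2 * k) * ?z ^ (2 * k))) \<le> C * x ^ (2 * (K + 1))"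
    proof (cases "x \<le> 1")
      case True
      have "norm ?z \<le> 2" unfolding n1 using True x sq2 by (intro order_trans[OF mult_mono[OF sq2, of _ 1]]) auto
      from C1(2)[OF this] have "norm (F ?z - (\<Sum>k\<le>K. cc (2 * k) * ?z ^ (2 * k))) \<le> C1 * (sqrt 2 * x) ^ (2 * K + 2)"
        unfolding n1 using x by simp
      also have "\<dots> = C1 * (sqrt 2) ^ (2 * K + 2) * x ^ (2 * (K + 1))"
        by (simp add: power_mult_distrib mult_ac)
      also have "\<dots> \<le> C * x ^ (2 * (K + 1))"
        using x by (intro mult_right_mono) (auto simp: C_def)
      finally show ?thesis .
    next
      case False
      have "norm (F ?z - (\<Sum>k\<le>K. cc (2 * k) * ?z ^ (2 * k))) \<le> norm (F ?z) + norm (\<Sum>k\<le>K. cc (2 * k) * ?z ^ (2 * k))"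
        by (rule norm_triangle_ineq4)
      also have "norm (\<Sum>k\<le>K. cc (2 * k) * ?z ^ (2 * k)) \<le> (\<Sum>k\<le>K. norm (cc (2 * k) * ?z ^ (2 * k)))"
        by (rule norm_sum)
      also have "\<dots> \<le> (\<Sum>k\<le>K. norm (cc (2 * k)) * (sqrt 2) ^ (2 * k) * x ^ (2 * (K + 1)))"
      proof (rule sum_mono)
        fix k assume k: "k \<in> {..K}"
        have "norm (cc (2 * k) * ?z ^ (2 * k)) = norm (cc (2 * k)) * (sqrt 2) ^ (2 * k) * x ^ (2 * k)"
          unfolding norm_mult[of "cc (2 * k)"] norm_power n1 using x by (simp add: power_mult_distrib)
        also have "\<dots> \<le> norm (cc (2 * k)) * (sqrt 2) ^ (2 * k) * x ^ (2 * (K + 1))"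
          using False k by (intro mult_left_mono power_increasing) auto
        finally show "norm (cc (2 * k) * ?z ^ (2 * k)) \<le> norm (cc (2 * k)) * (sqrt 2) ^ (2 * k) * x ^ (2 * (K + 1))" .
      qed
      also have "\<dots> = S * x ^ (2 * (K + 1))" by (simp only: S_def sum_distrib_right)
      also have "norm (F ?z) \<le> B2 * x ^ (2 * (K + 1))"
      proof -
        have "B2 \<ge> 0" by (simp add: B2_def le_max_iff_disj)
        moreover have "1 \<le> x ^ (2 * (K + 1))" using False by (intro one_le_power) auto
        ultimately have "B2 * 1 \<le> B2 * x ^ (2 * (K + 1))" by (intro mult_left_mono)
        then show ?thesis using B2[of x] False by linarith
      qed
      finally have "norm (F ?z - (\<Sum>k\<le>K. cc (2 * k) * ?z ^ (2 * k))) \<le> (B2 + S) * x ^ (2 * (K + 1))"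
        by (simp add: ring_distribs)
      also have "\<dots> \<le> C * x ^ (2 * (K + 1))" using x by (intro mult_right_mono) (auto simp: C_def)
      finally show ?thesis .
    qed
  qed
qed

lemma gg_uminus: "gg N (- T) = gg N T"
  by (simp add: gg_def F_uminus)

text \<open>Cauchy's theorem on the triangle 0, R, (1 + i) R, inside the sector 0 <= Im T <= Re T,
  which contains no poles of \<open>F\<close>. On the ray i (1 + i)^2 = -2 makes the Gaussian real;
  on the vertical side it is at most 1 in modulus and the decay of \<open>F\<close> gives the bound.
  Evenness of g doubles the half line.\<close>

lemma integral_rotate:
  assumes N: "N > 0" and R: "R \<ge> 2"
  shows "norm (integral {-R..R} (\<lambda>x. gg N (of_real x))
      - 2 * (1 + \<i>) * integral {0..R} (\<lambda>x. of_real (exp (- (2 * lam N) * x\<^sup>2)) * F ((1 + \<i>) * of_real x)))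
    \<le> 2 * (2 ^ M * 2 ^ L * exp (- ((real L - sg) / 2 * R)) * R)"
proof -
  define b where "b = complex_of_real R"
  define c where "c = (1 + \<i>) * complex_of_real R"
  define S where "S = {T. Im T \<ge> 0} \<inter> {T. Im T \<le> Re T}"
  have "convex S"
  proof -
    have "{T. Im T \<le> Re T} = {T. inner (\<i> - 1) T \<le> 0}" by (auto simp: inner_complex_def)
    then have "convex {T. Im T \<le> Re T}" using convex_halfspace_le by metis
    then show ?thesis unfolding S_def by (intro convex_Int convex_halfspace_Im_ge)
  qed
  have Sl: "S \<subseteq> - lattice_pts 1"
    by (auto simp: S_def lattice_pts_1)
  have gh: "gg N holomorphic_on - lattice_pts 1"
    unfolding gg_def by (intro holomorphic_intros F_holomorphic)
  have hull: "convex hull {0, b, c} \<subseteq> S"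
  proof (rule hull_minimal)
    show "{0, b, c} \<subseteq> S" using R by (auto simp: S_def b_def c_def)
  qed (rule \<open>convex S\<close>)
  have hol: "gg N holomorphic_on convex hull {0, b, c}"
    using hull Sl by (intro holomorphic_on_subset[OF gh]) auto
  have tri: "(gg N has_contour_integral 0) (linepath 0 b +++ linepath b c +++ linepath c 0)"
    by (rule Cauchy_theorem_triangle[OF hol])
  have seg: "closed_segment x y \<subseteq> convex hull {0, b, c}" if "x \<in> {0, b, c}" "y \<in> {0, b, c}" for x y
    by (intro closed_segment_subset convex_convex_hull hull_inc that)
  have int: "gg N contour_integrable_on linepath x y" if "x \<in> {0, b, c}" "y \<in> {0, b, c}" for x y
    by (intro contour_integrable_continuous_linepath continuous_on_subset[OF holomorphic_on_imp_continuous_on[OF hol] seg] that)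
  have "contour_integral (linepath 0 b) (gg N) + (contour_integral (linepath b c) (gg N) + contour_integral (linepath c 0) (gg N)) = 0"
    using contour_integral_unique[OF tri] int by simp
  moreover have "contour_integral (linepath c 0) (gg N) = - contour_integral (linepath 0 c) (gg N)"
    using contour_integral_reversepath[of "linepath 0 c" "gg N"] by simp
  ultimately have eq: "contour_integral (linepath 0 b) (gg N) - contour_integral (linepath 0 c) (gg N) = - contour_integral (linepath b c) (gg N)"
    by (simp add: algebra_simps)
  have I1: "contour_integral (linepath 0 b) (gg N) = integral {0..R} (\<lambda>x. gg N (of_real x))"
    using contour_integral_linepath_Reals_eq[of 0 b "gg N"] R by (simp add: b_def)
  have I2: "contour_integral (linepath 0 c) (gg N)
      = (1 + \<i>) * integral {0..R} (\<lambda>x. of_real (exp (- (2 * lam N) * x\<^sup>2)) * F ((1 + \<i>) * of_real x))"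
  proof -
    have "(gg N has_contour_integral contour_integral (linepath 0 c) (gg N)) (linepath 0 c)"
      using int[of 0 c] by (simp add: has_contour_integral_integral)
    then have "((\<lambda>z. (1 + \<i>) * gg N ((1 + \<i>) * z)) has_contour_integral contour_integral (linepath 0 c) (gg N)) (linepath 0 b)"
      unfolding has_contour_integral_linepath
      by (simp add: linepath_def b_def c_def scaleR_conv_of_real mult_ac)
    then have "((\<lambda>x. (1 + \<i>) * gg N ((1 + \<i>) * of_real x)) has_integral contour_integral (linepath 0 c) (gg N)) {0..R}"
      using has_contour_integral_linepath_Reals_iff[of 0 b] R by (simp add: b_def)
    moreover have "gg N ((1 + \<i>) * of_real x) = of_real (exp (- (2 * lam N) * x\<^sup>2)) * F ((1 + \<i>) * of_real x)" for x
    proof -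
      have "\<i> * of_real (lam N) * ((1 + \<i>) * of_real x)\<^sup>2 = of_real (- (2 * lam N) * x\<^sup>2)"
        by (simp add: power2_eq_square algebra_simps)
      then show ?thesis unfolding gg_def by (simp only: exp_of_real)
    qed
    ultimately have "((\<lambda>x. (1 + \<i>) * (of_real (exp (- (2 * lam N) * x\<^sup>2)) * F ((1 + \<i>) * of_real x))) has_integral contour_integral (linepath 0 c) (gg N)) {0..R}"
      by simp
    from integral_unique[OF this] show ?thesis by (simp only: integral_mult_right)
  qed
  have b1: "norm (contour_integral (linepath b c) (gg N)) \<le> 2 ^ M * 2 ^ L * exp (- ((real L - sg) / 2 * R)) * norm (c - b)"
  proof (rule contour_integral_bound_linepath)
    show "gg N contour_integrable_on linepath b c" by (rule int) auto
    fix x assume "x \<in> closed_segment b c"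
    then have x: "Re x = R" "0 \<le> Im x"
      using R by (auto simp: closed_segment_same_Re b_def c_def closed_segment_eq_real_ivl)
    have "norm (gg N x) = exp (- (2 * lam N * R * Im x)) * norm (F x)"
      unfolding gg_def norm_mult norm_exp_lam x(1) ..
    also have "\<dots> \<le> 1 * norm (F x)" using x R lam_pos[OF N] by (intro mult_right_mono) auto
    also have "\<dots> \<le> 2 ^ M * 2 ^ L * exp (- ((real L - sg) / 2 * R))" using norm_F_le[of x] x R by simp
    finally show "norm (gg N x) \<le> 2 ^ M * 2 ^ L * exp (- ((real L - sg) / 2 * R))" .
  qed simp
  have "c - b = \<i> * of_real R" by (simp add: b_def c_def algebra_simps)
  then have cb: "norm (c - b) = R" using R by (simp add: norm_mult)
  have dbl: "integral {-R..R} (\<lambda>x. gg N (of_real x)) = 2 * integral {0..R} (\<lambda>x. gg N (of_real x))"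
  proof -
    have "continuous_on UNIV (\<lambda>x. gg N (of_real x))"
    proof -
      have "continuous_on UNIV (gg N \<circ> of_real)"
        by (intro continuous_on_compose continuous_intros continuous_on_subset[OF holomorphic_on_imp_continuous_on[OF gh]])
           (auto simp: lattice_pts_1 complex_eq_iff)
      then show ?thesis by (simp add: o_def)
    qed
    then have i: "(\<lambda>x. gg N (of_real x)) integrable_on {a..b}" for a b :: real
      by (rule integrable_continuous_real[OF continuous_on_subset[OF _ subset_UNIV]])
    have "integral {-R..0} (\<lambda>x. gg N (of_real x)) = integral {-R..-0} (\<lambda>x. (\<lambda>y. gg N (of_real y)) (- x))"
      by (simp add: gg_uminus)
    also have "\<dots> = integral {0..R} (\<lambda>x. gg N (of_real x))"
      using Henstock_Kurzweil_Integration.integral_reflect_real[of R 0 "\<lambda>y. gg N (of_real y)"] by (simp only:)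
    finally show ?thesis
      using Henstock_Kurzweil_Integration.integral_combine[of "-R" 0 R "\<lambda>x. gg N (of_real x)"] i R by simp
  qed
  have "integral {-R..R} (\<lambda>x. gg N (of_real x))
      - 2 * (1 + \<i>) * integral {0..R} (\<lambda>x. of_real (exp (- (2 * lam N) * x\<^sup>2)) * F ((1 + \<i>) * of_real x))
     = 2 * (contour_integral (linepath 0 b) (gg N) - contour_integral (linepath 0 c) (gg N))"
    unfolding dbl I1 I2 by (simp add: algebra_simps)
  also have "norm \<dots> = 2 * norm (contour_integral (linepath b c) (gg N))"
    unfolding eq norm_mult by simp
  finally show ?thesis using b1 cb by simp
qed

lemma exp_decay:
  "((\<lambda>R. exp (- ((real L - sg) / 2 * R))) \<longlongrightarrow> 0) at_top"
  "((\<lambda>R. exp (- ((real L - sg) / 2 * R)) * R) \<longlongrightarrow> 0) at_top"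
proof -
  have d: "(real L - sg) / 2 > 0" using sg_less by simp
  have *: "((\<lambda>R. exp (- (d * R))) \<longlongrightarrow> 0) at_top" "((\<lambda>R. exp (- (d * R)) * R) \<longlongrightarrow> 0) at_top"
    if "d > 0" for d :: real
    using that by real_asymp+
  show "((\<lambda>R. exp (- ((real L - sg) / 2 * R))) \<longlongrightarrow> 0) at_top"
    "((\<lambda>R. exp (- ((real L - sg) / 2 * R)) * R) \<longlongrightarrow> 0) at_top"
    by (rule *[OF d])+
qed

definition Res :: "nat \<Rightarrow> complex" where
  "Res N = 2 * of_real pi * \<i> * (\<Sum>z\<in>poles N. residue (hh N) z)"

lemma ray_tendsto:
  assumes N: "N > 0"
  shows "((\<lambda>R. 2 * (1 + \<i>) * integral {0..R} (\<lambda>x. of_real (exp (- (2 * lam N) * x\<^sup>2)) * F ((1 + \<i>) * of_real x))) \<longlongrightarrow> Res N) at_top"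
proof (rule Lim_transform2)
  let ?E = "\<lambda>R. exp (- ((real L - sg) / 2 * R))"
  let ?A = "2 ^ M * 2 ^ L :: real"
  show "((\<lambda>R. integral {-R..R} (\<lambda>x. gg N (of_real x))) \<longlongrightarrow> Res N) at_top"
  proof (rule Lim_null[THEN iffD2], rule Lim_null_comparison)
    show "\<forall>\<^sub>F R in at_top. norm (integral {-R..R} (\<lambda>x. gg N (of_real x)) - Res N) \<le> 4 * (?A * ?E R) * (4 * pi * P)"
      using contour_identity[OF N] unfolding Res_def
      by (intro eventually_at_top_linorderI[of 2]) auto
    have "((\<lambda>R. (4 * ?A * (4 * pi * P)) * ?E R) \<longlongrightarrow> (4 * ?A * (4 * pi * P)) * 0) at_top"
      by (intro tendsto_intros exp_decay)
    then show "((\<lambda>R. 4 * (?A * ?E R) * (4 * pi * P)) \<longlongrightarrow> 0) at_top" by (simp add: mult_ac)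
  qed
  show "((\<lambda>R. integral {-R..R} (\<lambda>x. gg N (of_real x)) - 2 * (1 + \<i>) * integral {0..R} (\<lambda>x. of_real (exp (- (2 * lam N) * x\<^sup>2)) * F ((1 + \<i>) * of_real x))) \<longlongrightarrow> 0) at_top"
  proof (rule Lim_null_comparison)
    show "\<forall>\<^sub>F R in at_top. norm (integral {-R..R} (\<lambda>x. gg N (of_real x)) - 2 * (1 + \<i>) * integral {0..R} (\<lambda>x. of_real (exp (- (2 * lam N) * x\<^sup>2)) * F ((1 + \<i>) * of_real x)))
       \<le> 2 * (?A * ?E R * R)"
      using integral_rotate[OF N] by (intro eventually_at_top_linorderI[of 2]) auto
    have "((\<lambda>R. (2 * ?A) * (?E R * R)) \<longlongrightarrow> (2 * ?A) * 0) at_top"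
      by (intro tendsto_intros exp_decay)
    then show "((\<lambda>R. 2 * (?A * ?E R * R)) \<longlongrightarrow> 0) at_top" by (simp add: mult_ac)
  qed
qed

text \<open>Watson's lemma with a constant independent of N: C comes from \<open>taylor_ray\<close>,
  and N enters through the moments only. The estimate is proved on [0, R] and passes to the limit in
  R for fixed N; the factors (2 i)^k come from ((1 + i) x)^2 = 2 i x^2.\<close>

lemma Res_asymp:
  "\<exists>C\<ge>0. \<forall>N>0. norm (Res N - (\<Sum>k\<le>K. 2 * (1 + \<i>) * cc (2 * k) * (2 * \<i>) ^ k * of_real (gauss_mom k (2 * lam N))))
    \<le> C * gauss_mom (Suc K) (2 * lam N)"
proof -
  obtain C where C: "C \<ge> 0" "\<And>x. x \<ge> 0 \<Longrightarrow> norm (F ((1 + \<i>) * of_real x) - (\<Sum>k\<le>K. cc (2 * k) * ((1 + \<i>) * of_real x) ^ (2 * k))) \<le> C * x ^ (2 * (K + 1))"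
    using taylor_ray[of K] by blast
  have main: "norm (Res N - (\<Sum>k\<le>K. 2 * (1 + \<i>) * cc (2 * k) * (2 * \<i>) ^ k * of_real (gauss_mom k (2 * lam N))))
    \<le> norm (2 * (1 + \<i>)) * C * gauss_mom (Suc K) (2 * lam N)" if N: "N > 0" for N
  proof -
    let ?\<mu> = "2 * lam N"
    have \<mu>: "?\<mu> > 0" using lam_pos[OF N] by simp
    let ?f = "\<lambda>x. complex_of_real (exp (- ?\<mu> * x\<^sup>2)) * F ((1 + \<i>) * of_real x)"
    let ?h = "\<lambda>k x. exp (- ?\<mu> * x\<^sup>2) * x ^ (2 * k)"
    let ?a = "\<lambda>k. 2 * (1 + \<i>) * cc (2 * k) * (2 * \<i>) ^ k"
    have lim: "((\<lambda>R. 2 * (1 + \<i>) * integral {0..R} ?f - (\<Sum>k\<le>K. ?a k * of_real (integral {0..R} (?h k)))) \<longlongrightarrow>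
       Res N - (\<Sum>k\<le>K. ?a k * of_real (gauss_mom k ?\<mu>))) at_top"
      by (intro tendsto_diff ray_tendsto[OF N] tendsto_sum tendsto_mult tendsto_const tendsto_of_real gauss_mom_tendsto(1)[OF \<mu>])
    show ?thesis
    proof (rule Lim_norm_ubound[OF _ lim])
      have "norm (2 * (1 + \<i>) * integral {0..R} ?f - (\<Sum>k\<le>K. ?a k * of_real (integral {0..R} (?h k)))) \<le> norm (2 * (1 + \<i>)) * C * gauss_mom (Suc K) ?\<mu>"
        if R: "R \<ge> 0" for R
      proof -
        have "continuous_on {0..R} (F \<circ> (\<lambda>x. (1 + \<i>) * of_real x))"
          by (intro continuous_on_compose continuous_intros continuous_on_subset[OF holomorphic_on_imp_continuous_on[OF F_holomorphic]])
             (auto simp: lattice_pts_1 complex_eq_iff)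
        then have cf: "continuous_on {0..R} (\<lambda>x. F ((1 + \<i>) * of_real x))" by (simp add: o_def)
        have if': "?f integrable_on {0..R}"
          by (intro integrable_continuous_real continuous_intros cf)
        have ih: "(\<lambda>x. cc (2 * k) * (2 * \<i>) ^ k * of_real (?h k x)) integrable_on {0..R}" for k
          by (intro integrable_continuous_real continuous_intros)
        have e1: "integral {0..R} ?f - (\<Sum>k\<le>K. cc (2 * k) * (2 * \<i>) ^ k * of_real (integral {0..R} (?h k)))
           = integral {0..R} (\<lambda>x. ?f x - (\<Sum>k\<le>K. cc (2 * k) * (2 * \<i>) ^ k * of_real (?h k x)))"
        proof -
          have "integral {0..R} (\<lambda>x. \<Sum>k\<le>K. cc (2 * k) * (2 * \<i>) ^ k * of_real (?h k x))
             = (\<Sum>k\<le>K. integral {0..R} (\<lambda>x. cc (2 * k) * (2 * \<i>) ^ k * of_real (?h k x)))"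
            by (rule integral_sum[OF finite_atMost ih])
          also have "\<dots> = (\<Sum>k\<le>K. cc (2 * k) * (2 * \<i>) ^ k * of_real (integral {0..R} (?h k)))"
          proof (intro sum.cong refl)
            fix k
            have "(?h k) integrable_on {0..R}" by (intro integrable_continuous_real continuous_intros)
            then have "integral {0..R} (\<lambda>x. complex_of_real (?h k x)) = of_real (integral {0..R} (?h k))"
              by (intro integral_unique has_integral_of_real integrable_integral)
            then show "integral {0..R} (\<lambda>x. cc (2 * k) * (2 * \<i>) ^ k * of_real (?h k x)) = cc (2 * k) * (2 * \<i>) ^ k * of_real (integral {0..R} (?h k))"
              by (simp only: integral_mult_right)
          qed
          finally show ?thesis
            by (simp only: integral_diff[OF if' integrable_sum[OF finite_atMost ih]])
        qed
        have e2: "norm (integral {0..R} (\<lambda>x. ?f x - (\<Sum>k\<le>K. cc (2 * k) * (2 * \<i>) ^ k * of_real (?h k x))))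
          \<le> integral {0..R} (\<lambda>x. C * ?h (Suc K) x)"
        proof (rule integral_norm_bound_integral)
          show "(\<lambda>x. ?f x - (\<Sum>k\<le>K. cc (2 * k) * (2 * \<i>) ^ k * of_real (?h k x))) integrable_on {0..R}"
            by (rule integrable_diff[OF if' integrable_sum[OF finite_atMost ih]])
          show "(\<lambda>x. C * ?h (Suc K) x) integrable_on {0..R}"
            by (intro integrable_continuous_real continuous_intros)
          fix x assume x: "x \<in> {0..R}"
          have "((1 + \<i>) * complex_of_real x) ^ (2 * k) = (2 * \<i>) ^ k * of_real (x ^ (2 * k))" for k
          proof -
            have sq: "((1 + \<i>) * complex_of_real x) ^ 2 = 2 * \<i> * of_real (x ^ 2)"
              by (simp add: power2_eq_square algebra_simps)
            have "((1 + \<i>) * complex_of_real x) ^ (2 * k) = (2 * \<i> * of_real (x ^ 2)) ^ k"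
              unfolding power_mult sq ..
            also have "\<dots> = (2 * \<i>) ^ k * of_real (x ^ (2 * k))"
              by (simp add: power_mult_distrib power_mult)
            finally show ?thesis .
          qed
          then have "?f x - (\<Sum>k\<le>K. cc (2 * k) * (2 * \<i>) ^ k * of_real (?h k x))
             = of_real (exp (- ?\<mu> * x\<^sup>2)) * (F ((1 + \<i>) * of_real x) - (\<Sum>k\<le>K. cc (2 * k) * ((1 + \<i>) * of_real x) ^ (2 * k)))"
            by (simp add: sum_distrib_left right_diff_distrib mult_ac)
          also have "norm \<dots> = exp (- ?\<mu> * x\<^sup>2) * norm (F ((1 + \<i>) * of_real x) - (\<Sum>k\<le>K. cc (2 * k) * ((1 + \<i>) * of_real x) ^ (2 * k)))"
            unfolding norm_mult by simp
          also have "\<dots> \<le> exp (- ?\<mu> * x\<^sup>2) * (C * x ^ (2 * (K + 1)))"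
            using C(2)[of x] x by (intro mult_left_mono) auto
          finally show "norm (?f x - (\<Sum>k\<le>K. cc (2 * k) * (2 * \<i>) ^ k * of_real (?h k x))) \<le> C * ?h (Suc K) x"
            by (simp add: mult_ac)
        qed
        have e3: "integral {0..R} (\<lambda>x. C * ?h (Suc K) x) = C * integral {0..R} (?h (Suc K))"
          by (rule integral_mult_right)
        have e4: "C * integral {0..R} (?h (Suc K)) \<le> C * gauss_mom (Suc K) ?\<mu>"
          by (rule mult_left_mono[OF gauss_mom_tendsto(2)[OF \<mu> R] C(1)])
        have bd: "norm (integral {0..R} ?f - (\<Sum>k\<le>K. cc (2 * k) * (2 * \<i>) ^ k * of_real (integral {0..R} (?h k))))
          \<le> C * gauss_mom (Suc K) ?\<mu>"
          unfolding e1 by (rule order_trans[OF e2 order_trans[OF eq_refl[OF e3] e4]])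
        have eq: "2 * (1 + \<i>) * integral {0..R} ?f - (\<Sum>k\<le>K. ?a k * of_real (integral {0..R} (?h k)))
          = (2 * (1 + \<i>)) * (integral {0..R} ?f - (\<Sum>k\<le>K. cc (2 * k) * (2 * \<i>) ^ k * of_real (integral {0..R} (?h k))))"
          by (simp only: right_diff_distrib sum_distrib_left mult.assoc)
        have "norm (2 * (1 + \<i>) * integral {0..R} ?f - (\<Sum>k\<le>K. ?a k * of_real (integral {0..R} (?h k))))
          = norm (2 * (1 + \<i>)) * norm (integral {0..R} ?f - (\<Sum>k\<le>K. cc (2 * k) * (2 * \<i>) ^ k * of_real (integral {0..R} (?h k))))"
          unfolding eq by (rule norm_mult)
        also have "\<dots> \<le> norm (2 * (1 + \<i>)) * (C * gauss_mom (Suc K) ?\<mu>)"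
          by (rule mult_left_mono[OF bd norm_ge_zero])
        finally show ?thesis by (simp only: mult.assoc)
      qed
      then show "\<forall>\<^sub>F R in at_top. norm (2 * (1 + \<i>) * integral {0..R} ?f - (\<Sum>k\<le>K. ?a k * of_real (integral {0..R} (?h k)))) \<le> norm (2 * (1 + \<i>)) * C * gauss_mom (Suc K) ?\<mu>"
        by (intro eventually_at_top_linorderI[of 0])
    qed simp
  qed
  show ?thesis using main C(1) by (intro exI[of _ "norm (2 * (1 + \<i>)) * C"]) (auto simp del: norm_mult)
qed

end

subsection \<open>Sign vectors and periodic functions\<close>

lemma res_cong_0_iff:
  fixes a :: int
  assumes "coprime b c"
  shows "c dvd a * b \<longleftrightarrow> c dvd a"
  using assms by (simp add: coprime_commute coprime_dvd_mult_left_iff)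

text \<open>Two applications amount to reduction modulo 2P, so beyond the first application only the
  parity of k matters.\<close>

lemma sigma_funpow:
  assumes "P > 0" "k \<ge> 1"
  shows "(sigma P ^^ k) x = (if odd k then (int P - x) mod (2 * int P) else x mod (2 * int P))"
  using assms(2)
proof (induction k rule: dec_induct)
  case base
  show ?case by (simp add: sigma_def)
next
  case (step k)
  have "(int P - (int P - x) mod (2 * int P)) mod (2 * int P) = x mod (2 * int P)"
    by (simp add: mod_diff_right_eq)
  moreover have "(int P - x mod (2 * int P)) mod (2 * int P) = (int P - x) mod (2 * int P)"
    by (simp add: mod_diff_right_eq)
  ultimately show ?case using step by (simp add: sigma_def)
qed

context seifert
begin

text \<open>P/p_j is invertible modulo p_j. Combined with \<open>sum_P_div_split\<close>, this
  isolates the j-th entry of an integer combination of the P/p_i by reduction modulo p_j.\<close>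

lemma p_not_dvd_unit_mult:
  assumes j: "j \<in> {1..M}" and x: "\<not> int (p j) dvd x"
    and y: "y = x * int (P div p j) + int (p j) * z"
  shows "\<not> int (p j) dvd y"
proof
  assume "int (p j) dvd y"
  then have "int (p j) dvd x * int (P div p j)"
    unfolding y by (simp add: dvd_add_left_iff)
  moreover have "coprime (int (P div p j)) (int (p j))"
    using coprime_p_P_div[OF j] by (simp add: coprime_commute)
  ultimately show False using x by (simp add: res_cong_0_iff)
qed

lemma sum_P_div_split:
  assumes j: "j \<in> {1..M}"
  obtains z where "(\<Sum>i=1..M. e i * int (P div p i)) = e j * int (P div p j) + int (p j) * z"
proof -
  have "int (p j) dvd (\<Sum>i\<in>{1..M} - {j}. e i * int (P div p i))"
    using p_dvd_P_div j by (intro dvd_sum dvd_mult) auto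
  then obtain z where "(\<Sum>i\<in>{1..M} - {j}. e i * int (P div p i)) = int (p j) * z" by blast
  then show ?thesis using that[of z] j by (simp add: sum.remove[of _ j])
qed

lemma int_P_eq: "j \<in> {1..M} \<Longrightarrow> int P = int (p j) * int (P div p j)"
  using P_div_mult[of j] by (metis of_nat_mult)

lemma res_not_dvd:
  assumes j: "j \<in> {1..M}" and l: "l \<in> tuples M p" and e: "e \<in> signs M"
  shows "\<not> int (p j) dvd res M p e l"
proof -
  obtain z where z: "(\<Sum>i=1..M. e i * l i * int (P div p i)) = e j * l j * int (P div p j) + int (p j) * z"
    using sum_P_div_split[OF j, of "\<lambda>i. e i * l i"] by blast
  have lj: "0 < l j" "l j < int (p j)" using l j by (auto simp: tuples_def PiE_def Pi_def)
  have "\<not> int (p j) dvd e j * l j"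
    using signs_cases[OF e j] lj zdvd_not_zless[of "l j" "int (p j)"] by auto
  moreover have "res M p e l = e j * l j * int (P div p j) + int (p j) * (int (P div p j) + z)"
    unfolding res_def z by (subst int_P_eq[OF j]) (simp add: algebra_simps)
  ultimately show ?thesis by (rule p_not_dvd_unit_mult[OF j])
qed

lemma nn_not_dvd:
  assumes j: "j \<in> {1..M}" and \<eta>: "\<eta> \<in> signs M"
  shows "\<not> int (p j) dvd nn \<eta>"
proof -
  obtain z where z: "(\<Sum>i=1..M. \<eta> i * int (P div p i)) = \<eta> j * int (P div p j) + int (p j) * z"
    using sum_P_div_split[OF j] by blast
  have "\<not> int (p j) dvd \<eta> j"
    using signs_cases[OF \<eta> j] p_ge_2[OF j] by auto
  moreover have "nn \<eta> = \<eta> j * int (P div p j) + int (p j) * (int (P div p j) * int L + z)"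
    unfolding nn_def z by (subst int_P_eq[OF j]) (simp add: algebra_simps)
  ultimately show ?thesis by (rule p_not_dvd_unit_mult[OF j])
qed

lemma one_in: "1 \<in> {1..M}"
  using M_ge_3 by auto

lemma not_P_dvd_imp:
  assumes "\<not> int (p 1) dvd x"
  shows "\<not> int P dvd x" "x mod (2 * int P) \<noteq> 0" "x mod (2 * int P) \<noteq> int P"
proof -
  show 1: "\<not> int P dvd x" using assms p_dvd_P[OF one_in] by (meson dvd_trans int_dvd_int_iff)
  show "x mod (2 * int P) \<noteq> 0" "x mod (2 * int P) \<noteq> int P"
    using 1 by (auto dest: dvd_mult_right simp: dvd_eq_mod_eq_0) 
       (metis mod_mod_cancel dvd_triv_right mod_self)+
qed

text \<open>Where the signs differ, reduction modulo p_j shows that p_j divides 2 l_j, hence 2 l_j =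
  p_j and p_j is even. Coprimality permits this for one j only, and then the congruence modulo 2P,
  not merely modulo P, would make p_j divide l_j, which 0 < l_j < p_j excludes. This makes the
  choice inside \<open>chi\<close> unique.\<close>

lemma res_inj:
  assumes l: "l \<in> tuples M p" and e: "e \<in> signs M" "e' \<in> signs M"
    and c: "[res M p e l = res M p e' l] (mod 2 * int P)"
  shows "e = e'"
proof -
  define D where "D = {j \<in> {1..M}. e j \<noteq> e' j}"
  have diff: "res M p e l - res M p e' l = (\<Sum>i=1..M. (e i - e' i) * l i * int (P div p i))"
    by (simp add: res_def sum_subtractf left_diff_distrib)
  have c': "2 * int P dvd (\<Sum>i=1..M. (e i - e' i) * l i * int (P div p i))"
    using c unfolding cong_iff_dvd_diff diff .
  have lj: "0 < l j" "l j < int (p j)" if "j \<in> {1..M}" for j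
    using l that by (auto simp: tuples_def PiE_def Pi_def)
  have ev: "even (p j)" if j: "j \<in> D" for j
  proof -
    have jM: "j \<in> {1..M}" using j by (simp add: D_def)
    obtain z where z: "(\<Sum>i=1..M. (e i - e' i) * l i * int (P div p i)) = (e j - e' j) * l j * int (P div p j) + int (p j) * z"
      using sum_P_div_split[OF jM, of "\<lambda>i. (e i - e' i) * l i"] by blast
    have "int (p j) dvd (\<Sum>i=1..M. (e i - e' i) * l i * int (P div p i))"
      using c' p_dvd_P[OF jM] by (meson dvd_trans dvd_triv_right int_dvd_int_iff)
    then have "int (p j) dvd (e j - e' j) * l j"
      using p_not_dvd_unit_mult[OF jM _ z] by blast
    moreover have "e j - e' j = 2 \<or> e j - e' j = -2"
      using signs_cases[OF e(1) jM] signs_cases[OF e(2) jM] j by (auto simp: D_def)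
    ultimately have "int (p j) dvd 2 * l j" by (auto simp: dvd_minus_iff)
    then obtain k where k: "2 * l j = int (p j) * k" by blast
    have "0 < int (p j) * k" "int (p j) * k < int (p j) * 2" using lj[OF jM] k by linarith+
    then have "0 < k" "k < 2" using p_pos[OF jM] by (simp_all add: zero_less_mult_iff)
    then have "k = 1" by simp
    then show ?thesis using k by (metis even_of_nat dvd_triv_left mult.right_neutral)
  qed
  have "D = {}"
  proof (rule ccontr)
    assume "D \<noteq> {}"
    then obtain j where j: "j \<in> D" by blast
    then have jM: "j \<in> {1..M}" by (simp add: D_def)
    have only: "i = j" if "i \<in> D" for i
    proof (rule ccontr)
      assume "i \<noteq> j"
      then have "coprime (p i) (p j)"
        using p_coprime that j by (auto simp: pairwise_def D_def)
      moreover have "2 dvd p i" "2 dvd p j" using ev that j by auto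
      ultimately show False using coprime_common_divisor[of "p i" "p j" 2] by auto
    qed
    have "(\<Sum>i=1..M. (e i - e' i) * l i * int (P div p i)) = (\<Sum>i\<in>{j}. (e i - e' i) * l i * int (P div p i))"
      using only jM by (intro sum.mono_neutral_right) (auto simp: D_def)
    then have d: "2 * int P dvd (e j - e' j) * l j * int (P div p j)" using c' by simp
    moreover have "e j - e' j = 2 \<or> e j - e' j = -2"
      using signs_cases[OF e(1) jM] signs_cases[OF e(2) jM] j by (auto simp: D_def)
    ultimately have "2 * int P dvd 2 * (l j * int (P div p j))" by (auto simp: mult_ac dvd_minus_iff)
    then have "int (p j) * int (P div p j) dvd l j * int (P div p j)"
      unfolding int_P_eq[OF jM, symmetric] by simp
    moreover have "P div p j \<noteq> 0" using P_div_mult[OF jM] P_pos by (metis mult_0_right less_irrefl)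
    ultimately have "int (p j) dvd l j" by simp
    then show False using lj[OF jM] zdvd_not_zless by blast
  qed
  then have "e i = e' i" if "i \<in> {1..M}" for i using that by (auto simp: D_def)
  then show ?thesis by (rule PiE_ext[OF e[unfolded signs_def]])
qed

lemma chi_res:
  assumes l: "l \<in> tuples M p" and e: "e \<in> signs M" and n: "[n = res M p e l] (mod 2 * int P)"
  shows "chi M p l n = - esgn e"
proof -
  let ?Q = "\<lambda>e. e \<in> signs M \<and> [n = res M p e l] (mod 2 * int P)"
  have u: "e' = e" if "?Q e'" for e'
  proof -
    have "[res M p e' l = res M p e l] (mod 2 * int P)"
      using that n cong_sym cong_trans by blast
    then show ?thesis using that by (intro res_inj[OF l _ e]) auto
  qed
  have Qe: "?Q e" using e n by simp
  have some: "(SOME e. ?Q e) = e" by (rule some_equality[of ?Q, OF Qe u])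
  have ex: "\<exists>e. ?Q e" by (rule exI[of ?Q, OF Qe])
  show ?thesis unfolding chi_def Let_def some using ex by (simp only: if_True esgn_def)
qed

lemma chi_eq_0:
  assumes "\<And>e. e \<in> signs M \<Longrightarrow> \<not> [n = res M p e l] (mod 2 * int P)"
  shows "chi M p l n = 0"
  using assms unfolding chi_def Let_def by auto

lemma chi_multiple:
  assumes l: "l \<in> tuples M p" and j: "j \<in> {1..M}" and n: "int (p j) dvd n"
  shows "chi M p l n = 0"
proof (rule chi_eq_0)
  fix e assume e: "e \<in> signs M"
  show "\<not> [n = res M p e l] (mod 2 * int P)"
  proof
    assume "[n = res M p e l] (mod 2 * int P)"
    moreover have "int (p j) dvd 2 * int P" using p_dvd_P[OF j] by (simp add: dvd_mult)
    ultimately have "[n = res M p e l] (mod int (p j))" by (rule cong_dvd_modulus)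
    then show False using res_not_dvd[OF j l e] n cong_dvd_iff by blast
  qed
qed

text \<open>By \<open>res_inj\<close> the support of \<open>chi\<close> modulo 2P consists of
  distinct residues indexed by the sign vectors.\<close>

lemma sum_chi:
  fixes G :: "int \<Rightarrow> 'a :: comm_ring_1"
  assumes l: "l \<in> tuples M p"
  shows "(\<Sum>n\<in>{0..<2 * int P}. of_int (chi M p l n) * G n)
    = - (\<Sum>e\<in>signs M. of_int (esgn e) * G (res M p e l mod (2 * int P)))"
proof -
  let ?r = "\<lambda>e. res M p e l mod (2 * int P)"
  have inj: "inj_on ?r (signs M)"
    using res_inj[OF l] by (auto simp: inj_on_def cong_def)
  have "(\<Sum>n\<in>{0..<2 * int P}. of_int (chi M p l n) * G n) = (\<Sum>n\<in>?r ` signs M. of_int (chi M p l n) * G n)"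
  proof (rule sum.mono_neutral_right)
    show "?r ` signs M \<subseteq> {0..<2 * int P}" using P_pos by auto
    show "\<forall>n\<in>{0..<2 * int P} - ?r ` signs M. of_int (chi M p l n) * G n = 0"
    proof
      fix n assume n: "n \<in> {0..<2 * int P} - ?r ` signs M"
      have "chi M p l n = 0"
      proof (rule chi_eq_0)
        fix e assume "e \<in> signs M"
        then show "\<not> [n = res M p e l] (mod 2 * int P)"
          using n by (auto simp: cong_def image_iff)
      qed
      then show "of_int (chi M p l n) * G n = 0" by simp
    qed
  qed simp
  also have "\<dots> = (\<Sum>e\<in>signs M. of_int (chi M p l (?r e)) * G (?r e))"
    by (simp add: sum.reindex[OF inj])
  also have "\<dots> = (\<Sum>e\<in>signs M. - (of_int (esgn e) * G (?r e)))"
  proof (intro sum.cong refl)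
    fix e assume e: "e \<in> signs M"
    have "chi M p l (?r e) = - esgn e" by (rule chi_res[OF l e]) (simp add: cong_def)
    then show "of_int (chi M p l (?r e)) * G (?r e) = - (of_int (esgn e) * G (?r e))" by simp
  qed
  finally show ?thesis by (simp add: sum_negf)
qed

text \<open>The ranges differ by 0 and 2P, both multiples of p_1, where \<open>chi\<close>
  vanishes.\<close>

lemma sum_chi_nat:
  fixes G :: "int \<Rightarrow> 'a :: comm_ring_1"
  assumes l: "l \<in> tuples M p"
  shows "(\<Sum>n=1..2 * P. of_int (chi M p l (int n)) * G (int n)) = (\<Sum>n\<in>{0..<2 * int P}. of_int (chi M p l n) * G n)"
proof -
  have z: "chi M p l 0 = 0" "chi M p l (2 * int P) = 0"
    using chi_multiple[OF l one_in, of 0] chi_multiple[OF l one_in, of "2 * int P"] p_dvd_P[OF one_in]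
    by (auto simp: dvd_mult)
  have "(\<Sum>n=1..2 * P. of_int (chi M p l (int n)) * G (int n)) = (\<Sum>n\<in>int ` {1..2 * P}. of_int (chi M p l n) * G n)"
    by (subst sum.reindex) (auto simp: o_def)
  also have "int ` {1..2 * P} = {1..2 * int P}"
    by (simp add: image_int_atLeastAtMost)
  also have "(\<Sum>n\<in>{1..2 * int P}. of_int (chi M p l n) * G n) = (\<Sum>n\<in>{1..<2 * int P}. of_int (chi M p l n) * G n)"
    using z P_pos by (intro sum.mono_neutral_right) auto
  also have "\<dots> = (\<Sum>n\<in>{0..<2 * int P}. of_int (chi M p l n) * G n)"
  proof (rule sum.mono_neutral_left)
    show "\<forall>n\<in>{0..<2 * int P} - {1..<2 * int P}. of_int (chi M p l n) * G n = 0"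
    proof
      fix n assume "n \<in> {0..<2 * int P} - {1..<2 * int P}"
      then have "n = 0" by auto
      then show "of_int (chi M p l n) * G n = 0" by (simp add: z)
    qed
  qed auto
  finally show ?thesis .
qed

section \<open>The tuple \<open>l0\<close> and the frequencies \<open>nn\<close>\<close>

definition l0 :: "nat \<Rightarrow> int" where "l0 = (flip p 1 ^^ (M - 1)) (allones M)"

lemma flip_flip: "flip p j (flip p j l) = l"
  by (simp add: flip_def)

lemma flip_funpow: "(flip p 1 ^^ k) l = (if even k then l else flip p 1 l)"
  by (induction k) (auto simp: flip_flip)

lemma allones_tuples: "allones M \<in> tuples M p"
  using p_ge_2 by (force simp: allones_def tuples_def)

lemma flip_tuples: "j \<in> {1..M} \<Longrightarrow> l \<in> tuples M p \<Longrightarrow> flip p j l \<in> tuples M p"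
  by (auto simp: flip_def tuples_def PiE_def Pi_def extensional_def)

lemma l0_eq: "l0 = (if even M then flip p 1 (allones M) else allones M)"
  unfolding l0_def flip_funpow using M_ge_3 by auto

lemma l0_tuples: "l0 \<in> tuples M p"
  using allones_tuples flip_tuples[OF one_in] by (simp add: l0_eq)

lemma esgn_flip: "j \<in> {1..M} \<Longrightarrow> esgn (\<eta>(j := - \<eta> j)) = - esgn \<eta>"
  unfolding esgn_def by (simp add: prod.remove[of _ j])

lemma mod_L: "[int P * int L = (if even M then 0 else int P)] (mod 2 * int P)"
proof -
  obtain k where "L = 2 * k + (if even M then 0 else 1)"
    using even_M by (metis add.right_neutral evenE oddE)
  then have "int P * int L - (if even M then 0 else int P) = 2 * int P * int k"
    by (simp add: algebra_simps)
  then show ?thesis by (simp add: cong_iff_dvd_diff)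
qed

text \<open>For odd M also L is odd, and \<open>nn\<close> is the residue of the tuple of ones. For
  even M the term P L disappears modulo 2P, so the leading P in \<open>res\<close> has to be
  compensated; changing the first entry to p_1 - 1 achieves this at the price of negating the first
  sign.\<close>

lemma res_l0:
  assumes "\<eta> \<in> signs M"
  shows "[nn \<eta> = res M p (if even M then \<eta>(1 := - \<eta> 1) else \<eta>) l0] (mod 2 * int P)"
proof (cases "even M")
  case False
  have "res M p \<eta> l0 = (\<Sum>j=1..M. \<eta> j * int (P div p j)) + int P"
    using False by (simp add: res_def l0_eq allones_def)
  then show ?thesis using mod_L False by (simp add: nn_def cong_add_lcancel)
next
  case True
  have "res M p (\<eta>(1 := - \<eta> 1)) l0 = int P + (- \<eta> 1 * (int (p 1) - 1) * int (P div p 1) + (\<Sum>j\<in>{1..M}-{1}. \<eta> j * int (P div p j)))"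
    using True one_in by (simp add: res_def l0_eq allones_def flip_def sum.remove[of _ 1])
  also have "\<dots> = (\<Sum>j=1..M. \<eta> j * int (P div p j)) + (1 - \<eta> 1) * int P"
    using one_in int_P_eq[OF one_in] by (simp add: sum.remove[of _ 1] algebra_simps)
  finally have r: "res M p (\<eta>(1 := - \<eta> 1)) l0 = (\<Sum>j=1..M. \<eta> j * int (P div p j)) + (1 - \<eta> 1) * int P" .
  have "[(1 - \<eta> 1) * int P = 0] (mod 2 * int P)"
    using signs_cases[OF assms one_in] by (auto simp: cong_0_iff)
  moreover have "[int P * int L = 0] (mod 2 * int P)" using mod_L True by simp
  ultimately have "[int P * int L = (1 - \<eta> 1) * int P] (mod 2 * int P)"
    by (meson cong_sym cong_trans)
  then show ?thesis by (simp only: True if_True r nn_def cong_add_lcancel)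
qed

text \<open>The factor (-1)^M combines the minus sign in \<open>chi\<close> with the negation of the
  first sign, which occurs for even M only.\<close>

lemma sum_chi_l0:
  fixes G :: "int \<Rightarrow> 'a :: comm_ring_1"
  shows "(\<Sum>n\<in>{0..<2 * int P}. of_int (chi M p l0 n) * G n)
    = (-1) ^ M * (\<Sum>\<eta>\<in>signs M. of_int (esgn \<eta>) * G (nn \<eta> mod (2 * int P)))"
proof (cases "even M")
  case False
  have "res M p \<eta> l0 mod (2 * int P) = nn \<eta> mod (2 * int P)" if "\<eta> \<in> signs M" for \<eta>
    using res_l0[OF that] False by (simp add: cong_def)
  then have "(\<Sum>\<eta>\<in>signs M. of_int (esgn \<eta>) * G (res M p \<eta> l0 mod (2 * int P))) = (\<Sum>\<eta>\<in>signs M. of_int (esgn \<eta>) * G (nn \<eta> mod (2 * int P)))"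
    by (intro sum.cong refl) simp
  then show ?thesis using False by (simp add: sum_chi[OF l0_tuples])
next
  case True
  have eq: "res M p (\<eta>(1 := - \<eta> 1)) l0 mod (2 * int P) = nn \<eta> mod (2 * int P)" if "\<eta> \<in> signs M" for \<eta>
    using res_l0[OF that] True by (simp add: cong_def)
  have "(\<Sum>e\<in>signs M. of_int (esgn e) * G (res M p e l0 mod (2 * int P)))
     = (\<Sum>\<eta>\<in>signs M. of_int (esgn (\<eta>(1 := - \<eta> 1))) * G (res M p (\<eta>(1 := - \<eta> 1)) l0 mod (2 * int P)))"
    by (rule sum.reindex_bij_witness[of _ "\<lambda>\<eta>. \<eta>(1 := - \<eta> 1)" "\<lambda>\<eta>. \<eta>(1 := - \<eta> 1)"])
       (use signs_flip[OF one_in] in auto)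
  also have "\<dots> = (\<Sum>\<eta>\<in>signs M. - (of_int (esgn \<eta>) * G (nn \<eta> mod (2 * int P))))"
    by (intro sum.cong refl) (simp only: eq esgn_flip[OF one_in] of_int_minus mult_minus_left)
  finally show ?thesis using True by (simp add: sum_chi[OF l0_tuples] sum_negf)
qed

definition neg :: "(nat \<Rightarrow> int) \<Rightarrow> nat \<Rightarrow> int" where "neg \<eta> = (\<lambda>j\<in>{1..M}. - \<eta> j)"

lemma neg_signs: "\<eta> \<in> signs M \<Longrightarrow> neg \<eta> \<in> signs M"
  by (auto simp: neg_def signs_def PiE_def Pi_def)

lemma neg_neg: "\<eta> \<in> signs M \<Longrightarrow> neg (neg \<eta>) = \<eta>"
  by (auto simp: neg_def signs_def PiE_def extensional_def fun_eq_iff)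

lemma s_neg: "s (neg \<eta>) = - s \<eta>"
  by (simp add: eta_quot_def neg_def sum_negf)

lemma esgn_neg: "esgn (neg \<eta>) = (-1) ^ M * esgn \<eta>"
proof -
  have "esgn (neg \<eta>) = (\<Prod>j=1..M. (-1) * \<eta> j)" by (simp add: esgn_def neg_def)
  then show ?thesis unfolding prod.distrib by (simp add: esgn_def)
qed

lemma nn_neg: "[nn (neg \<eta>) = - nn \<eta>] (mod 2 * int P)"
proof -
  have "nn (neg \<eta>) - - nn \<eta> = 2 * int P * int L"
    by (simp add: nn_def neg_def sum_negf)
  then show ?thesis by (simp add: cong_iff_dvd_diff)
qed

lemma sum_signs_neg: "(\<Sum>\<eta>\<in>signs M. f (neg \<eta>)) = (\<Sum>\<eta>\<in>signs M. f \<eta>)"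
  by (rule sum.reindex_bij_witness[of _ neg neg]) (auto simp: neg_neg neg_signs)

section \<open>Reduction of \<open>s \<eta>\<close> modulo 2 and the sums over a and b\<close>

definition aa :: "(nat \<Rightarrow> int) \<Rightarrow> int" where "aa \<eta> = \<lfloor>(s \<eta> + 1) / 2\<rfloor>"
definition zz :: "(nat \<Rightarrow> int) \<Rightarrow> real" where "zz \<eta> = s \<eta> - 2 * of_int (aa \<eta>)"

text \<open>An integral value of \<open>s \<eta>\<close> would make \<open>nn \<eta>\<close> a
  multiple of P. So no sign vector falls on a boundary 2a - 1 or 2a + 1, and every one belongs to
  exactly one a.\<close>

lemma s_not_odd:
  assumes "\<eta> \<in> signs M"
  shows "s \<eta> \<noteq> of_int k"
proof
  assume "s \<eta> = of_int k"
  then have "real_of_int (nn \<eta>) = real_of_int (int P * (k + int L))" by (simp add: nn_eq)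
  then have "nn \<eta> = int P * (k + int L)" by (rule of_int_eq_iff[THEN iffD1])
  then show False using nn_not_dvd[OF one_in assms] p_dvd_P[OF one_in] by simp
qed

lemma zz_bounds:
  assumes "\<eta> \<in> signs M"
  shows "-1 < zz \<eta>" "zz \<eta> < 1" "zz \<eta> \<noteq> 0"
proof -
  have "of_int (aa \<eta>) \<le> (s \<eta> + 1) / 2" "(s \<eta> + 1) / 2 < of_int (aa \<eta>) + 1"
    unfolding aa_def by linarith+
  then have "-1 \<le> zz \<eta>" "zz \<eta> < 1" by (auto simp: zz_def)
  moreover have "zz \<eta> \<noteq> -1" using s_not_odd[OF assms, of "2 * aa \<eta> - 1"] by (auto simp: zz_def)
  ultimately show "-1 < zz \<eta>" "zz \<eta> < 1" by auto
  show "zz \<eta> \<noteq> 0" using s_not_odd[OF assms, of "2 * aa \<eta>"] by (auto simp: zz_def)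
qed

lemma aa_unique: "\<eta> \<in> signs M \<Longrightarrow> aa \<eta> = a \<longleftrightarrow> 2 * of_int a - 1 < s \<eta> \<and> s \<eta> < 2 * of_int a + 1"
  using zz_bounds[of \<eta>] unfolding zz_def
  by (smt (verit, best) of_int_less_iff of_int_1 of_int_add)

lemma aa_neg: "\<eta> \<in> signs M \<Longrightarrow> aa (neg \<eta>) = - aa \<eta>"
  using zz_bounds[of \<eta>] by (subst aa_unique) (auto simp: neg_signs s_neg zz_def)

lemma zz_neg: "\<eta> \<in> signs M \<Longrightarrow> zz (neg \<eta>) = - zz \<eta>"
  by (simp add: zz_def aa_neg s_neg)

text \<open>nn/P = s + L agrees modulo 2 with \<open>zz\<close> for even M and with
  \<open>zz + 1\<close> for odd M; the case distinction selects the representative in (0,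
  2).\<close>

lemma mod_nn_zz:
  assumes \<eta>: "\<eta> \<in> signs M"
  shows "real_of_int (nn \<eta> mod (2 * int P)) = real P * (if odd M then zz \<eta> + 1 else if zz \<eta> > 0 then zz \<eta> else zz \<eta> + 2)"
proof -
  define t where "t = (if odd M then zz \<eta> + 1 else if zz \<eta> > 0 then zz \<eta> else zz \<eta> + 2)"
  have t: "0 < t" "t < 2" using zz_bounds[OF \<eta>] by (auto simp: t_def)
  obtain k where k: "L = 2 * k + (if even M then 0 else 1)"
    using even_M by (metis add.right_neutral evenE oddE)
  obtain c :: int where c: "s \<eta> + real L = t + 2 * of_int c"
  proof -
    have "s \<eta> + real L = t + 2 * of_int (aa \<eta> + int k - (if odd M \<or> zz \<eta> > 0 then 0 else 1))"
      by (auto simp: t_def zz_def k)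
    then show ?thesis using that by blast
  qed
  have "real_of_int (nn \<eta>) = real P * (t + 2 * of_int c)"
    unfolding nn_eq c ..
  then have "real_of_int (nn \<eta> - 2 * int P * c) = real P * t"
    by (simp add: algebra_simps)
  moreover have "0 \<le> real P * t" "real P * t < real P * 2"
    using t P_pos by auto
  ultimately have "0 \<le> nn \<eta> - 2 * int P * c" "nn \<eta> - 2 * int P * c < 2 * int P"
    by linarith+
  then have "(nn \<eta> - 2 * int P * c) mod (2 * int P) = nn \<eta> - 2 * int P * c"
    by (rule mod_pos_pos_trivial)
  moreover have "(nn \<eta> - 2 * int P * c) mod (2 * int P) = nn \<eta> mod (2 * int P)"
    by (metis mod_mult_self2 diff_add_cancel mult.commute)
  ultimately show ?thesis
    using \<open>real_of_int (nn \<eta> - 2 * int P * c) = real P * t\<close> by (simp add: t_def)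
qed

lemma yy_mod:
  assumes \<eta>: "\<eta> \<in> signs M"
  shows "yy \<eta> = real_of_int (nn \<eta> mod (2 * int P)) / (2 * real P)"
proof -
  have "(s \<eta> + real L) / 2 = real_of_int (nn \<eta>) / real_of_int (2 * int P)"
    using P_pos by (simp add: nn_eq)
  then show ?thesis unfolding yy_def
    using P_pos by (simp only: frac_def floor_divide_of_int_eq) (simp add: field_simps mod_div_decomp flip: minus_mult_div_eq_mod)
qed

lemma fpoly_telescope:
  assumes "l \<in> {1..L}" "l < L"
  shows "fpoly l L (x + real a) = fpoly l L x + real (L - 1) * (\<Sum>b<a. fpoly l (L - 1) (x + real b + 1/2))"
proof (induction a)
  case (Suc a)
  have "fpoly l L (x + real (Suc a)) = fpoly l L ((x + real a) + 1)" by (simp add: add_ac)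
  also have "\<dots> = fpoly l L (x + real a) + real (L - 1) * fpoly l (L - 1) (x + real a + 1/2)"
    using fpoly_plus_one[OF assms(1), of "x + real a"] assms by simp
  finally show ?case using Suc by (simp add: algebra_simps)
qed simp

text \<open>Replacing \<open>s \<eta>\<close> by its representative \<open>zz \<eta>\<close> in \<open>(-1, 1)\<close> modulo \<open>2\<close> telescopes through the difference equation
  of \<open>fpoly\<close>; this is the origin of the sums over \<open>a\<close> and \<open>b\<close> in the expansion.\<close>

lemma sum_fpoly_fold:
  fixes W :: "int \<Rightarrow> 'a :: real_algebra_1"
  assumes l: "l \<in> {1..L}" "l < L"
    and per: "\<And>x y. [x = y] (mod 2 * int P) \<Longrightarrow> W x = W y"
    and par: "\<And>\<eta>. \<eta> \<in> signs M \<Longrightarrow> W (- nn \<eta>) = (-1) ^ l * W (nn \<eta>)"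
  shows "(\<Sum>\<eta>\<in>signs M. of_int (esgn \<eta>) * of_real (fpoly l L (- s \<eta> / 2)) * W (nn \<eta>))
    = (-1) ^ (L + l) * (\<Sum>\<eta>\<in>signs M. of_int (esgn \<eta>) * of_real (fpoly l L (zz \<eta> / 2)) * W (nn \<eta>))
      - 2 * of_nat (L - 1) * (\<Sum>\<eta>\<in>{\<eta>\<in>signs M. aa \<eta> \<ge> 1}. of_int (esgn \<eta>) *
          (\<Sum>b<nat (aa \<eta>). of_real (fpoly l (L - 1) (real b + 1/2 - 1/2 * s \<eta>)) * W (nn \<eta>)))"
proof -
  \<comment> \<open>The change of a summand when s is replaced by \<open>zz\<close>. It is invariant
    under negation of \<eta>, so the vectors with aa <= -1 repeat the total of those with aa >= 1;
    this is the origin of the factor 2.\<close>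
  define D where "D \<eta> = of_int (esgn \<eta>) * of_real (fpoly l L (- zz \<eta> / 2) - fpoly l L (- s \<eta> / 2)) * W (nn \<eta>)" for \<eta>
  have Wneg: "W (nn (neg \<eta>)) = (-1) ^ l * W (nn \<eta>)" if "\<eta> \<in> signs M" for \<eta>
    using per[OF nn_neg] par[OF that] by simp
  have par_f: "fpoly l L (- x) = (-1) ^ (L + l) * fpoly l L x" for x
    by (rule fpoly_uminus[OF l(1)])
  have sg: "(-1) ^ M * ((-1) ^ (L + l) * (-1) ^ l) = (1 :: 'a)"
    using even_M by (auto simp: minus_one_power_iff)
  have Dneg: "D (neg \<eta>) = D \<eta>" if \<eta>: "\<eta> \<in> signs M" for \<eta>
  proof -
    have 1: "fpoly l L (- zz (neg \<eta>) / 2) - fpoly l L (- s (neg \<eta>) / 2) = (-1) ^ (L + l) * (fpoly l L (- zz \<eta> / 2) - fpoly l L (- s \<eta> / 2))"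
      using par_f[of "- zz \<eta> / 2"] par_f[of "- s \<eta> / 2"] by (simp add: zz_neg[OF \<eta>] s_neg right_diff_distrib)
    have "D (neg \<eta>) = ((-1) ^ M * ((-1) ^ (L + l) * (-1) ^ l)) * D \<eta>"
      unfolding D_def 1 esgn_neg Wneg[OF \<eta>] by (cases "even l"; cases "even L"; cases "even M") (simp_all add: algebra_simps)
    then show ?thesis by (simp only: sg mult_1)
  qed
  have D0: "D \<eta> = 0" if "aa \<eta> = 0" for \<eta> using that by (simp add: D_def zz_def)
  have Dpos: "D \<eta> = of_nat (L - 1) * (of_int (esgn \<eta>) * (\<Sum>b<nat (aa \<eta>). of_real (fpoly l (L - 1) (real b + 1/2 - 1/2 * s \<eta>)) * W (nn \<eta>)))"
    if "aa \<eta> \<ge> 1" for \<eta>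
  proof -
    have "- zz \<eta> / 2 = - s \<eta> / 2 + real (nat (aa \<eta>))" using that by (simp add: zz_def field_simps)
    then have "fpoly l L (- zz \<eta> / 2) - fpoly l L (- s \<eta> / 2) = real (L - 1) * (\<Sum>b<nat (aa \<eta>). fpoly l (L - 1) (- s \<eta> / 2 + real b + 1/2))"
      using fpoly_telescope[OF l, of "- s \<eta> / 2" "nat (aa \<eta>)"] by simp
    also have "(\<Sum>b<nat (aa \<eta>). fpoly l (L - 1) (- s \<eta> / 2 + real b + 1/2)) = (\<Sum>b<nat (aa \<eta>). fpoly l (L - 1) (real b + 1/2 - 1/2 * s \<eta>))"
      by (intro sum.cong refl arg_cong[where f = "fpoly l (L - 1)"]) simp
    finally have "D \<eta> = of_int (esgn \<eta>) * (of_nat (L - 1) * of_real (\<Sum>b<nat (aa \<eta>). fpoly l (L - 1) (real b + 1/2 - 1/2 * s \<eta>))) * W (nn \<eta>)"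
      unfolding D_def by (simp del: of_nat_diff)
    also have "\<dots> = of_nat (L - 1) * (of_int (esgn \<eta>) * (of_real (\<Sum>b<nat (aa \<eta>). fpoly l (L - 1) (real b + 1/2 - 1/2 * s \<eta>)) * W (nn \<eta>)))"
      by (metis (no_types, lifting) mult.assoc mult_of_nat_commute)
    finally show ?thesis by (simp only: of_real_sum sum_distrib_right)
  qed
  have "(\<Sum>\<eta>\<in>signs M. D \<eta>) = (\<Sum>\<eta>\<in>{\<eta>\<in>signs M. aa \<eta> \<ge> 1} \<union> {\<eta>\<in>signs M. aa \<eta> \<le> -1}. D \<eta>)"
  proof (rule sum.mono_neutral_right[OF finite_signs])
    show "\<forall>\<eta>\<in>signs M - ({\<eta>\<in>signs M. aa \<eta> \<ge> 1} \<union> {\<eta>\<in>signs M. aa \<eta> \<le> -1}). D \<eta> = 0"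
    proof
      fix \<eta> assume "\<eta> \<in> signs M - ({\<eta>\<in>signs M. aa \<eta> \<ge> 1} \<union> {\<eta>\<in>signs M. aa \<eta> \<le> -1})"
      then have "aa \<eta> = 0" by auto
      then show "D \<eta> = 0" by (rule D0)
    qed
  qed auto
  also have "\<dots> = (\<Sum>\<eta>\<in>{\<eta>\<in>signs M. aa \<eta> \<ge> 1}. D \<eta>) + (\<Sum>\<eta>\<in>{\<eta>\<in>signs M. aa \<eta> \<le> -1}. D \<eta>)"
    using finite_signs by (intro sum.union_disjoint) auto
  also have "(\<Sum>\<eta>\<in>{\<eta>\<in>signs M. aa \<eta> \<le> -1}. D \<eta>) = (\<Sum>\<eta>\<in>{\<eta>\<in>signs M. aa \<eta> \<ge> 1}. D \<eta>)"
    by (rule sum.reindex_bij_witness[of _ neg neg]) (auto simp: neg_neg neg_signs aa_neg Dneg)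
  also have "(\<Sum>\<eta>\<in>{\<eta>\<in>signs M. aa \<eta> \<ge> 1}. D \<eta>) = of_nat (L - 1) * (\<Sum>\<eta>\<in>{\<eta>\<in>signs M. aa \<eta> \<ge> 1}. of_int (esgn \<eta>) *
          (\<Sum>b<nat (aa \<eta>). of_real (fpoly l (L - 1) (real b + 1/2 - 1/2 * s \<eta>)) * W (nn \<eta>)))" (is "_ = _ * ?C")
    unfolding sum_distrib_left[of "of_nat (L - 1)"] by (intro sum.cong refl Dpos) auto
  finally have "(\<Sum>\<eta>\<in>signs M. D \<eta>) = 2 * of_nat (L - 1) * ?C" by (simp add: mult_2 distrib_right)
  moreover have "(\<Sum>\<eta>\<in>signs M. D \<eta>) = (\<Sum>\<eta>\<in>signs M. of_int (esgn \<eta>) * of_real (fpoly l L (- zz \<eta> / 2)) * W (nn \<eta>))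
     - (\<Sum>\<eta>\<in>signs M. of_int (esgn \<eta>) * of_real (fpoly l L (- s \<eta> / 2)) * W (nn \<eta>))"
    unfolding D_def by (simp only: of_real_diff right_diff_distrib left_diff_distrib sum_subtractf)
  moreover have "(\<Sum>\<eta>\<in>signs M. of_int (esgn \<eta>) * of_real (fpoly l L (- zz \<eta> / 2)) * W (nn \<eta>))
     = (-1) ^ (L + l) * (\<Sum>\<eta>\<in>signs M. of_int (esgn \<eta>) * of_real (fpoly l L (zz \<eta> / 2)) * W (nn \<eta>))"
    using par_f[of "zz _ / 2"] by (cases "even (L + l)") (simp_all add: sum_negf)
  ultimately show ?thesis by (simp add: algebra_simps)
qed

text \<open>Negating \<eta> replaces the residue r of \<open>nn\<close> modulo 2P by 2P - r and
  leaves the summand unchanged, so the residues below P carry half of the total. For these, r/(2P) -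
  m_2(M)/2 is \<open>zz \<eta> / 2\<close> whatever the parity of M.\<close>

lemma half_sum:
  fixes Z :: "int \<Rightarrow> complex"
  assumes l: "l \<in> {1..L}"
    and per: "\<And>x y. [x = y] (mod 2 * int P) \<Longrightarrow> Z x = Z y"
    and par: "\<And>\<eta>. \<eta> \<in> signs M \<Longrightarrow> Z (- nn \<eta>) = (-1) ^ l * Z (nn \<eta>)"
  shows "(\<Sum>\<eta>\<in>signs M. of_int (esgn \<eta>) * of_real (fpoly l L (zz \<eta> / 2)) * Z (nn \<eta>))
    = 2 * (-1) ^ M * (\<Sum>a=0..P. of_real (real_of_int (chi M p l0 (int a)) * fpoly l L (real a / (2 * real P) - real (m2 M) / 2)) * Z (int a))"
proof -
  define G where "G n = (if n \<le> int P then of_real (fpoly l L (real_of_int n / (2 * real P) - real (m2 M) / 2)) * Z n else 0)" for n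
  define T where "T \<eta> = of_int (esgn \<eta>) * of_real (fpoly l L (zz \<eta> / 2)) * Z (nn \<eta>)" for \<eta>
  let ?r = "\<lambda>\<eta>. nn \<eta> mod (2 * int P)"
  have PP: "real P > 0" using P_pos by simp
  have "(\<Sum>a=0..P. of_real (real_of_int (chi M p l0 (int a)) * fpoly l L (real a / (2 * real P) - real (m2 M) / 2)) * Z (int a))
     = (\<Sum>n\<in>int ` {0..P}. of_int (chi M p l0 n) * G n)"
    by (subst sum.reindex) (auto simp: o_def G_def mult_ac)
  also have "int ` {0..P} = {0..int P}" using image_int_atLeastAtMost[of 0 P] by simp
  also have "(\<Sum>n\<in>{0..int P}. of_int (chi M p l0 n) * G n) = (\<Sum>n\<in>{0..<2 * int P}. of_int (chi M p l0 n) * G n)"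
    using P_pos by (intro sum.mono_neutral_left) (auto simp: G_def)
  also have "\<dots> = (-1) ^ M * (\<Sum>\<eta>\<in>signs M. of_int (esgn \<eta>) * G (?r \<eta>))"
    by (rule sum_chi_l0)
  also have "(\<Sum>\<eta>\<in>signs M. of_int (esgn \<eta>) * G (?r \<eta>)) = (\<Sum>\<eta>\<in>signs M. if ?r \<eta> \<le> int P then T \<eta> else 0)"
  proof (intro sum.cong refl)
    fix \<eta> assume \<eta>: "\<eta> \<in> signs M"
    show "of_int (esgn \<eta>) * G (?r \<eta>) = (if ?r \<eta> \<le> int P then T \<eta> else 0)"
    proof (cases "?r \<eta> \<le> int P")
      case True
      then have "real_of_int (?r \<eta>) \<le> real P" by linarith
      then have "real P * (if odd M then zz \<eta> + 1 else if zz \<eta> > 0 then zz \<eta> else zz \<eta> + 2) \<le> real P * 1"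
        unfolding mod_nn_zz[OF \<eta>] by simp
      then have "(if odd M then zz \<eta> + 1 else if zz \<eta> > 0 then zz \<eta> else zz \<eta> + 2) \<le> 1"
        using PP by (rule mult_left_le_imp_le)
      then have "even M \<longrightarrow> zz \<eta> > 0" using zz_bounds[OF \<eta>] by (auto split: if_splits)
      then have "real_of_int (?r \<eta>) / (2 * real P) - real (m2 M) / 2 = zz \<eta> / 2"
        unfolding mod_nn_zz[OF \<eta>] using PP by (auto simp: m2_def field_simps)
      moreover have "Z (?r \<eta>) = Z (nn \<eta>)" by (rule per) (simp add: cong_def)
      ultimately show ?thesis unfolding G_def T_def by (simp only: True if_True mult.assoc)
    qed (simp add: G_def)
  qed
  finally have e: "(\<Sum>a=0..P. of_real (real_of_int (chi M p l0 (int a)) * fpoly l L (real a / (2 * real P) - real (m2 M) / 2)) * Z (int a))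
    = (-1) ^ M * (\<Sum>\<eta>\<in>signs M. if ?r \<eta> \<le> int P then T \<eta> else 0)" .
  have dbl: "2 * (\<Sum>\<eta>\<in>signs M. if ?r \<eta> \<le> int P then T \<eta> else 0) = (\<Sum>\<eta>\<in>signs M. T \<eta>)"
  proof -
    have Tneg: "T (neg \<eta>) = T \<eta>" if \<eta>: "\<eta> \<in> signs M" for \<eta>
    proof -
      have "Z (nn (neg \<eta>)) = (-1) ^ l * Z (nn \<eta>)" using per[OF nn_neg] par[OF \<eta>] by simp
      moreover have "fpoly l L (zz (neg \<eta>) / 2) = (-1) ^ (L + l) * fpoly l L (zz \<eta> / 2)"
        using fpoly_uminus[OF l, of "zz \<eta> / 2"] by (simp add: zz_neg[OF \<eta>])
      ultimately show ?thesis unfolding T_def esgn_neg using even_M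
        by (cases "even l"; cases "even L") simp_all
    qed
    have rneg: "?r (neg \<eta>) \<le> int P \<longleftrightarrow> \<not> ?r \<eta> \<le> int P" if \<eta>: "\<eta> \<in> signs M" for \<eta>
    proof -
      have nz: "?r \<eta> \<noteq> 0" "?r \<eta> \<noteq> int P" using not_P_dvd_imp[OF nn_not_dvd[OF one_in \<eta>]] by auto
      have "?r (neg \<eta>) = (- nn \<eta>) mod (2 * int P)" using nn_neg[of \<eta>] by (simp add: cong_def)
      also have "\<dots> = 2 * int P - ?r \<eta>" using nz P_pos by (simp add: zmod_zminus1_eq_if)
      finally show ?thesis using nz by auto
    qed
    have "2 * (\<Sum>\<eta>\<in>signs M. if ?r \<eta> \<le> int P then T \<eta> else 0)
       = (\<Sum>\<eta>\<in>signs M. if ?r \<eta> \<le> int P then T \<eta> else 0) + (\<Sum>\<eta>\<in>signs M. if ?r (neg \<eta>) \<le> int P then T (neg \<eta>) else 0)"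
      using sum_signs_neg[of "\<lambda>\<eta>. if ?r \<eta> \<le> int P then T \<eta> else 0"] by simp
    also have "\<dots> = (\<Sum>\<eta>\<in>signs M. T \<eta>)"
      unfolding sum.distrib[symmetric] by (intro sum.cong refl) (simp add: rneg Tneg)
    finally show ?thesis .
  qed
  have h: "2 * (-1) ^ M * ((-1) ^ M * H) = 2 * H" for H :: complex
    by (cases "even M") simp_all
  show ?thesis unfolding e h dbl T_def[symmetric] ..
qed

lemma eta_set_eq: "eta_set M p a = {\<eta>\<in>signs M. aa \<eta> = int a}"
  unfolding eta_set_def using aa_unique[of _ "int a"] by auto

text \<open>Every \<eta> with aa >= 1 lies in exactly one of the sets, that with a =
  \<open>aa \<eta>\<close>, and the sets with a > M are empty since \<open>s \<eta>\<close> is below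
  L. The infinite sum is therefore a finite one over \<eta>.\<close>

lemma infsum_signed:
  fixes g :: "nat \<Rightarrow> nat \<Rightarrow> (nat \<Rightarrow> int) \<Rightarrow> 'a :: real_normed_field"
  shows "(\<Sum>\<^sub>\<infinity>a\<in>{1..}. \<Sum>b<a. signed_sum M p a (g a b))
    = (\<Sum>\<eta>\<in>{\<eta>\<in>signs M. aa \<eta> \<ge> 1}. of_int (esgn \<eta>) * (\<Sum>b<nat (aa \<eta>). g (nat (aa \<eta>)) b \<eta>))"
proof -
  have big: "eta_set M p a = {}" if "a > M" for a
  proof -
    have "\<not> 2 * real a - 1 < s \<eta>" if "\<eta> \<in> signs M" for \<eta>
      using abs_s_less[OF that] \<open>a > M\<close> by (auto simp: L_def)
    then show ?thesis by (auto simp: eta_set_def)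
  qed
  have "(\<Sum>\<^sub>\<infinity>a\<in>{1..}. \<Sum>b<a. signed_sum M p a (g a b)) = (\<Sum>\<^sub>\<infinity>a\<in>{1..M}. \<Sum>b<a. signed_sum M p a (g a b))"
    by (rule infsum_cong_neutral) (auto simp: signed_sum_def big)
  also have "\<dots> = (\<Sum>a\<in>{1..M}. \<Sum>b<a. signed_sum M p a (g a b))" by simp
  also have "\<dots> = (\<Sum>a\<in>{1..M}. \<Sum>\<eta>\<in>{\<eta>\<in>{\<eta>\<in>signs M. aa \<eta> \<ge> 1}. nat (aa \<eta>) = a}. of_int (esgn \<eta>) * (\<Sum>b<nat (aa \<eta>). g (nat (aa \<eta>)) b \<eta>))"
  proof (intro sum.cong refl)
    fix a assume a: "a \<in> {1..M}"
    have e: "eta_set M p a = {\<eta>\<in>{\<eta>\<in>signs M. aa \<eta> \<ge> 1}. nat (aa \<eta>) = a}"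
      unfolding eta_set_eq using a by auto
    have "(\<Sum>b<a. signed_sum M p a (g a b)) = (\<Sum>\<eta>\<in>eta_set M p a. \<Sum>b<a. of_int (esgn \<eta>) * g a b \<eta>)"
      unfolding signed_sum_def esgn_def by (rule sum.swap)
    also have "\<dots> = (\<Sum>\<eta>\<in>eta_set M p a. of_int (esgn \<eta>) * (\<Sum>b<nat (aa \<eta>). g (nat (aa \<eta>)) b \<eta>))"
      by (intro sum.cong refl) (simp add: e sum_distrib_left)
    finally show "(\<Sum>b<a. signed_sum M p a (g a b)) = (\<Sum>\<eta>\<in>{\<eta>\<in>{\<eta>\<in>signs M. aa \<eta> \<ge> 1}. nat (aa \<eta>) = a}. of_int (esgn \<eta>) * (\<Sum>b<nat (aa \<eta>). g (nat (aa \<eta>)) b \<eta>))"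
      by (simp only: e)
  qed
  also have "\<dots> = (\<Sum>\<eta>\<in>{\<eta>\<in>signs M. aa \<eta> \<ge> 1}. of_int (esgn \<eta>) * (\<Sum>b<nat (aa \<eta>). g (nat (aa \<eta>)) b \<eta>))"
  proof (rule sum.group)
    show "(\<lambda>\<eta>. nat (aa \<eta>)) ` {\<eta>\<in>signs M. aa \<eta> \<ge> 1} \<subseteq> {1..M}"
    proof
      fix a assume "a \<in> (\<lambda>\<eta>. nat (aa \<eta>)) ` {\<eta>\<in>signs M. aa \<eta> \<ge> 1}"
      then obtain \<eta> where \<eta>: "\<eta> \<in> signs M" "aa \<eta> \<ge> 1" "a = nat (aa \<eta>)" by blast
      then have "\<eta> \<in> eta_set M p a" by (simp add: eta_set_eq)
      then have "\<not> a > M" using big by auto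
      then show "a \<in> {1..M}" using \<eta> by auto
    qed
  qed (use finite_signs in auto)
  finally show ?thesis .
qed

text \<open>The M - 1 applications of \<open>sigma\<close> reduce their argument for odd M and
  subtract it from P for even M. In both cases the term P (2a - 1) supplies the multiple of P that
  turns the result into \<open>nn\<close> or its negative.\<close>

lemma xarg_cong:
  "[xarg M p \<eta> a = (if odd M then nn \<eta> else - nn \<eta>)] (mod 2 * int P)"
  "xarg M p \<eta> a \<in> {0..<2 * int P}"
proof -
  let ?n = "\<Sum>j=1..M. \<eta> j * int (P div p j)"
  have M1: "M - 1 \<ge> 1" "odd (M - 1) \<longleftrightarrow> even M" using M_ge_3 by auto
  have x: "xarg M p \<eta> a = (if even M then int P - (?n - int P * (2 * int a - 1)) else ?n - int P * (2 * int a - 1)) mod (2 * int P)"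
    unfolding xarg_def sigma_funpow[OF P_pos M1(1)] M1(2) by simp
  show "xarg M p \<eta> a \<in> {0..<2 * int P}" unfolding x using P_pos by auto
  obtain k where k: "L = 2 * k + (if even M then 0 else 1)"
    using even_M by (metis add.right_neutral evenE oddE)
  have "[(if even M then int P - (?n - int P * (2 * int a - 1)) else ?n - int P * (2 * int a - 1)) = (if odd M then nn \<eta> else - nn \<eta>)] (mod 2 * int P)"
  proof (cases "even M")
    case True
    have "int P - (?n - int P * (2 * int a - 1)) - - nn \<eta> = 2 * int P * (int a + int k)"
      using True by (simp add: nn_def k algebra_simps)
    then show ?thesis using True by (simp add: cong_iff_dvd_diff)
  next
    case False
    have "?n - int P * (2 * int a - 1) - nn \<eta> = 2 * int P * (- int a - int k)"
      using False by (simp add: nn_def k algebra_simps)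
    then show ?thesis using False by (simp add: cong_iff_dvd_diff)
  qed
  then show "[xarg M p \<eta> a = (if odd M then nn \<eta> else - nn \<eta>)] (mod 2 * int P)"
    unfolding x by (simp add: cong_def)
qed

end

subsection \<open>Gauss sums weighted by Bernoulli polynomials\<close>

lemma mult_left_cong: "x * b = y * c \<Longrightarrow> x * (w * b) = y * (w * c)" for x :: "'a :: comm_monoid_mult"
  by (metis mult.left_commute)

lemma mult_imaginary_cong:
  assumes "x * b = q * (2 * s)"
  shows "q * (2 * \<i> * (s * e)) = x * \<i> * (b * e)"
proof -
  have "x * \<i> * (b * e) = (x * b) * (\<i> * e)" by (simp only: mult_ac)
  then show ?thesis unfolding assms by (simp only: mult_ac)
qed

text \<open>The 2r factors of the quotient split into the even ones, with product 2^r m!/(m - r)!,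
  and the odd ones, with product 2^r times that of the m - 1/2 - k. The latter is the product in
  \<open>Kcoeff\<close>.\<close>

lemma fact_double_ratio:
  assumes "r \<le> m"
  shows "fact (2 * m) / fact (2 * (m - r)) = 4 ^ r * (fact m / fact (m - r)) * (\<Prod>k<r. real m - 1/2 - real k)"
  using assms
proof (induction r)
  case (Suc r)
  define q where "q = m - Suc r"
  have q: "m - r = Suc q" "real m - 1/2 - real r = real q + 1/2" using Suc.prems by (auto simp: q_def of_nat_diff)
  have IH: "fact (2 * m) / fact (2 * Suc q) = 4 ^ r * (fact m / fact (Suc q)) * (\<Prod>k<r. real m - 1/2 - real k)"
    using Suc by (simp only: q(1))
  have gen: "(2 * y + 2) * (2 * y + 1) * (u * (A / ((y + 1) * B)) * X) = 4 * u * (A / B) * (X * (y + 1/2))"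
    if "y + 1 \<noteq> 0" for y u A B X :: real
  proof -
    have 1: "(2 * y + 2) * (A / ((y + 1) * B)) = 2 * (A / B)"
    proof -
      have "2 * y + 2 = 2 * (y + 1)" by simp
      then show ?thesis using that by (simp only: times_divide_eq_right mult.assoc mult_divide_mult_cancel_left)
                                      (simp add: mult.left_commute)
    qed
    have "(2 * y + 2) * (2 * y + 1) * (u * (A / ((y + 1) * B)) * X) = ((2 * y + 2) * (A / ((y + 1) * B))) * ((2 * y + 1) * u * X)"
      by (simp only: mult_ac)
    also have "\<dots> = 4 * u * (A / B) * (X * (y + 1/2))"
      unfolding 1 by (simp add: algebra_simps add_divide_distrib)
    finally show ?thesis .
  qed
  have f2: "(fact (2 * Suc q) :: real) = (2 * real q + 2) * ((2 * real q + 1) * fact (2 * q))"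
    by (simp add: algebra_simps)
  have f1: "(fact (Suc q) :: real) = (real q + 1) * fact q" by simp
  have "fact (2 * m) / fact (2 * q) = (2 * real q + 2) * (2 * real q + 1) * (fact (2 * m) / fact (2 * Suc q))"
    unfolding f2 by simp
  also have "\<dots> = (2 * real q + 2) * (2 * real q + 1) * (4 ^ r * (fact m / ((real q + 1) * fact q)) * (\<Prod>k<r. real m - 1/2 - real k))"
    unfolding IH f1 ..
  also have "\<dots> = 4 * 4 ^ r * (fact m / fact q) * ((\<Prod>k<r. real m - 1/2 - real k) * (real q + 1/2))"
    by (rule gen) simp
  also have "(\<Prod>k<r. real m - 1/2 - real k) * (real q + 1/2) = (\<Prod>k<Suc r. real m - 1/2 - real k)"
    by (simp add: q(2))
  finally show ?case by (simp only: q_def power_Suc)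
qed simp

lemma Kcoeff_prod:
  assumes "j \<le> m"
  shows "real (m choose j) * (\<Prod>k<m - j. real m - 1/2 - real k) = fact (2 * m) / (fact (2 * j) * fact (m - j) * 4 ^ (m - j))"
proof -
  have "fact (2 * m) / fact (2 * j) = 4 ^ (m - j) * (fact m / fact j) * (\<Prod>k<m - j. real m - 1/2 - real k)"
    using fact_double_ratio[of "m - j" m] assms by simp
  then have "fact (2 * m) / (fact (2 * j) * fact (m - j) * 4 ^ (m - j))
     = (4 ^ (m - j) * (fact m / fact j) * (\<Prod>k<m - j. real m - 1/2 - real k)) / (fact (m - j) * 4 ^ (m - j))"
    by (metis divide_divide_eq_left mult.assoc)
  then show ?thesis by (simp add: binomial_fact[OF assms])
qed

text \<open>The ratio (2m)!/((2j)! (m - j)!) is what multiplying the Gaussian series by the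
  Bernoulli series produces in \<open>YY\<close>; the power of 4 stems from lam = N/(8 pi P) =
  (N/4)/(2 pi P).\<close>

lemma Kcoeff_even:
  assumes "1 \<le> j" "j \<le> m"
  shows "Kcoeff (j - 1) (m - 1) 0 * (real m / real j) = fact (2 * m) / (fact (2 * j) * fact (m - j) * 4 ^ (m - j))"
proof -
  have "real j * real (m choose j) = real m * real (m - 1 choose (j - 1))"
    using times_binomial_minus1_eq[of j m] assms by (metis less_eq_Suc_le One_nat_def of_nat_mult)
  then have b: "real (m - 1 choose (j - 1)) * (real m / real j) = real (m choose j)"
    using assms by (simp add: field_simps)
  have K: "Kcoeff (j - 1) (m - 1) 0 = real (m - 1 choose (j - 1)) * (\<Prod>k<m - j. real m - 1/2 - real k)"
    unfolding Kcoeff_def using assms by (intro arg_cong2[of _ _ _ _ "(*)"] prod.cong) (auto simp: of_nat_diff)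
  have gen: "(A * X) * q = B * X" if "A * q = B" for A X q B :: real
    using that by (simp add: mult_ac)
  have "Kcoeff (j - 1) (m - 1) 0 * (real m / real j) = real (m choose j) * (\<Prod>k<m - j. real m - 1/2 - real k)"
    unfolding K by (rule gen[OF b])
  then show ?thesis using Kcoeff_prod[OF assms(2)] by simp
qed

lemma Kcoeff_odd:
  assumes "j \<le> m"
  shows "Kcoeff j m 1 * (real (2 * m + 1) / real (2 * j + 1)) = fact (2 * m + 1) / (fact (2 * j + 1) * fact (m - j) * 4 ^ (m - j))"
proof -
  have "Kcoeff j m 1 = real (m choose j) * (\<Prod>k<m - j. real m - 1/2 - real k)"
    unfolding Kcoeff_def by (intro arg_cong2[of _ _ _ _ "(*)"] prod.cong) auto
  also have "\<dots> = fact (2 * m) / (fact (2 * j) * fact (m - j) * 4 ^ (m - j))"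
    by (rule Kcoeff_prod[OF assms])
  finally show ?thesis by (simp add: mult_ac)
qed

lemma sum_parity_even:
  "(\<Sum>k=1..2 * m. if even (2 * m - k) then f k else 0) = (\<Sum>j=1..m. f (2 * j))" for f :: "nat \<Rightarrow> 'a :: comm_monoid_add"
proof -
  have "(\<Sum>k=1..2 * m. if even (2 * m - k) then f k else 0) = (\<Sum>k\<in>(\<lambda>j. 2 * j) ` {1..m}. if even (2 * m - k) then f k else 0)"
    by (intro sum.mono_neutral_right) (auto elim!: evenE)
  also have "\<dots> = (\<Sum>j=1..m. f (2 * j))"
    by (subst sum.reindex) (auto simp: inj_on_def)
  finally show ?thesis .
qed

lemma sum_parity_odd:
  "(\<Sum>k=1..2 * m + 1. if even (2 * m + 1 - k) then f k else 0) = (\<Sum>j=0..m. f (2 * j + 1))" for f :: "nat \<Rightarrow> 'a :: comm_monoid_add"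
proof -
  have "(\<Sum>k=1..2 * m + 1. if even (2 * m + 1 - k) then f k else 0) = (\<Sum>k\<in>(\<lambda>j. 2 * j + 1) ` {0..m}. if even (2 * m + 1 - k) then f k else 0)"
  proof (intro sum.mono_neutral_right ballI)
    fix k assume k: "k \<in> {1..2 * m + 1} - (\<lambda>j. 2 * j + 1) ` {0..m}"
    have "even k"
    proof (rule ccontr)
      assume "odd k"
      then obtain j where "k = 2 * j + 1" by (rule oddE)
      then show False using k by auto
    qed
    then show "(if even (2 * m + 1 - k) then f k else 0) = 0" using k by auto
  qed auto
  also have "\<dots> = (\<Sum>j=0..m. f (2 * j + 1))"
    by (subst sum.reindex) (auto simp: inj_on_def)
  finally show ?thesis .
qed

text \<open>The generating function at 1 - y in t is that at y in - t, by e^t e^(-yt) =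
  e^((1-y)t).\<close>

lemma bernpoly_reflect: "bernpoly k (1 - y) = (-1) ^ k * bernpoly k y"
proof -
  let ?A = "Abs_fps (\<lambda>k. (-1) ^ k * of_real (bernpoly k y) / fact k) :: complex fps"
  let ?B = "Abs_fps (\<lambda>k. 1 ^ k * of_real (bernpoly k (1 - y)) / fact k) :: complex fps"
  have e: "fps_exp 1 * fps_exp (-1) = (1 :: complex fps)"
    "fps_exp 1 * fps_exp (-1 * of_real y) = (fps_exp (1 * of_real (1 - y)) :: complex fps)"
    by (simp_all flip: fps_exp_add_mult)
  have "- ((fps_exp 1 - 1) * ?A) = fps_exp 1 * fps_exp (-1) * ?A - fps_exp 1 * ?A"
    unfolding e(1) by (simp add: algebra_simps)
  also have "\<dots> = fps_exp 1 * ((fps_exp (-1) - 1) * ?A)"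
    by (simp only: right_diff_distrib left_diff_distrib mult.assoc mult_1)
  also have "(fps_exp (-1) - 1) * ?A = fps_const (-1) * fps_X * fps_exp (-1 * of_real y)"
    by (rule bernpoly_generating_scaled)
  also have "fps_exp 1 * (fps_const (-1) * fps_X * fps_exp (-1 * of_real y))
      = fps_const (-1) * fps_X * (fps_exp 1 * fps_exp (-1 * of_real y) :: complex fps)"
    by (simp only: mult_ac)
  also have "\<dots> = - (fps_const 1 * fps_X * fps_exp (1 * of_real (1 - y)))"
    unfolding e(2) by (simp flip: fps_const_neg)
  finally have "(fps_exp 1 - 1) * ?A = fps_const 1 * fps_X * fps_exp (1 * of_real (1 - y))"
    by (simp only: neg_equal_iff_equal)
  also have "\<dots> = (fps_exp 1 - 1) * ?B"
    by (rule bernpoly_generating_scaled[symmetric])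
  finally have "?A = ?B" by simp
  then have "fps_nth ?A k = fps_nth ?B k" by simp
  then have "complex_of_real ((-1) ^ k * bernpoly k y) = of_real (bernpoly k (1 - y))" by simp
  then show ?thesis by (simp only: of_real_eq_iff)
qed

lemma epi_plus_minus: "epi x + epi (- x) = of_real (2 * cos (x * pi))"
  by (simp add: epi_cis complex_eq_iff)

lemma epi_diff_minus: "epi x - epi (- x) = \<i> * of_real (2 * sin (x * pi))"
  by (simp add: epi_cis complex_eq_iff)

lemma epi_int: "epi (real_of_int k) = (if even k then 1 else -1)"
  using sin_npi_int[of k] cos_npi_int[of k] by (simp add: epi_cis complex_eq_iff mult.commute)

context seifert
begin

text \<open>The reflection m -> 2P - m fixes P and, modulo 2P, also 0; the remaining residues are
  paired.\<close>

lemma sum_int_P: "(\<Sum>m\<in>{0..<2 * int P}. h m) = h 0 + h (int P) + (\<Sum>c=1..P - 1. h (int c) + h (2 * int P - int c))"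
  for h :: "int \<Rightarrow> 'b :: comm_monoid_add"
proof -
  have eq: "{0..<2 * int P} = insert 0 (insert (int P) (int ` {1..P - 1} \<union> (\<lambda>c. 2 * int P - int c) ` {1..P - 1}))" (is "_ = ?R")
  proof (intro equalityI subsetI)
    fix m assume m: "m \<in> {0..<2 * int P}"
    consider "m = 0" | "m = int P" | "0 < m" "m < int P" | "int P < m" using m by force
    then show "m \<in> ?R"
    proof cases
      case 3
      then have "m = int (nat m)" "nat m \<in> {1..P - 1}" by auto
      then show ?thesis by blast
    next
      case 4
      then have "m = 2 * int P - int (nat (2 * int P - m))" "nat (2 * int P - m) \<in> {1..P - 1}" using m by auto
      then show ?thesis by blast
    qed auto
  qed (use P_pos in auto)
  have "(\<Sum>m\<in>{0..<2 * int P}. h m) = h 0 + (h (int P) + (\<Sum>m\<in>int ` {1..P - 1} \<union> (\<lambda>c. 2 * int P - int c) ` {1..P - 1}. h m))"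
    unfolding eq using P_pos by (subst sum.insert; (subst sum.insert)?) auto
  also have "(\<Sum>m\<in>int ` {1..P - 1} \<union> (\<lambda>c. 2 * int P - int c) ` {1..P - 1}. h m)
    = (\<Sum>m\<in>int ` {1..P - 1}. h m) + (\<Sum>m\<in>(\<lambda>c. 2 * int P - int c) ` {1..P - 1}. h m)"
    by (intro sum.union_disjoint) auto
  also have "\<dots> = (\<Sum>c=1..P - 1. h (int c)) + (\<Sum>c=1..P - 1. h (2 * int P - int c))"
    by (subst (1 2) sum.reindex) (auto simp: inj_on_def)
  finally show ?thesis by (simp add: sum.distrib add.assoc)
qed

lemma gs_reflect: "gs N a (2 * int P - int c) = ee N (int c) * epi (- (real c * real_of_int a / real P))"
proof -
  have "gs N a (2 * int P - int c) = gs N a (- int c)"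
    by (rule gs_cong) (auto simp: cong_iff_dvd_diff)
  then show ?thesis by (simp add: gs_eq)
qed

lemma bern_reflect_P:
  assumes "c \<le> 2 * P"
  shows "bernpoly k (real_of_int (2 * int P - int c) / (2 * real P)) = (-1) ^ k * bernpoly k (real c / (2 * real P))"
proof -
  have "real_of_int (2 * int P - int c) / (2 * real P) = 1 - real c / (2 * real P)"
    using P_pos by (simp add: field_simps)
  then show ?thesis by (simp only: bernpoly_reflect)
qed

text \<open>Bernoulli polynomials of even index are symmetric under y -> 1 - y, so paired phases add
  up to cosines. The unpaired points c = 0 and c = P account for the two Kronecker symbols.\<close>

lemma gs_bern_even:
  assumes k: "even k"
  shows "(\<Sum>m\<in>{0..<2 * int P}. gs N a m * of_real (bernpoly k (real_of_int m / (2 * real P))))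
    = (\<Sum>c=0..P. of_real (cos (real_of_int a * real c * pi / real P) * (2 - of_bool (c = 0) - of_bool (c = P))
        * bernpoly k (real c / (2 * real P))) * ee N (int c))"
    (is "?l = (\<Sum>c=0..P. ?g c)")
proof -
  let ?h = "\<lambda>m. gs N a m * of_real (bernpoly k (real_of_int m / (2 * real P)))"
  have "{0..P} = insert 0 (insert P {1..P - 1})" using P_pos by auto
  then have "(\<Sum>c=0..P. ?g c) = ?g 0 + ?g P + (\<Sum>c=1..P - 1. ?g c)"
    using P_pos by simp
  moreover have "?g 0 = ?h 0" using P_pos by (simp add: gs_eq)
  moreover have "?g P = ?h (int P)"
  proof -
    have "epi (real_of_int a) = of_real (cos (real_of_int a * pi))"
      using sin_npi_int[of a] by (simp add: epi_cis complex_eq_iff mult.commute)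
    then show ?thesis using P_pos by (simp add: gs_eq)
  qed
  moreover have "(\<Sum>c=1..P - 1. ?g c) = (\<Sum>c=1..P - 1. ?h (int c) + ?h (2 * int P - int c))"
  proof (intro sum.cong refl)
    fix c assume c: "c \<in> {1..P - 1}"
    let ?x = "real c * real_of_int a / real P"
    have "c \<noteq> P" "c \<le> 2 * P" using c P_pos by auto
    have "?h (int c) + ?h (2 * int P - int c) = ee N (int c) * (epi ?x + epi (- ?x)) * of_real (bernpoly k (real c / (2 * real P)))"
      unfolding gs_reflect bern_reflect_P[OF \<open>c \<le> 2 * P\<close>] unfolding gs_eq using k by (simp add: algebra_simps)
    also have "\<dots> = ?g c"
      unfolding epi_plus_minus using c \<open>c \<noteq> P\<close> by (simp add: mult_ac)
    finally show "?g c = ?h (int c) + ?h (2 * int P - int c)" ..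
  qed
  ultimately show ?thesis by (simp only: sum_int_P[of ?h])
qed

text \<open>Antisymmetry turns paired phases into sines and kills the term at P, whose argument is
  1/2. The term at 0 stays; being independent of a, it is cancelled later by
  \<open>sum_fpoly_0\<close>.\<close>

lemma gs_bern_odd:
  assumes k: "odd k"
  shows "(\<Sum>m\<in>{0..<2 * int P}. gs N a m * of_real (bernpoly k (real_of_int m / (2 * real P))))
    = of_real (bernpoly k 0) + 2 * \<i> * (\<Sum>c=1..P - 1. of_real (sin (real_of_int a * real c * pi / real P)
        * bernpoly k (real c / (2 * real P))) * ee N (int c))"
    (is "?l = _ + 2 * \<i> * (\<Sum>c=1..P - 1. ?g c)")
proof -
  let ?h = "\<lambda>m. gs N a m * of_real (bernpoly k (real_of_int m / (2 * real P)))"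
  have h0: "?h 0 = of_real (bernpoly k 0)" by (simp add: gs_eq)
  have hP: "?h (int P) = 0"
  proof -
    have "bernpoly k (1/2) = 0" using bernpoly_reflect[of k "1/2"] k by simp
    then show ?thesis using P_pos by simp
  qed
  have hs: "(\<Sum>c=1..P - 1. ?h (int c) + ?h (2 * int P - int c)) = (\<Sum>c=1..P - 1. 2 * \<i> * ?g c)"
  proof (intro sum.cong refl)
    fix c assume c: "c \<in> {1..P - 1}"
    let ?x = "real c * real_of_int a / real P"
    have "c \<le> 2 * P" using c P_pos by auto
    have "?h (int c) + ?h (2 * int P - int c) = ee N (int c) * (epi ?x - epi (- ?x)) * of_real (bernpoly k (real c / (2 * real P)))"
      unfolding gs_reflect bern_reflect_P[OF \<open>c \<le> 2 * P\<close>] unfolding gs_eq using k by (simp add: algebra_simps)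
    also have "\<dots> = 2 * \<i> * ?g c"
      unfolding epi_diff_minus by (simp add: mult_ac)
    finally show "?h (int c) + ?h (2 * int P - int c) = 2 * \<i> * ?g c" .
  qed
  show ?thesis unfolding sum_int_P[of ?h] h0 hP hs sum_distrib_left[symmetric] by simp
qed

text \<open>One factor sqrt N is set aside; it is the one that cancels against the normalisation
  1/sqrt(2 P N).\<close>

lemma N_power_split:
  assumes N: "N > 0"
  shows "of_nat N ^ k * (\<i> * of_real (lam N)) ^ r * of_real (A / (B * C))
    = of_real (sqrt (real N)) * (of_real (real N powr (real k + real r - 1/2)) * (\<i> / of_real (2 * real P * pi)) ^ r * of_real (A / (B * C * 4 ^ r)))"
proof -
  have "real N ^ k * real N ^ r = real N powr (1/2) * real N powr (real k + real r - 1/2)"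
    using N by (simp add: powr_add[symmetric] powr_realpow[symmetric])
  then have pw: "of_nat N ^ k * of_nat N ^ r = complex_of_real (sqrt (real N)) * of_real (real N powr (real k + real r - 1/2))"
    using N by (metis of_real_mult of_real_of_nat_eq of_real_power powr_half_sqrt of_nat_0_le_iff)
  have "\<i> * of_real (lam N) = of_nat N * (\<i> / of_real (2 * real P * pi)) / 4"
    using P_pos by (simp add: lam_def field_simps)
  then have "(\<i> * of_real (lam N)) ^ r = of_nat N ^ r * (\<i> / of_real (2 * real P * pi)) ^ r / 4 ^ r"
    by (simp only: power_mult_distrib power_divide)
  then have "of_nat N ^ k * (\<i> * of_real (lam N)) ^ r * of_real (A / (B * C))
    = (of_nat N ^ k * of_nat N ^ r) * ((\<i> / of_real (2 * real P * pi)) ^ r * of_real (A / (B * C * 4 ^ r)))"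
    by (simp add: mult_ac)
  then show ?thesis unfolding pw by (simp only: mult.assoc)
qed

text \<open>Since P does not divide a, \<open>Nmat\<close> is in its generic cosine case. Its factor
  sqrt(2/P) turns sqrt(2 P N) into 2 sqrt N.\<close>

lemma even_part_eq:
  assumes N: "N > 0" and m: "m \<ge> 1" and a: "\<not> int P dvd a"
  shows "YY N (2 * m) a = of_real (sqrt (2 * real P * real N)) * even_part P N m a"
proof -
  let ?B = "\<lambda>k. \<Sum>c=0..P. of_real (cos (real_of_int a * real c * pi / real P) * (2 - of_bool (c = 0) - of_bool (c = P))
        * bernpoly k (real c / (2 * real P))) * ee N (int c)"
  have Nm: "Nmat P a c = sqrt (2 / real P) * cos (real_of_int a * real c * pi / real P)" for c
  proof -
    have "\<not> [a = 0] (mod 2 * int P)" "\<not> [a = int P] (mod 2 * int P)"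
      using a by (auto simp: cong_iff_dvd_diff dest: dvd_mult_right) (metis dvd_diffD dvd_mult_right dvd_refl dvd_triv_right dvd_trans zdvd_zdiffD)
    then show ?thesis by (simp add: Nmat_def)
  qed
  have sq: "sqrt (2 * real P * real N) * sqrt (2 / real P) = 2 * sqrt (real N)"
  proof -
    have "sqrt (2 * real P * real N) * sqrt (2 / real P) = sqrt (4 * real N)"
      using P_pos by (simp flip: real_sqrt_mult)
    then show ?thesis by (simp add: real_sqrt_mult)
  qed
  have "YY N (2 * m) a = (\<Sum>j=1..m. of_nat N ^ (2 * j) * (\<i> * of_real (lam N)) ^ ((2 * m - 2 * j) div 2)
     * of_real (fact (2 * m) / (fact (2 * j) * fact ((2 * m - 2 * j) div 2))) * ?B (2 * j))"
    unfolding YY_def sum_parity_even by (intro sum.cong refl) (simp add: gs_bern_even)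
  also have "\<dots> = (\<Sum>j=1..m. of_real (sqrt (real N)) * (of_real (real N powr (real m + real j - 1/2)) * (\<i> / of_real (2 * real P * pi)) ^ (m - j)
     * of_real (Kcoeff (j - 1) (m - 1) 0 * (real m / real j)) * ?B (2 * j)))"
  proof (intro sum.cong refl)
    fix j assume j: "j \<in> {1..m}"
    have r: "(2 * m - 2 * j) div 2 = m - j" by simp
    have "real (2 * j) + real (m - j) - 1/2 = real m + real j - 1/2" using j by (simp add: of_nat_diff)
    then show "of_nat N ^ (2 * j) * (\<i> * of_real (lam N)) ^ ((2 * m - 2 * j) div 2)
     * of_real (fact (2 * m) / (fact (2 * j) * fact ((2 * m - 2 * j) div 2))) * ?B (2 * j)
     = of_real (sqrt (real N)) * (of_real (real N powr (real m + real j - 1/2)) * (\<i> / of_real (2 * real P * pi)) ^ (m - j)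
     * of_real (Kcoeff (j - 1) (m - 1) 0 * (real m / real j)) * ?B (2 * j))"
      unfolding r N_power_split[OF N] using Kcoeff_even[of j m] j by (simp only: atLeastAtMost_iff mult.assoc)
  qed
  also have "\<dots> = (\<Sum>j=1..m. of_real (sqrt (2 * real P * real N)) * (of_real (real N powr (real m + real j - 1/2)) * (\<i> / of_real (2 * real P * pi)) ^ (m - j)
     * of_real (Kcoeff (j - 1) (m - 1) 0 * (real m / real j)) * (\<Sum>c=0..P. of_real (Nmat P a c * ((2 - of_bool (c = 0) - of_bool (c = P)) / 2)
              * bernpoly (2 * j) (real c / (2 * real P))) * epi (- (real N * (real c ^ 2 / (2 * real P)))))))"
  proof (rule sum.cong[OF refl])
    fix j
    have "complex_of_real (sqrt (real N)) * ?B (2 * j) = of_real (sqrt (2 * real P * real N)) * (\<Sum>c=0..P. of_real (Nmat P a c * ((2 - of_bool (c = 0) - of_bool (c = P)) / 2)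
              * bernpoly (2 * j) (real c / (2 * real P))) * epi (- (real N * (real c ^ 2 / (2 * real P)))))"
      unfolding sum_distrib_left
    proof (rule sum.cong[OF refl])
      fix c
      have "complex_of_real (sqrt (2 * real P * real N)) * of_real (Nmat P a c * ((2 - of_bool (c = 0) - of_bool (c = P)) / 2) * bernpoly (2 * j) (real c / (2 * real P)))
        = of_real ((sqrt (2 * real P * real N) * sqrt (2 / real P)) * (cos (real_of_int a * real c * pi / real P) * (2 - of_bool (c = 0) - of_bool (c = P)) / 2 * bernpoly (2 * j) (real c / (2 * real P))))"
        unfolding Nm of_real_mult[symmetric] by (rule arg_cong[of _ _ of_real]) (simp only: mult_ac times_divide_eq_right)
      also have "\<dots> = of_real (sqrt (real N)) * of_real (cos (real_of_int a * real c * pi / real P) * (2 - of_bool (c = 0) - of_bool (c = P)) * bernpoly (2 * j) (real c / (2 * real P)))"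
        unfolding sq of_real_mult[symmetric] by (rule arg_cong[of _ _ of_real]) simp
      finally show "of_real (sqrt (real N)) * (of_real (cos (real_of_int a * real c * pi / real P) * (2 - of_bool (c = 0) - of_bool (c = P))
        * bernpoly (2 * j) (real c / (2 * real P))) * ee N (int c))
        = of_real (sqrt (2 * real P * real N)) * (of_real (Nmat P a c * ((2 - of_bool (c = 0) - of_bool (c = P)) / 2)
              * bernpoly (2 * j) (real c / (2 * real P))) * epi (- (real N * (real c ^ 2 / (2 * real P)))))"
        by (simp only: mult.assoc[symmetric] of_int_of_nat_eq times_divide_eq_right)
    qed
    then show "of_real (sqrt (real N)) * (of_real (real N powr (real m + real j - 1/2)) * (\<i> / of_real (2 * real P * pi)) ^ (m - j)
     * of_real (Kcoeff (j - 1) (m - 1) 0 * (real m / real j)) * ?B (2 * j))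
     = of_real (sqrt (2 * real P * real N)) * (of_real (real N powr (real m + real j - 1/2)) * (\<i> / of_real (2 * real P * pi)) ^ (m - j)
     * of_real (Kcoeff (j - 1) (m - 1) 0 * (real m / real j)) * (\<Sum>c=0..P. of_real (Nmat P a c * ((2 - of_bool (c = 0) - of_bool (c = P)) / 2)
              * bernpoly (2 * j) (real c / (2 * real P))) * epi (- (real N * (real c ^ 2 / (2 * real P))))))"
      by (rule mult_left_cong)
  qed
  also have "\<dots> = of_real (sqrt (2 * real P * real N)) * even_part P N m a"
    unfolding even_part_def by (rule sum_distrib_left[symmetric])
  finally show ?thesis .
qed

text \<open>The remainder of \<open>gs_bern_odd\<close> is carried along as the value at a = 0,
  where all sines vanish.\<close>

lemma odd_part_eq:
  assumes N: "N > 0"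
  shows "YY N (2 * m + 1) a = of_real (sqrt (2 * real P * real N)) * \<i> * odd_part P N m a + YY N (2 * m + 1) 0"
proof -
  let ?B = "\<lambda>k a. \<Sum>c=1..P - 1. of_real (sin (real_of_int a * real c * pi / real P)
        * bernpoly k (real c / (2 * real P))) * ee N (int c)"
  let ?q = "\<lambda>j. of_nat N ^ (2 * j + 1) * (\<i> * of_real (lam N)) ^ ((2 * m + 1 - (2 * j + 1)) div 2)
     * complex_of_real (fact (2 * m + 1) / (fact (2 * j + 1) * fact ((2 * m + 1 - (2 * j + 1)) div 2)))"
  have sq: "sqrt (2 * real P * real N) * sqrt (2 / real P) = 2 * sqrt (real N)"
  proof -
    have "sqrt (2 * real P * real N) * sqrt (2 / real P) = sqrt (4 * real N)"
      using P_pos by (simp flip: real_sqrt_mult)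
    then show ?thesis by (simp add: real_sqrt_mult)
  qed
  have Y: "YY N (2 * m + 1) a = (\<Sum>j=0..m. ?q j * (of_real (bernpoly (2 * j + 1) 0) + 2 * \<i> * ?B (2 * j + 1) a))" for a
    unfolding YY_def sum_parity_odd by (intro sum.cong refl) (subst gs_bern_odd, simp, rule refl)
  have Y0: "YY N (2 * m + 1) 0 = (\<Sum>j=0..m. ?q j * of_real (bernpoly (2 * j + 1) 0))"
    unfolding Y by (intro sum.cong refl) simp
  have "YY N (2 * m + 1) a - YY N (2 * m + 1) 0 = (\<Sum>j=0..m. ?q j * (2 * \<i> * ?B (2 * j + 1) a))"
    unfolding Y[of a] Y0 sum_subtractf[symmetric] by (intro sum.cong refl) (simp only: distrib_left add_diff_cancel_left')
  also have "\<dots> = (\<Sum>j=0..m. of_real (sqrt (real N)) * (of_real (real N powr (real m + real j + 1/2)) * (\<i> / of_real (2 * real P * pi)) ^ (m - j)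
     * of_real (Kcoeff j m 1 * (real (2 * m + 1) / real (2 * j + 1))) * (2 * \<i> * ?B (2 * j + 1) a)))"
  proof (intro sum.cong refl)
    fix j assume j: "j \<in> {0..m}"
    have r: "(2 * m + 1 - (2 * j + 1)) div 2 = m - j" by simp
    have "real (2 * j + 1) + real (m - j) - 1/2 = real m + real j + 1/2" using j by (simp add: of_nat_diff)
    then show "?q j * (2 * \<i> * ?B (2 * j + 1) a) = of_real (sqrt (real N)) * (of_real (real N powr (real m + real j + 1/2)) * (\<i> / of_real (2 * real P * pi)) ^ (m - j)
     * of_real (Kcoeff j m 1 * (real (2 * m + 1) / real (2 * j + 1))) * (2 * \<i> * ?B (2 * j + 1) a))"
      unfolding r N_power_split[OF N] using Kcoeff_odd[of j m] j by (simp only: atLeastAtMost_iff mult.assoc)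
  qed
  also have "\<dots> = (\<Sum>j=0..m. of_real (sqrt (2 * real P * real N)) * \<i> * (of_real (real N powr (real m + real j + 1/2)) * (\<i> / of_real (2 * real P * pi)) ^ (m - j)
     * of_real (Kcoeff j m 1 * (real (2 * m + 1) / real (2 * j + 1))) * (\<Sum>c=1..P - 1. of_real (Mmat P a c
              * bernpoly (2 * j + 1) (real c / (2 * real P))) * epi (- (real N * (real c ^ 2 / (2 * real P)))))))"
  proof (rule sum.cong[OF refl])
    fix j
    have "complex_of_real (sqrt (real N)) * (2 * \<i> * ?B (2 * j + 1) a) = of_real (sqrt (2 * real P * real N)) * \<i> * (\<Sum>c=1..P - 1. of_real (Mmat P a c
              * bernpoly (2 * j + 1) (real c / (2 * real P))) * epi (- (real N * (real c ^ 2 / (2 * real P)))))"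
      unfolding sum_distrib_left
    proof (rule sum.cong[OF refl])
      fix c
      have "complex_of_real (sqrt (2 * real P * real N)) * of_real (Mmat P a c * bernpoly (2 * j + 1) (real c / (2 * real P)))
        = of_real ((sqrt (2 * real P * real N) * sqrt (2 / real P)) * (sin (real_of_int a * real c * pi / real P) * bernpoly (2 * j + 1) (real c / (2 * real P))))"
        unfolding Mmat_def of_real_mult[symmetric] by (rule arg_cong[of _ _ of_real]) (simp only: mult_ac)
      then have "complex_of_real (sqrt (2 * real P * real N)) * of_real (Mmat P a c * bernpoly (2 * j + 1) (real c / (2 * real P)))
        = of_real (sqrt (real N)) * (2 * of_real (sin (real_of_int a * real c * pi / real P) * bernpoly (2 * j + 1) (real c / (2 * real P))))"
        unfolding sq by (simp only: of_real_mult of_real_numeral mult_ac)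
      then show "of_real (sqrt (real N)) * (2 * \<i> * (of_real (sin (real_of_int a * real c * pi / real P)
        * bernpoly (2 * j + 1) (real c / (2 * real P))) * ee N (int c)))
        = of_real (sqrt (2 * real P * real N)) * \<i> * (of_real (Mmat P a c
              * bernpoly (2 * j + 1) (real c / (2 * real P))) * epi (- (real N * (real c ^ 2 / (2 * real P)))))"
        unfolding of_int_of_nat_eq times_divide_eq_right by (rule mult_imaginary_cong)
    qed
    then show "of_real (sqrt (real N)) * (of_real (real N powr (real m + real j + 1/2)) * (\<i> / of_real (2 * real P * pi)) ^ (m - j)
     * of_real (Kcoeff j m 1 * (real (2 * m + 1) / real (2 * j + 1))) * (2 * \<i> * ?B (2 * j + 1) a))
     = of_real (sqrt (2 * real P * real N)) * \<i> * (of_real (real N powr (real m + real j + 1/2)) * (\<i> / of_real (2 * real P * pi)) ^ (m - j)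
     * of_real (Kcoeff j m 1 * (real (2 * m + 1) / real (2 * j + 1))) * (\<Sum>c=1..P - 1. of_real (Mmat P a c
              * bernpoly (2 * j + 1) (real c / (2 * real P))) * epi (- (real N * (real c ^ 2 / (2 * real P))))))"
      by (rule mult_left_cong)
  qed
  also have "\<dots> = of_real (sqrt (2 * real P * real N)) * \<i> * odd_part P N m a"
    unfolding odd_part_def by (rule sum_distrib_left[symmetric])
  finally show ?thesis by (simp add: algebra_simps)
qed

text \<open>\<open>F\<close> has no pole at 0, so the principal coefficients of \<open>FL 0\<close>
  vanish. This removes every weight in the sum over \<eta> that does not depend on \<eta>.\<close>

lemma sum_fpoly_0:
  assumes l: "l \<in> {1..L}"
  shows "(\<Sum>\<eta>\<in>signs M. of_int (esgn \<eta>) * complex_of_real (fpoly l L (- s \<eta> / 2))) = 0"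
proof -
  have "fls_nth (FL 0) (- int l) = 0" unfolding FL_0_fps using l by simp
  moreover have "fls_nth (FL 0) (- int l) = (-1) ^ (L + l) * fact l / fact (L - 1) * (\<Sum>\<eta>\<in>signs M. of_int (esgn \<eta>) * epi (real_of_int 0 * (s \<eta> + real L))
      * of_real (fpoly l L (- s \<eta> / 2)))"
    using FL_nth_neg[of l 0] l by (simp only: atLeastAtMost_iff if_True)
  ultimately show ?thesis by simp
qed

lemma cc_eq: "cc (2 * k) = - ((-1) ^ L / (fact (L - 1) * fact (2 * k))) * of_real (\<Sum>j=1..L. real j / real (2 * k + j) *
     (\<Sum>\<eta>\<in>signs M. of_int (esgn \<eta>) * fpoly j L (- s \<eta> / 2) * bernpoly (2 * k + j) (yy \<eta>)))"
proof -
  have "cc (2 * k) = fls_nth (FL 0) (int (2 * k))" unfolding FL_0_fps cc_def by (simp add: nat_mult_distrib)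
  also have "\<dots> = - ((-1) ^ L / (fact (L - 1) * fact (2 * k))) * (\<Sum>\<eta>\<in>signs M. of_int (esgn \<eta>) * epi (real_of_int 0 * (s \<eta> + real L))
      * of_real (\<Sum>j=1..L. real j / real (2 * k + j) * fpoly j L (- s \<eta> / 2) * bernpoly (2 * k + j) (yy \<eta>)))"
    by (rule FL_nth)
  also have "(\<Sum>\<eta>\<in>signs M. of_int (esgn \<eta>) * epi (real_of_int 0 * (s \<eta> + real L))
      * of_real (\<Sum>j=1..L. real j / real (2 * k + j) * fpoly j L (- s \<eta> / 2) * bernpoly (2 * k + j) (yy \<eta>)))
    = of_real (\<Sum>\<eta>\<in>signs M. \<Sum>j=1..L. real j / real (2 * k + j) * (of_int (esgn \<eta>) * fpoly j L (- s \<eta> / 2) * bernpoly (2 * k + j) (yy \<eta>)))"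
    by (simp add: sum_distrib_left mult_ac)
  also have "(\<Sum>\<eta>\<in>signs M. \<Sum>j=1..L. real j / real (2 * k + j) * (of_int (esgn \<eta>) * fpoly j L (- s \<eta> / 2) * bernpoly (2 * k + j) (yy \<eta>)))
    = (\<Sum>j=1..L. \<Sum>\<eta>\<in>signs M. real j / real (2 * k + j) * (of_int (esgn \<eta>) * fpoly j L (- s \<eta> / 2) * bernpoly (2 * k + j) (yy \<eta>)))"
    by (rule sum.swap)
  finally show ?thesis by (simp only: sum_distrib_left)
qed

text \<open>The shift by (M - 1) P makes the fractional part (zz + 1)/2 for either parity of M, so
  the floor expression in \<open>Tcoeff\<close> is \<open>zz \<eta> / 2\<close>.\<close>

lemma frac_zz:
  assumes \<eta>: "\<eta> \<in> signs M"
  defines "x \<equiv> (real_of_int (nn \<eta> mod (2 * int P)) + real ((M - 1) * P)) / (2 * real P)"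
  shows "x - of_int \<lfloor>x\<rfloor> - 1/2 = zz \<eta> / 2"
proof -
  obtain k where k: "M = 2 * k + (if even M then 0 else 1)"
    by (metis add.right_neutral evenE oddE)
  have "\<exists>c::int. x = (zz \<eta> + 1) / 2 + of_int c"
  proof (cases "even M")
    case False
    then have "x = (zz \<eta> + 1) / 2 + of_int (int k)"
      unfolding x_def mod_nn_zz[OF \<eta>] using P_pos k by (simp add: field_simps)
    then show ?thesis by blast
  next
    case True
    then have "k \<ge> 1" using k M_ge_3 by auto
    then have "x = (zz \<eta> + 1) / 2 + of_int (int k - (if zz \<eta> > 0 then 1 else 0))"
      unfolding x_def mod_nn_zz[OF \<eta>] using True P_pos k by (auto simp: field_simps of_nat_diff)
    then show ?thesis by blast
  qed
  then obtain c :: int where c: "x = (zz \<eta> + 1) / 2 + of_int c" by blast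
  have "\<lfloor>x\<rfloor> = c" using zz_bounds[OF \<eta>] unfolding c by (intro floor_unique) auto
  then show ?thesis by (simp add: c field_simps)
qed

end

subsection \<open>The S-matrix\<close>

lemma prod_dvd_coprime:
  fixes f :: "nat \<Rightarrow> nat" and x :: int
  assumes "finite A" "pairwise (\<lambda>i j. coprime (f i) (f j)) A" "\<And>i. i \<in> A \<Longrightarrow> int (f i) dvd x"
  shows "int (\<Prod>i\<in>A. f i) dvd x"
  using assms
proof (induction A rule: finite_induct)
  case (insert a A)
  have "coprime (f a) (\<Prod>i\<in>A. f i)"
    using insert.prems(1) insert.hyps by (intro prod_coprime_right) (auto simp: pairwise_insert)
  then have "coprime (int (f a)) (int (\<Prod>i\<in>A. f i))" by (simp only: coprime_int_iff)
  moreover have "int (\<Prod>i\<in>A. f i) dvd x"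
    using insert by (auto simp: pairwise_insert)
  ultimately have "int (f a) * int (\<Prod>i\<in>A. f i) dvd x"
    using insert.prems(2)[of a] by (intro divides_mult) auto
  then show ?case using insert.hyps by simp
qed simp

lemma minus_one_powi_eq_epi: "(-1) powi k = epi (real_of_int k)"
  by (simp add: epi_int power_int_minus_left)

text \<open>2 i sin(pi y); at y = m/p_j it is a numerator factor of \<open>F\<close> at 2 pi i
  m.\<close>

definition sn :: "real \<Rightarrow> complex" where "sn y = epi y - epi (- y)"

lemma sn_add_int: "sn (real_of_int k + y) = epi (real_of_int k) * sn y"
proof -
  have "epi (- real_of_int k) = epi (real_of_int k)"
    using epi_int[of k] epi_int[of "- k"] by simp
  moreover have "epi (- (real_of_int k + y)) = epi (- real_of_int k) * epi (- y)"
    by (simp flip: epi_add)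
  ultimately show ?thesis by (simp add: sn_def epi_add right_diff_distrib)
qed

lemma sn_minus: "sn (- y) = - sn y"
  by (simp add: sn_def)

lemma sn_int: "sn (real_of_int k) = 0"
  using sn_add_int[of k 0] by (simp add: sn_def)

lemma sn_sin: "sn y = 2 * \<i> * of_real (sin (y * pi))"
  by (simp add: sn_def epi_diff_minus)

lemma epi_sum: "epi (\<Sum>i\<in>A. f i) = (\<Prod>i\<in>A. epi (f i))"
  by (induction A rule: infinite_finite_induct) (auto simp: epi_add)

lemma epi_parity: "even (a - b) \<Longrightarrow> epi (real_of_int a) = epi (real_of_int b)"
  by (auto simp: epi_int)

lemma epi_of_nat_mult: "epi (real n * x) = epi x ^ n"
  by (induction n) (auto simp: epi_add ring_distribs)

lemma ipow_split: "2 ^ M * ipow (real M - real k) = ipow (- real k) * (2 * \<i>) ^ M"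
proof -
  have "ipow (real M - real k) = epi (real M * (1/2)) * ipow (- real k)"
    by (simp add: ipow_def diff_divide_distrib flip: epi_add)
  also have "epi (real M * (1/2)) = \<i> ^ M"
    by (simp only: epi_of_nat_mult epi_half)
  finally show ?thesis by (simp add: power_mult_distrib)
qed

context seifert
begin

text \<open>The two residues differ by - 2 e_j l_j P/p_j and add up to a multiple of 2 p_j, so their
  squares differ by a multiple of 4P. The phase attached to a tuple is therefore the same at all
  points of the support of its \<open>chi\<close>.\<close>

lemma res_square_flip:
  assumes j: "j \<in> {1..M}"
  shows "[(res M p (e(j := - e j)) l)\<^sup>2 = (res M p e l)\<^sup>2] (mod 4 * int P)"
proof -
  let ?b = "int (P div p j)"
  have "int (p j) dvd (\<Sum>i\<in>{1..M} - {j}. e i * l i * int (P div p i))"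
    using p_dvd_P_div j by (intro dvd_sum dvd_mult) auto
  then obtain z where z: "(\<Sum>i\<in>{1..M} - {j}. e i * l i * int (P div p i)) = int (p j) * z" by blast
  have sp: "res M p f l = int (p j) * ?b + (f j * l j * ?b + (\<Sum>i\<in>{1..M} - {j}. f i * l i * int (P div p i)))" for f
    unfolding res_def using j int_P_eq[OF j] by (simp add: sum.remove[of _ j])
  have "(\<Sum>i\<in>{1..M} - {j}. (e(j := - e j)) i * l i * int (P div p i)) = int (p j) * z"
    unfolding z[symmetric] by (intro sum.cong) auto
  then have r: "res M p (e(j := - e j)) l = int (p j) * ?b + (- e j * l j * ?b + int (p j) * z)"
    "res M p e l = int (p j) * ?b + (e j * l j * ?b + int (p j) * z)"
    unfolding sp[of e] sp[of "e(j := - e j)"] z by simp_all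
  have "(res M p (e(j := - e j)) l)\<^sup>2 - (res M p e l)\<^sup>2 = 4 * (int (p j) * ?b) * (- (e j * l j * (?b + z)))"
    unfolding r by (simp add: power2_eq_square algebra_simps)
  then show ?thesis unfolding int_P_eq[OF j, symmetric] cong_iff_dvd_diff by simp
qed

lemma ee_res:
  assumes e: "e \<in> signs M" and n: "[n = res M p e l] (mod 2 * int P)"
  shows "epi (- (real N * (real P / 2) * (1 + (\<Sum>i=1..M. real_of_int (l i) / real (p i))) ^ 2)) = ee N n"
proof -
  let ?o = "\<lambda>j\<in>{1..M}. 1 :: int"
  have "(res M p e l)\<^sup>2 mod (4 * int P) = (res M p ?o l)\<^sup>2 mod (4 * int P)"
    by (rule signs_flip_invariant[OF _ e]) (simp only: res_square_flip[unfolded cong_def])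
  then have "[- int N * (res M p e l)\<^sup>2 = - int N * (res M p ?o l)\<^sup>2] (mod 4 * int P)"
    by (intro cong_mult cong_refl) (simp add: cong_def)
  from epi_cong[OF this P_pos] have "ee N (res M p e l) = ee N (res M p ?o l)"
    by simp
  moreover have "ee N n = ee N (res M p e l)"
    using gs_cong[OF n cong_refl, of N 0] by (simp add: gs_eq)
  moreover have "real_of_int (res M p ?o l) = real P * (1 + (\<Sum>i=1..M. real_of_int (l i) / real (p i)))"
  proof -
    have "(\<Sum>j=1..M. real_of_int (?o j * l j * int (P div p j))) = (\<Sum>j=1..M. real P * (real_of_int (l j) / real (p j)))"
      by (intro sum.cong refl) (auto simp: real_P_div)
    then show ?thesis by (simp add: res_def sum_distrib_left algebra_simps)
  qed
  moreover have "real N * (real P * x)\<^sup>2 / (2 * real P) = real N * (real P / 2) * x\<^sup>2" for x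
    using P_pos by (simp add: power2_eq_square field_simps)
  ultimately show ?thesis by (simp only:)
qed

text \<open>A single flip of the tuple moves the residues by P or - P, up to a change of sign
  vector. Two flips move them by a multiple of 2P, which is why classes are formed by pairs of
  flips.\<close>

lemma res_flip:
  assumes j: "j \<in> {1..M}"
  shows "res M p e (flip p j l) = res M p (e(j := - e j)) l + e j * int P"
proof -
  have "res M p e (flip p j l) = int P + (e j * (int (p j) - l j) * int (P div p j) + (\<Sum>i\<in>{1..M}-{j}. e i * l i * int (P div p i)))"
    unfolding res_def flip_def using j by (simp add: sum.remove[of _ j])
  moreover have "res M p (e(j := - e j)) l = int P + (- e j * l j * int (P div p j) + (\<Sum>i\<in>{1..M}-{j}. e i * l i * int (P div p i)))"
    unfolding res_def using j by (simp add: sum.remove[of _ j])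
  moreover have "e j * int P = e j * (int (p j) * int (P div p j))" using int_P_eq[OF j] by simp
  ultimately show ?thesis by (simp only: ring_distribs)
qed

section \<open>Classes of tuples and the supports of the functions \<open>chi\<close>\<close>

definition hits :: "int \<Rightarrow> (nat \<Rightarrow> int) \<Rightarrow> bool" where
  "hits n l \<longleftrightarrow> l \<in> tuples M p \<and> (\<exists>e\<in>signs M. [n = res M p e l] (mod 2 * int P))"

lemma hits_flip2:
  assumes h: "hits n l" and i: "i \<in> {1..M}" and j: "j \<in> {1..M}"
  shows "hits n (flip p i (flip p j l))"
proof -
  obtain e where e: "e \<in> signs M" "[n = res M p e l] (mod 2 * int P)" and l: "l \<in> tuples M p"
    using h by (auto simp: hits_def)
  define f where "f = e(j := - e j)"
  define g where "g = f(i := - f i)"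
  have f: "f \<in> signs M" and g: "g \<in> signs M"
    unfolding g_def f_def using signs_flip[OF i signs_flip[OF j e(1)]] signs_flip[OF j e(1)] by auto
  have fe: "f(j := - f j) = e" and gf: "g(i := - g i) = f" by (auto simp: f_def g_def fun_eq_iff)
  have "res M p g (flip p i (flip p j l)) = res M p e l + (f j + g i) * int P"
    unfolding res_flip[OF i] res_flip[OF j] gf fe by (simp add: algebra_simps)
  moreover have "even (f j + g i)"
    using signs_cases[OF f j] signs_cases[OF g i] by auto
  ultimately have "[res M p e l = res M p g (flip p i (flip p j l))] (mod 2 * int P)"
    by (auto simp: cong_iff_dvd_diff elim!: evenE)
  then have "[n = res M p g (flip p i (flip p j l))] (mod 2 * int P)"
    by (rule cong_trans[OF e(2)])
  moreover have "flip p i (flip p j l) \<in> tuples M p"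
    by (intro flip_tuples i j l)
  ultimately show ?thesis using g by (auto simp: hits_def)
qed

lemma hits_equiv:
  assumes "tuple_equiv M p l l'" "hits n l"
  shows "hits n l'"
  using assms(1) unfolding tuple_equiv_def
proof (induction rule: equivclp_induct)
  case base
  show ?case by (rule assms(2))
next
  case (step y z)
  from step(2) show ?case
  proof
    assume "\<exists>i\<in>{1..M}. \<exists>j\<in>{1..M}. z = flip p i (flip p j y)"
    then show ?thesis using hits_flip2[OF step(3)] by blast
  next
    assume "\<exists>i\<in>{1..M}. \<exists>j\<in>{1..M}. y = flip p i (flip p j z)"
    then obtain i j where ij: "i \<in> {1..M}" "j \<in> {1..M}" "y = flip p i (flip p j z)" by blast
    then have "z = flip p j (flip p i y)" by (simp add: flip_flip)
    then show ?thesis using hits_flip2[OF step(3) ij(2,1)] by simp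
  qed
qed

definition flips :: "nat set \<Rightarrow> (nat \<Rightarrow> int) \<Rightarrow> nat \<Rightarrow> int" where
  "flips D l = (\<lambda>j\<in>{1..M}. if j \<in> D then int (p j) - l j else l j)"

text \<open>Positions are removed from D two at a time, each pair being one generator of the
  equivalence.\<close>

lemma flips_equiv:
  assumes "D \<subseteq> {1..M}" "even (card D)" "l \<in> tuples M p"
  shows "tuple_equiv M p l (flips D l)"
  using assms(1,2)
proof (induction "card D" arbitrary: D rule: less_induct)
  case less
  have fin: "finite D" using less.prems(1) finite_subset by blast
  show ?case
  proof (cases "D = {}")
    case True
    have "flips D l = l"
      using assms(3) by (auto simp: flips_def True tuples_def PiE_def extensional_def fun_eq_iff)
    then show ?thesis by (simp add: tuple_equiv_def equivclp_refl)
  next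
    case False
    then obtain i where i: "i \<in> D" by blast
    have "card D \<noteq> 1" using less.prems(2) by auto
    then have "D - {i} \<noteq> {}" using i by (metis card_1_singleton_iff Diff_eq_empty_iff subset_singletonD empty_iff One_nat_def)
    then obtain j where j: "j \<in> D" "j \<noteq> i" by blast
    let ?D = "D - {i} - {j}"
    have c: "card D = Suc (Suc (card ?D))"
      using i j fin by (metis card.remove Diff_iff finite_Diff singletonD)
    then have "tuple_equiv M p l (flips ?D l)"
      using less.prems by (intro less.hyps) auto
    moreover have "flips D l = flip p i (flip p j (flips ?D l))"
      using i j less.prems(1) by (auto simp: flips_def flip_def fun_eq_iff)
    ultimately show ?thesis unfolding tuple_equiv_def
      using i j less.prems(1) by (elim equivclp_into_equivclp) blast
  qed
qed

text \<open>Modulo p_j the common residue determines e_j l_j, so l'_j is l_j where the signs agree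
  and p_j - l_j where they differ. The difference of the two residues is then P times a sum of signs
  over the flipped positions, and divisibility by 2P makes their number even.\<close>

lemma hits_unique:
  assumes "hits n l" "hits n l'"
  shows "tuple_equiv M p l l'"
proof -
  obtain e where e: "e \<in> signs M" "[n = res M p e l] (mod 2 * int P)" and l: "l \<in> tuples M p"
    using assms(1) by (auto simp: hits_def)
  obtain e' where e': "e' \<in> signs M" "[n = res M p e' l'] (mod 2 * int P)" and l': "l' \<in> tuples M p"
    using assms(2) by (auto simp: hits_def)
  define v where "v i = e i * l i - e' i * l' i" for i
  have "[res M p e l = res M p e' l'] (mod 2 * int P)"
    by (rule cong_trans[OF cong_sym[OF e(2)] e'(2)])
  moreover have "res M p e l - res M p e' l' = (\<Sum>i=1..M. v i * int (P div p i))"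
    by (simp add: res_def v_def sum_subtractf left_diff_distrib)
  ultimately have d: "2 * int P dvd (\<Sum>i=1..M. v i * int (P div p i))"
    by (simp add: cong_iff_dvd_diff)
  define D where "D = {j\<in>{1..M}. e j \<noteq> e' j}"
  have lb: "0 < l j" "l j < int (p j)" "0 < l' j" "l' j < int (p j)" if "j \<in> {1..M}" for j
    using l l' that by (auto simp: tuples_def PiE_def Pi_def)
  have pv: "int (p j) dvd v j" if j: "j \<in> {1..M}" for j
  proof -
    obtain z where z: "(\<Sum>i=1..M. v i * int (P div p i)) = v j * int (P div p j) + int (p j) * z"
      using sum_P_div_split[OF j] by blast
    have "int (p j) dvd (\<Sum>i=1..M. v i * int (P div p i))"
      using d p_dvd_P[OF j] by (meson dvd_trans dvd_triv_right int_dvd_int_iff)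
    then show ?thesis using p_not_dvd_unit_mult[OF j _ z] by blast
  qed
  have out: "l' j = l j" if j: "j \<in> {1..M}" "j \<notin> D" for j
  proof -
    have "v j = e j * (l j - l' j)" using j by (simp add: v_def D_def right_diff_distrib)
    then have "int (p j) dvd l j - l' j" using pv[OF j(1)] signs_cases[OF e(1) j(1)] by (auto simp: dvd_diff_commute)
    moreover have "\<bar>l j - l' j\<bar> < int (p j)" using lb[OF j(1)] by auto
    ultimately have "l j - l' j = 0" using dvd_imp_le_int[of "l j - l' j" "int (p j)"] by force
    then show ?thesis by simp
  qed
  have inD: "l' j = int (p j) - l j \<and> v j = e j * int (p j)" if j: "j \<in> D" for j
  proof -
    have jM: "j \<in> {1..M}" using j by (simp add: D_def)
    have "e' j = - e j" using signs_cases[OF e(1) jM] signs_cases[OF e'(1) jM] j by (auto simp: D_def)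
    then have vj: "v j = e j * (l j + l' j)" by (simp add: v_def distrib_left)
    then have "l j + l' j = e j * v j" using signs_cases[OF e(1) jM] by auto
    then have "int (p j) dvd l j + l' j" using pv[OF jM] by (simp only: dvd_mult)
    then obtain k where k: "l j + l' j = int (p j) * k" by blast
    have "0 < int (p j) * k" "int (p j) * k < int (p j) * 2" using lb[OF jM] k by linarith+
    then have "0 < k" "k < 2" using p_pos[OF jM] by (simp_all add: zero_less_mult_iff)
    then have "k = 1" by simp
    then show ?thesis using k vj by auto
  qed
  have "l' = flips D l"
    using l' out inD by (auto simp: flips_def tuples_def PiE_def extensional_def fun_eq_iff D_def)
  moreover have "even (card D)"
  proof -
    have vz: "v j = 0" if "j \<in> {1..M} - D" for j using that out[of j] by (auto simp: v_def D_def)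
    have "(\<Sum>i=1..M. v i * int (P div p i)) = (\<Sum>i\<in>D. v i * int (P div p i))"
      using vz by (intro sum.mono_neutral_right) (auto simp: D_def)
    also have "\<dots> = (\<Sum>i\<in>D. e i * int P)"
    proof (intro sum.cong refl)
      fix i assume i: "i \<in> D"
      then have "i \<in> {1..M}" by (simp add: D_def)
      then show "v i * int (P div p i) = e i * int P"
        using inD[OF i] int_P_eq[of i] by (simp add: mult.assoc)
    qed
    also have "\<dots> = (\<Sum>i\<in>D. e i) * int P" by (simp add: sum_distrib_right)
    finally have "2 * int P dvd (\<Sum>i\<in>D. e i) * int P" using d by simp
    then have "even (\<Sum>i\<in>D. e i)" using P_pos by simp
    moreover have "even (\<Sum>i\<in>D. e i) \<longleftrightarrow> even (\<Sum>i\<in>D. 1 :: int)"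
    proof -
      have "even ((\<Sum>i\<in>D. e i) - (\<Sum>i\<in>D. 1))"
        unfolding sum_subtractf[symmetric] using signs_cases[OF e(1)] by (intro dvd_sum) (force simp: D_def)
      then show ?thesis by simp
    qed
    ultimately show ?thesis by simp
  qed
  moreover have "D \<subseteq> {1..M}" by (auto simp: D_def)
  ultimately show ?thesis using flips_equiv[OF _ _ l, of D] by simp
qed

text \<open>The congruences x_j P/p_j = n modulo p_j are solvable with 0 < x_j < p_j, and
  coprimality joins them to a congruence modulo P for the residue with all signs 1. If the defect is
  an odd multiple of P, a flip of the first entry corrects it.\<close>

lemma hits_exists:
  assumes n: "\<And>j. j \<in> {1..M} \<Longrightarrow> \<not> int (p j) dvd n"
  shows "\<exists>l. hits n l"
proof -
  have "\<exists>x. 0 < x \<and> x < int (p j) \<and> [x * int (P div p j) = n] (mod int (p j))" if j: "j \<in> {1..M}" for j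
  proof -
    have "coprime (int (P div p j)) (int (p j))"
      using coprime_p_P_div[OF j] by (simp add: coprime_commute)
    then obtain y where y: "[int (P div p j) * y = 1] (mod int (p j))"
      using cong_solve_coprime_int by blast
    define x where "x = n * y mod int (p j)"
    have "[x * int (P div p j) = n * y * int (P div p j)] (mod int (p j))"
      by (intro cong_mult cong_refl) (simp add: x_def cong_def)
    also have "[n * y * int (P div p j) = n * (int (P div p j) * y)] (mod int (p j))" by (simp add: mult_ac)
    also have "[n * (int (P div p j) * y) = n * 1] (mod int (p j))" by (intro cong_mult cong_refl y)
    finally have c: "[x * int (P div p j) = n] (mod int (p j))" by simp
    have "x \<noteq> 0"
    proof
      assume "x = 0"
      then have "int (p j) dvd n" using c by (simp add: cong_def mod_eq_0_iff_dvd eq_commute[of 0])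
      then show False using n[OF j] by simp
    qed
    moreover have "0 \<le> x" "x < int (p j)" using p_pos[OF j] by (auto simp: x_def)
    ultimately show ?thesis using c by (intro exI[of _ x]) auto
  qed
  then obtain x where x: "\<And>j. j \<in> {1..M} \<Longrightarrow> 0 < x j \<and> x j < int (p j) \<and> [x j * int (P div p j) = n] (mod int (p j))"
    by metis
  define l where "l = (\<lambda>j\<in>{1..M}. x j)"
  define o1 where "o1 = (\<lambda>j\<in>{1..M}. 1 :: int)"
  have l: "l \<in> tuples M p" using x by (auto simp: l_def tuples_def)
  have o1: "o1 \<in> signs M" by (auto simp: o1_def signs_def)
  have "int (\<Prod>j\<in>{1..M}. p j) dvd n - res M p o1 l"
  proof (rule prod_dvd_coprime[OF _ p_coprime])
    fix j assume j: "j \<in> {1..M}"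
    obtain z where z: "(\<Sum>i=1..M. o1 i * l i * int (P div p i)) = o1 j * l j * int (P div p j) + int (p j) * z"
      using sum_P_div_split[OF j, of "\<lambda>i. o1 i * l i"] by blast
    have "res M p o1 l = x j * int (P div p j) + int (p j) * (int (P div p j) + z)"
      unfolding res_def z using j by (subst int_P_eq[OF j]) (simp add: o1_def l_def algebra_simps)
    then have "n - res M p o1 l = - (x j * int (P div p j) - n) - int (p j) * (int (P div p j) + z)" by simp
    moreover have "int (p j) dvd x j * int (P div p j) - n" using x[OF j] by (simp add: cong_iff_dvd_diff)
    ultimately show "int (p j) dvd n - res M p o1 l" by (metis dvd_diff dvd_minus_iff dvd_triv_left)
  qed simp
  then obtain t where t: "n - res M p o1 l = int P * t" unfolding prodP_def by blast
  show ?thesis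
  proof (cases "even t")
    case True
    then have "[n = res M p o1 l] (mod 2 * int P)" using t by (auto simp: cong_iff_dvd_diff elim!: evenE)
    then show ?thesis using l o1 by (auto simp: hits_def)
  next
    case False
    define f where "f = o1(1 := - o1 1)"
    have f: "f \<in> signs M" unfolding f_def by (rule signs_flip[OF one_in o1])
    have ff: "f(1 := - f 1) = o1" by (auto simp: f_def fun_eq_iff)
    have "n - res M p f (flip p 1 l) = int P * (t - f 1)"
      unfolding res_flip[OF one_in] ff using t by (simp add: algebra_simps)
    moreover have "even (t - f 1)" using False signs_cases[OF f one_in] by auto
    ultimately have "[n = res M p f (flip p 1 l)] (mod 2 * int P)" by (auto simp: cong_iff_dvd_diff elim!: evenE)
    then show ?thesis using f flip_tuples[OF one_in l] by (auto simp: hits_def)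
  qed
qed

section \<open>Sign bookkeeping for the S-matrix\<close>

definition PP :: "nat \<Rightarrow> nat \<Rightarrow> int" where "PP j k = int (P div (p j * p k))"

lemma PP_mult:
  assumes "j \<in> {1..M}" "k \<in> {1..M}" "j \<noteq> k"
  shows "PP j k * int (p k) = int (P div p j)" "PP j k * int (p j) = int (P div p k)" "real_of_int (PP j k) = real P / (real (p j) * real (p k))"
proof -
  have "p k dvd P div p j" using p_dvd_P_div[of j k] assms by auto
  then obtain c where c: "P div p j = p k * c" by blast
  then have P: "P = p j * p k * c" using P_div_mult[OF assms(1)] by (simp add: mult.assoc)
  have pos: "p j > 0" "p k > 0" using p_pos assms by auto
  then have "P div (p j * p k) = c" "P div p k = p j * c" unfolding P by simp_all
  then show "PP j k * int (p k) = int (P div p j)" "PP j k * int (p j) = int (P div p k)" "real_of_int (PP j k) = real P / (real (p j) * real (p k))"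
    using c pos by (simp_all add: PP_def) (simp add: P)
qed

text \<open>After division by p_j only e_j l_j P/p_j^2 may fail to be an integer, because p_j
  divides P/p_i for i \<noteq> j. Integer shifts of \<open>sn\<close> produce nothing but signs,
  which \<open>AA\<close> collects.\<close>

lemma sn_res:
  assumes e: "e \<in> signs M" and j: "j \<in> {1..M}"
  shows "sn (real_of_int (res M p e l) / real (p j))
    = epi (real_of_int (int (P div p j) + (\<Sum>i\<in>{1..M}-{j}. e i * l i * PP j i))) * (of_int (e j) * sn (real P * real_of_int (l j) / real (p j) ^ 2))"
proof -
  have pj: "real (p j) \<noteq> 0" using p_pos[OF j] by simp
  have "real_of_int (res M p e l) / real (p j) = real P / real (p j) + (real_of_int (e j * l j) * real (P div p j) / real (p j)
     + (\<Sum>i\<in>{1..M}-{j}. real_of_int (e i * l i) * real (P div p i) / real (p j)))"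
    unfolding res_def using j by (simp add: sum.remove[of _ j] add_divide_distrib sum_divide_distrib)
  also have "real P / real (p j) = real_of_int (int (P div p j))" using real_P_div[OF j] by simp
  also have "(\<Sum>i\<in>{1..M}-{j}. real_of_int (e i * l i) * real (P div p i) / real (p j)) = (\<Sum>i\<in>{1..M}-{j}. real_of_int (e i * l i * PP j i))"
  proof (intro sum.cong refl)
    fix i assume i: "i \<in> {1..M} - {j}"
    then have "real_of_int (PP j i) = real (P div p i) / real (p j)"
      using PP_mult(3)[of j i] real_P_div[of i] j by (simp add: mult.commute)
    then show "real_of_int (e i * l i) * real (P div p i) / real (p j) = real_of_int (e i * l i * PP j i)" by simp
  qed
  also have "real_of_int (e j * l j) * real (P div p j) / real (p j) = real_of_int (e j) * (real P * real_of_int (l j) / real (p j) ^ 2)"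
    using real_P_div[OF j] by (simp add: power2_eq_square)
  finally have "real_of_int (res M p e l) / real (p j) = real_of_int (int (P div p j) + (\<Sum>i\<in>{1..M}-{j}. e i * l i * PP j i))
     + real_of_int (e j) * (real P * real_of_int (l j) / real (p j) ^ 2)"
    by simp
  moreover have "sn (real_of_int (e j) * y) = of_int (e j) * sn y" for y
    using signs_cases[OF e j] by (auto simp: sn_minus)
  ultimately show ?thesis by (simp only: sn_add_int)
qed

definition AA :: "(nat \<Rightarrow> int) \<Rightarrow> (nat \<Rightarrow> int) \<Rightarrow> int" where
  "AA e l = (\<Sum>j=1..M. int (P div p j) + (\<Sum>i\<in>{1..M}-{j}. e i * l i * PP j i))"

lemma prod_sn_res:
  assumes e: "e \<in> signs M"
  shows "(\<Prod>j=1..M. sn (real_of_int (res M p e l) / real (p j)))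
    = epi (real_of_int (AA e l)) * (of_int (esgn e) * (\<Prod>j=1..M. sn (real P * real_of_int (l j) / real (p j) ^ 2)))"
proof -
  have "(\<Prod>j=1..M. sn (real_of_int (res M p e l) / real (p j)))
    = (\<Prod>j=1..M. epi (real_of_int (int (P div p j) + (\<Sum>i\<in>{1..M}-{j}. e i * l i * PP j i))) * (of_int (e j) * sn (real P * real_of_int (l j) / real (p j) ^ 2)))"
    by (intro prod.cong refl sn_res e)
  also have "\<dots> = epi (real_of_int (AA e l)) * (of_int (esgn e) * (\<Prod>j=1..M. sn (real P * real_of_int (l j) / real (p j) ^ 2)))"
    by (simp only: prod.distrib epi_sum[symmetric] AA_def esgn_def of_int_sum of_int_prod)
  finally show ?thesis .
qed

definition XE :: "(nat \<Rightarrow> int) \<Rightarrow> (nat \<Rightarrow> int) \<Rightarrow> int" where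
  "XE l l' = int P + (\<Sum>j=1..M. (l j + l' j) * int (P div p j)) + (\<Sum>j=1..M. \<Sum>k\<in>{1..M} - {j}. l j * l' k * PP j k)"

lemma Smat_sn:
  "Smat M p l l' = ipow (- real (m2 M)) / of_real (sqrt (2 * real P)) * epi (real_of_int (XE l l'))
    * (\<Prod>j=1..M. sn (real P * (real_of_int (l j) * real_of_int (l' j) / real (p j) ^ 2)))"
proof -
  have "(\<Prod>j=1..M. sn (real P * (real_of_int (l j) * real_of_int (l' j) / real (p j) ^ 2)))
    = (2 * \<i>) ^ M * of_real (\<Prod>j=1..M. sin (real P * (real_of_int (l j) * real_of_int (l' j) / real (p j) ^ 2) * pi))"
    unfolding sn_sin by (simp add: prod.distrib)
  then show ?thesis
    unfolding Smat_def Let_def minus_one_powi_eq_epi ipow_split XE_def PP_def by simp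
qed

lemma prod_sn_l0:
  "(\<Prod>j=1..M. sn (real P * (real_of_int (l0 j) * real_of_int (l j) / real (p j) ^ 2)))
    = (if even M then - epi (real_of_int (l 1 * int (P div p 1))) else 1) * (\<Prod>j=1..M. sn (real P * real_of_int (l j) / real (p j) ^ 2))"
proof (cases "even M")
  case False
  have "(\<Prod>j=1..M. sn (real P * (real_of_int (l0 j) * real_of_int (l j) / real (p j) ^ 2))) = (\<Prod>j=1..M. sn (real P * real_of_int (l j) / real (p j) ^ 2))"
    using False by (intro prod.cong refl) (simp add: l0_eq allones_def)
  then show ?thesis using False by simp
next
  case True
  have p1: "real (p 1) \<noteq> 0" using p_pos[OF one_in] by simp
  have "real P * (real_of_int (l0 1) * real_of_int (l 1) / real (p 1) ^ 2) = real_of_int (l 1 * int (P div p 1)) + - (real P * real_of_int (l 1) / real (p 1) ^ 2)"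
    using True one_in p1 real_P_div[OF one_in] by (simp add: l0_eq allones_def flip_def power2_eq_square field_simps)
  then have 1: "sn (real P * (real_of_int (l0 1) * real_of_int (l 1) / real (p 1) ^ 2)) = - epi (real_of_int (l 1 * int (P div p 1))) * sn (real P * real_of_int (l 1) / real (p 1) ^ 2)"
    by (simp only: sn_add_int sn_minus) simp
  have 2: "(\<Prod>j\<in>{1..M}-{1}. sn (real P * (real_of_int (l0 j) * real_of_int (l j) / real (p j) ^ 2))) = (\<Prod>j\<in>{1..M}-{1}. sn (real P * real_of_int (l j) / real (p j) ^ 2))"
    using True by (intro prod.cong refl) (simp add: l0_eq allones_def flip_def)
  show ?thesis
    unfolding prod.remove[OF finite_atLeastAtMost one_in] 1 2 using True by (simp add: mult.assoc)
qed

text \<open>Modulo 2 the signs e_i may be replaced by 1, after which the exponents match. For even M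
  the first entry of \<open>l0\<close> exceeds 1 by p_1 - 2; by p_1 P/(p_1 p_k) = P/p_k this excess
  doubles P and the terms l_k P/p_k with k \<noteq> 1, up to further even terms.\<close>

lemma parity_XE:
  assumes e: "e \<in> signs M"
  shows "even (XE l0 l + (if even M then l 1 * int (P div p 1) else 0) - (AA e l + res M p e l * int L))"
proof -
  have ee: "even (1 - e j)" if "j \<in> {1..M}" for j using signs_cases[OF e that] by auto
  have d1: "even (\<Sum>j=1..M. \<Sum>i\<in>{1..M}-{j}. (1 - e i) * (l i * PP j i))"
    using ee by (intro dvd_sum) auto
  have d2: "even (\<Sum>j=1..M. (1 - e j) * (l j * int (P div p j)))"
    using ee by (intro dvd_sum) auto
  show ?thesis
  proof (cases "even M")
    case False
    have L: "odd L" using False even_M by simp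
    have l01: "l0 j = 1" if "j \<in> {1..M}" for j using False that by (simp add: l0_eq allones_def)
    have "XE l0 l = int P + (\<Sum>j=1..M. (1 + l j) * int (P div p j)) + (\<Sum>j=1..M. \<Sum>k\<in>{1..M} - {j}. l k * PP j k)"
      unfolding XE_def using l01 by simp
    then have "XE l0 l - (AA e l + res M p e l) = (\<Sum>j=1..M. (1 - e j) * (l j * int (P div p j)))
       + (\<Sum>j=1..M. \<Sum>i\<in>{1..M}-{j}. (1 - e i) * (l i * PP j i))"
      by (simp add: AA_def res_def sum.distrib sum_subtractf algebra_simps)
    then have "even (XE l0 l - (AA e l + res M p e l))" using d1 d2 by simp
    then show ?thesis using L False by simp
  next
    case True
    have L: "even L" using True even_M by simp
    let ?q = "int (p 1) - 2"
    have l01: "l0 j = (if j = 1 then 1 + ?q else 1)" if "j \<in> {1..M}" for j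
      using True that by (simp add: l0_eq allones_def flip_def)
    have a: "(\<Sum>j=1..M. (l0 j + l j) * int (P div p j)) = (\<Sum>j=1..M. (1 + l j) * int (P div p j)) + ?q * int (P div p 1)"
    proof -
      have "(\<Sum>j=1..M. (l0 j + l j) * int (P div p j)) = (\<Sum>j=1..M. (1 + l j) * int (P div p j) + (if j = 1 then ?q * int (P div p 1) else 0))"
        by (intro sum.cong refl) (auto simp: l01 algebra_simps)
      then show ?thesis using one_in by (simp add: sum.distrib)
    qed
    have b: "(\<Sum>j=1..M. \<Sum>k\<in>{1..M} - {j}. l0 j * l k * PP j k) = (\<Sum>j=1..M. \<Sum>k\<in>{1..M} - {j}. l k * PP j k) + (\<Sum>k\<in>{1..M} - {1}. ?q * l k * PP 1 k)"
    proof -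
      have "(\<Sum>j=1..M. \<Sum>k\<in>{1..M} - {j}. l0 j * l k * PP j k) = (\<Sum>j=1..M. (\<Sum>k\<in>{1..M} - {j}. l k * PP j k) + (if j = 1 then (\<Sum>k\<in>{1..M} - {1}. ?q * l k * PP 1 k) else 0))"
        by (intro sum.cong refl) (auto simp: l01 sum.distrib[symmetric] algebra_simps)
      then show ?thesis using one_in by (simp add: sum.distrib)
    qed
    have c: "(\<Sum>k\<in>{1..M} - {1}. ?q * l k * PP 1 k) = (\<Sum>k\<in>{1..M} - {1}. l k * int (P div p k)) - 2 * (\<Sum>k\<in>{1..M} - {1}. l k * PP 1 k)"
      unfolding sum_distrib_left sum_subtractf[symmetric]
    proof (intro sum.cong refl)
      fix k assume k: "k \<in> {1..M} - {1}"
      show "?q * l k * PP 1 k = l k * int (P div p k) - 2 * (l k * PP 1 k)"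
        using PP_mult(2)[of 1 k] k one_in by (simp add: algebra_simps flip: PP_mult(2)[of 1 k])
    qed
    have d: "?q * int (P div p 1) = int P - 2 * int (P div p 1)"
      using int_P_eq[OF one_in] by (simp add: algebra_simps)
    have f: "(\<Sum>j=1..M. l j * int (P div p j)) = l 1 * int (P div p 1) + (\<Sum>k\<in>{1..M} - {1}. l k * int (P div p k))"
      using one_in by (simp add: sum.remove[of _ 1])
    define U where "U = (\<Sum>k\<in>{1..M} - {1}. l k * int (P div p k))"
    define V where "V = (\<Sum>k\<in>{1..M} - {1}. l k * PP 1 k)"
    have "XE l0 l + l 1 * int (P div p 1) - AA e l = 2 * (int P - int (P div p 1) + l 1 * int (P div p 1) + U - V)
       + (\<Sum>j=1..M. \<Sum>i\<in>{1..M}-{j}. (1 - e i) * (l i * PP j i))"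
      unfolding XE_def a b c d AA_def U_def[symmetric] V_def[symmetric]
      using f unfolding U_def[symmetric]
      by (simp add: sum.distrib sum_subtractf algebra_simps)
    then have "even (XE l0 l + l 1 * int (P div p 1) - AA e l)" using d1 by (simp only: dvd_add dvd_triv_left)
    moreover have "even (res M p e l * int L)" using L by simp
    ultimately show ?thesis using True by (simp add: algebra_simps)
  qed
qed

lemma Smat_res:
  assumes e: "e \<in> signs M"
  shows "- of_int (esgn e) * Smat M p l0 l = (-1) ^ M * ipow (- real (m2 M)) / of_real (sqrt (2 * real P))
    * (epi (real_of_int (res M p e l * int L)) * (\<Prod>j=1..M. sn (real_of_int (res M p e l) / real (p j))))"
proof -
  let ?S = "\<Prod>j=1..M. sn (real P * real_of_int (l j) / real (p j) ^ 2)"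
  let ?C = "ipow (- real (m2 M)) / complex_of_real (sqrt (2 * real P))"
  have par: "epi (real_of_int (XE l0 l + (if even M then l 1 * int (P div p 1) else 0))) = epi (real_of_int (AA e l + res M p e l * int L))"
    by (rule epi_parity[OF parity_XE[OF e]])
  have "- of_int (esgn e) * Smat M p l0 l = ?C * (-1) ^ M * (epi (real_of_int (XE l0 l + (if even M then l 1 * int (P div p 1) else 0)))) * of_int (esgn e) * ?S"
    unfolding Smat_sn prod_sn_l0 by (cases "even M") (simp_all add: epi_add)
  also have "\<dots> = ?C * (-1) ^ M * (epi (real_of_int (res M p e l * int L)) * (epi (real_of_int (AA e l)) * (of_int (esgn e) * ?S)))"
    unfolding par unfolding of_int_add epi_add by (simp only: mult_ac)
  finally show ?thesis unfolding prod_sn_res[OF e] by simp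
qed

text \<open>For fixed m at most one representative has m in the support of its \<open>chi\<close>,
  since inequivalent tuples have disjoint supports. Its entry of the S-matrix is, up to the sign in
  \<open>chi\<close>, the product of sines at m by \<open>Smat_res\<close>. If some p_j divides m,
  both sides vanish.\<close>

lemma sum_Smat_chi:
  assumes R: "representatives M p R"
  shows "(\<Sum>l\<in>R. Smat M p l0 l * of_int (chi M p l m)) = (-1) ^ M * ipow (- real (m2 M)) / of_real (sqrt (2 * real P))
    * (epi (real_of_int (m * int L)) * (\<Prod>j=1..M. sn (real_of_int m / real (p j))))"
proof (cases "\<exists>j\<in>{1..M}. int (p j) dvd m")
  case True
  then obtain j where j: "j \<in> {1..M}" "int (p j) dvd m" by blast
  have RT: "R \<subseteq> tuples M p" using R by (simp add: representatives_def)
  have "(\<Sum>l\<in>R. Smat M p l0 l * of_int (chi M p l m)) = 0"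
    using chi_multiple[OF _ j] RT by (intro sum.neutral) auto
  moreover have "sn (real_of_int m / real (p j)) = 0"
  proof -
    obtain k where "m = int (p j) * k" using j by blast
    then show ?thesis using p_pos[OF j(1)] sn_int[of k] by simp
  qed
  then have "(\<Prod>j=1..M. sn (real_of_int m / real (p j))) = 0" using j by (intro prod_zero) auto
  ultimately show ?thesis by simp
next
  case False
  have RT: "R \<subseteq> tuples M p" using R by (simp add: representatives_def)
  have fin: "finite R"
    by (rule finite_subset[OF RT]) (auto simp: tuples_def intro!: finite_PiE)
  obtain l where l: "hits m l" using hits_exists[of m] False by blast
  then obtain r where r: "r \<in> R" "tuple_equiv M p l r"
    using R by (auto simp: representatives_def hits_def)
  have hr: "hits m r" by (rule hits_equiv[OF r(2) l])
  then obtain e where e: "e \<in> signs M" "[m = res M p e r] (mod 2 * int P)" and rt: "r \<in> tuples M p"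
    by (auto simp: hits_def)
  have zero: "chi M p r' m = 0" if r': "r' \<in> R" "r' \<noteq> r" for r'
  proof (rule chi_eq_0)
    fix e' assume e': "e' \<in> signs M"
    show "\<not> [m = res M p e' r'] (mod 2 * int P)"
    proof
      assume "[m = res M p e' r'] (mod 2 * int P)"
      then have "hits m r'" using e' r' RT by (auto simp: hits_def)
      then have "tuple_equiv M p r' r" using hits_unique hr by blast
      moreover have "tuple_equiv M p r' r'" by (simp add: tuple_equiv_def equivclp_refl)
      ultimately show False using R r' r(1) RT unfolding representatives_def by blast
    qed
  qed
  have "(\<Sum>l\<in>R. Smat M p l0 l * of_int (chi M p l m)) = (\<Sum>l\<in>{r}. Smat M p l0 l * of_int (chi M p l m))"
    using zero r fin by (intro sum.mono_neutral_right) auto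
  also have "\<dots> = - of_int (esgn e) * Smat M p l0 r"
    using chi_res[OF rt e] by simp
  also have "\<dots> = (-1) ^ M * ipow (- real (m2 M)) / of_real (sqrt (2 * real P))
    * (epi (real_of_int (res M p e r * int L)) * (\<Prod>j=1..M. sn (real_of_int (res M p e r) / real (p j))))"
    by (rule Smat_res[OF e(1)])
  also have "(\<Prod>j=1..M. sn (real_of_int (res M p e r) / real (p j))) = (\<Prod>j=1..M. sn (real_of_int m / real (p j)))"
  proof (intro prod.cong refl)
    fix j assume j: "j \<in> {1..M}"
    obtain k where k: "res M p e r = m + 2 * int P * k" using e(2) by (metis cong_iff_lin mult.commute)
    have "real_of_int (res M p e r) / real (p j) = real_of_int (2 * (int (P div p j) * k)) + real_of_int m / real (p j)"
      using real_P_div[OF j] by (simp add: k add_divide_distrib)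
    then show "sn (real_of_int (res M p e r) / real (p j)) = sn (real_of_int m / real (p j))"
      by (simp only: sn_add_int epi_int) simp
  qed
  also have "epi (real_of_int (res M p e r * int L)) = epi (real_of_int (m * int L))"
  proof (rule epi_parity)
    have "2 * int P dvd m - res M p e r" using e(2) by (simp add: cong_iff_dvd_diff)
    then have "even (m - res M p e r)" by (rule dvd_trans[OF dvd_triv_left])
    then show "even (res M p e r * int L - m * int L)" by auto
  qed
  finally show ?thesis .
qed

lemma prod_sn_expand:
  "epi (real_of_int (m * int L)) * (\<Prod>j=1..M. sn (real_of_int m / real (p j)))
    = (\<Sum>\<eta>\<in>signs M. of_int (esgn \<eta>) * epi (real_of_int m * real_of_int (nn \<eta>) / real P))"
proof -
  let ?T = "2 * of_real pi * \<i> * of_int m :: complex"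
  have "(\<Prod>j=1..M. sn (real_of_int m / real (p j))) = (\<Prod>j=1..M. exp (?T / (2 * of_nat (p j))) - exp (- (?T / (2 * of_nat (p j)))))"
  proof (intro prod.cong refl)
    fix j
    have "?T / (2 * of_nat (p j)) = of_real (real_of_int m / real (p j)) * of_real pi * \<i>"
      "- (?T / (2 * of_nat (p j))) = of_real (- (real_of_int m / real (p j))) * of_real pi * \<i>" by simp_all
    then show "sn (real_of_int m / real (p j)) = exp (?T / (2 * of_nat (p j))) - exp (- (?T / (2 * of_nat (p j))))"
      unfolding sn_def epi_def by (simp only:)
  qed
  also have "\<dots> = (\<Sum>\<eta>\<in>signs M. of_int (esgn \<eta>) * exp (?T * of_real (s \<eta>) / 2))"
    by (rule prod_exp_diff)
  finally have "epi (real_of_int (m * int L)) * (\<Prod>j=1..M. sn (real_of_int m / real (p j)))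
    = (\<Sum>\<eta>\<in>signs M. of_int (esgn \<eta>) * (epi (real_of_int (m * int L)) * exp (?T * of_real (s \<eta>) / 2)))"
    by (simp add: sum_distrib_left mult_ac)
  also have "\<dots> = (\<Sum>\<eta>\<in>signs M. of_int (esgn \<eta>) * epi (real_of_int m * real_of_int (nn \<eta>) / real P))"
  proof (intro sum.cong refl arg_cong2[of _ _ _ _ "(*)"])
    fix \<eta>
    have "exp (?T * of_real (s \<eta>) / 2) = epi (real_of_int m * s \<eta>)"
      unfolding epi_def by (rule arg_cong[of _ _ exp]) simp
    then have "epi (real_of_int (m * int L)) * exp (?T * of_real (s \<eta>) / 2) = epi (real_of_int m * (s \<eta> + real L))"
      by (simp add: epi_add[symmetric] algebra_simps)
    then show "epi (real_of_int (m * int L)) * exp (?T * of_real (s \<eta>) / 2) = epi (real_of_int m * real_of_int (nn \<eta>) / real P)"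
      by (simp only: epi_nn)
  qed
  finally show ?thesis .
qed

definition SS :: "nat \<Rightarrow> nat \<Rightarrow> complex" where
  "SS N k = (\<Sum>\<eta>\<in>signs M. of_int (esgn \<eta>) * (\<Sum>m\<in>{0..<2 * int P}. gs N (nn \<eta>) m * of_real (bernpoly k (real_of_int m / (2 * real P)))))"

text \<open>Applied at every m, \<open>sum_Smat_chi\<close> turns the sum over classes of tuples
  into the sum over sign vectors produced by the residues. The phase of a tuple may be replaced by
  that of m, by \<open>ee_res\<close>, wherever \<open>chi\<close> is nonzero.\<close>

lemma sum_Smat:
  assumes R: "representatives M p R"
  shows "(\<Sum>l\<in>R. Smat M p l0 l * of_real (\<Sum>n=1..2 * P. real_of_int (chi M p l (int n)) * bernpoly k (real n / (2 * real P)))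
      * epi (- (real N * (real P / 2) * (1 + (\<Sum>i=1..M. real_of_int (l i) / real (p i))) ^ 2)))
    = (-1) ^ M * ipow (- real (m2 M)) / of_real (sqrt (2 * real P)) * SS N k"
proof -
  let ?b = "\<lambda>m. complex_of_real (bernpoly k (real_of_int m / (2 * real P)))"
  let ?C = "(-1) ^ M * ipow (- real (m2 M)) / complex_of_real (sqrt (2 * real P))"
  have RT: "R \<subseteq> tuples M p" using R by (simp add: representatives_def)
  have "(\<Sum>l\<in>R. Smat M p l0 l * of_real (\<Sum>n=1..2 * P. real_of_int (chi M p l (int n)) * bernpoly k (real n / (2 * real P)))
      * epi (- (real N * (real P / 2) * (1 + (\<Sum>i=1..M. real_of_int (l i) / real (p i))) ^ 2)))
    = (\<Sum>l\<in>R. \<Sum>m\<in>{0..<2 * int P}. ee N m * ?b m * (Smat M p l0 l * of_int (chi M p l m)))"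
  proof (intro sum.cong refl)
    fix l assume "l \<in> R"
    then have l: "l \<in> tuples M p" using RT by auto
    let ?e = "epi (- (real N * (real P / 2) * (1 + (\<Sum>i=1..M. real_of_int (l i) / real (p i))) ^ 2))"
    have "complex_of_real (\<Sum>n=1..2 * P. real_of_int (chi M p l (int n)) * bernpoly k (real n / (2 * real P)))
      = (\<Sum>n=1..2 * P. of_int (chi M p l (int n)) * ?b (int n))" by simp
    also have "\<dots> = (\<Sum>m\<in>{0..<2 * int P}. of_int (chi M p l m) * ?b m)"
      by (rule sum_chi_nat[OF l])
    finally have "Smat M p l0 l * of_real (\<Sum>n=1..2 * P. real_of_int (chi M p l (int n)) * bernpoly k (real n / (2 * real P))) * ?e
      = (\<Sum>m\<in>{0..<2 * int P}. of_int (chi M p l m) * ?e * ?b m * Smat M p l0 l)"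
      by (simp add: sum_distrib_left sum_distrib_right mult_ac)
    also have "\<dots> = (\<Sum>m\<in>{0..<2 * int P}. ee N m * ?b m * (Smat M p l0 l * of_int (chi M p l m)))"
    proof (intro sum.cong refl)
      fix m
      have "of_int (chi M p l m) * ?e = of_int (chi M p l m) * ee N m"
      proof (cases "chi M p l m = 0")
        case False
        then obtain e where "e \<in> signs M" "[m = res M p e l] (mod 2 * int P)" using chi_eq_0 by blast
        from ee_res[OF this] show ?thesis by simp
      qed simp
      then show "of_int (chi M p l m) * ?e * ?b m * Smat M p l0 l = ee N m * ?b m * (Smat M p l0 l * of_int (chi M p l m))"
        by (simp only: mult_ac)
    qed
    finally show "Smat M p l0 l * of_real (\<Sum>n=1..2 * P. real_of_int (chi M p l (int n)) * bernpoly k (real n / (2 * real P))) * ?e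
      = (\<Sum>m\<in>{0..<2 * int P}. ee N m * ?b m * (Smat M p l0 l * of_int (chi M p l m)))" .
  qed
  also have "\<dots> = (\<Sum>m\<in>{0..<2 * int P}. \<Sum>l\<in>R. ee N m * ?b m * (Smat M p l0 l * of_int (chi M p l m)))"
    by (rule sum.swap)
  also have "\<dots> = (\<Sum>m\<in>{0..<2 * int P}. ee N m * ?b m * (?C * (\<Sum>\<eta>\<in>signs M. of_int (esgn \<eta>) * epi (real_of_int m * real_of_int (nn \<eta>) / real P))))"
    unfolding sum_distrib_left[symmetric] sum_Smat_chi[OF R] prod_sn_expand ..
  also have "\<dots> = (\<Sum>m\<in>{0..<2 * int P}. \<Sum>\<eta>\<in>signs M. ?C * (of_int (esgn \<eta>) * (gs N (nn \<eta>) m * ?b m)))"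
    unfolding gs_eq sum_distrib_left by (intro sum.cong refl) (simp add: mult_ac)
  also have "\<dots> = (\<Sum>\<eta>\<in>signs M. \<Sum>m\<in>{0..<2 * int P}. ?C * (of_int (esgn \<eta>) * (gs N (nn \<eta>) m * ?b m)))"
    by (rule sum.swap)
  also have "\<dots> = ?C * SS N k"
    by (simp only: SS_def sum_distrib_left)
  finally show ?thesis .
qed

end

subsection \<open>The power series\<close>

lemma of_int_cong_div:
  assumes P: "P > 0" and c: "[a = b] (mod 2 * int P)"
  obtains z where "real_of_int b * real k * pi / real P = real_of_int a * real k * pi / real P + (2 * pi) * of_int (z * int k)"
proof -
  obtain z where z: "b = a + 2 * int P * z" using c by (auto simp: cong_iff_lin)
  have "real_of_int b * real k * pi / real P = real_of_int a * real k * pi / real P + (2 * pi) * of_int (z * int k)"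
    using P by (simp add: z field_simps)
  then show ?thesis by (rule that)
qed

lemma Nmat_cong:
  assumes P: "P > 0" and c: "[a = b] (mod 2 * int P)"
  shows "Nmat P a k = Nmat P b k"
proof -
  obtain z where z: "real_of_int b * real k * pi / real P = real_of_int a * real k * pi / real P + (2 * pi) * of_int (z * int k)"
    by (rule of_int_cong_div[OF assms])
  have "cos (real_of_int b * real k * pi / real P) = cos (real_of_int a * real k * pi / real P)"
    unfolding z cos_add cos_int_2pin sin_int_2pin by simp
  moreover have "[a = y] (mod 2 * int P) \<longleftrightarrow> [b = y] (mod 2 * int P)" for y
    using c cong_sym cong_trans by blast
  ultimately show ?thesis by (simp only: Nmat_def)
qed

lemma Mmat_cong:
  assumes P: "P > 0" and c: "[a = b] (mod 2 * int P)"
  shows "Mmat P a k = Mmat P b k"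
proof -
  obtain z where z: "real_of_int b * real k * pi / real P = real_of_int a * real k * pi / real P + (2 * pi) * of_int (z * int k)"
    by (rule of_int_cong_div[OF assms])
  have "sin (real_of_int b * real k * pi / real P) = sin (real_of_int a * real k * pi / real P)"
    unfolding z sin_add cos_int_2pin sin_int_2pin by simp
  then show ?thesis by (simp only: Mmat_def)
qed

lemma Nmat_minus: "Nmat P (- a) k = Nmat P a k"
proof -
  have "[- a = 0] (mod 2 * int P) \<longleftrightarrow> [a = 0] (mod 2 * int P)"
    by (simp add: cong_0_iff)
  moreover have "[- a = int P] (mod 2 * int P) \<longleftrightarrow> [a = int P] (mod 2 * int P)"
  proof -
    have "- a - int P = - (a - int P) + (- 1) * (2 * int P)" by simp
    then have "2 * int P dvd - a - int P \<longleftrightarrow> 2 * int P dvd a - int P"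
      by (simp only: dvd_add_times_triv_right_iff dvd_minus_iff)
    then show ?thesis by (simp only: cong_iff_dvd_diff)
  qed
  moreover have "cos (real_of_int (- a) * real k * pi / real P) = cos (real_of_int a * real k * pi / real P)"
    by simp
  ultimately show ?thesis by (simp only: Nmat_def)
qed

lemma Mmat_minus: "Mmat P (- a) k = - Mmat P a k"
  by (simp add: Mmat_def)

lemma even_part_cong: "P > 0 \<Longrightarrow> [a = b] (mod 2 * int P) \<Longrightarrow> even_part P N m a = even_part P N m b"
  unfolding even_part_def by (simp only: Nmat_cong[of P a b])

lemma odd_part_cong: "P > 0 \<Longrightarrow> [a = b] (mod 2 * int P) \<Longrightarrow> odd_part P N m a = odd_part P N m b"
  unfolding odd_part_def by (simp only: Mmat_cong[of P a b])

lemma even_part_minus: "even_part P N m (- a) = even_part P N m a"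
  unfolding even_part_def by (simp only: Nmat_minus)

lemma odd_part_minus: "odd_part P N m (- a) = - odd_part P N m a"
  unfolding odd_part_def sum_negf[symmetric] Mmat_minus
  by (intro sum.cong refl) (simp add: sum_negf)

lemma sum_even_odd:
  "(\<Sum>l=1..n. f l) = (\<Sum>m=1..n div 2. f (2 * m)) + (\<Sum>m\<in>{m. 2 * m + 1 \<le> n}. f (2 * m + 1))"
  for f :: "nat \<Rightarrow> 'a :: comm_monoid_add"
proof -
  have o: "{m. 2 * m + 1 \<le> n} \<subseteq> {..n}" by auto
  have "(\<Sum>l=1..n. f l) = sum f ((\<lambda>m. 2 * m) ` {1..n div 2} \<union> (\<lambda>m. 2 * m + 1) ` {m. 2 * m + 1 \<le> n})"
  proof (rule sum.cong[OF _ refl])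
    show "{1..n} = (\<lambda>m. 2 * m) ` {1..n div 2} \<union> (\<lambda>m. 2 * m + 1) ` {m. 2 * m + 1 \<le> n}"
    proof (intro equalityI subsetI)
      fix x assume x: "x \<in> {1..n}"
      show "x \<in> (\<lambda>m. 2 * m) ` {1..n div 2} \<union> (\<lambda>m. 2 * m + 1) ` {m. 2 * m + 1 \<le> n}"
      proof (cases "even x")
        case True
        then obtain m where "x = 2 * m" by blast
        then show ?thesis using x by auto
      next
        case False
        then obtain m where "x = 2 * m + 1" by (rule oddE)
        then show ?thesis using x by auto
      qed
    qed auto
  qed
  also have "\<dots> = sum f ((\<lambda>m. 2 * m) ` {1..n div 2}) + sum f ((\<lambda>m. 2 * m + 1) ` {m. 2 * m + 1 \<le> n})"
  proof (rule sum.union_disjoint)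
    show "finite ((\<lambda>m. 2 * m + 1) ` {m. 2 * m + 1 \<le> n})" using finite_subset[OF o] by blast
    show "(\<lambda>m. 2 * m) ` {1..n div 2} \<inter> (\<lambda>m. 2 * m + 1) ` {m. 2 * m + 1 \<le> n} = {}"
      by (auto simp: double_not_eq_Suc_double)
  qed simp
  also have "sum f ((\<lambda>m. 2 * m) ` {1..n div 2}) = (\<Sum>m=1..n div 2. f (2 * m))"
    by (subst sum.reindex) (auto simp: inj_on_def)
  also have "sum f ((\<lambda>m. 2 * m + 1) ` {m. 2 * m + 1 \<le> n}) = (\<Sum>m\<in>{m. 2 * m + 1 \<le> n}. f (2 * m + 1))"
    by (subst sum.reindex) (auto simp: inj_on_def)
  finally show ?thesis .
qed

lemma epi_quarter: "epi (1/4) = of_real (1 / sqrt 2) * (1 + \<i>)"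
proof -
  have "1 / 4 * pi = pi / 4" by simp
  then show ?thesis unfolding epi_cis by (simp add: complex_eq_iff cos_45 sin_45 real_div_sqrt field_simps)
qed

text \<open>The origin of the constants i^(-3/2) and i^(-1/2): even and odd indices differ by the
  factor i that accompanies the sines.\<close>

lemma epi_quarter_eq: "epi (1/4) = - 1 / ipow (3/2)" "epi (1/4) * \<i> = - 1 / ipow (1/2)"
proof -
  have "epi (1/4) * ipow (3/2) = epi (real_of_int 1)" by (simp add: ipow_def flip: epi_add)
  then have "epi (1/4) * ipow (3/2) = - 1" unfolding epi_int by simp
  then show "epi (1/4) = - 1 / ipow (3/2)" using eq_divide_imp[of "ipow (3/2)" "epi (1/4)" "- 1"] by (simp add: ipow_def)
  have "epi (1/4) * ipow (1/2) = epi (1/2)" by (simp add: ipow_def flip: epi_add)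
  then have "epi (1/4) * \<i> * ipow (1/2) = - 1" unfolding epi_half by (simp add: mult_ac)
  then show "epi (1/4) * \<i> = - 1 / ipow (1/2)" using eq_divide_imp[of "ipow (1/2)" "epi (1/4) * \<i>" "- 1"] by (simp add: ipow_def)
qed

lemma gauss_mom_scale:
  assumes N: "N > 0" and P: "P > 0"
  shows "N / (2 * sqrt (2 * P * N)) * (sqrt 2 / pi) * gauss_mom k (2 * (N / (8 * pi * P)))
    = 1/2 * (fact (2 * k) / (2 ^ (2 * k) * fact k)) * (4 * pi * P / N) ^ k"
proof -
  \<comment> \<open>The square roots become variables, which reduces the constant to a rational
    identity.\<close>
  define x y z where "x = sqrt N" "y = sqrt P" "z = sqrt pi"
  have xyz: "x > 0" "y > 0" "z > 0" "N = x * x" "P = y * y" "pi = z * z"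
    using N P by (simp_all add: x_y_z_def)
  have mu: "2 * (N / (8 * pi * P)) = inverse (4 * pi * P / N)" using N P by (simp add: field_simps)
  have s1: "sqrt (2 * P * N) = sqrt 2 * (y * x)" by (simp add: x_y_z_def real_sqrt_mult)
  have s2: "sqrt (inverse (4 * pi * P / N)) = inverse (2 * (z * y) / x)"
    by (simp add: x_y_z_def real_sqrt_mult real_sqrt_divide real_sqrt_inverse)
  have gen: "X * (A * F / (S * I)) = h * (F / I)" if "X * A / S = h" for X A F S I h :: real
    unfolding that[symmetric] by (simp add: mult_ac)
  have "N / (2 * sqrt (2 * P * N)) * (sqrt 2 / pi) * (sqrt pi / 2) / sqrt (inverse (4 * pi * P / N)) = 1/2"
    unfolding s1 s2 unfolding xyz(4,6) using xyz(1-3) by (simp add: field_simps)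
  then have "N / (2 * sqrt (2 * P * N)) * (sqrt 2 / pi) * gauss_mom k (2 * (N / (8 * pi * P)))
    = 1/2 * ((fact (2 * k) / (2 ^ (2 * k) * fact k)) / inverse (4 * pi * P / N) ^ k)"
    unfolding gauss_mom_def mu by (rule gen)
  also have "\<dots> = 1/2 * (fact (2 * k) / (2 ^ (2 * k) * fact k)) * (4 * pi * P / N) ^ k"
    by (simp only: power_inverse divide_inverse inverse_inverse_eq mult.assoc)
  finally show ?thesis .
qed

context seifert
begin

lemma nn_not_P_dvd: "\<eta> \<in> signs M \<Longrightarrow> \<not> int P dvd nn \<eta>"
  using not_P_dvd_imp(1)[OF nn_not_dvd[OF one_in]] .

text \<open>The common value of the sums over a, b and signed \<eta>, for a weight W. It serves the
  leading terms with complex weights and the power series with real ones.\<close>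

definition wrap :: "nat \<Rightarrow> (int \<Rightarrow> 'a) \<Rightarrow> 'a :: real_normed_field" where
  "wrap l W = (\<Sum>\<eta>\<in>{\<eta>\<in>signs M. aa \<eta> \<ge> 1}. of_int (esgn \<eta>) *
          (\<Sum>b<nat (aa \<eta>). of_real (fpoly l (L - 1) (real b + 1/2 - 1/2 * s \<eta>)) * W (nn \<eta>)))"

definition chi_sum :: "nat \<Rightarrow> (int \<Rightarrow> complex) \<Rightarrow> complex" where
  "chi_sum l W = (\<Sum>a=0..P. of_real (real_of_int (chi M p l0 (int a)) * fpoly l L (real a / (2 * real P) - real (m2 M) / 2)) * W (int a))"

text \<open>M and L have the same parity, so the signs (-1)^(L+l) of the folding and (-1)^M of the
  halving combine to (-1)^l.\<close>

lemma fold_half: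
  assumes l: "l \<in> {1..L}" "l < L"
    and per: "\<And>x y. [x = y] (mod 2 * int P) \<Longrightarrow> W x = W y"
    and par: "\<And>x. W (- x) = (-1) ^ l * W x"
  shows "(\<Sum>\<eta>\<in>signs M. of_int (esgn \<eta>) * of_real (fpoly l L (- s \<eta> / 2)) * W (nn \<eta>))
    = 2 * ((-1) ^ l * chi_sum l W - of_nat (L - 1) * wrap l W)"
proof -
  have sg: "(-1) ^ (L + l) * (2 * (-1) ^ M * x) = 2 * ((-1) ^ l * x)" for x :: complex
    using even_M by (cases "even M"; cases "even l") auto
  have f: "(\<Sum>\<eta>\<in>signs M. of_int (esgn \<eta>) * of_real (fpoly l L (- s \<eta> / 2)) * W (nn \<eta>))
    = (-1) ^ (L + l) * (\<Sum>\<eta>\<in>signs M. of_int (esgn \<eta>) * of_real (fpoly l L (zz \<eta> / 2)) * W (nn \<eta>)) - 2 * of_nat (L - 1) * wrap l W"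
    unfolding wrap_def by (rule sum_fpoly_fold[where W = W and l = l, OF l per par])
  have h: "(\<Sum>\<eta>\<in>signs M. of_int (esgn \<eta>) * of_real (fpoly l L (zz \<eta> / 2)) * W (nn \<eta>)) = 2 * (-1) ^ M * chi_sum l W"
    unfolding chi_sum_def by (rule half_sum[where Z = W and l = l, OF l(1) per par])
  show ?thesis unfolding f h sg by (simp only: right_diff_distrib mult.assoc)
qed

lemma infsum_wrap:
  fixes W :: "'i \<Rightarrow> int \<Rightarrow> 'a :: real_normed_field"
  assumes g: "\<And>\<eta> b. \<eta> \<in> signs M \<Longrightarrow> g (nat (aa \<eta>)) b \<eta>
      = (\<Sum>j\<in>J. c j * (of_real (fpoly (h j) (L - 1) (real b + 1/2 - 1/2 * s \<eta>)) * W j (nn \<eta>)))"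
  shows "(\<Sum>\<^sub>\<infinity>a\<in>{1..}. \<Sum>b<a. signed_sum M p a (g a b)) = (\<Sum>j\<in>J. c j * wrap (h j) (W j))"
proof -
  let ?A = "{\<eta>\<in>signs M. aa \<eta> \<ge> 1}"
  let ?t = "\<lambda>\<eta> b j. of_real (fpoly (h j) (L - 1) (real b + 1/2 - 1/2 * s \<eta>)) * W j (nn \<eta>)"
  have "(\<Sum>\<^sub>\<infinity>a\<in>{1..}. \<Sum>b<a. signed_sum M p a (g a b))
    = (\<Sum>\<eta>\<in>?A. of_int (esgn \<eta>) * (\<Sum>b<nat (aa \<eta>). g (nat (aa \<eta>)) b \<eta>))"
    by (rule infsum_signed)
  also have "\<dots> = (\<Sum>\<eta>\<in>?A. \<Sum>j\<in>J. c j * (of_int (esgn \<eta>) * (\<Sum>b<nat (aa \<eta>). ?t \<eta> b j)))"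
  proof (intro sum.cong refl)
    fix \<eta> assume "\<eta> \<in> ?A"
    then have \<eta>: "\<eta> \<in> signs M" by simp
    have "(\<Sum>b<nat (aa \<eta>). g (nat (aa \<eta>)) b \<eta>) = (\<Sum>j\<in>J. \<Sum>b<nat (aa \<eta>). c j * ?t \<eta> b j)"
      unfolding g[OF \<eta>] by (rule sum.swap)
    also have "\<dots> = (\<Sum>j\<in>J. c j * (\<Sum>b<nat (aa \<eta>). ?t \<eta> b j))" by (simp only: sum_distrib_left)
    finally show "of_int (esgn \<eta>) * (\<Sum>b<nat (aa \<eta>). g (nat (aa \<eta>)) b \<eta>)
      = (\<Sum>j\<in>J. c j * (of_int (esgn \<eta>) * (\<Sum>b<nat (aa \<eta>). ?t \<eta> b j)))"
      by (simp only: sum_distrib_left mult.left_commute)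
  qed
  also have "\<dots> = (\<Sum>j\<in>J. \<Sum>\<eta>\<in>?A. c j * (of_int (esgn \<eta>) * (\<Sum>b<nat (aa \<eta>). ?t \<eta> b j)))"
    by (rule sum.swap)
  also have "\<dots> = (\<Sum>j\<in>J. c j * wrap (h j) (W j))"
    by (simp only: wrap_def sum_distrib_left)
  finally show ?thesis .
qed

text \<open>By \<open>cc_eq\<close> the Taylor coefficient pairs Bernoulli values with
  \<open>fpoly j L\<close> at - s/2. For j < L, folding s to \<open>zz\<close> separates the sum
  with the floor, recovered through \<open>sum_chi_l0\<close>, from the sums over a and b; for j = L
  \<open>fpoly\<close> is constant and nothing is split off. The sign (-1)^((M+1)(j+1)) accounts for
  x(\<eta>, a) being congruent to minus \<open>nn\<close> when M is even.\<close>

lemma Tcoeff_eq: "of_real (Tcoeff M p k) = 1/2 * of_real ((2 * real P) ^ (2 * k) * fact (2 * k)) * cc (2 * k)"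
proof -
  define W where "W j x = bernpoly (2 * k + j) (real_of_int (x mod (2 * int P)) / (2 * real P))" for j :: nat and x :: int
  define q where "q j = real j / real (2 * k + j)" for j
  define Z where "Z j = (\<Sum>\<eta>\<in>signs M. of_int (esgn \<eta>) * of_real (fpoly j L (zz \<eta> / 2)) * W j (nn \<eta>))" for j
  have per: "W j x = W j y" if "[x = y] (mod 2 * int P)" for j x y
    using that by (simp add: W_def cong_def)
  have par: "W j (- nn \<eta>) = (-1) ^ j * W j (nn \<eta>)" if \<eta>: "\<eta> \<in> signs M" for j \<eta>
  proof -
    have "nn \<eta> mod (2 * int P) \<noteq> 0" by (rule not_P_dvd_imp(2)[OF nn_not_dvd[OF one_in \<eta>]])
    then have "(- nn \<eta>) mod (2 * int P) = 2 * int P - nn \<eta> mod (2 * int P)"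
      by (simp add: zmod_zminus1_eq_if)
    then have "real_of_int ((- nn \<eta>) mod (2 * int P)) / (2 * real P) = 1 - real_of_int (nn \<eta> mod (2 * int P)) / (2 * real P)"
      using P_pos by (simp add: field_simps)
    then show ?thesis unfolding W_def by (simp add: bernpoly_reflect power_add)
  qed
  have S: "(\<Sum>\<eta>\<in>signs M. of_int (esgn \<eta>) * fpoly j L (- s \<eta> / 2) * bernpoly (2 * k + j) (yy \<eta>))
      = (\<Sum>\<eta>\<in>signs M. of_int (esgn \<eta>) * of_real (fpoly j L (- s \<eta> / 2)) * W j (nn \<eta>))" for j
    unfolding W_def by (intro sum.cong refl) (simp add: yy_mod)
  have Slt: "(\<Sum>\<eta>\<in>signs M. of_int (esgn \<eta>) * of_real (fpoly j L (- s \<eta> / 2)) * W j (nn \<eta>))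
      = (-1) ^ (L + j) * Z j - 2 * real (L - 1) * wrap j (W j)" if "j \<in> {1..L}" "j < L" for j
    unfolding Z_def wrap_def by (rule sum_fpoly_fold[where W = "W j" and l = j, OF that per par])
  have SL: "(\<Sum>\<eta>\<in>signs M. of_int (esgn \<eta>) * of_real (fpoly L L (- s \<eta> / 2)) * W L (nn \<eta>)) = (-1) ^ (L + L) * Z L"
    unfolding Z_def fpoly_self by simp
  have Lset: "{1..L} = insert L {1..L - 1}" "L \<notin> {1..L - 1}" using L_ge_1 by auto
  have "(\<Sum>j=1..L. q j * (\<Sum>\<eta>\<in>signs M. of_int (esgn \<eta>) * of_real (fpoly j L (- s \<eta> / 2)) * W j (nn \<eta>)))
      = q L * ((-1) ^ (L + L) * Z L) + (\<Sum>j=1..L - 1. q j * ((-1) ^ (L + j) * Z j - 2 * real (L - 1) * wrap j (W j)))"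
    unfolding Lset(1) sum.insert[OF finite_atLeastAtMost Lset(2)] SL
  proof (intro arg_cong2[of _ _ _ _ "(+)"] refl sum.cong)
    fix j assume "j \<in> {1..L - 1}"
    then have "j \<in> {1..L}" "j < L" using L_ge_1 by auto
    then show "q j * (\<Sum>\<eta>\<in>signs M. of_int (esgn \<eta>) * of_real (fpoly j L (- s \<eta> / 2)) * W j (nn \<eta>))
      = q j * ((-1) ^ (L + j) * Z j - 2 * real (L - 1) * wrap j (W j))"
      by (simp only: Slt)
  qed
  also have "\<dots> = (q L * ((-1) ^ (L + L) * Z L) + (\<Sum>j=1..L - 1. q j * ((-1) ^ (L + j) * Z j))) - (\<Sum>j=1..L - 1. q j * (2 * real (L - 1) * wrap j (W j)))"
    by (simp only: right_diff_distrib sum_subtractf add_diff_eq)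
  also have "q L * ((-1) ^ (L + L) * Z L) + (\<Sum>j=1..L - 1. q j * ((-1) ^ (L + j) * Z j)) = (\<Sum>j=1..L. q j * ((-1) ^ (L + j) * Z j))"
    unfolding Lset(1) sum.insert[OF finite_atLeastAtMost Lset(2)] ..
  also have "\<dots> = (-1) ^ L * (\<Sum>j=1..L. (-1) ^ j * q j * Z j)"
    by (simp add: sum_distrib_left power_add mult_ac)
  also have "(\<Sum>j=1..L - 1. q j * (2 * real (L - 1) * wrap j (W j))) = 2 * real (L - 1) * (\<Sum>j=1..L - 1. q j * wrap j (W j))"
    by (simp add: sum_distrib_left mult_ac)
  finally have tot: "(\<Sum>j=1..L. q j * (\<Sum>\<eta>\<in>signs M. of_int (esgn \<eta>) * fpoly j L (- s \<eta> / 2) * bernpoly (2 * k + j) (yy \<eta>)))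
      = (-1) ^ L * (\<Sum>j=1..L. (-1) ^ j * q j * Z j) - 2 * real (L - 1) * (\<Sum>j=1..L - 1. q j * wrap j (W j))"
    unfolding S .
  have first: "(\<Sum>n=1..2 * P. real_of_int (chi M p l0 (int n))
          * (\<Sum>j=1..L. (-1) ^ j * q j * bernpoly (2 * k + j) (real n / (2 * real P))
              * fpoly j L (real (n + (M - 1) * P) / (2 * real P)
                    - of_int \<lfloor>real (n + (M - 1) * P) / (2 * real P)\<rfloor> - 1/2)))
      = (-1) ^ M * (\<Sum>j=1..L. (-1) ^ j * q j * Z j)"
  proof -
    define fr where "fr n = (real_of_int n + real ((M - 1) * P)) / (2 * real P)
                    - of_int \<lfloor>(real_of_int n + real ((M - 1) * P)) / (2 * real P)\<rfloor> - 1/2" for n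
    define G where "G n = (\<Sum>j=1..L. (-1) ^ j * q j * bernpoly (2 * k + j) (real_of_int n / (2 * real P)) * fpoly j L (fr n))" for n
    have "real (n + (M - 1) * P) / (2 * real P) - of_int \<lfloor>real (n + (M - 1) * P) / (2 * real P)\<rfloor> - 1/2 = fr (int n)" for n
      unfolding fr_def of_nat_add of_int_of_nat_eq ..
    then have "(\<Sum>n=1..2 * P. real_of_int (chi M p l0 (int n))
          * (\<Sum>j=1..L. (-1) ^ j * q j * bernpoly (2 * k + j) (real n / (2 * real P))
              * fpoly j L (real (n + (M - 1) * P) / (2 * real P)
                    - of_int \<lfloor>real (n + (M - 1) * P) / (2 * real P)\<rfloor> - 1/2)))
      = (\<Sum>n=1..2 * P. of_int (chi M p l0 (int n)) * G (int n))"
      unfolding G_def of_int_of_nat_eq by (simp only:)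
    also have "\<dots> = (\<Sum>n\<in>{0..<2 * int P}. of_int (chi M p l0 n) * G n)"
      by (rule sum_chi_nat[OF l0_tuples])
    also have "\<dots> = (-1) ^ M * (\<Sum>\<eta>\<in>signs M. of_int (esgn \<eta>) * G (nn \<eta> mod (2 * int P)))"
      by (rule sum_chi_l0)
    also have "(\<Sum>\<eta>\<in>signs M. of_int (esgn \<eta>) * G (nn \<eta> mod (2 * int P)))
      = (\<Sum>\<eta>\<in>signs M. \<Sum>j=1..L. (-1) ^ j * q j * (of_int (esgn \<eta>) * of_real (fpoly j L (zz \<eta> / 2)) * W j (nn \<eta>)))"
    proof (intro sum.cong refl)
      fix \<eta> assume \<eta>: "\<eta> \<in> signs M"
      have f: "fr (nn \<eta> mod (2 * int P)) = zz \<eta> / 2" unfolding fr_def by (rule frac_zz[OF \<eta>])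
      show "of_int (esgn \<eta>) * G (nn \<eta> mod (2 * int P))
        = (\<Sum>j=1..L. (-1) ^ j * q j * (of_int (esgn \<eta>) * of_real (fpoly j L (zz \<eta> / 2)) * W j (nn \<eta>)))"
        unfolding G_def unfolding f W_def sum_distrib_left by (intro sum.cong refl) (simp add: mult_ac)
    qed
    also have "\<dots> = (\<Sum>j=1..L. \<Sum>\<eta>\<in>signs M. (-1) ^ j * q j * (of_int (esgn \<eta>) * of_real (fpoly j L (zz \<eta> / 2)) * W j (nn \<eta>)))"
      by (rule sum.swap)
    also have "\<dots> = (\<Sum>j=1..L. (-1) ^ j * q j * Z j)"
      by (simp only: Z_def sum_distrib_left)
    finally show ?thesis .
  qed
  have second: "(\<Sum>\<^sub>\<infinity>a\<in>{1..}. \<Sum>b<a. signed_sum M p a (\<lambda>\<eta>.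
          \<Sum>j=1..L - 1. (-1) ^ ((M + 1) * (j + 1)) * q j
            * fpoly j (L - 1) (real b + 1/2 - 1/2 * s \<eta>)
            * bernpoly (2 * k + j) (real_of_int (xarg M p \<eta> a) / (2 * real P))))
      = (\<Sum>j=1..L - 1. (-1) ^ (M + 1) * q j * wrap j (W j))"
  proof (rule infsum_wrap[where h = "\<lambda>j. j"])
    fix \<eta> b assume \<eta>: "\<eta> \<in> signs M"
    let ?x = "xarg M p \<eta> (nat (aa \<eta>))"
    have "bernpoly (2 * k + j) (real_of_int ?x / (2 * real P)) = W j ?x" for j
      using xarg_cong(2)[of \<eta> "nat (aa \<eta>)"] by (simp add: W_def)
    moreover have "W j ?x = (if odd M then W j (nn \<eta>) else (-1) ^ j * W j (nn \<eta>))" for j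
      using per[OF xarg_cong(1)] par[OF \<eta>] by simp
    ultimately have "(-1) ^ ((M + 1) * (j + 1)) * bernpoly (2 * k + j) (real_of_int ?x / (2 * real P)) = (-1) ^ (M + 1) * W j (nn \<eta>)" for j
      by (cases "even M"; cases "even j") simp_all
    moreover have "a * q j * f * B = c * q j * (of_real f * w)" if "a * B = c * w" for a B c w f :: real and j
    proof -
      have "a * q j * f * B = (a * B) * (q j * f)" by (simp only: mult_ac)
      then show ?thesis unfolding that by (simp add: mult_ac)
    qed
    ultimately have "(-1) ^ ((M + 1) * (j + 1)) * q j * f * bernpoly (2 * k + j) (real_of_int ?x / (2 * real P))
      = (-1) ^ (M + 1) * q j * (of_real f * W j (nn \<eta>))" for j f
      by blast
    then show "(\<Sum>j=1..L - 1. (-1) ^ ((M + 1) * (j + 1)) * q j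
            * fpoly j (L - 1) (real b + 1/2 - 1/2 * s \<eta>)
            * bernpoly (2 * k + j) (real_of_int ?x / (2 * real P)))
       = (\<Sum>j=1..L - 1. (-1) ^ (M + 1) * q j * (of_real (fpoly j (L - 1) (real b + 1/2 - 1/2 * s \<eta>)) * W j (nn \<eta>)))"
      by (simp only:)
  qed
  have M3: "M - 3 = L - 1" "M - 2 = L" "M - 4 = L - 2" by (simp_all add: L_def)
  define U where "U = (\<Sum>j=1..L. (-1) ^ j * q j * Z j)"
  define V where "V = (\<Sum>j=1..L - 1. q j * wrap j (W j))"
  have V': "(\<Sum>j=1..L - 1. (-1) ^ (M + 1) * q j * wrap j (W j)) = (-1) ^ (M + 1) * V"
    by (simp only: V_def sum_distrib_left mult.assoc)
  have T: "Tcoeff M p k = (-1) ^ (M + 1) / 2 * ((2 * real P) ^ (2 * k) / fact (L - 1)) * ((-1) ^ M * U)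
      - (2 * real P) ^ (2 * k) / fact (L - 2) * ((-1) ^ (M + 1) * V)"
    unfolding Tcoeff_def Let_def M3 l0_def[symmetric] q_def[symmetric] first second U_def[symmetric] V' ..
  have c: "cc (2 * k) = - ((-1) ^ L / (fact (L - 1) * fact (2 * k))) * of_real ((-1) ^ L * U - 2 * real (L - 1) * V)"
    unfolding cc_eq q_def[symmetric] tot U_def V_def ..
  \<comment> \<open>For L = 1 the natural number subtractions truncate, but then V is an empty
    sum.\<close>
  have VV: "real (L - 1) * V / fact (L - 1) = V / fact (L - 2)"
  proof (cases "L = 1")
    case True then show ?thesis by (simp add: V_def)
  next
    case False
    then obtain n where "L = Suc (Suc n)" using L_ge_1 by (metis One_nat_def not_one_le_zero old.nat.exhaust)
    then show ?thesis by (simp del: of_nat_Suc)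
  qed
  have "1/2 * ((2 * real P) ^ (2 * k) * fact (2 * k)) * (- ((-1) ^ L / (fact (L - 1) * fact (2 * k))) * ((-1) ^ L * U - 2 * real (L - 1) * V))
    = (2 * real P) ^ (2 * k) * (- (1/2) * U / fact (L - 1) + (-1) ^ L * (real (L - 1) * V / fact (L - 1)))"
    by (cases "even L") (simp_all add: field_simps del: of_nat_diff)
  also have "\<dots> = Tcoeff M p k"
    unfolding VV T using even_M by (cases "even L") (simp_all add: field_simps)
  finally have "complex_of_real (1/2 * ((2 * real P) ^ (2 * k) * fact (2 * k)) * (- ((-1) ^ L / (fact (L - 1) * fact (2 * k))) * ((-1) ^ L * U - 2 * real (L - 1) * V)))
    = of_real (Tcoeff M p k)" by (rule arg_cong)
  then show ?thesis unfolding c by simp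
qed

definition pref :: "nat \<Rightarrow> complex" where
  "pref N = epi (1/4) / of_real (2 * sqrt (2 * real P * real N))"

text \<open>e^(pi i/4) (1 + i) = i sqrt 2 cancels the i in 2 pi i, so the normalisation, the residue
  theorem and the rotated contour together give a real constant.\<close>

lemma pref_gauss_mom:
  assumes N: "N > 0"
  shows "pref N * of_nat N / (2 * of_real pi * \<i>) * (2 * (1 + \<i>)) * of_real (gauss_mom k (2 * lam N))
    = of_real (1/2 * (fact (2 * k) / (2 ^ (2 * k) * fact k)) * (4 * pi * real P / real N) ^ k)"
proof -
  have "(1 + \<i>) * (1 + \<i>) = 2 * \<i>" by (simp add: algebra_simps)
  then have e: "epi (1/4) * (1 + \<i>) = of_real (1 / sqrt 2) * (2 * \<i>)"
    unfolding epi_quarter by (simp only: mult.assoc)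
  have "1 / sqrt 2 * 2 = sqrt 2" by (simp add: real_div_sqrt field_simps)
  then have e2: "of_real (1 / sqrt 2) * 2 = complex_of_real (sqrt 2)"
    by (metis of_real_mult of_real_numeral)
  have gen: "e / D * n / (2 * a * b) * (2 * w) = e * w * n / (D * a * b)" for e D n a b w :: complex
    by (simp add: mult_ac)
  have "pref N * of_nat N / (2 * of_real pi * \<i>) * (2 * (1 + \<i>))
    = (epi (1/4) * (1 + \<i>)) * of_nat N / (of_real (2 * sqrt (2 * real P * real N)) * of_real pi * \<i>)"
    unfolding pref_def by (rule gen)
  also have "\<dots> = (of_real (1 / sqrt 2) * 2) * of_nat N / (of_real (2 * sqrt (2 * real P * real N)) * of_real pi)"
    unfolding e by simp
  also have "\<dots> = of_real (real N / (2 * sqrt (2 * real P * real N)) * (sqrt 2 / pi))"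
    unfolding e2 by simp
  finally have "pref N * of_nat N / (2 * of_real pi * \<i>) * (2 * (1 + \<i>)) * of_real (gauss_mom k (2 * lam N))
    = of_real (real N / (2 * sqrt (2 * real P * real N)) * (sqrt 2 / pi) * gauss_mom k (2 * (real N / (8 * pi * real P))))"
    unfolding lam_def by (simp only: of_real_mult)
  also have "\<dots> = of_real (1/2 * (fact (2 * k) / (2 ^ (2 * k) * fact k)) * (4 * pi * real P / real N) ^ k)"
    using gauss_mom_scale[of "real N" "real P" k] N P_pos by simp
  finally show ?thesis .
qed

lemma Res_term:
  assumes N: "N > 0"
  shows "pref N * of_nat N / (2 * of_real pi * \<i>) * (2 * (1 + \<i>) * cc (2 * k) * (2 * \<i>) ^ k * of_real (gauss_mom k (2 * lam N)))
    = of_real (Tcoeff M p k) / fact k * (of_real pi * \<i> / of_real (2 * real P * real N)) ^ k"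
proof -
  have 1: "pref N * of_nat N / (2 * of_real pi * \<i>) * (2 * (1 + \<i>) * cc (2 * k) * (2 * \<i>) ^ k * of_real (gauss_mom k (2 * lam N)))
    = (pref N * of_nat N / (2 * of_real pi * \<i>) * (2 * (1 + \<i>)) * of_real (gauss_mom k (2 * lam N))) * (cc (2 * k) * (2 * \<i>) ^ k)"
    by (simp only: mult_ac)
  have gen: "(of_real a * (2 * \<i>) / 2 ^ 2) ^ k = of_real (a ^ k) * (2 * \<i>) ^ k / complex_of_real (2 ^ (2 * k))" for a
    by (simp only: power_mult_distrib power_divide of_real_power power_mult of_real_numeral)
  have "of_real ((2 * real P) ^ (2 * k)) * (of_real pi * \<i> / of_real (2 * real P * real N)) ^ k
      = ((2 * of_nat P) ^ 2 * (of_real pi * \<i> / of_real (2 * real P * real N))) ^ k"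
    by (simp only: power_mult power_mult_distrib of_real_power of_real_mult of_real_of_nat_eq of_real_numeral)
  also have "(2 * of_nat P) ^ 2 * (of_real pi * \<i> / of_real (2 * real P * real N)) = of_real (4 * pi * real P / real N) * (2 * \<i>) / 2 ^ 2"
    using P_pos N by (simp add: field_simps power2_eq_square)
  also have "\<dots> ^ k = of_real ((4 * pi * real P / real N) ^ k) * (2 * \<i>) ^ k / of_real (2 ^ (2 * k))"
    by (rule gen)
  finally have 2: "of_real ((2 * real P) ^ (2 * k)) * (of_real pi * \<i> / of_real (2 * real P * real N)) ^ k
    = complex_of_real ((4 * pi * real P / real N) ^ k) * (2 * \<i>) ^ k / of_real (2 ^ (2 * k))" .
  have "of_real (Tcoeff M p k) / fact k * (of_real pi * \<i> / of_real (2 * real P * real N)) ^ k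
    = 1/2 * (fact (2 * k) / fact k) * cc (2 * k) * (of_real ((2 * real P) ^ (2 * k)) * (of_real pi * \<i> / of_real (2 * real P * real N)) ^ k)"
    unfolding Tcoeff_eq by (simp add: mult_ac)
  then show ?thesis unfolding 1 pref_gauss_mom[OF N] 2 by (simp add: field_simps)
qed

text \<open>The identity \<open>pref_gauss_mom\<close> is used a second time, for k = K + 1: it
  shows that the prefactor times the moment bounding the error is of order N^(-K-1).\<close>

lemma tail_bound:
  "\<exists>C. \<forall>N>0. norm (pref N * of_nat N / (2 * of_real pi * \<i>) * Res N
      - (\<Sum>k\<le>K. of_real (Tcoeff M p k) / fact k * (of_real pi * \<i> / of_real (2 * real P * real N)) ^ k))
    \<le> C * (1 / real N ^ (K + 1))"
proof -
  obtain C where C: "C \<ge> 0" "\<And>N. N > 0 \<Longrightarrow> norm (Res N - (\<Sum>k\<le>K. 2 * (1 + \<i>) * cc (2 * k) * (2 * \<i>) ^ k * of_real (gauss_mom k (2 * lam N))))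
    \<le> C * gauss_mom (Suc K) (2 * lam N)" using Res_asymp[of K] by blast
  define A where "A = 1/2 * (fact (2 * Suc K) / (2 ^ (2 * Suc K) * fact (Suc K))) * (4 * pi * real P) ^ Suc K"
  show ?thesis
  proof (intro exI[of _ "C * A"] allI impI)
    fix N :: nat assume N: "N > 0"
    define d where "d = pref N * of_nat N / (2 * of_real pi * \<i>)"
    define g where "g = gauss_mom (Suc K) (2 * lam N)"
    have g0: "g \<ge> 0" unfolding g_def gauss_mom_def using lam_pos[OF N] by simp
    have "norm (d * (2 * (1 + \<i>)) * of_real g) = norm (complex_of_real (1/2 * (fact (2 * Suc K) / (2 ^ (2 * Suc K) * fact (Suc K))) * (4 * pi * real P / real N) ^ Suc K))"
      unfolding d_def g_def pref_gauss_mom[OF N] ..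
    also have "\<dots> = A / real N ^ Suc K"
      unfolding A_def norm_of_real by (simp only: power_divide) (simp add: abs_mult)
    finally have "norm d * norm (2 * (1 + \<i>)) * g = A / real N ^ Suc K"
      unfolding norm_mult using g0 by simp
    moreover have "1 \<le> norm (2 * (1 + \<i>))"
      using abs_Re_le_cmod[of "2 * (1 + \<i>)"] by simp
    then have "norm d * g * 1 \<le> norm d * g * norm (2 * (1 + \<i>))"
      using g0 by (intro mult_left_mono) auto
    ultimately have dg: "norm d * g \<le> A / real N ^ Suc K" by (simp only: mult_ac mult_1_right) 
    have "d * Res N - (\<Sum>k\<le>K. of_real (Tcoeff M p k) / fact k * (of_real pi * \<i> / of_real (2 * real P * real N)) ^ k)
      = d * (Res N - (\<Sum>k\<le>K. 2 * (1 + \<i>) * cc (2 * k) * (2 * \<i>) ^ k * of_real (gauss_mom k (2 * lam N))))"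
      unfolding d_def right_diff_distrib sum_distrib_left Res_term[OF N] ..
    then have "norm (d * Res N - (\<Sum>k\<le>K. of_real (Tcoeff M p k) / fact k * (of_real pi * \<i> / of_real (2 * real P * real N)) ^ k))
      \<le> norm d * (C * g)"
      unfolding g_def by (simp only: norm_mult) (intro mult_left_mono C(2)[OF N] norm_ge_zero)
    also have "\<dots> = C * (norm d * g)" by simp
    also have "\<dots> \<le> C * (A / real N ^ Suc K)" by (intro mult_left_mono dg C(1))
    finally show "norm (pref N * of_nat N / (2 * of_real pi * \<i>) * Res N
      - (\<Sum>k\<le>K. of_real (Tcoeff M p k) / fact k * (of_real pi * \<i> / of_real (2 * real P * real N)) ^ k))
    \<le> C * A * (1 / real N ^ (K + 1))"
      unfolding d_def by simp
  qed
qed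

end

context seifert
begin

subsection \<open>The leading terms\<close>

definition part :: "nat \<Rightarrow> nat \<Rightarrow> int \<Rightarrow> complex" where
  "part N l x = (if even l then even_part P N (l div 2) x else odd_part P N (l div 2) x)"

definition unit_const :: "nat \<Rightarrow> complex" where
  "unit_const l = (if even l then - 1 / ipow (3/2) else - 1 / ipow (1/2))"

lemma part_cong: "[x = y] (mod 2 * int P) \<Longrightarrow> part N l x = part N l y"
  unfolding part_def using even_part_cong[OF P_pos] odd_part_cong[OF P_pos] by simp

lemma part_minus: "part N l (- x) = (-1) ^ l * part N l x"
  by (simp add: part_def even_part_minus odd_part_minus)

text \<open>Only the top index \<open>l = L\<close> is excluded: there \<open>fpoly\<close> is constant and the \<open>S\<close>-matrix terms arise instead.\<close>

lemma pref_XX: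
  assumes N: "N > 0" and l: "l \<in> {1..L}" "l < L"
  shows "pref N * XX N l = unit_const l / fact (L - 1) *
    ((-1) ^ (L + l + 1) * chi_sum l (part N l) + (-1) ^ L * of_nat (L - 1) * wrap l (part N l))"
proof -
  let ?s = "complex_of_real (sqrt (2 * real P * real N))"
  let ?u = "if even l then 1 else \<i>"
  let ?S = "\<lambda>f. \<Sum>\<eta>\<in>signs M. of_int (esgn \<eta>) * complex_of_real (fpoly l L (- s \<eta> / 2)) * f \<eta>"
  have s0: "?s \<noteq> 0" using N P_pos by simp
  have "?S (\<lambda>\<eta>. YY N l (nn \<eta>)) = ?s * ?u * ?S (\<lambda>\<eta>. part N l (nn \<eta>))"
  proof (cases "even l")
    case True
    then obtain m where m: "l = 2 * m" by blast
    have "m \<ge> 1" using l m by auto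
    then have "YY N l (nn \<eta>) = ?s * part N l (nn \<eta>)" if "\<eta> \<in> signs M" for \<eta>
      using even_part_eq[OF N _ nn_not_P_dvd[OF that]] by (simp add: part_def m)
    then show ?thesis using True by (simp add: sum_distrib_left mult_ac)
  next
    case False
    then obtain m where m: "l = 2 * m + 1" by (rule oddE)
    have "YY N l a = ?s * \<i> * part N l a + YY N l 0" for a
      using odd_part_eq[OF N, of m a] by (simp add: part_def m)
    then have "?S (\<lambda>\<eta>. YY N l (nn \<eta>)) = ?S (\<lambda>\<eta>. ?s * \<i> * part N l (nn \<eta>) + YY N l 0)"
      by (intro sum.cong refl arg_cong2[of _ _ _ _ "(*)"])
    also have "\<dots> = ?S (\<lambda>\<eta>. ?s * \<i> * part N l (nn \<eta>)) + ?S (\<lambda>\<eta>. YY N l 0)"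
      by (simp only: distrib_left sum.distrib)
    also have "?S (\<lambda>\<eta>. YY N l 0) = 0"
      unfolding sum_distrib_right[symmetric] sum_fpoly_0[OF l(1)] by simp
    finally show ?thesis using False by (simp add: sum_distrib_left mult_ac)
  qed
  also have "?S (\<lambda>\<eta>. part N l (nn \<eta>)) = 2 * ((-1) ^ l * chi_sum l (part N l) - of_nat (L - 1) * wrap l (part N l))"
    by (rule fold_half[where W = "part N l" and l = l, OF l part_cong part_minus])
  finally have S: "?S (\<lambda>\<eta>. YY N l (nn \<eta>)) = ?s * ?u * (2 * ((-1) ^ l * chi_sum l (part N l) - of_nat (L - 1) * wrap l (part N l)))" .
  have u: "epi (1/4) * ?u = unit_const l"
    using epi_quarter_eq by (simp add: unit_const_def)
  have gen: "e / (2 * s) * (c / d * (s * u * (2 * y))) = e * u / d * (c * y)" if "s \<noteq> 0" for e s c d u y :: complex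
    using that by simp
  have "pref N * XX N l = epi (1/4) / (2 * ?s) * ((-1) ^ (L + 1) / fact (L - 1) * (?s * ?u * (2 * ((-1) ^ l * chi_sum l (part N l) - of_nat (L - 1) * wrap l (part N l)))))"
    unfolding pref_def XX_def S by simp
  also have "\<dots> = epi (1/4) * ?u / fact (L - 1) * ((-1) ^ (L + 1) * ((-1) ^ l * chi_sum l (part N l) - of_nat (L - 1) * wrap l (part N l)))"
    by (rule gen[OF s0])
  also have "(-1) ^ (L + 1) * ((-1) ^ l * chi_sum l (part N l) - of_nat (L - 1) * wrap l (part N l))
     = (-1) ^ (L + l + 1) * chi_sum l (part N l) + (-1) ^ L * of_nat (L - 1) * wrap l (part N l)"
    by (cases "even L"; cases "even l") (simp_all del: of_nat_diff)
  finally show ?thesis unfolding u .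
qed

definition even_terms :: "nat \<Rightarrow> complex" where
  "even_terms N = 1 / fact (M - 3) * ((-1) ^ M / ipow (3/2))
           * (\<Sum>m=1..(M - 3) div 2. \<Sum>a=0..P.
               complex_of_real (real_of_int (chi M p l0 (int a))
                 * fpoly (2 * m) (M - 2) (real a / (2 * real P) - real (m2 M) / 2))
               * even_part P N m (int a))"

definition odd_terms :: "nat \<Rightarrow> complex" where
  "odd_terms N = 1 / fact (M - 3) * ((-1) ^ (M - 1) / ipow (1/2))
           * (\<Sum>m\<in>{m. 2 * m + 4 \<le> M}. \<Sum>a=1..P.
               complex_of_real (real_of_int (chi M p l0 (int a))
                 * fpoly (2 * m + 1) (M - 2) (real a / (2 * real P) - real (m2 M) / 2))
               * odd_part P N m (int a))"

definition wrap_terms :: "nat \<Rightarrow> complex" where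
  "wrap_terms N = (-1) ^ M / fact (M - 4)
           * (\<Sum>\<^sub>\<infinity>a\<in>{1..}. \<Sum>b<a. signed_sum M p a (\<lambda>\<eta>.
               (\<Sum>m=1..(M - 3) div 2.
                  complex_of_real (fpoly (2 * m) (M - 3) (real b + 1/2 - 1/2 * eta_quot M p \<eta>))
                  * (- 1 / ipow (3/2)) * even_part P N m (xarg M p \<eta> a))
               + (-1) ^ (M - 1) * (\<Sum>m\<in>{m. 2 * m + 4 \<le> M}.
                  complex_of_real (fpoly (2 * m + 1) (M - 3) (real b + 1/2 - 1/2 * eta_quot M p \<eta>))
                  * (- 1 / ipow (1/2)) * odd_part P N m (xarg M p \<eta> a))))"

definition top_terms :: "(nat \<Rightarrow> int) set \<Rightarrow> nat \<Rightarrow> complex" where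
  "top_terms R N = 1/2 * (1 / fact (M - 3)) * (1 / ipow (3/2 - real (m2 M)))
           * (\<Sum>j=0..(M - 3) div 2. complex_of_real (real N powr (real j + real (M div 2) - 1/2))
               * (\<i> / complex_of_real (2 * real P * pi)) ^ ((M - 3) div 2 - j)
               * complex_of_real (Kcoeff j ((M - 3) div 2) (real (m2 M)))
               * (1 / of_nat (2 * j + 2 - m2 M))
               * (\<Sum>l\<in>R. Smat M p l0 l
                   * complex_of_real (\<Sum>n=1..2 * P. real_of_int (chi M p l (int n))
                       * bernpoly (2 * j + 2 - m2 M) (real n / (2 * real P)))
                   * epi (- (real N * (real P / 2)
                       * (1 + (\<Sum>i=1..M. real_of_int (l i) / real (p i))) ^ 2))))"

lemma M_minus: "M - 3 = L - 1" "M - 2 = L" "M - 4 = L - 2"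
  by (simp_all add: L_def)

lemma M_sets: "{m. 2 * m + 4 \<le> M} = {m. 2 * m + 1 \<le> L - 1}"
  using M_ge_3 by (auto simp: L_def)

lemma minus_one_power_M: "(-1) ^ M = ((-1) ^ L :: 'a :: ring_1)"
  using even_M by (simp add: minus_one_power_iff)

lemma minus_one_power_M_minus_1: "(-1) ^ (M - 1) = ((-1) ^ (L + 1) :: 'a :: ring_1)"
proof -
  have "even (M - 1) \<longleftrightarrow> even (L + 1)" using M_ge_3 by (simp add: L_def)
  then show ?thesis by (simp only: minus_one_power_iff)
qed

lemmas minus_one_powers = minus_one_power_M minus_one_power_M_minus_1

lemma chi_0: "chi M p l0 0 = 0"
  by (rule chi_multiple[OF l0_tuples one_in]) simp

text \<open>x(\<eta>, a) is congruent to \<open>nn\<close> for odd M and to its negative for even M.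
  The even part ignores this sign, the odd part picks it up, and the factor (-1)^(M-1) in front of
  the odd sum undoes it.\<close>

lemma wrap_terms_eq:
  "wrap_terms N = (-1) ^ L / fact (L - 2) * (\<Sum>l=1..L - 1. unit_const l * wrap l (part N l))"
proof -
  have "(\<Sum>\<^sub>\<infinity>a\<in>{1..}. \<Sum>b<a. signed_sum M p a (\<lambda>\<eta>.
               (\<Sum>m=1..(L - 1) div 2.
                  complex_of_real (fpoly (2 * m) (L - 1) (real b + 1/2 - 1/2 * eta_quot M p \<eta>))
                  * (- 1 / ipow (3/2)) * even_part P N m (xarg M p \<eta> a))
               + (-1) ^ (M - 1) * (\<Sum>m\<in>{m. 2 * m + 1 \<le> L - 1}.
                  complex_of_real (fpoly (2 * m + 1) (L - 1) (real b + 1/2 - 1/2 * eta_quot M p \<eta>))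
                  * (- 1 / ipow (1/2)) * odd_part P N m (xarg M p \<eta> a))))
    = (\<Sum>l=1..L - 1. unit_const l * wrap l (part N l))"
  proof (rule infsum_wrap[where h = "\<lambda>j. j"])
    fix \<eta> b assume \<eta>: "\<eta> \<in> signs M"
    let ?x = "xarg M p \<eta> (nat (aa \<eta>))"
    let ?f = "\<lambda>l. complex_of_real (fpoly l (L - 1) (real b + 1/2 - 1/2 * s \<eta>))"
    have x: "part N l ?x = (if odd M then part N l (nn \<eta>) else (-1) ^ l * part N l (nn \<eta>))" for l
      using part_cong[OF xarg_cong(1)[of \<eta> "nat (aa \<eta>)"], of N l] part_minus by simp
    have e: "?f (2 * m) * (- 1 / ipow (3/2)) * even_part P N m ?x = unit_const (2 * m) * (?f (2 * m) * part N (2 * m) (nn \<eta>))" for m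
      using x[of "2 * m"] by (simp add: part_def unit_const_def split: if_splits)
    have o: "(-1) ^ (M - 1) * (?f (2 * m + 1) * (- 1 / ipow (1/2)) * odd_part P N m ?x) = unit_const (2 * m + 1) * (?f (2 * m + 1) * part N (2 * m + 1) (nn \<eta>))" for m
    proof -
      have "(-1) ^ (M - 1) * odd_part P N m ?x = part N (2 * m + 1) (nn \<eta>)"
        using x[of "2 * m + 1"] M_ge_3 by (cases "even M") (simp_all add: part_def)
      then show ?thesis by (simp add: unit_const_def mult_ac)
    qed
    show "(\<Sum>m=1..(L - 1) div 2. ?f (2 * m) * (- 1 / ipow (3/2)) * even_part P N m ?x)
         + (-1) ^ (M - 1) * (\<Sum>m\<in>{m. 2 * m + 1 \<le> L - 1}. ?f (2 * m + 1) * (- 1 / ipow (1/2)) * odd_part P N m ?x)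
      = (\<Sum>l=1..L - 1. unit_const l * (?f l * part N l (nn \<eta>)))"
      unfolding sum_even_odd[of "\<lambda>l. unit_const l * (?f l * part N l (nn \<eta>))" "L - 1"] sum_distrib_left[of "(-1) ^ (M - 1)"] o e ..
  qed
  then show ?thesis unfolding wrap_terms_def M_minus M_sets minus_one_powers(1) by (simp only:)
qed

text \<open>The factor L - 1 from the difference equation of \<open>fpoly\<close> turns (M - 3)!
  into (M - 4)!, whence the different factorials in front of the two kinds of sums.\<close>

lemma low_terms:
  assumes N: "N > 0"
  shows "(\<Sum>l=1..L - 1. pref N * XX N l) = even_terms N + odd_terms N + wrap_terms N"
proof -
  have fac: "of_nat (L - 1) / fact (L - 1) * w = (1 / fact (L - 2) * w :: complex)" if "L \<ge> 2" for w
  proof -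
    define n where "n = L - 2"
    then have "L = Suc (Suc n)" using that by simp
    then show ?thesis by (simp del: of_nat_Suc)
  qed
  have gen: "u / d * (a * x + b * k * w) = u / d * a * x + k / d * (b * (u * w))" for u d a x b k w :: complex
    by (simp add: distrib_left add_divide_distrib mult_ac)
  have XX: "pref N * XX N l = unit_const l / fact (L - 1) * (-1) ^ (L + l + 1) * chi_sum l (part N l)
      + (-1) ^ L / fact (L - 2) * (unit_const l * wrap l (part N l))" if l: "l \<in> {1..L - 1}" for l
  proof -
    have l': "l \<in> {1..L}" "l < L" "L \<ge> 2" using l by auto
    have "pref N * XX N l = unit_const l / fact (L - 1) * (-1) ^ (L + l + 1) * chi_sum l (part N l)
      + of_nat (L - 1) / fact (L - 1) * ((-1) ^ L * (unit_const l * wrap l (part N l)))"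
      unfolding pref_XX[OF N l'(1,2)] by (rule gen)
    then show ?thesis unfolding fac[OF l'(3)] by simp
  qed
  have "(\<Sum>l=1..L - 1. pref N * XX N l) = (\<Sum>l=1..L - 1. unit_const l / fact (L - 1) * (-1) ^ (L + l + 1) * chi_sum l (part N l)
      + (-1) ^ L / fact (L - 2) * (unit_const l * wrap l (part N l)))"
    by (intro sum.cong refl XX)
  also have "\<dots> = (\<Sum>l=1..L - 1. unit_const l / fact (L - 1) * (-1) ^ (L + l + 1) * chi_sum l (part N l)) + wrap_terms N"
    by (simp only: sum.distrib sum_distrib_left wrap_terms_eq)
  also have "(\<Sum>l=1..L - 1. unit_const l / fact (L - 1) * (-1) ^ (L + l + 1) * chi_sum l (part N l)) = even_terms N + odd_terms N"
    unfolding sum_even_odd[of "\<lambda>l. unit_const l / fact (L - 1) * (-1) ^ (L + l + 1) * chi_sum l (part N l)" "L - 1"]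
  proof (rule arg_cong2[of _ _ _ _ "(+)"])
    have e: "unit_const (2 * m) / fact (L - 1) * (-1) ^ (L + 2 * m + 1) = 1 / fact (L - 1) * ((-1) ^ L / ipow (3/2))"
        "part N (2 * m) = even_part P N m" for m
      by (simp_all add: unit_const_def power_add power_mult part_def fun_eq_iff)
    show "(\<Sum>m=1..(L - 1) div 2. unit_const (2 * m) / fact (L - 1) * (-1) ^ (L + 2 * m + 1) * chi_sum (2 * m) (part N (2 * m))) = even_terms N"
      unfolding even_terms_def M_minus minus_one_powers e chi_sum_def by (rule sum_distrib_left[symmetric])
    have o: "unit_const (2 * m + 1) / fact (L - 1) * (-1) ^ (L + (2 * m + 1) + 1) = 1 / fact (L - 1) * ((-1) ^ (L + 1) / ipow (1/2))"
        "part N (2 * m + 1) = odd_part P N m" for m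
      by (simp_all add: unit_const_def power_add power_mult part_def fun_eq_iff)
    have c: "chi_sum l W = (\<Sum>a=1..P. of_real (real_of_int (chi M p l0 (int a)) * fpoly l L (real a / (2 * real P) - real (m2 M) / 2)) * W (int a))" for l W
      unfolding chi_sum_def
    proof (rule sum.mono_neutral_right)
      show "\<forall>i\<in>{0..P} - {1..P}. of_real (real_of_int (chi M p l0 (int i)) * fpoly l L (real i / (2 * real P) - real (m2 M) / 2)) * W (int i) = 0"
      proof
        fix i assume "i \<in> {0..P} - {1..P}"
        then have "i = 0" by auto
        then show "of_real (real_of_int (chi M p l0 (int i)) * fpoly l L (real i / (2 * real P) - real (m2 M) / 2)) * W (int i) = 0"
          by (simp add: chi_0)
      qed
    qed auto
    show "(\<Sum>m\<in>{m. 2 * m + 1 \<le> L - 1}. unit_const (2 * m + 1) / fact (L - 1) * (-1) ^ (L + (2 * m + 1) + 1) * chi_sum (2 * m + 1) (part N (2 * m + 1))) = odd_terms N"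
      unfolding odd_terms_def M_minus M_sets minus_one_powers o c by (rule sum_distrib_left[symmetric])
  qed
  finally show ?thesis .
qed

lemma L_parity: "L = 2 * ((M - 3) div 2) + 2 - m2 M" "M div 2 = (M - 3) div 2 + 2 - m2 M"
proof -
  obtain n where "M = n + 3" using M_ge_3 by (metis add.commute le_Suc_ex)
  then show "L = 2 * ((M - 3) div 2) + 2 - m2 M" "M div 2 = (M - 3) div 2 + 2 - m2 M"
    unfolding L_def m2_def by (cases "even n"; auto elim!: evenE oddE)+
qed

lemma sum_parity_top:
  "(\<Sum>k=1..L. if even (L - k) then f k else 0) = (\<Sum>j=0..(M - 3) div 2. f (2 * j + 2 - m2 M))" for f :: "nat \<Rightarrow> complex"
proof (cases "even M")
  case True
  then have m: "m2 M = 0" by (simp add: m2_def)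
  have "(\<Sum>k=1..L. if even (L - k) then f k else 0) = (\<Sum>j=1..(M - 3) div 2 + 1. f (2 * j))"
    using sum_parity_even[of "(M - 3) div 2 + 1" f] L_parity(1) m by simp
  also have "\<dots> = (\<Sum>j=0..(M - 3) div 2. f (2 * (j + 1)))"
    by (rule sum.reindex_bij_witness[of _ "\<lambda>j. j + 1" "\<lambda>j. j - 1"]) auto
  finally show ?thesis using m by simp
next
  case False
  then have m: "m2 M = 1" by (simp add: m2_def)
  show ?thesis using sum_parity_odd[of "(M - 3) div 2" f] L_parity(1) m by simp
qed

text \<open>For even M this is \<open>Kcoeff_even\<close> with both indices raised by one, for odd M
  it is \<open>Kcoeff_odd\<close>. The factor 1/L matches the constant
  \<open>fpoly L L\<close>.\<close>

lemma Kcoeff_top: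
  assumes "j \<le> (M - 3) div 2"
  shows "Kcoeff j ((M - 3) div 2) (real (m2 M)) * (1 / real (2 * j + 2 - m2 M))
    = 1 / real L * (fact L / (fact (2 * j + 2 - m2 M) * fact ((M - 3) div 2 - j) * 4 ^ ((M - 3) div 2 - j)))"
proof (cases "even M")
  case True
  then have m: "m2 M = 0" by (simp add: m2_def)
  then have L: "L = 2 * Suc ((M - 3) div 2)" using L_parity(1) by simp
  have "Kcoeff (Suc j - 1) (Suc ((M - 3) div 2) - 1) 0 * (real (Suc ((M - 3) div 2)) / real (Suc j))
    = fact L / (fact (2 * Suc j) * fact (Suc ((M - 3) div 2) - Suc j) * 4 ^ (Suc ((M - 3) div 2) - Suc j))"
    unfolding L using assms by (intro Kcoeff_even) auto
  then have K: "Kcoeff j ((M - 3) div 2) 0 * (real (Suc ((M - 3) div 2)) / real (Suc j))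
    = fact L / (fact (2 * j + 2) * fact ((M - 3) div 2 - j) * 4 ^ ((M - 3) div 2 - j))"
    unfolding diff_Suc_1 diff_Suc_Suc mult_Suc_right add_2_eq_Suc add_2_eq_Suc' .
  have "real L = 2 * real (Suc ((M - 3) div 2))" "real (2 * j + 2) = 2 * real (Suc j)" using L by simp_all
  moreover have "real (Suc ((M - 3) div 2)) > 0" by simp
  ultimately show ?thesis unfolding m diff_zero of_nat_0 K[symmetric]
    by (simp del: of_nat_Suc of_nat_add of_nat_mult)
next
  case False
  then have m: "m2 M = 1" by (simp add: m2_def)
  then have L: "L = 2 * ((M - 3) div 2) + 1" using L_parity(1) by simp
  have K: "Kcoeff j ((M - 3) div 2) 1 * (real L / real (2 * j + 1))
    = fact L / (fact (2 * j + 1) * fact ((M - 3) div 2 - j) * 4 ^ ((M - 3) div 2 - j))"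
    unfolding L by (rule Kcoeff_odd[OF assms])
  have e: "2 * j + 2 - 1 = 2 * j + 1" by simp
  have "Kcoeff j ((M - 3) div 2) 1 * (1 / real (2 * j + 1)) = 1 / real L * (Kcoeff j ((M - 3) div 2) 1 * (real L / real (2 * j + 1)))"
    using L_ge_1 by simp
  then show ?thesis unfolding m of_nat_1 K e .
qed

text \<open>For l = L \<open>fpoly\<close> is the constant 1/L, so every sign vector has the same
  weight up to sign; this is the sum that \<open>sum_Smat\<close> expresses through the
  S-matrix.\<close>

lemma top_terms_eq:
  assumes N: "N > 0" and R: "representatives M p R"
  shows "pref N * XX N L = top_terms R N"
proof -
  let ?h = "(M - 3) div 2"
  let ?k = "\<lambda>j. 2 * j + 2 - m2 M"
  let ?G = "\<lambda>j. complex_of_real (real N powr (real j + real (M div 2) - 1/2))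
               * (\<i> / complex_of_real (2 * real P * pi)) ^ (?h - j)
               * complex_of_real (Kcoeff j ?h (real (m2 M)))
               * (1 / of_nat (?k j)) * SS N (?k j)"
  have coeff: "of_nat N ^ ?k j * (\<i> * of_real (lam N)) ^ ((L - ?k j) div 2) * of_real (fact L / (fact (?k j) * fact ((L - ?k j) div 2))) * SS N (?k j)
     = of_nat L * (of_real (sqrt (real N)) * ?G j)" if j: "j \<in> {0..?h}" for j
  proof -
    have m2: "m2 M \<le> 1" by (simp add: m2_def)
    have "L - ?k j = 2 * (?h - j)" using L_parity(1) m2 j by (simp add: diff_mult_distrib2)
    then have r: "(L - ?k j) div 2 = ?h - j" by simp
    have ex: "real (?k j) + real (?h - j) - 1/2 = real j + real (M div 2) - 1/2"
      using L_parity(2) m2 j by (simp add: of_nat_diff)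
    have "j \<le> ?h" using j by simp
    then have K0: "real L * (Kcoeff j ?h (real (m2 M)) * (1 / real (?k j))) = fact L / (fact (?k j) * fact (?h - j) * 4 ^ (?h - j))"
      using L_ge_1 by (subst Kcoeff_top) auto
    have K: "complex_of_real (fact L / (fact (?k j) * fact (?h - j) * 4 ^ (?h - j))) = of_nat L * (of_real (Kcoeff j ?h (real (m2 M))) * (1 / of_nat (?k j)))"
      unfolding K0[symmetric] by (simp only: of_real_mult of_real_divide of_real_1 of_real_of_nat_eq)
    show ?thesis unfolding r N_power_split[OF N] ex K by (simp only: mult_ac)
  qed
  have L0: "of_nat L \<noteq> (0 :: complex)" using L_ge_1 by simp
  have gen0: "e * (\<Sum>k\<in>A. if Q k then c k * d k else 0) = (\<Sum>k\<in>A. if Q k then c k * (e * d k) else 0)"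
    for e :: complex and c d :: "nat \<Rightarrow> complex" and A Q
    unfolding sum_distrib_left by (intro sum.cong refl) (simp add: mult.left_commute)
  have "(\<Sum>\<eta>\<in>signs M. of_int (esgn \<eta>) * YY N L (nn \<eta>))
    = (\<Sum>\<eta>\<in>signs M. \<Sum>k=1..L. if even (L - k) then of_nat N ^ k * (\<i> * of_real (lam N)) ^ ((L - k) div 2) * of_real (fact L / (fact k * fact ((L - k) div 2)))
       * (of_int (esgn \<eta>) * (\<Sum>m\<in>{0..<2 * int P}. gs N (nn \<eta>) m * of_real (bernpoly k (real_of_int m / (2 * real P))))) else 0)"
    unfolding YY_def gen0 ..
  also have "\<dots> = (\<Sum>k=1..L. \<Sum>\<eta>\<in>signs M. if even (L - k) then of_nat N ^ k * (\<i> * of_real (lam N)) ^ ((L - k) div 2) * of_real (fact L / (fact k * fact ((L - k) div 2)))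
       * (of_int (esgn \<eta>) * (\<Sum>m\<in>{0..<2 * int P}. gs N (nn \<eta>) m * of_real (bernpoly k (real_of_int m / (2 * real P))))) else 0)"
    by (rule sum.swap)
  also have "\<dots> = (\<Sum>k=1..L. if even (L - k) then of_nat N ^ k * (\<i> * of_real (lam N)) ^ ((L - k) div 2) * of_real (fact L / (fact k * fact ((L - k) div 2))) * SS N k else 0)"
    unfolding SS_def by (intro sum.cong refl) (simp add: sum_distrib_left)
  also have "\<dots> = (\<Sum>j=0..?h. of_nat L * (of_real (sqrt (real N)) * ?G j))"
    unfolding sum_parity_top by (intro sum.cong refl coeff)
  also have "\<dots> = of_nat L * (of_real (sqrt (real N)) * (\<Sum>j=0..?h. ?G j))"
    by (simp only: sum_distrib_left)
  finally have Y: "(\<Sum>\<eta>\<in>signs M. of_int (esgn \<eta>) * YY N L (nn \<eta>)) = of_nat L * (of_real (sqrt (real N)) * (\<Sum>j=0..?h. ?G j))" .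
  have "(\<Sum>\<eta>\<in>signs M. of_int (esgn \<eta>) * of_real (fpoly L L (- s \<eta> / 2)) * YY N L (nn \<eta>)) = (\<Sum>\<eta>\<in>signs M. of_int (esgn \<eta>) * YY N L (nn \<eta>)) / of_nat L"
    unfolding fpoly_self sum_divide_distrib by (intro sum.cong refl) simp
  then have X: "XX N L = (-1) ^ (L + 1) / fact (L - 1) * (of_real (sqrt (real N)) * (\<Sum>j=0..?h. ?G j))"
    unfolding XX_def Y using L0 by simp
  have sq: "complex_of_real (2 * sqrt (2 * real P * real N)) = 2 * (of_real (sqrt (2 * real P)) * of_real (sqrt (real N)))"
    by (simp add: real_sqrt_mult)
  have sN: "complex_of_real (sqrt (real N)) \<noteq> 0" using N by simp
  have gen: "e / (2 * (q * sn)) * (c / d * (sn * G)) = 1/2 * (1/d) * (c * e) / q * G" if "sn \<noteq> 0" for e q sn c d G :: complex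
    using that by (simp add: mult_ac)
  have X': "pref N * XX N L = 1/2 * (1 / fact (L - 1)) * ((-1) ^ (L + 1) * epi (1/4)) / of_real (sqrt (2 * real P)) * (\<Sum>j=0..?h. ?G j)"
    unfolding pref_def sq X by (rule gen[OF sN])
  have E: "(-1) ^ (L + 1) * epi (1/4) = 1 / ipow (3/2 - real (m2 M)) * ((-1) ^ M * ipow (- real (m2 M)))"
  proof -
    have "ipow (3/2 - real (m2 M)) = ipow (3/2) * ipow (- real (m2 M))"
      by (simp add: ipow_def diff_divide_distrib flip: epi_add)
    then show ?thesis unfolding epi_quarter_eq(1) minus_one_powers(1) by (simp add: ipow_def)
  qed
  have gen2: "1/2 * (1 / f) * (u * v) / q * S = 1/2 * (1 / f) * u * (v / q * S)" for f u v q S :: complex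
    by simp
  have "pref N * XX N L = 1/2 * (1 / fact (L - 1)) * (1 / ipow (3/2 - real (m2 M)))
     * ((-1) ^ M * ipow (- real (m2 M)) / of_real (sqrt (2 * real P)) * (\<Sum>j=0..?h. ?G j))"
    unfolding X' E by (rule gen2)
  also have "(-1) ^ M * ipow (- real (m2 M)) / of_real (sqrt (2 * real P)) * (\<Sum>j=0..?h. ?G j)
    = (\<Sum>j=0..?h. complex_of_real (real N powr (real j + real (M div 2) - 1/2))
               * (\<i> / complex_of_real (2 * real P * pi)) ^ (?h - j)
               * complex_of_real (Kcoeff j ?h (real (m2 M)))
               * (1 / of_nat (?k j)) * ((-1) ^ M * ipow (- real (m2 M)) / of_real (sqrt (2 * real P)) * SS N (?k j)))"
    unfolding sum_distrib_left[of "(-1) ^ M * ipow (- real (m2 M)) / of_real (sqrt (2 * real P))"] by (intro sum.cong refl) (simp only: mult_ac)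
  finally show ?thesis unfolding top_terms_def sum_Smat[OF R] M_minus(1) .
qed

text \<open>The leading terms are exact for every N > 0; the only approximation is the expansion of
  the integral \<open>Res N\<close>.\<close>

lemma lawrence_rozansky_expansion:
  assumes R: "representatives M p R"
  shows "\<exists>C. \<forall>N>0. norm (lawrence_rozansky M p N - (top_terms R N + even_terms N + odd_terms N + wrap_terms N)
      - (\<Sum>k\<le>K. of_real (Tcoeff M p k) / fact k * (of_real pi * \<i> / of_real (2 * real P * real N)) ^ k))
    \<le> C * (1 / real N ^ (K + 1))"
proof -
  have "lawrence_rozansky M p N - (top_terms R N + even_terms N + odd_terms N + wrap_terms N)
    = pref N * of_nat N / (2 * of_real pi * \<i>) * Res N" if N: "N > 0" for N
  proof -
    have Lset: "{1..L} = insert L {1..L - 1}" "L \<notin> {1..L - 1}" using L_ge_1 by auto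
    have "(\<Sum>l=1..L. pref N * XX N l) = top_terms R N + (even_terms N + odd_terms N + wrap_terms N)"
      unfolding Lset(1) sum.insert[OF finite_atLeastAtMost Lset(2)] low_terms[OF N] top_terms_eq[OF N R] ..
    then have X: "pref N * (\<Sum>l=1..L. XX N l) = top_terms R N + even_terms N + odd_terms N + wrap_terms N"
      by (simp only: sum_distrib_left add.assoc)
    have "lawrence_rozansky M p N = pref N * Sg N"
      unfolding pref_def by (rule lawrence_rozansky_eq[OF N])
    also have "Sg N = of_nat N * (\<Sum>z\<in>poles N. residue (hh N) z) + (\<Sum>l=1..L. XX N l)"
      using sum_residues[OF N] by simp
    also have "(\<Sum>z\<in>poles N. residue (hh N) z) = Res N / (2 * of_real pi * \<i>)"
      by (simp add: Res_def)
    finally show ?thesis unfolding X[symmetric] by (simp add: distrib_left)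
  qed
  then show ?thesis using tail_bound[of K] by simp
qed

text \<open>epi(2/N) = 1 would make N divide 1. At N = 1 the quotient defining \<open>wrt\<close>
  has divisor 0, which an asymptotic statement may ignore.\<close>

lemma wrt_eq:
  assumes "N \<ge> 2"
  shows "epi (2 / real N * (phi M p / 4 - 1/2)) * (epi (2 / real N) - 1) * wrt M p N = lawrence_rozansky M p N"
proof -
  have "epi (2 / real N) \<noteq> 1"
  proof
    assume "epi (2 / real N) = 1"
    then obtain n :: int where "2 / real N * pi = of_int (2 * n) * pi"
      by (auto simp: epi_def exp_eq_1)
    then have "2 / real N = of_int (2 * n)" by (rule mult_right_cancel[THEN iffD1, OF pi_neq_zero])
    then have "1 = of_int n * real N" using assms by (simp add: field_simps)
    then have "1 = n * int N" by (metis of_int_1 of_int_eq_iff of_int_mult of_int_of_nat_eq)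
    then have "int N dvd 1" by (metis dvd_triv_right)
    then show False using assms by simp
  qed
  then show ?thesis by (simp add: wrt_def)
qed

lemma wrt_expansion:
  assumes R: "representatives M p R"
  shows "(\<lambda>N. epi (2 / real N * (phi M p / 4 - 1/2)) * (epi (2 / real N) - 1) * wrt M p N
      - (top_terms R N + even_terms N + odd_terms N + wrap_terms N)
      - (\<Sum>k\<le>K. of_real (Tcoeff M p k) / fact k * (of_real pi * \<i> / of_real (2 * real P * real N)) ^ k))
    \<in> O(\<lambda>N. 1 / of_nat N ^ (K + 1))"
proof -
  obtain C where C: "\<And>N. N > 0 \<Longrightarrow> norm (lawrence_rozansky M p N - (top_terms R N + even_terms N + odd_terms N + wrap_terms N)
      - (\<Sum>k\<le>K. of_real (Tcoeff M p k) / fact k * (of_real pi * \<i> / of_real (2 * real P * real N)) ^ k))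
    \<le> C * (1 / real N ^ (K + 1))" using lawrence_rozansky_expansion[OF R, of K] by blast
  show ?thesis
  proof (rule bigoI[of _ C], rule eventually_mono[OF eventually_ge_at_top[of 2]])
    fix N :: nat assume N: "2 \<le> N"
    have n: "norm (1 / of_nat N ^ (K + 1) :: complex) = 1 / real N ^ (K + 1)"
      by (simp only: norm_divide norm_power norm_of_nat norm_one)
    show "norm (epi (2 / real N * (phi M p / 4 - 1/2)) * (epi (2 / real N) - 1) * wrt M p N
      - (top_terms R N + even_terms N + odd_terms N + wrap_terms N)
      - (\<Sum>k\<le>K. of_real (Tcoeff M p k) / fact k * (of_real pi * \<i> / of_real (2 * real P * real N)) ^ k))
      \<le> C * norm (1 / of_nat N ^ (K + 1) :: complex)"
      unfolding n wrt_eq[OF N] using N by (intro C) simp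
  qed
qed

end

text \<open>By coprimality p_1 and p_2 are not both 2, so the sum is strictly below M/2, and M/2 <=
  M - 2 for M >= 4.\<close>

lemma seifert_sum_less:
  fixes p :: "nat \<Rightarrow> nat"
  assumes M: "M \<ge> 4"
    and p_ge_2: "\<And>j. j \<in> {1..M} \<Longrightarrow> p j \<ge> 2"
    and p_coprime: "pairwise (\<lambda>i j. coprime (p i) (p j)) {1..M}"
  shows "(\<Sum>j=1..M. 1 / real (p j)) < real (M - 2)"
proof -
  have "coprime (p 1) (p 2)" using p_coprime M by (auto simp: pairwise_def)
  then have "p 1 \<noteq> 2 \<or> p 2 \<noteq> 2" by auto
  then obtain i where "i \<in> {1, 2}" "p i \<noteq> 2" by blast
  then have i: "i \<in> {1..M}" "p i \<noteq> 2" using M by auto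
  have "p i > 2" using p_ge_2[OF i(1)] i(2) by simp
  have "(\<Sum>j=1..M. 1 / real (p j)) < (\<Sum>j=1..M. 1/2)"
  proof (rule sum_strict_mono_ex1)
    show "\<forall>j\<in>{1..M}. 1 / real (p j) \<le> 1/2"
    proof
      fix j assume "j \<in> {1..M}"
      then have "2 \<le> real (p j)" using p_ge_2 by fastforce
      then show "1 / real (p j) \<le> 1/2" by (simp add: field_simps)
    qed
    show "\<exists>j\<in>{1..M}. 1 / real (p j) < 1/2"
      using i(1) \<open>p i > 2\<close> by (intro bexI[of _ i]) (auto simp: field_simps)
  qed simp
  also have "\<dots> \<le> real (M - 2)" using M by (simp add: of_nat_diff)
  finally show ?thesis .
qed

text \<open>R is any system of representatives of the classes of tuples. The index set
  \<open>{m. 2 * m + 4 \<le> M}\<close> is empty for M = 3, where truncated subtraction in an upper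
  limit (M - 4) div 2 would admit m = 0.\<close>

theorem theorem16:
  fixes M :: nat and p :: "nat \<Rightarrow> nat" and R :: "(nat \<Rightarrow> int) set"
  assumes M: "M \<ge> 4 \<or> (M = 3 \<and> (\<Sum>j=1..M. 1 / real (p j)) < 1)"
    and p_ge_2: "\<And>j. j \<in> {1..M} \<Longrightarrow> p j \<ge> 2"
    and p_coprime: "pairwise (\<lambda>i j. coprime (p i) (p j)) {1..M}"
    and R: "representatives M p R"
  defines "P \<equiv> prodP M p"
    and "l0 \<equiv> (flip p 1 ^^ (M - 1)) (allones M)"
  shows "\<forall>K::nat. (\<lambda>N::nat.
      epi (2 / real N * (phi M p / 4 - 1/2)) * (epi (2 / real N) - 1) * wrt M p N
      - (1/2 * (1 / fact (M - 3)) * (1 / ipow (3/2 - real (m2 M)))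
           * (\<Sum>j=0..(M - 3) div 2. complex_of_real (real N powr (real j + real (M div 2) - 1/2))
               * (\<i> / complex_of_real (2 * real P * pi)) ^ ((M - 3) div 2 - j)
               * complex_of_real (Kcoeff j ((M - 3) div 2) (real (m2 M)))
               * (1 / of_nat (2 * j + 2 - m2 M))
               * (\<Sum>l\<in>R. Smat M p l0 l
                   * complex_of_real (\<Sum>n=1..2 * P. real_of_int (chi M p l (int n))
                       * bernpoly (2 * j + 2 - m2 M) (real n / (2 * real P)))
                   * epi (- (real N * (real P / 2)
                       * (1 + (\<Sum>i=1..M. real_of_int (l i) / real (p i))) ^ 2))))
         + 1 / fact (M - 3) * ((-1) ^ M / ipow (3/2))
           * (\<Sum>m=1..(M - 3) div 2. \<Sum>a=0..P.
               complex_of_real (real_of_int (chi M p l0 (int a))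
                 * fpoly (2 * m) (M - 2) (real a / (2 * real P) - real (m2 M) / 2))
               * even_part P N m (int a))
         + 1 / fact (M - 3) * ((-1) ^ (M - 1) / ipow (1/2))
           * (\<Sum>m\<in>{m. 2 * m + 4 \<le> M}. \<Sum>a=1..P.
               complex_of_real (real_of_int (chi M p l0 (int a))
                 * fpoly (2 * m + 1) (M - 2) (real a / (2 * real P) - real (m2 M) / 2))
               * odd_part P N m (int a))
         + (-1) ^ M / fact (M - 4)
           * (\<Sum>\<^sub>\<infinity>a\<in>{1..}. \<Sum>b<a. signed_sum M p a (\<lambda>\<eta>.
               (\<Sum>m=1..(M - 3) div 2.
                  complex_of_real (fpoly (2 * m) (M - 3) (real b + 1/2 - 1/2 * eta_quot M p \<eta>))
                  * (- 1 / ipow (3/2)) * even_part P N m (xarg M p \<eta> a))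
               + (-1) ^ (M - 1) * (\<Sum>m\<in>{m. 2 * m + 4 \<le> M}.
                  complex_of_real (fpoly (2 * m + 1) (M - 3) (real b + 1/2 - 1/2 * eta_quot M p \<eta>))
                  * (- 1 / ipow (1/2)) * odd_part P N m (xarg M p \<eta> a)))))
      - (\<Sum>k\<le>K. complex_of_real (Tcoeff M p k) / fact k
           * (complex_of_real pi * \<i> / complex_of_real (2 * real P * real N)) ^ k))
    \<in> O(\<lambda>N. 1 / of_nat N ^ (K + 1))"
proof -
  interpret S: seifert M p
  proof
    show "M \<ge> 3" using M by auto
    show "(\<Sum>j=1..M. 1 / real (p j)) < real (M - 2)"
      using M
    proof
      assume "M \<ge> 4"
      then show ?thesis using p_ge_2 p_coprime by (rule seifert_sum_less)
    next
      assume m: "M = 3 \<and> (\<Sum>j=1..M. 1 / real (p j)) < 1"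
      then have "(\<Sum>j=1..M. 1 / real (p j)) < 1" by (rule conjunct2)
      moreover have "real (M - 2) = 1" using m by simp
      ultimately show ?thesis by (simp only:)
    qed
  qed (use p_ge_2 p_coprime in auto)
  have l0: "l0 = S.l0" by (simp only: l0_def S.l0_def)
  show ?thesis
    using S.wrt_expansion[OF R]
    unfolding S.top_terms_def S.even_terms_def S.odd_terms_def S.wrap_terms_def P_def l0
    by blast
qed

end
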